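(* Let $H\in(\tfrac12,1)$, let $z_0\in\mathbb{C}\setminus\{0\}$, and let $B=(B_t)_{t\ge 0}$ be a complex fractional Brownian motion with Hurst parameter $H$ started at $z_0$. Then, almost surely, $$\frac{1}{\log t}\int_0^t\frac{\delta B_s}{B_s}\xrightarrow[t\to+\infty]{}H$$ and $$\frac{1}{\log t}\int_0^t\frac{ds}{|B_s|^{1/H}}\xrightarrow[t\to+\infty]{}\frac{\Gamma\left(1-\frac{1}{2H}\right)}{2^{1/(2H)}}.$$
   Context: Complex fractional Brownian motion started at $z_0=x^1+ix^2$: $B_t=B_t^1+iB_t^2$, where $B^1,B^2$ are independent real continuous Gaussian processes with $\mathbb{E}(B^j_t)=x^j$ and covariance $\tfrac12(s^{2H}+t^{2H}-|t-s|^{2H})$. Almost surely $B$ never vanishes and its paths are locally $\gamma$-Hölder for every $\gamma<H$. The symbols $\int\cdots\delta B_s$ (divergence integral) and $\int\cdots dB_s$ (pathwise Riemann–Stieltjes, i.e. Young, integral) are used interchangeably for holomorphic functions of $B$, since the two integrals coincide; thus $\int_0^t\frac{\delta B_s}{B_s}$ may be taken to be the complex-valued pathwise Riemann–Stieltjes integral $\int_0^t\frac{dB_s}{B_s}$. $\Gamma$ is the Euler Gamma function. *)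

theory Defs
  imports "HOL-Probability.Probability"
begin

text \<open>A real Gaussian variable may be degenerate, i.e. almost surely constant.\<close>

definition gaussian_variable :: "'a measure \<Rightarrow> ('a \<Rightarrow> real) \<Rightarrow> bool" where
  "gaussian_variable M X \<longleftrightarrow> X \<in> borel_measurable M \<and>
     ((\<exists>\<mu> \<sigma>. \<sigma> > 0 \<and> distributed M lborel X (normal_density \<mu> \<sigma>)) \<or> (\<exists>c. AE \<omega> in M. X \<omega> = c))"

locale gaussian_process = prob_space M for M :: "'a measure" +
  fixes T :: "'i set" and X :: "'i \<Rightarrow> 'a \<Rightarrow> real"
  assumes gaussian_combination:
    "\<And>J c. finite J \<Longrightarrow> J \<subseteq> T \<Longrightarrow> gaussian_variable M (\<lambda>\<omega>. \<Sum>t\<in>J. c t * X t \<omega>)"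

locale fractional_brownian_motion = gaussian_process M "{0..}" X
  for M :: "'a measure" and X :: "real \<Rightarrow> 'a \<Rightarrow> real" +
  fixes H x :: real
  assumes mean: "\<And>t. t \<ge> 0 \<Longrightarrow> expectation (X t) = x"
    and covariance: "\<And>s t. s \<ge> 0 \<Longrightarrow> t \<ge> 0 \<Longrightarrow>
      expectation (\<lambda>\<omega>. (X s \<omega> - expectation (X s)) * (X t \<omega> - expectation (X t)))
        = (s powr (2 * H) + t powr (2 * H) - \<bar>t - s\<bar> powr (2 * H)) / 2"
    and continuous_paths: "AE \<omega> in M. continuous_on {0..} (\<lambda>t. X t \<omega>)"

text \<open>Independence is that of the two processes, as random elements of the product space
  \<open>\<real>\<^bsup>[0,\<infinity>)\<^esup>\<close>.\<close>

locale complex_fractional_brownian_motion = prob_space M for M :: "'a measure" +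
  fixes B :: "real \<Rightarrow> 'a \<Rightarrow> complex" and H :: real and z0 :: complex
  assumes Re_fbm: "fractional_brownian_motion M (\<lambda>t \<omega>. Re (B t \<omega>)) H (Re z0)"
    and Im_fbm: "fractional_brownian_motion M (\<lambda>t \<omega>. Im (B t \<omega>)) H (Im z0)"
    and indep_Re_Im:
      "indep_var (\<Pi>\<^sub>M t\<in>{0..}. borel) (\<lambda>\<omega>. \<lambda>t\<in>{0..}. Re (B t \<omega>))
                 (\<Pi>\<^sub>M t\<in>{0..}. borel) (\<lambda>\<omega>. \<lambda>t\<in>{0..}. Im (B t \<omega>))"

text \<open>The Riemann--Stieltjes integral of \<open>f\<close> against \<open>g\<close>, as the limit of Riemann sums with
  arbitrary tags when the mesh tends to 0: the gauge is a constant radius, and \<open>Sup K\<close>, \<open>Inf K\<close>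
  are the endpoints of the subinterval \<open>K\<close>.\<close>

definition has_rs_integral ::
    "(real \<Rightarrow> complex) \<Rightarrow> (real \<Rightarrow> complex) \<Rightarrow> real \<Rightarrow> real \<Rightarrow> complex \<Rightarrow> bool" where
  "has_rs_integral f g a b I \<longleftrightarrow>
     (\<forall>\<epsilon>>0. \<exists>\<delta>>0. \<forall>p. p tagged_division_of {a..b} \<and> (\<lambda>x. ball x \<delta>) fine p \<longrightarrow>
        norm ((\<Sum>(x, K)\<in>p. f x * (g (Sup K) - g (Inf K))) - I) < \<epsilon>)"

definition rs_integrable ::
    "(real \<Rightarrow> complex) \<Rightarrow> (real \<Rightarrow> complex) \<Rightarrow> real \<Rightarrow> real \<Rightarrow> bool" where
  "rs_integrable f g a b \<longleftrightarrow> (\<exists>I. has_rs_integral f g a b I)"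

definition rs_integral ::
    "(real \<Rightarrow> complex) \<Rightarrow> (real \<Rightarrow> complex) \<Rightarrow> real \<Rightarrow> real \<Rightarrow> complex" where
  "rs_integral f g a b = (THE I. has_rs_integral f g a b I)"

lemma has_rs_integral_unique:
  assumes "has_rs_integral f g a b I" "has_rs_integral f g a b J"
  shows "I = J"
proof (rule ccontr)
  assume "I \<noteq> J"
  define e where "e = norm (I - J) / 2"
  define S where "S = (\<lambda>p. \<Sum>(x, K)\<in>p. f x * (g (Sup K) - g (Inf K)))"
  have e: "e > 0" using \<open>I \<noteq> J\<close> by (simp add: e_def)
  have ex: "\<exists>d>0. \<forall>p. p tagged_division_of {a..b} \<and> (\<lambda>x. ball x d) fine p \<longrightarrow> norm (S p - L) < e"
    if "has_rs_integral f g a b L" for L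
    using that[unfolded has_rs_integral_def, THEN spec, THEN mp, OF e] unfolding S_def .
  obtain d1 where d1: "d1 > 0"
    "\<forall>p. p tagged_division_of {a..b} \<and> (\<lambda>x. ball x d1) fine p \<longrightarrow> norm (S p - I) < e"
    using ex[OF assms(1)] by (elim exE conjE)
  obtain d2 where d2: "d2 > 0"
    "\<forall>p. p tagged_division_of {a..b} \<and> (\<lambda>x. ball x d2) fine p \<longrightarrow> norm (S p - J) < e"
    using ex[OF assms(2)] by (elim exE conjE)
  have "gauge (\<lambda>x::real. ball x d1 \<inter> ball x d2)"
    unfolding gauge_def using d1(1) d2(1) by (simp add: open_Int)
  then obtain p where p: "p tagged_division_of {a..b}" "(\<lambda>x. ball x d1 \<inter> ball x d2) fine p"
    by (rule fine_division_exists_real)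
  have "(\<lambda>x. ball x d1) fine p" "(\<lambda>x. ball x d2) fine p"
    using p(2) by (simp_all only: fine_Int)
  then have "norm (S p - I) < e" "norm (S p - J) < e"
    using d1(2) d2(2) p(1) by simp_all
  then have "norm (I - J) < e + e"
    using norm_triangle_ineq4[of "S p - J" "S p - I"] by simp
  then show False by (simp add: e_def)
qed

lemma rs_integral_unique: "has_rs_integral f g a b I \<Longrightarrow> rs_integral f g a b = I"
  unfolding rs_integral_def by (blast intro: has_rs_integral_unique)

end

theory Submission
  imports Defs "HOL-Real_Asymp.Real_Asymp"
begin

text \<open>
  Both integrals are sums over the dyadic blocks \<open>[2\<^sup>n, 2\<^bsup>n+1\<^esup>]\<close>, and self-similarity makes the blocks
  asymptotically stationary; the theorem is a strong law along \<open>n\<close>, interpolated to real times.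

  A path \<open>B\<close> is Hoelder of order above \<open>1/2\<close> and avoids 0, so \<open>B = exp L\<close> with \<open>L\<close> continuous, and the
  Young integral of \<open>1 / B\<close> against \<open>B\<close> is \<open>L t - L 0\<close>. Its real part is \<open>ln \<bar>B t\<bar> - ln \<bar>z0\<bar>\<close>, which is
  \<open>(H + o(1)) ln t\<close> by Gaussian moment bounds at the times \<open>2\<^sup>n\<close>. Its imaginary part is the winding: over one
  block it is a Riemann sum of slowly growing level plus a sewing error that is summable on average. The
  Riemann sums of different blocks decorrelate geometrically, which is seen by regressing the increments on
  the base points, where \<open>Im\<close> kills the component of an increment along its own base point.

  For the second limit, the integrand over one block is truncated near 0. The truncated masses are Lipschitz
  functions of the path and decorrelate geometrically, and their means converge to \<open>ln 2\<close> times the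
  moment \<open>E \<bar>N\<bar>\<^bsup>-1/H\<^esup>\<close> of a standard complex Gaussian \<open>N\<close> with independent unit-variance coordinates.
\<close>

section \<open>Uniqueness and independence from characteristic functions\<close>

text \<open>The obstacle is that \<open>1 / B\<close> has moments of order below 2 only: a planar
  Gaussian has a positive density at 0, so \<open>norm (B t) powr (- c)\<close> is integrable just
  for \<open>c < 2\<close>. Everything is therefore arranged around an exponent \<open>q\<close>
  with \<open>1 / H < q < 2\<close>. The lower bound makes \<open>q * H > 1\<close>, so that dyadic
  sewing errors sum; the upper bound keeps them integrable. Such a \<open>q\<close> exists because
  \<open>H > 1 / 2\<close>. Second moments of Riemann sums of \<open>1 / B\<close> are out of reach,
  so covariances are computed only after a truncation; for the winding it replaces
  \<open>1 / w\<close> by a positive multiple of \<open>cnj w\<close>, which keeps the product with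
  \<open>w\<close> real. Truncation and Riemann sums over block \<open>n\<close> use a resolution
  with \<open>2 ^ level n\<close> of order \<open>n powr (1 / 16)\<close>: the powers of it lost in
  second moments stay within what the strong law tolerates, and errors of size
  \<open>2 powr (- c * level n)\<close> become summable once divided by \<open>n\<close>.
  Independence, moments and correlations all come from the joint characteristic function of finitely
  many values of the path.\<close>

lemma (in prob_space) signed_char_unique_real:
  fixes U Y :: "'a \<Rightarrow> real"
  assumes [measurable]: "U \<in> borel_measurable M" "Y \<in> borel_measurable M"
    and bd: "\<And>\<xi>. \<bar>U \<xi>\<bar> \<le> 1"
    and ch: "\<And>a. (CLINT \<xi>|M. complex_of_real (U \<xi>) * iexp (a * Y \<xi>)) = 0"
    and A: "A \<in> sets borel"
  shows "expectation (\<lambda>\<xi>. U \<xi> * indicator A (Y \<xi>)) = 0"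
proof -
  have iU: "integrable M U"
    by (rule integrable_const_bound[where B=1]) (use bd in auto)
  have iUY: "integrable M (\<lambda>\<xi>. complex_of_real (U \<xi>) * iexp (a * Y \<xi>))" for a
    by (rule integrable_const_bound[where B=1]) (use bd in \<open>auto simp: norm_mult\<close>)
  have U0: "expectation U = 0"
    using ch[of 0] by simp
  have nn: "0 \<le> 1 + U \<xi>" for \<xi>
    using bd[of \<xi>] by linarith
  \<comment> \<open>Since \<open>1 + U\<close> is nonnegative and has mean 1 (the hypothesis at
    \<open>a = 0\<close>), it is a probability density. Under it and under \<open>M\<close> the
    variable \<open>Y\<close> has the same characteristic function, so Levy uniqueness turns a
    statement about a signed weight into one about two laws.\<close>
  define N where "N = density M (\<lambda>\<xi>. ennreal (1 + U \<xi>))"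
  interpret N: prob_space N
  proof
    have "emeasure N (space N) = (\<integral>\<^sup>+\<xi>. ennreal (1 + U \<xi>) \<partial>M)"
      unfolding N_def by (simp add: emeasure_density cong: nn_integral_cong)
    also have "\<dots> = ennreal (expectation (\<lambda>\<xi>. 1 + U \<xi>))"
      using nn iU by (intro nn_integral_eq_integral) auto
    also have "\<dots> = 1"
      using iU U0 by (simp add: prob_space)
    finally show "emeasure N (space N) = 1" .
  qed
  have [measurable]: "Y \<in> borel_measurable N" "random_variable borel Y" 
    by (simp_all add: N_def)
  have rd: "real_distribution (distr N borel Y)" "real_distribution (distr M borel Y)"
    by (auto intro!: N.real_distribution_distr real_distribution_distr)
  have "char (distr N borel Y) t = char (distr M borel Y) t" for t
  proof -
    have "char (distr N borel Y) t = (CLINT \<xi>|N. iexp (t * Y \<xi>))"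
      by (simp add: char_def integral_distr)
    also have "\<dots> = (CLINT \<xi>|M. (1 + U \<xi>) *\<^sub>R iexp (t * Y \<xi>))"
      unfolding N_def using nn by (subst integral_density) auto
    also have "\<dots> = (CLINT \<xi>|M. iexp (t * Y \<xi>) + complex_of_real (U \<xi>) * iexp (t * Y \<xi>))"
      by (intro Bochner_Integration.integral_cong) (auto simp: scaleR_conv_of_real algebra_simps)
    also have "\<dots> = (CLINT \<xi>|M. iexp (t * Y \<xi>))"
      using iUY[of t] ch[of t] by (subst Bochner_Integration.integral_add) (auto intro!: integrable_iexp)
    also have "\<dots> = char (distr M borel Y) t"
      by (simp add: char_def integral_distr)
    finally show ?thesis .
  qed
  then have "distr N borel Y = distr M borel Y"
    using Levy_uniqueness[OF rd] by blast
  then have "(LINT x|distr N borel Y. indicator A x) = (LINT x|distr M borel Y. (indicator A x :: real))"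
    by simp
  then have "(LINT \<xi>|N. indicator A (Y \<xi>)) = (LINT \<xi>|M. (indicator A (Y \<xi>) :: real))"
    using A by (subst (asm) (1 2) integral_distr) auto
  moreover have "(LINT \<xi>|N. (indicator A (Y \<xi>) :: real)) = (LINT \<xi>|M. (1 + U \<xi>) *\<^sub>R indicator A (Y \<xi>))"
    unfolding N_def using A nn by (subst integral_density) auto
  moreover have "\<dots> = (LINT \<xi>|M. indicator A (Y \<xi>) + U \<xi> * indicator A (Y \<xi>))"
    by (intro Bochner_Integration.integral_cong) (auto simp: algebra_simps)
  moreover have "\<dots> = (LINT \<xi>|M. indicator A (Y \<xi>)) + (LINT \<xi>|M. U \<xi> * indicator A (Y \<xi>))"
    using A bd by (intro Bochner_Integration.integral_add integrable_const_bound[where B=1])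
      (auto simp: abs_mult indicator_def)
  ultimately show ?thesis by simp
qed

text \<open>Conjugating the hypothesis at \<open>- a\<close> gives it for \<open>cnj U\<close>, so
  the real and imaginary parts of \<open>U\<close> satisfy it separately; dividing by a bound
  \<open>D \<ge> 1\<close> brings them into the range of the real case.\<close>

lemma (in prob_space) signed_char_unique_1d:
  fixes U :: "'a \<Rightarrow> complex" and Y :: "'a \<Rightarrow> real"
  assumes [measurable]: "U \<in> borel_measurable M" "Y \<in> borel_measurable M"
    and bd: "\<And>\<xi>. norm (U \<xi>) \<le> C"
    and ch: "\<And>a. (CLINT \<xi>|M. U \<xi> * iexp (a * Y \<xi>)) = 0"
    and A: "A \<in> sets borel"
  shows "(CLINT \<xi>|M. U \<xi> * indicator A (Y \<xi>)) = 0"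
proof -
  define D where "D = max C 1"
  have D: "D > 0" "\<And>\<xi>. norm (U \<xi>) \<le> D" using bd by (auto simp: D_def intro: le_max_iff_disj[THEN iffD2])
  have iUY: "integrable M (\<lambda>\<xi>. U \<xi> * iexp (a * Y \<xi>))" for a
    by (rule integrable_const_bound[where B=D]) (use D in \<open>auto simp: norm_mult\<close>)
  have [measurable]: "(\<lambda>\<xi>. cnj (U \<xi>)) \<in> borel_measurable M"
    by (rule borel_measurable_continuous_on[where f=cnj]) (auto intro: continuous_intros)
  have iUYc: "integrable M (\<lambda>\<xi>. cnj (U \<xi>) * iexp (a * Y \<xi>))" for a
    by (rule integrable_const_bound[where B=D]) (use D in \<open>auto simp: norm_mult\<close>)
  have ch': "(CLINT \<xi>|M. cnj (U \<xi>) * iexp (a * Y \<xi>)) = 0" for a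
  proof -
    have "(CLINT \<xi>|M. cnj (U \<xi>) * iexp (a * Y \<xi>)) = (CLINT \<xi>|M. cnj (U \<xi> * iexp (- a * Y \<xi>)))"
      by (intro Bochner_Integration.integral_cong) (auto simp: exp_cnj)
    also have "\<dots> = cnj (CLINT \<xi>|M. U \<xi> * iexp (- a * Y \<xi>))"
      by (rule Bochner_Integration.integral_cnj)
    finally show ?thesis using ch[of "-a"] by simp
  qed
  have chRe: "(CLINT \<xi>|M. complex_of_real (Re (U \<xi>) / D) * iexp (a * Y \<xi>)) = 0" for a
  proof -
    have "(CLINT \<xi>|M. complex_of_real (Re (U \<xi>) / D) * iexp (a * Y \<xi>))
      = (CLINT \<xi>|M. (U \<xi> * iexp (a * Y \<xi>) + cnj (U \<xi>) * iexp (a * Y \<xi>)) / (2 * D))"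
      using D by (intro Bochner_Integration.integral_cong)
        (auto simp: complex_add_cnj distrib_right[symmetric])
    then show ?thesis using ch[of a] ch'[of a] iUY[of a] iUYc[of a] by simp
  qed
  have chIm: "(CLINT \<xi>|M. complex_of_real (Im (U \<xi>) / D) * iexp (a * Y \<xi>)) = 0" for a
  proof -
    have "(CLINT \<xi>|M. complex_of_real (Im (U \<xi>) / D) * iexp (a * Y \<xi>))
      = (CLINT \<xi>|M. (U \<xi> * iexp (a * Y \<xi>) - cnj (U \<xi>) * iexp (a * Y \<xi>)) / (2 * D * \<i>))"
      using D by (intro Bochner_Integration.integral_cong)
        (auto simp: complex_diff_cnj left_diff_distrib[symmetric])
    then show ?thesis using ch[of a] ch'[of a] iUY[of a] iUYc[of a] by simp
  qed
  have "expectation (\<lambda>\<xi>. (Re (U \<xi>) / D) * indicator A (Y \<xi>)) = 0"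
    using D abs_Re_le_cmod order_trans
    by (intro signed_char_unique_real[OF _ _ _ chRe A]) (auto simp: field_simps, blast)
  then have re: "expectation (\<lambda>\<xi>. Re (U \<xi>) * indicator A (Y \<xi>)) = 0"
    using D by simp
  have "expectation (\<lambda>\<xi>. (Im (U \<xi>) / D) * indicator A (Y \<xi>)) = 0"
    using D abs_Im_le_cmod order_trans
    by (intro signed_char_unique_real[OF _ _ _ chIm A]) (auto simp: field_simps, blast)
  then have im: "expectation (\<lambda>\<xi>. Im (U \<xi>) * indicator A (Y \<xi>)) = 0"
    using D by simp
  have int: "integrable M (\<lambda>\<xi>. U \<xi> * indicator A (Y \<xi>))"
    by (rule integrable_const_bound[where B=D]) (use D A in \<open>auto simp: norm_mult indicator_def intro: less_imp_le\<close>)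
  show ?thesis
  proof (rule complex_eqI)
    have "Re (CLINT \<xi>|M. U \<xi> * indicator A (Y \<xi>)) = expectation (\<lambda>\<xi>. Re (U \<xi> * indicator A (Y \<xi>)))"
      using int by (rule integral_Re[symmetric])
    also have "\<dots> = expectation (\<lambda>\<xi>. Re (U \<xi>) * indicator A (Y \<xi>))"
      by (intro Bochner_Integration.integral_cong) (auto simp: indicator_def)
    finally show "Re (CLINT \<xi>|M. U \<xi> * indicator A (Y \<xi>)) = Re 0" using re by simp
    have "Im (CLINT \<xi>|M. U \<xi> * indicator A (Y \<xi>)) = expectation (\<lambda>\<xi>. Im (U \<xi> * indicator A (Y \<xi>)))"
      using int by (rule integral_Im[symmetric])
    also have "\<dots> = expectation (\<lambda>\<xi>. Im (U \<xi>) * indicator A (Y \<xi>))"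
      by (intro Bochner_Integration.integral_cong) (auto simp: indicator_def)
    finally show "Im (CLINT \<xi>|M. U \<xi> * indicator A (Y \<xi>)) = Im 0" using im by simp
  qed
qed

text \<open>The coordinates are treated one at a time: the exponentials of the remaining coordinates and
  the indicators of those already done are absorbed into the bounded weight.\<close>

lemma (in prob_space) signed_char_unique_box:
  fixes U :: "'a \<Rightarrow> complex" and Y :: "'a \<Rightarrow> 'b::euclidean_space"
  assumes [measurable]: "U \<in> borel_measurable M" "Y \<in> borel_measurable M"
    and bd: "\<And>\<xi>. norm (U \<xi>) \<le> C"
    and ch: "\<And>a. (CLINT \<xi>|M. U \<xi> * iexp (a \<bullet> Y \<xi>)) = 0"
  shows "(CLINT \<xi>|M. U \<xi> * indicator (box p r) (Y \<xi>)) = 0"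
proof -
  define I where "I = (\<lambda>b \<xi>. indicator {p \<bullet> b<..<r \<bullet> b} (Y \<xi> \<bullet> b) :: complex)"
  have [measurable]: "I b \<in> borel_measurable M" for b
    unfolding I_def by measurable
  have I1: "norm (I b \<xi>) \<le> 1" for b \<xi> by (auto simp: I_def indicator_def)
  have "finite K \<Longrightarrow> K \<subseteq> Basis \<Longrightarrow>
      \<forall>a. (CLINT \<xi>|M. U \<xi> * (\<Prod>b\<in>K. I b \<xi>) * iexp (\<Sum>b\<in>Basis - K. a b * (Y \<xi> \<bullet> b))) = 0"
    for K :: "'b set"
  proof (induction K rule: finite_induct)
    case empty
    show ?case
    proof
      fix a :: "'b \<Rightarrow> real"
      have "(\<Sum>b\<in>Basis. a b *\<^sub>R b) \<bullet> Y \<xi> = (\<Sum>b\<in>Basis. a b * (Y \<xi> \<bullet> b))" for \<xi>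
        by (simp add: inner_sum_right inner_commute[of _ "Y \<xi>"])
      then show "(CLINT \<xi>|M. U \<xi> * (\<Prod>b\<in>{}. I b \<xi>) * iexp (\<Sum>b\<in>Basis - {}. a b * (Y \<xi> \<bullet> b))) = 0"
        using ch[of "\<Sum>b\<in>Basis. a b *\<^sub>R b"] by simp
    qed
  next
    case (insert c K)
    show ?case
    proof
      fix a :: "'b \<Rightarrow> real"
      define U' where "U' = (\<lambda>\<xi>. U \<xi> * (\<Prod>b\<in>K. I b \<xi>) * iexp (\<Sum>b\<in>Basis - insert c K. a b * (Y \<xi> \<bullet> b)))"
      have [measurable]: "U' \<in> borel_measurable M" unfolding U'_def by measurable
      have P1: "norm (\<Prod>b\<in>K. I b \<xi>) \<le> 1" for \<xi>
        unfolding prod_norm[symmetric] by (intro prod_le_1) (use I1 in auto)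
      have "norm (U' \<xi>) \<le> C" for \<xi>
      proof -
        have "norm (U' \<xi>) = norm (U \<xi>) * norm (\<Prod>b\<in>K. I b \<xi>)"
          unfolding U'_def norm_mult norm_exp_i_times by simp
        also have "\<dots> \<le> norm (U \<xi>) * 1" by (intro mult_left_mono P1) auto
        finally show ?thesis using bd[of \<xi>] by simp
      qed
      moreover have "(CLINT \<xi>|M. U' \<xi> * iexp (t * (Y \<xi> \<bullet> c))) = 0" for t
      proof -
        have "(\<Sum>b\<in>Basis - K. (a(c := t)) b * (Y \<xi> \<bullet> b))
          = t * (Y \<xi> \<bullet> c) + (\<Sum>b\<in>Basis - insert c K. a b * (Y \<xi> \<bullet> b))" for \<xi>
        proof -
          have e: "Basis - K = insert c (Basis - insert c K)" using insert by auto
          show ?thesis by (subst e, subst sum.insert) (auto intro!: sum.cong)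
        qed
        then have "U' \<xi> * iexp (t * (Y \<xi> \<bullet> c)) = U \<xi> * (\<Prod>b\<in>K. I b \<xi>)
            * iexp (\<Sum>b\<in>Basis - K. (a(c := t)) b * (Y \<xi> \<bullet> b))" for \<xi>
          by (simp only: U'_def of_real_add distrib_left exp_add) (simp add: mult_ac)
        then show ?thesis using insert.IH insert.prems by simp
      qed
      ultimately have "(CLINT \<xi>|M. U' \<xi> * indicator {p \<bullet> c<..<r \<bullet> c} (Y \<xi> \<bullet> c)) = 0"
        by (intro signed_char_unique_1d[where C=C]) auto
      moreover have "U' \<xi> * indicator {p \<bullet> c<..<r \<bullet> c} (Y \<xi> \<bullet> c) =
        U \<xi> * (\<Prod>b\<in>insert c K. I b \<xi>) * iexp (\<Sum>b\<in>Basis - insert c K. a b * (Y \<xi> \<bullet> b))" for \<xi>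
        unfolding U'_def using insert by (simp add: I_def mult_ac)
      ultimately show "(CLINT \<xi>|M. U \<xi> * (\<Prod>b\<in>insert c K. I b \<xi>)
          * iexp (\<Sum>b\<in>Basis - insert c K. a b * (Y \<xi> \<bullet> b))) = 0" by simp
    qed
  qed
  from this[of Basis] have "(CLINT \<xi>|M. U \<xi> * (\<Prod>b\<in>Basis. I b \<xi>)) = 0" by simp
  moreover have "(\<Prod>b\<in>Basis. I b \<xi>) = indicator (box p r) (Y \<xi>)" for \<xi>
  proof (cases "Y \<xi> \<in> box p r")
    case True
    then show ?thesis by (auto simp: I_def mem_box intro!: prod.neutral)
  next
    case False
    then obtain b where "b \<in> Basis" "\<not> (p \<bullet> b < Y \<xi> \<bullet> b \<and> Y \<xi> \<bullet> b < r \<bullet> b)" by (auto simp: mem_box)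
    then have "I b \<xi> = 0" by (auto simp: I_def)
    then show ?thesis using False \<open>b \<in> Basis\<close> by (auto intro!: prod_zero)
  qed
  ultimately show ?thesis by simp
qed

text \<open>Boxes form an intersection-stable generator of the Borel sets. Adding 1 to
  \<open>U\<close> again produces a measure, so equality on boxes extends to all Borel sets by the
  uniqueness theorem for measures.\<close>

lemma (in prob_space) signed_char_unique_pos:
  fixes U :: "'a \<Rightarrow> real" and Y :: "'a \<Rightarrow> 'b::euclidean_space"
  assumes [measurable]: "U \<in> borel_measurable M" "Y \<in> borel_measurable M"
    and bd: "\<And>\<xi>. \<bar>U \<xi>\<bar> \<le> 1"
    and bx: "\<And>p r. expectation (\<lambda>\<xi>. U \<xi> * indicator (box p r) (Y \<xi>)) = 0"
    and A: "A \<in> sets borel"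
  shows "expectation (\<lambda>\<xi>. U \<xi> * indicator A (Y \<xi>)) = 0"
proof -
  have nn: "0 \<le> 1 + U \<xi>" for \<xi>
    using bd[of \<xi>] by linarith
  have iU: "integrable M (\<lambda>\<xi>. U \<xi> * indicator A (Y \<xi>))" if "A \<in> sets borel" for A
    by (rule integrable_const_bound[where B=1]) (use bd that in \<open>auto simp: indicator_def\<close>)
  define N where "N = density M (\<lambda>\<xi>. ennreal (1 + U \<xi>))"
  have Neq: "emeasure (distr N borel Y) A = ennreal (expectation (\<lambda>\<xi>. U \<xi> * indicator A (Y \<xi>))
       + prob (Y -` A \<inter> space M))" if [measurable]: "A \<in> sets borel" for A
  proof -
    have "emeasure (distr N borel Y) A = emeasure N (Y -` A \<inter> space M)"
      by (subst emeasure_distr) (auto simp: N_def)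
    also have "\<dots> = (\<integral>\<^sup>+\<xi>. ennreal (1 + U \<xi>) * indicator (Y -` A \<inter> space M) \<xi> \<partial>M)"
      unfolding N_def by (subst emeasure_density) auto
    also have "\<dots> = (\<integral>\<^sup>+\<xi>. ennreal (U \<xi> * indicator A (Y \<xi>) + indicator (Y -` A \<inter> space M) \<xi>) \<partial>M)"
      by (intro nn_integral_cong) (auto simp: indicator_def add.commute)
    also have "\<dots> = ennreal (expectation (\<lambda>\<xi>. U \<xi> * indicator A (Y \<xi>) + indicator (Y -` A \<inter> space M) \<xi>))"
    proof (intro nn_integral_eq_integral AE_I2 Bochner_Integration.integrable_add iU[OF that])
      show "0 \<le> U \<xi> * indicator A (Y \<xi>) + indicator (Y -` A \<inter> space M) \<xi>" if "\<xi> \<in> space M" for \<xi>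
        using nn[of \<xi>] that by (auto simp: indicator_def)
    qed (auto intro!: integrable_real_indicator simp: emeasure_eq_measure)
    also have "\<dots> = ennreal (expectation (\<lambda>\<xi>. U \<xi> * indicator A (Y \<xi>)) + prob (Y -` A \<inter> space M))"
      using iU[OF that] by (subst Bochner_Integration.integral_add)
        (auto intro!: integrable_real_indicator simp: emeasure_eq_measure)
    finally show ?thesis .
  qed
  have "distr N borel Y = distr M borel Y"
  proof (rule measure_eqI_generator_eq[where E="range (\<lambda>(p, r). box p r)" and \<Omega>=UNIV
        and A="\<lambda>n. box (- (real n *\<^sub>R One)) (real n *\<^sub>R One)"])
    show "Int_stable (range (\<lambda>(p, r). box p r :: 'b set))"
      by (auto simp: Int_stable_def box_Int_box)
    show "emeasure (distr N borel Y) X = emeasure (distr M borel Y) X"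
      if "X \<in> range (\<lambda>(p, r). box p r)" for X
    proof -
      have [measurable]: "X \<in> sets borel" using that by auto
      have "expectation (\<lambda>\<xi>. U \<xi> * indicator X (Y \<xi>)) = 0" using that bx by auto
      then show ?thesis
        by (simp add: Neq emeasure_distr emeasure_eq_measure)
    qed
    show "(\<Union>i::nat. box (- (real i *\<^sub>R One)) (real i *\<^sub>R One)) = (UNIV :: 'b set)"
      by (rule UN_box_eq_UNIV)
    show "emeasure (distr N borel Y) (box (- (real i *\<^sub>R One)) (real i *\<^sub>R One)) \<noteq> \<infinity>" for i
      by (subst Neq) auto
  qed (auto simp: borel_eq_box)
  then have "emeasure (distr N borel Y) A = emeasure (distr M borel Y) A" by simp
  then have "ennreal (expectation (\<lambda>\<xi>. U \<xi> * indicator A (Y \<xi>)) + prob (Y -` A \<inter> space M))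
     = ennreal (prob (Y -` A \<inter> space M))"
    using A by (simp add: Neq emeasure_distr emeasure_eq_measure)
  moreover have "0 \<le> expectation (\<lambda>\<xi>. U \<xi> * indicator A (Y \<xi>)) + prob (Y -` A \<inter> space M)"
  proof -
    have [measurable]: "A \<in> sets borel" by fact
    have "0 \<le> expectation (\<lambda>\<xi>. U \<xi> * indicator A (Y \<xi>) + indicator (Y -` A \<inter> space M) \<xi>)"
      using nn by (intro integral_nonneg_AE AE_I2) (auto simp: indicator_def add.commute)
    also have "\<dots> = expectation (\<lambda>\<xi>. U \<xi> * indicator A (Y \<xi>)) + prob (Y -` A \<inter> space M)"
      using iU[OF A] by (subst Bochner_Integration.integral_add)
        (auto intro!: integrable_real_indicator simp: emeasure_eq_measure)
    finally show ?thesis .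
  qed
  ultimately show ?thesis by (simp add: ennreal_inj)
qed

lemma (in prob_space) signed_char_unique:
  fixes U :: "'a \<Rightarrow> complex" and Y :: "'a \<Rightarrow> 'b::euclidean_space"
  assumes [measurable]: "U \<in> borel_measurable M" "Y \<in> borel_measurable M"
    and bd: "\<And>\<xi>. norm (U \<xi>) \<le> C"
    and ch: "\<And>a. (CLINT \<xi>|M. U \<xi> * iexp (a \<bullet> Y \<xi>)) = 0"
    and A: "A \<in> sets borel"
  shows "(CLINT \<xi>|M. U \<xi> * indicator A (Y \<xi>)) = 0"
proof -
  define D where "D = max C 1"
  have D: "D > 0" "\<And>\<xi>. norm (U \<xi>) \<le> D" using bd by (auto simp: D_def intro: le_max_iff_disj[THEN iffD2])
  have int: "integrable M (\<lambda>\<xi>. U \<xi> * indicator A (Y \<xi>))" if "A \<in> sets borel" for A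
    by (rule integrable_const_bound[where B=D]) (use D that in \<open>auto simp: norm_mult indicator_def intro: less_imp_le\<close>)
  have Re: "Re (CLINT \<xi>|M. U \<xi> * indicator A (Y \<xi>)) = D * expectation (\<lambda>\<xi>. (Re (U \<xi>) / D) * indicator A (Y \<xi>))"
    if "A \<in> sets borel" for A
  proof -
    have "Re (CLINT \<xi>|M. U \<xi> * indicator A (Y \<xi>)) = expectation (\<lambda>\<xi>. Re (U \<xi> * indicator A (Y \<xi>)))"
      using int[OF that] by (rule integral_Re[symmetric])
    also have "\<dots> = expectation (\<lambda>\<xi>. D * ((Re (U \<xi>) / D) * indicator A (Y \<xi>)))"
      using D by (intro Bochner_Integration.integral_cong) (auto simp: indicator_def)
    finally show ?thesis by simp
  qed
  have Im: "Im (CLINT \<xi>|M. U \<xi> * indicator A (Y \<xi>)) = D * expectation (\<lambda>\<xi>. (Im (U \<xi>) / D) * indicator A (Y \<xi>))"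
    if "A \<in> sets borel" for A
  proof -
    have "Im (CLINT \<xi>|M. U \<xi> * indicator A (Y \<xi>)) = expectation (\<lambda>\<xi>. Im (U \<xi> * indicator A (Y \<xi>)))"
      using int[OF that] by (rule integral_Im[symmetric])
    also have "\<dots> = expectation (\<lambda>\<xi>. D * ((Im (U \<xi>) / D) * indicator A (Y \<xi>)))"
      using D by (intro Bochner_Integration.integral_cong) (auto simp: indicator_def)
    finally show ?thesis by simp
  qed
  have bx: "(CLINT \<xi>|M. U \<xi> * indicator (box p r) (Y \<xi>)) = 0" for p r
    by (rule signed_char_unique_box[OF _ _ bd ch]) auto
  have "expectation (\<lambda>\<xi>. (Re (U \<xi>) / D) * indicator A (Y \<xi>)) = 0"
  proof (rule signed_char_unique_pos[OF _ _ _ _ A])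
    show "\<bar>Re (U \<xi>) / D\<bar> \<le> 1" for \<xi>
      using D order_trans[OF abs_Re_le_cmod[of "U \<xi>"] D(2)[of \<xi>]] by (simp add: field_simps)
    show "expectation (\<lambda>\<xi>. Re (U \<xi>) / D * indicator (box p r) (Y \<xi>)) = 0" for p r
      using Re[of "box p r"] bx[of p r] D by simp
  qed auto
  moreover have "expectation (\<lambda>\<xi>. (Im (U \<xi>) / D) * indicator A (Y \<xi>)) = 0"
  proof (rule signed_char_unique_pos[OF _ _ _ _ A])
    show "\<bar>Im (U \<xi>) / D\<bar> \<le> 1" for \<xi>
      using D order_trans[OF abs_Im_le_cmod[of "U \<xi>"] D(2)[of \<xi>]] by (simp add: field_simps)
    show "expectation (\<lambda>\<xi>. Im (U \<xi>) / D * indicator (box p r) (Y \<xi>)) = 0" for p r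
      using Im[of "box p r"] bx[of p r] D by simp
  qed auto
  ultimately show ?thesis
    using Re[OF A] Im[OF A] by (intro complex_eqI) auto
qed

text \<open>Kac's criterion, proved in two passes: centring the exponential of
  \<open>b \<bullet> W\<close> gives a bounded weight orthogonal to all characters of
  \<open>V\<close>, hence to all indicators of \<open>V\<close>; the centred indicator of
  \<open>V \<in> A\<close> is then a bounded weight orthogonal to all characters of
  \<open>W\<close>.\<close>

lemma (in prob_space) indep_var_charI:
  fixes V :: "'a \<Rightarrow> 'b::euclidean_space" and W :: "'a \<Rightarrow> 'b"
  assumes [measurable]: "V \<in> borel_measurable M" "W \<in> borel_measurable M"
    and ch: "\<And>a b. (CLINT \<xi>|M. iexp (a \<bullet> V \<xi> + b \<bullet> W \<xi>))
        = (CLINT \<xi>|M. iexp (a \<bullet> V \<xi>)) * (CLINT \<xi>|M. iexp (b \<bullet> W \<xi>))"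
  shows "indep_var borel V borel W"
proof -
  have iV: "integrable M (\<lambda>\<xi>. iexp (a \<bullet> V \<xi>))" for a
    by (rule integrable_const_bound[where B=1]) auto
  have iW: "integrable M (\<lambda>\<xi>. iexp (b \<bullet> W \<xi>))" for b
    by (rule integrable_const_bound[where B=1]) auto
  have iVW: "integrable M (\<lambda>\<xi>. iexp (b \<bullet> W \<xi>) * iexp (a \<bullet> V \<xi>))" for a b
    by (rule integrable_const_bound[where B=1]) (auto simp: norm_mult)
  have iA: "integrable M (\<lambda>\<xi>. iexp (b \<bullet> W \<xi>) * indicator A (V \<xi>))" if "A \<in> sets borel" for A b
    by (rule integrable_const_bound[where B=1]) (use that in \<open>auto simp: norm_mult indicator_def\<close>)
  have 1: "(CLINT \<xi>|M. iexp (b \<bullet> W \<xi>) * indicator A (V \<xi>))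
      = (CLINT \<xi>|M. iexp (b \<bullet> W \<xi>)) * (CLINT \<xi>|M. indicator A (V \<xi>))" if A[measurable]: "A \<in> sets borel" for A b
  proof -
    define c where "c = (CLINT \<xi>|M. iexp (b \<bullet> W \<xi>))"
    have "(CLINT \<xi>|M. (iexp (b \<bullet> W \<xi>) - c) * indicator A (V \<xi>)) = 0"
    proof (rule signed_char_unique[OF _ _ _ _ A])
      show "norm (iexp (b \<bullet> W \<xi>) - c) \<le> 1 + norm c" for \<xi>
        by (rule order_trans[OF norm_triangle_ineq4]) auto
      show "(CLINT \<xi>|M. (iexp (b \<bullet> W \<xi>) - c) * iexp (a \<bullet> V \<xi>)) = 0" for a
      proof -
        have "(CLINT \<xi>|M. (iexp (b \<bullet> W \<xi>) - c) * iexp (a \<bullet> V \<xi>)) =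
            (CLINT \<xi>|M. iexp (b \<bullet> W \<xi>) * iexp (a \<bullet> V \<xi>)) - c * (CLINT \<xi>|M. iexp (a \<bullet> V \<xi>))"
          using iVW[of b a] iV[of a] by (simp add: left_diff_distrib)
        also have "(CLINT \<xi>|M. iexp (b \<bullet> W \<xi>) * iexp (a \<bullet> V \<xi>)) = (CLINT \<xi>|M. iexp (a \<bullet> V \<xi> + b \<bullet> W \<xi>))"
          by (simp add: distrib_left exp_add mult.commute)
        finally show ?thesis using ch[of a b] by (simp add: c_def)
      qed
    qed auto
    then show ?thesis
      using iA[OF A, of b] by (simp add: left_diff_distrib integrable_const_bound[where B=1] indicator_def c_def)
  qed
  have 2: "prob (V -` A \<inter> space M \<inter> (W -` C \<inter> space M)) = prob (V -` A \<inter> space M) * prob (W -` C \<inter> space M)"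
    if A[measurable]: "A \<in> sets borel" and C[measurable]: "C \<in> sets borel" for A C
  proof -
    define c where "c = prob (V -` A \<inter> space M)"
    have cA: "(CLINT \<xi>|M. indicator A (V \<xi>)) = of_real c"
    proof -
      have "(CLINT \<xi>|M. indicator A (V \<xi>)) = (CLINT \<xi>|M. complex_of_real (indicator (V -` A \<inter> space M) \<xi>))"
        by (intro Bochner_Integration.integral_cong) (auto simp: indicator_def)
      also have "\<dots> = of_real (expectation (indicator (V -` A \<inter> space M)))"
        by (rule integral_complex_of_real)
      finally show ?thesis by (simp add: c_def)
    qed
    have "(CLINT \<xi>|M. (indicator A (V \<xi>) - of_real c) * indicator C (W \<xi>)) = 0"
    proof (rule signed_char_unique[OF _ _ _ _ C])
      show "norm (indicator A (V \<xi>) - complex_of_real c) \<le> 1 + \<bar>c\<bar>" for \<xi>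
        by (rule order_trans[OF norm_triangle_ineq4]) (auto simp: indicator_def)
      show "(CLINT \<xi>|M. (indicator A (V \<xi>) - of_real c) * iexp (b \<bullet> W \<xi>)) = 0" for b
        using iA[OF A, of b] iW[of b] 1[OF A, of b] cA
        by (simp add: left_diff_distrib mult.commute)
    qed auto
    then have "expectation (\<lambda>\<xi>. (indicator A (V \<xi>) - c) * indicator C (W \<xi>)) = 0"
    proof -
      have "(CLINT \<xi>|M. (indicator A (V \<xi>) - of_real c) * indicator C (W \<xi>))
        = (CLINT \<xi>|M. complex_of_real ((indicator A (V \<xi>) - c) * indicator C (W \<xi>)))"
        by (intro Bochner_Integration.integral_cong) (auto simp: indicator_def)
      also have "\<dots> = of_real (expectation (\<lambda>\<xi>. (indicator A (V \<xi>) - c) * indicator C (W \<xi>)))"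
        by (rule integral_complex_of_real)
      finally show ?thesis using \<open>(CLINT \<xi>|M. (indicator A (V \<xi>) - of_real c) * indicator C (W \<xi>)) = 0\<close> by simp
    qed
    moreover have "expectation (\<lambda>\<xi>. (indicator A (V \<xi>) - c) * indicator C (W \<xi>))
      = expectation (\<lambda>\<xi>. indicator (V -` A \<inter> space M \<inter> (W -` C \<inter> space M)) \<xi> - c * indicator (W -` C \<inter> space M) \<xi>)"
      by (intro Bochner_Integration.integral_cong) (auto simp: indicator_def)
    moreover have "\<dots> = prob (V -` A \<inter> space M \<inter> (W -` C \<inter> space M)) - c * prob (W -` C \<inter> space M)"
      by (subst Bochner_Integration.integral_diff)
        (auto intro!: integrable_real_indicator integrable_mult_right simp: emeasure_eq_measure)
    ultimately show ?thesis by (simp add: c_def)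
  qed
  show ?thesis
    unfolding indep_var_eq
  proof (intro conjI indep_set_sigma_sets)
    show "indep_set {V -` A \<inter> space M |A. A \<in> sets borel} {W -` A \<inter> space M |A. A \<in> sets borel}"
      unfolding indep_sets2_eq using 2 by auto
    show "Int_stable {V -` A \<inter> space M |A. A \<in> sets borel}" 
      unfolding Int_stable_def by safe (rule_tac x="A \<inter> Aa" in exI, auto)
    show "Int_stable {W -` A \<inter> space M |A. A \<in> sets borel}" 
      unfolding Int_stable_def by safe (rule_tac x="A \<inter> Aa" in exI, auto)
  qed auto
qed

section \<open>Covariances and the centred process\<close>

text \<open>The law is stated as an image of the standard normal law, not through a density, so that
  \<open>\<sigma> = 0\<close>, which occurs at time 0, is covered without a separate case.\<close>

lemma (in prob_space) gaussian_law_of_char: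
  fixes V :: "'a \<Rightarrow> real"
  assumes [measurable]: "V \<in> borel_measurable M"
    and ch: "\<And>x. (CLINT \<xi>|M. iexp (x * V \<xi>)) = of_real (exp (- (x * \<sigma>)\<^sup>2 / 2))"
  shows "distr M borel V = distr std_normal_distribution borel (\<lambda>y. \<sigma> * y)"
proof (rule Levy_uniqueness)
  show "real_distribution (distr M borel V)"
    by (auto intro!: real_distribution_distr)
  interpret N: real_distribution std_normal_distribution
    by (rule real_dist_normal_dist)
  show "real_distribution (distr std_normal_distribution borel (\<lambda>y. \<sigma> * y))"
    by (rule N.real_distribution_distr) auto
  show "char (distr M borel V) = char (distr std_normal_distribution borel (\<lambda>y. \<sigma> * y))"
  proof
    fix t
    have "char (distr std_normal_distribution borel (\<lambda>y. \<sigma> * y)) t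
      = (CLINT y|std_normal_distribution. iexp (t * (\<sigma> * y)))"
      unfolding char_def by (subst integral_distr) auto
    also have "\<dots> = char std_normal_distribution (t * \<sigma>)"
      by (simp add: char_def mult.assoc)
    also have "\<dots> = of_real (exp (- (t * \<sigma>)\<^sup>2 / 2))"
      by (simp only: char_std_normal_distribution)
    also have "\<dots> = char (distr M borel V) t"
      unfolding char_def by (subst integral_distr) (use ch[of t, symmetric] in auto)
    finally show "char (distr M borel V) t = char (distr std_normal_distribution borel (\<lambda>y. \<sigma> * y)) t" ..
  qed
qed

lemma std_normal_second_moment: "integrable std_normal_distribution (\<lambda>x. x\<^sup>2)"
    "(LINT x|std_normal_distribution. x\<^sup>2) = 1"
    "integrable std_normal_distribution (\<lambda>x. x)" "(LINT x|std_normal_distribution. x) = 0"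
proof -
  have 1: "std_normal_density \<in> borel_measurable lborel" "AE x in lborel. 0 \<le> std_normal_density x" by auto
  show "integrable std_normal_distribution (\<lambda>x. x\<^sup>2)"
    using integrable_std_normal_moment[of 2] by (subst integrable_real_density) auto
  show "integrable std_normal_distribution (\<lambda>x. x)"
    using integrable_std_normal_moment[of 1] by (subst integrable_real_density) auto
  show "(LINT x|std_normal_distribution. x\<^sup>2) = 1"
    using std_normal_moment_even[of 1] by (subst integral_real_density) (auto simp: has_bochner_integral_iff)
  show "(LINT x|std_normal_distribution. x) = 0"
    using std_normal_moment_odd[of 0] by (subst integral_real_density) (auto simp: has_bochner_integral_iff)
qed

lemma (in prob_space)
  fixes V :: "'a \<Rightarrow> real"
  assumes [measurable]: "V \<in> borel_measurable M"
    and law: "distr M borel V = distr std_normal_distribution borel (\<lambda>y. \<sigma> * y)"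
  shows scaled_normal_nn_integral:
      "f \<in> borel_measurable borel \<Longrightarrow> (\<integral>\<^sup>+\<xi>. f (V \<xi>) \<partial>M) = (\<integral>\<^sup>+y. f (\<sigma> * y) \<partial>std_normal_distribution)"
    and scaled_normal_integral:
      "g \<in> borel_measurable borel \<Longrightarrow> (\<integral>\<xi>. g (V \<xi>) \<partial>M) = (\<integral>y. (g (\<sigma> * y) :: real) \<partial>std_normal_distribution)"
    and scaled_normal_integrable:
      "g \<in> borel_measurable borel \<Longrightarrow>
        integrable M (\<lambda>\<xi>. g (V \<xi>)) \<longleftrightarrow> integrable std_normal_distribution (\<lambda>y. g (\<sigma> * y))"
proof -
  show "(\<integral>\<^sup>+\<xi>. f (V \<xi>) \<partial>M) = (\<integral>\<^sup>+y. f (\<sigma> * y) \<partial>std_normal_distribution)"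
    if [measurable]: "f \<in> borel_measurable borel"
  proof -
    have "(\<integral>\<^sup>+\<xi>. f (V \<xi>) \<partial>M) = (\<integral>\<^sup>+x. f x \<partial>distr M borel V)" by (simp add: nn_integral_distr)
    also have "\<dots> = (\<integral>\<^sup>+y. f (\<sigma> * y) \<partial>std_normal_distribution)"
      unfolding law by (subst nn_integral_distr) auto
    finally show ?thesis .
  qed
  show "(\<integral>\<xi>. g (V \<xi>) \<partial>M) = (\<integral>y. (g (\<sigma> * y) :: real) \<partial>std_normal_distribution)"
    if [measurable]: "g \<in> borel_measurable borel"
  proof -
    have "(\<integral>\<xi>. g (V \<xi>) \<partial>M) = (\<integral>x. g x \<partial>distr M borel V)" by (simp add: integral_distr)
    also have "\<dots> = (\<integral>y. g (\<sigma> * y) \<partial>std_normal_distribution)"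
      unfolding law by (subst integral_distr) auto
    finally show ?thesis .
  qed
  show "integrable M (\<lambda>\<xi>. g (V \<xi>)) \<longleftrightarrow> integrable std_normal_distribution (\<lambda>y. g (\<sigma> * y))"
    if [measurable]: "g \<in> borel_measurable borel"
  proof -
    have "integrable M (\<lambda>\<xi>. g (V \<xi>)) \<longleftrightarrow> integrable (distr M borel V) g" by (simp add: integrable_distr_eq)
    also have "\<dots> \<longleftrightarrow> integrable std_normal_distribution (\<lambda>y. g (\<sigma> * y))"
      unfolding law by (subst integrable_distr_eq) auto
    finally show ?thesis .
  qed
qed

section \<open>Covariance form of finite linear combinations\<close>

definition fbm_cov :: "real \<Rightarrow> real \<Rightarrow> real \<Rightarrow> real" where
  "fbm_cov H s t = (s powr (2 * H) + t powr (2 * H) - \<bar>t - s\<bar> powr (2 * H)) / 2"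

lemma fbm_cov_commute: "fbm_cov H s t = fbm_cov H t s"
  by (simp add: fbm_cov_def abs_minus_commute)

text \<open>The covariance of two linear combinations of the values of one coordinate at the times
  in \<open>J\<close>. Working with this bilinear form reduces later covariances to algebra on
  coefficient functions.\<close>

definition cov_form :: "real \<Rightarrow> real set \<Rightarrow> (real \<Rightarrow> real) \<Rightarrow> (real \<Rightarrow> real) \<Rightarrow> real" where
  "cov_form H J a b = (\<Sum>s\<in>J. \<Sum>t\<in>J. a s * b t * fbm_cov H s t)"

lemma cov_form_commute: "cov_form H J a b = cov_form H J b a"
  unfolding cov_form_def by (subst sum.swap) (simp add: fbm_cov_commute mult_ac)

lemma cov_form_add_left: "cov_form H J (\<lambda>t. a t + b t) c = cov_form H J a c + cov_form H J b c"
  unfolding cov_form_def by (simp add: distrib_right sum.distrib)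

lemma cov_form_scale_left: "cov_form H J (\<lambda>t. x * a t) c = x * cov_form H J a c"
  unfolding cov_form_def by (simp add: sum_distrib_left mult_ac)

lemma cov_form_add_right: "cov_form H J c (\<lambda>t. a t + b t) = cov_form H J c a + cov_form H J c b"
  by (simp add: cov_form_commute[of _ _ c] cov_form_add_left)

lemma cov_form_scale_right: "cov_form H J c (\<lambda>t. x * a t) = x * cov_form H J c a"
  by (simp add: cov_form_commute[of _ _ c] cov_form_scale_left)

lemma cov_form_diff_left: "cov_form H J (\<lambda>t. a t - b t) c = cov_form H J a c - cov_form H J b c"
  unfolding cov_form_def by (simp add: left_diff_distrib sum_subtractf)

lemma cov_form_diff_right: "cov_form H J c (\<lambda>t. a t - b t) = cov_form H J c a - cov_form H J c b"
  by (simp add: cov_form_commute[of _ _ c] cov_form_diff_left)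

lemma cov_form_indicator:
  assumes "finite J" "s \<in> J" "t \<in> J"
  shows "cov_form H J (indicator {s}) (indicator {t}) = fbm_cov H s t"
proof -
  have "cov_form H J (indicator {s}) (indicator {t}) = (\<Sum>s'\<in>J. indicator {s} s' * (\<Sum>t'\<in>J. indicator {t} t' * fbm_cov H s' t'))"
    unfolding cov_form_def by (simp add: sum_distrib_left mult_ac)
  also have "\<dots> = fbm_cov H s t"
    using assms by (simp add: indicator_def if_distrib[of "\<lambda>x. x * _"] sum.delta' cong: if_cong)
  finally show ?thesis .
qed

lemmas cov_form_simps = cov_form_add_left cov_form_add_right cov_form_scale_left cov_form_scale_right
  cov_form_diff_left cov_form_diff_right

text \<open>The centred process, modified on a null set so that all its paths are continuous, and
  frozen on the negative half-line.\<close>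

locale centred_fbm = prob_space M for M :: "'a measure" +
  fixes W :: "real \<Rightarrow> 'a \<Rightarrow> complex" and H :: real
  assumes H_gt: "1 / 2 < H" and H_lt: "H < 1"
    and W_measurable[measurable]: "\<And>t. W t \<in> borel_measurable M"
    and W_continuous: "\<And>\<xi>. continuous_on UNIV (\<lambda>t. W t \<xi>)"
    and W_char: "\<And>J a b. finite J \<Longrightarrow> J \<subseteq> {0..} \<Longrightarrow>
       (CLINT \<xi>|M. iexp ((\<Sum>t\<in>J. a t * Re (W t \<xi>)) + (\<Sum>t\<in>J. b t * Im (W t \<xi>))))
         = of_real (exp (- (cov_form H J a a + cov_form H J b b) / 2))"
begin

definition comb :: "real set \<Rightarrow> (real \<Rightarrow> real) \<Rightarrow> 'a \<Rightarrow> complex" where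
  "comb J c \<xi> = (\<Sum>t\<in>J. c t *\<^sub>R W t \<xi>)"

lemma comb_measurable[measurable]: "comb J c \<in> borel_measurable M"
  unfolding comb_def by measurable

lemma comb_add: "comb J (\<lambda>t. a t + b t) \<xi> = comb J a \<xi> + comb J b \<xi>"
  by (simp add: comb_def scaleR_left_distrib sum.distrib)

lemma comb_diff: "comb J (\<lambda>t. a t - b t) \<xi> = comb J a \<xi> - comb J b \<xi>"
  by (simp add: comb_def scaleR_left_diff_distrib sum_subtractf)

lemma comb_scale: "comb J (\<lambda>t. x * a t) \<xi> = x *\<^sub>R comb J a \<xi>"
  by (simp add: comb_def scaleR_sum_right)

lemma comb_indicator: "finite J \<Longrightarrow> t \<in> J \<Longrightarrow> comb J (indicator {t}) \<xi> = W t \<xi>"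
proof -
  assume "finite J" "t \<in> J"
  have "comb J (indicator {t}) \<xi> = (\<Sum>s\<in>J. if s = t then W s \<xi> else 0)"
    unfolding comb_def by (intro sum.cong) auto
  then show ?thesis using \<open>finite J\<close> \<open>t \<in> J\<close> by simp
qed

lemmas comb_simps = comb_add comb_diff comb_scale

context
  fixes J :: "real set"
  assumes J: "finite J" "J \<subseteq> {0..}"
begin

lemma comb_char:
  "(CLINT \<xi>|M. iexp (Re (comb J a \<xi>) + Im (comb J b \<xi>)))
     = of_real (exp (- (cov_form H J a a + cov_form H J b b) / 2))"
  using W_char[OF J, of a b] by (simp add: comb_def)

text \<open>Positive semidefiniteness of the kernel is read off the characteristic function: its
  modulus is at most 1, so the exponent cannot be positive.\<close>

lemma cov_form_nonneg: "0 \<le> cov_form H J a a"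
proof -
  have "norm (CLINT \<xi>|M. iexp (Re (comb J a \<xi>) + Im (comb J (\<lambda>_. 0) \<xi>))) \<le> expectation (\<lambda>\<xi>. 1)"
    by (rule order_trans[OF integral_norm_bound]) (simp add: norm_exp_i_times del: of_real_add)
  then show ?thesis unfolding comb_char norm_of_real by (simp add: prob_space cov_form_def)
qed

lemma comb_law:
  "distr M borel (\<lambda>\<xi>. Re (comb J a \<xi>) + Im (comb J b \<xi>))
    = distr std_normal_distribution borel (\<lambda>y. sqrt (cov_form H J a a + cov_form H J b b) * y)"
proof (rule gaussian_law_of_char)
  fix x
  have "(CLINT \<xi>|M. iexp (x * (Re (comb J a \<xi>) + Im (comb J b \<xi>))))
    = (CLINT \<xi>|M. iexp (Re (comb J (\<lambda>t. x * a t) \<xi>) + Im (comb J (\<lambda>t. x * b t) \<xi>)))"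
    by (simp add: comb_scale distrib_left)
  also have "\<dots> = of_real (exp (- (x * sqrt (cov_form H J a a + cov_form H J b b))\<^sup>2 / 2))"
    unfolding comb_char using cov_form_nonneg[of a] cov_form_nonneg[of b]
    by (simp add: cov_form_simps power_mult_distrib algebra_simps power2_eq_square)
  finally show "(CLINT \<xi>|M. iexp (x * (Re (comb J a \<xi>) + Im (comb J b \<xi>))))
    = of_real (exp (- (x * sqrt (cov_form H J a a + cov_form H J b b))\<^sup>2 / 2))" .
qed measurable

lemma comb_moments:
  shows "integrable M (\<lambda>\<xi>. (Re (comb J a \<xi>) + Im (comb J b \<xi>))\<^sup>2)"
    "expectation (\<lambda>\<xi>. (Re (comb J a \<xi>) + Im (comb J b \<xi>))\<^sup>2) = cov_form H J a a + cov_form H J b b"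
    "integrable M (\<lambda>\<xi>. Re (comb J a \<xi>) + Im (comb J b \<xi>))"
    "expectation (\<lambda>\<xi>. Re (comb J a \<xi>) + Im (comb J b \<xi>)) = 0"
proof -
  define \<sigma> where "\<sigma> = sqrt (cov_form H J a a + cov_form H J b b)"
  define V where "V = (\<lambda>\<xi>. Re (comb J a \<xi>) + Im (comb J b \<xi>))"
  have V: "V \<in> borel_measurable M" "distr M borel V = distr std_normal_distribution borel (\<lambda>y. \<sigma> * y)"
    using comb_law[of a b] unfolding V_def \<sigma>_def by measurable
  have \<sigma>2: "\<sigma>\<^sup>2 = cov_form H J a a + cov_form H J b b"
    using cov_form_nonneg[of a] cov_form_nonneg[of b] by (simp add: \<sigma>_def)
  show "integrable M (\<lambda>\<xi>. (Re (comb J a \<xi>) + Im (comb J b \<xi>))\<^sup>2)"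
    using scaled_normal_integrable[OF V, of "\<lambda>x. x\<^sup>2"] std_normal_second_moment(1)
    unfolding V_def power_mult_distrib by auto
  show "expectation (\<lambda>\<xi>. (Re (comb J a \<xi>) + Im (comb J b \<xi>))\<^sup>2) = cov_form H J a a + cov_form H J b b"
    using scaled_normal_integral[OF V, of "\<lambda>x. x\<^sup>2"] std_normal_second_moment(2)
    unfolding \<sigma>2[symmetric] V_def power_mult_distrib by (simp only: integral_mult_right_zero) simp
  show "integrable M (\<lambda>\<xi>. Re (comb J a \<xi>) + Im (comb J b \<xi>))"
    using scaled_normal_integrable[OF V, of "\<lambda>x. x"] integrable_mult_right[OF std_normal_second_moment(3), of \<sigma>]
    unfolding V_def by auto
  show "expectation (\<lambda>\<xi>. Re (comb J a \<xi>) + Im (comb J b \<xi>)) = 0"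
    using scaled_normal_integral[OF V, of "\<lambda>x. x"] std_normal_second_moment(4)
    unfolding V_def by (simp only: integral_mult_right_zero) simp
qed

lemma comb_zero: "comb J (\<lambda>_. 0) \<xi> = 0"
  by (simp add: comb_def)

lemma comb_Re_moments:
  "integrable M (\<lambda>\<xi>. (Re (comb J a \<xi>))\<^sup>2)" "expectation (\<lambda>\<xi>. (Re (comb J a \<xi>))\<^sup>2) = cov_form H J a a"
  "integrable M (\<lambda>\<xi>. Re (comb J a \<xi>))" "expectation (\<lambda>\<xi>. Re (comb J a \<xi>)) = 0"
  using comb_moments[of a "\<lambda>_. 0"] by (simp_all add: comb_zero cov_form_def)

lemma comb_Im_moments:
  "integrable M (\<lambda>\<xi>. (Im (comb J a \<xi>))\<^sup>2)" "expectation (\<lambda>\<xi>. (Im (comb J a \<xi>))\<^sup>2) = cov_form H J a a"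
  "integrable M (\<lambda>\<xi>. Im (comb J a \<xi>))" "expectation (\<lambda>\<xi>. Im (comb J a \<xi>)) = 0"
  using comb_moments[of "\<lambda>_. 0" a] by (simp_all add: comb_zero cov_form_def)

text \<open>Polarisation. The mixed products have mean zero because the variance of
  \<open>Re (comb J a \<xi>) + Im (comb J b \<xi>)\<close> is the sum of the two variances.\<close>

lemma comb_products:
  "integrable M (\<lambda>\<xi>. Re (comb J a \<xi>) * Re (comb J b \<xi>))"
  "expectation (\<lambda>\<xi>. Re (comb J a \<xi>) * Re (comb J b \<xi>)) = cov_form H J a b"
  "integrable M (\<lambda>\<xi>. Im (comb J a \<xi>) * Im (comb J b \<xi>))"
  "expectation (\<lambda>\<xi>. Im (comb J a \<xi>) * Im (comb J b \<xi>)) = cov_form H J a b"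
  "integrable M (\<lambda>\<xi>. Re (comb J a \<xi>) * Im (comb J b \<xi>))"
  "expectation (\<lambda>\<xi>. Re (comb J a \<xi>) * Im (comb J b \<xi>)) = 0"
proof -
  have R: "(\<lambda>\<xi>. Re (comb J a \<xi>) * Re (comb J b \<xi>)) = (\<lambda>\<xi>. ((Re (comb J (\<lambda>t. a t + b t) \<xi>))\<^sup>2
      - (Re (comb J a \<xi>))\<^sup>2 - (Re (comb J b \<xi>))\<^sup>2) / 2)"
    by (rule ext) (simp add: comb_add power2_eq_square algebra_simps)
  show "integrable M (\<lambda>\<xi>. Re (comb J a \<xi>) * Re (comb J b \<xi>))"
    unfolding R by (intro integrable_divide Bochner_Integration.integrable_diff comb_Re_moments)
  show "expectation (\<lambda>\<xi>. Re (comb J a \<xi>) * Re (comb J b \<xi>)) = cov_form H J a b"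
    unfolding R by (simp add: comb_Re_moments cov_form_simps cov_form_commute[of _ _ b a])
  have I: "(\<lambda>\<xi>. Im (comb J a \<xi>) * Im (comb J b \<xi>)) = (\<lambda>\<xi>. ((Im (comb J (\<lambda>t. a t + b t) \<xi>))\<^sup>2
      - (Im (comb J a \<xi>))\<^sup>2 - (Im (comb J b \<xi>))\<^sup>2) / 2)"
    by (rule ext) (simp add: comb_add power2_eq_square algebra_simps)
  show "integrable M (\<lambda>\<xi>. Im (comb J a \<xi>) * Im (comb J b \<xi>))"
    unfolding I by (intro integrable_divide Bochner_Integration.integrable_diff comb_Im_moments)
  show "expectation (\<lambda>\<xi>. Im (comb J a \<xi>) * Im (comb J b \<xi>)) = cov_form H J a b"
    unfolding I by (simp add: comb_Im_moments cov_form_simps cov_form_commute[of _ _ b a])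
  have X: "(\<lambda>\<xi>. Re (comb J a \<xi>) * Im (comb J b \<xi>)) = (\<lambda>\<xi>. ((Re (comb J a \<xi>) + Im (comb J b \<xi>))\<^sup>2
      - (Re (comb J a \<xi>))\<^sup>2 - (Im (comb J b \<xi>))\<^sup>2) / 2)"
    by (rule ext) (simp add: power2_eq_square algebra_simps)
  show "integrable M (\<lambda>\<xi>. Re (comb J a \<xi>) * Im (comb J b \<xi>))"
    unfolding X by (intro integrable_divide Bochner_Integration.integrable_diff comb_Im_moments comb_Re_moments comb_moments)
  show "expectation (\<lambda>\<xi>. Re (comb J a \<xi>) * Im (comb J b \<xi>)) = 0"
    unfolding X by (simp add: comb_Im_moments comb_Re_moments comb_moments)
qed

text \<open>For Gaussian vectors, vanishing covariances make the exponent of the joint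
  characteristic function split, hence independence. Pairs are used because the regression for the
  winding has two base points and two residuals.\<close>

lemma comb_indep:
  assumes 0: "cov_form H J a1 b1 = 0" "cov_form H J a1 b2 = 0" "cov_form H J a2 b1 = 0" "cov_form H J a2 b2 = 0"
  shows "indep_var borel (\<lambda>\<xi>. (comb J a1 \<xi>, comb J a2 \<xi>)) borel (\<lambda>\<xi>. (comb J b1 \<xi>, comb J b2 \<xi>))"
proof (rule indep_var_charI)
  fix u v :: "complex \<times> complex"
  \<comment> \<open>The inner product on pairs of complex numbers is again a combination:
    \<open>A\<close> and \<open>C\<close> collect the coefficients acting on real parts,
    \<open>A'\<close> and \<open>C'\<close> those acting on imaginary parts.\<close>
  define A where "A = (\<lambda>t. Re (fst u) * a1 t + Re (snd u) * a2 t)"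
  define A' where "A' = (\<lambda>t. Im (fst u) * a1 t + Im (snd u) * a2 t)"
  define C where "C = (\<lambda>t. Re (fst v) * b1 t + Re (snd v) * b2 t)"
  define C' where "C' = (\<lambda>t. Im (fst v) * b1 t + Im (snd v) * b2 t)"
  have u: "u \<bullet> (comb J a1 \<xi>, comb J a2 \<xi>) = Re (comb J A \<xi>) + Im (comb J A' \<xi>)" for \<xi>
    by (simp add: A_def A'_def comb_simps inner_prod_def inner_complex_def)
  have v: "v \<bullet> (comb J b1 \<xi>, comb J b2 \<xi>) = Re (comb J C \<xi>) + Im (comb J C' \<xi>)" for \<xi>
    by (simp add: C_def C'_def comb_simps inner_prod_def inner_complex_def)
  have uv: "u \<bullet> (comb J a1 \<xi>, comb J a2 \<xi>) + v \<bullet> (comb J b1 \<xi>, comb J b2 \<xi>)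
      = Re (comb J (\<lambda>t. A t + C t) \<xi>) + Im (comb J (\<lambda>t. A' t + C' t) \<xi>)" for \<xi>
    by (simp add: u v comb_add)
  have "cov_form H J A C = 0" "cov_form H J A' C' = 0"
    unfolding A_def C_def A'_def C'_def by (simp_all add: cov_form_simps 0)
  then show "(CLINT \<xi>|M. iexp (u \<bullet> (comb J a1 \<xi>, comb J a2 \<xi>) + v \<bullet> (comb J b1 \<xi>, comb J b2 \<xi>)))
     = (CLINT \<xi>|M. iexp (u \<bullet> (comb J a1 \<xi>, comb J a2 \<xi>)))
       * (CLINT \<xi>|M. iexp (v \<bullet> (comb J b1 \<xi>, comb J b2 \<xi>)))"
    unfolding uv unfolding u v comb_char of_real_mult[symmetric] mult_exp_exp
    by (simp add: cov_form_simps cov_form_commute[of _ _ C A] cov_form_commute[of _ _ C' A'] field_simps)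
qed measurable

lemma comb_Re_Im_indep: "indep_var borel (\<lambda>\<xi>. Re (comb J a \<xi>)) borel (\<lambda>\<xi>. Im (comb J a \<xi>))"
proof (rule indep_var_charI)
  fix u v :: real
  have uv: "u \<bullet> Re (comb J a \<xi>) + v \<bullet> Im (comb J a \<xi>)
    = Re (comb J (\<lambda>t. u * a t) \<xi>) + Im (comb J (\<lambda>t. v * a t) \<xi>)" for \<xi>
    by (simp add: comb_scale)
  have u: "u \<bullet> Re (comb J a \<xi>) = Re (comb J (\<lambda>t. u * a t) \<xi>) + Im (comb J (\<lambda>t. 0) \<xi>)" for \<xi>
    by (simp add: comb_scale comb_zero)
  have v: "v \<bullet> Im (comb J a \<xi>) = Re (comb J (\<lambda>t. 0) \<xi>) + Im (comb J (\<lambda>t. v * a t) \<xi>)" for \<xi>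
    by (simp add: comb_scale comb_zero)
  show "(CLINT \<xi>|M. iexp (u \<bullet> Re (comb J a \<xi>) + v \<bullet> Im (comb J a \<xi>)))
     = (CLINT \<xi>|M. iexp (u \<bullet> Re (comb J a \<xi>))) * (CLINT \<xi>|M. iexp (v \<bullet> Im (comb J a \<xi>)))"
    unfolding uv unfolding u v comb_char of_real_mult[symmetric] mult_exp_exp
    by (simp add: cov_form_simps cov_form_def field_simps)
qed measurable

end

end

section \<open>Characteristic function of a complex fractional Brownian motion\<close>

text \<open>A constant is the Gaussian of variance 0 and obeys the same formula, so both branches of
  \<open>gaussian_variable\<close> lead to one statement.\<close>

lemma (in prob_space) gaussian_variable_moments:
  assumes "gaussian_variable M X"
  shows "integrable M X" "integrable M (\<lambda>\<xi>. (X \<xi>)\<^sup>2)"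
    "(CLINT \<xi>|M. iexp (X \<xi> - expectation X)) = of_real (exp (- variance X / 2))"
proof -
  have X[measurable]: "X \<in> borel_measurable M" using assms by (simp add: gaussian_variable_def)
  from assms consider (normal) \<mu> \<sigma> where "\<sigma> > 0" "distributed M lborel X (normal_density \<mu> \<sigma>)"
    | (const) c where "AE \<xi> in M. X \<xi> = c" unfolding gaussian_variable_def by blast
  then have "integrable M X \<and> integrable M (\<lambda>\<xi>. (X \<xi>)\<^sup>2) \<and>
    (CLINT \<xi>|M. iexp (X \<xi> - expectation X)) = of_real (exp (- variance X / 2))"
  proof cases
    case normal
    define Z where "Z = (\<lambda>\<xi>. (X \<xi> - \<mu>) / \<sigma>)"
    have Z[measurable]: "Z \<in> borel_measurable M" unfolding Z_def by measurable
    have E: "expectation X = \<mu>" "variance X = \<sigma>\<^sup>2"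
      using normal_distributed_expectation[OF normal] normal_distributed_variance[OF normal(1,2)] by auto
    have "distributed M lborel Z std_normal_density"
      using normal_standard_normal_convert[OF normal(1), of X \<mu>] normal(2) by (simp add: Z_def)
    then have dZ: "distr M borel Z = std_normal_distribution"
      using distributed_distr_eq_density[of M lborel Z std_normal_density]
      by (simp add: distr_def)
    then have law: "distr M borel Z = distr std_normal_distribution borel (\<lambda>y. 1 * y)"
      by (simp add: distr_id2)
    have mI: "(\<lambda>x::real. x) \<in> borel_measurable borel" "(\<lambda>x::real. x\<^sup>2) \<in> borel_measurable borel"
      by measurable
    have ZZ: "integrable M Z" "integrable M (\<lambda>\<xi>. (Z \<xi>)\<^sup>2)"
      using std_normal_second_moment(1,3)
      by (simp_all only: scaled_normal_integrable[OF Z law mI(1)] scaled_normal_integrable[OF Z law mI(2)] mult_1)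
    have XZ: "X = (\<lambda>\<xi>. \<mu> + \<sigma> * Z \<xi>)" "(\<lambda>\<xi>. (X \<xi>)\<^sup>2) = (\<lambda>\<xi>. \<mu>\<^sup>2 + 2 * \<mu> * \<sigma> * Z \<xi> + \<sigma>\<^sup>2 * (Z \<xi>)\<^sup>2)"
      using normal(1) by (auto simp: Z_def fun_eq_iff power2_eq_square field_simps)
    have "integrable M X" "integrable M (\<lambda>\<xi>. (X \<xi>)\<^sup>2)"
      unfolding XZ(2) by (subst XZ(1), use ZZ in simp, use ZZ in simp)
    moreover have "(CLINT \<xi>|M. iexp (X \<xi> - expectation X)) = (CLINT \<xi>|M. iexp (\<sigma> * Z \<xi>))"
      unfolding E using normal(1) by (simp add: Z_def)
    moreover have "\<dots> = char (distr M borel Z) \<sigma>"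
      unfolding char_def by (subst integral_distr) auto
    moreover have "\<dots> = of_real (exp (- variance X / 2))"
      unfolding E(2) dZ char_std_normal_distribution by simp
    ultimately show ?thesis by simp
  next
    case const
    have E: "expectation X = c"
      using const by (subst integral_cong_AE[where g="\<lambda>_. c"]) (auto simp: prob_space)
    have V: "variance X = 0"
      unfolding E using const by (subst integral_cong_AE[where g="\<lambda>_. 0"]) auto
    have "(CLINT \<xi>|M. iexp (X \<xi> - c)) = (CLINT \<xi>|M. 1)"
      using const by (intro integral_cong_AE) auto
    moreover have "integrable M X" "integrable M (\<lambda>\<xi>. (X \<xi>)\<^sup>2)"
      using const by (auto intro!: integrable_const_bound[where B="\<bar>c\<bar>" and f=X]
          integrable_const_bound[where B="c\<^sup>2" and f="\<lambda>\<xi>. (X \<xi>)\<^sup>2"])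
    ultimately show ?thesis unfolding V unfolding E by (simp add: prob_space)
  qed
  then show "integrable M X" "integrable M (\<lambda>\<xi>. (X \<xi>)\<^sup>2)"
    "(CLINT \<xi>|M. iexp (X \<xi> - expectation X)) = of_real (exp (- variance X / 2))" by auto
qed

context fractional_brownian_motion
begin

lemma gaussian_at: "t \<ge> 0 \<Longrightarrow> gaussian_variable M (X t)"
  using gaussian_combination[of "{t}" "\<lambda>_. 1"] by simp

lemma X_measurable: "t \<ge> 0 \<Longrightarrow> X t \<in> borel_measurable M"
  using gaussian_at by (simp add: gaussian_variable_def)

text \<open>The combination is Gaussian, so only its variance matters, and the covariance assumption
  expands that variance into \<open>cov_form\<close>. The integrability of products needed for the
  expansion follows from the second moments.\<close>

lemma centred_char:
  assumes J: "finite J" "J \<subseteq> {0..}"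
  shows "(CLINT \<xi>|M. iexp (\<Sum>t\<in>J. c t * (X t \<xi> - x))) = of_real (exp (- cov_form H J c c / 2))"
proof -
  have ge: "t \<ge> 0" if "t \<in> J" for t using J that by auto
  define V where "V = (\<lambda>\<xi>. \<Sum>t\<in>J. c t * X t \<xi>)"
  have i1: "integrable M (X t)" "integrable M (\<lambda>\<xi>. (X t \<xi>)\<^sup>2)" if "t \<in> J" for t
    using gaussian_variable_moments[OF gaussian_at[OF ge[OF that]]] by auto
  have EV: "expectation V = (\<Sum>t\<in>J. c t * x)"
    unfolding V_def using i1 by (subst Bochner_Integration.integral_sum) (auto intro!: sum.cong simp: mean ge)
  have VE: "V \<xi> - expectation V = (\<Sum>t\<in>J. c t * (X t \<xi> - x))" for \<xi>
    unfolding EV by (simp add: V_def sum_subtractf[symmetric] right_diff_distrib)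
  have int: "integrable M (\<lambda>\<xi>. (X s \<xi> - x) * (X t \<xi> - x))" if "s \<in> J" "t \<in> J" for s t
  proof (rule Bochner_Integration.integrable_bound)
    have [measurable]: "X s \<in> borel_measurable M" "X t \<in> borel_measurable M" using that ge X_measurable by auto
    show "integrable M (\<lambda>\<xi>. 2 * (X s \<xi>)\<^sup>2 + 2 * (X t \<xi>)\<^sup>2 + 4 * x\<^sup>2)"
      using i1 that by auto
    have "\<bar>(a - x) * (b - x)\<bar> \<le> 2 * a\<^sup>2 + 2 * b\<^sup>2 + 4 * x\<^sup>2" for a b :: real
    proof -
      have "2 * \<bar>(a - x) * (b - x)\<bar> \<le> (a - x)\<^sup>2 + (b - x)\<^sup>2"
        using sum_squares_bound[of "\<bar>a - x\<bar>" "\<bar>b - x\<bar>"] by (simp add: abs_mult)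
      also have "\<dots> \<le> (2 * a\<^sup>2 + 2 * x\<^sup>2) + (2 * b\<^sup>2 + 2 * x\<^sup>2)"
        using zero_le_power2[of "a + x"] zero_le_power2[of "b + x"]
        by (intro add_mono) (auto simp: power2_eq_square algebra_simps)
      also have "\<dots> \<le> 2 * (2 * a\<^sup>2 + 2 * b\<^sup>2 + 4 * x\<^sup>2)" by simp
      finally show ?thesis by simp
    qed
    moreover have "0 \<le> 2 * a\<^sup>2 + 2 * b\<^sup>2 + 4 * x\<^sup>2" for a b :: real by simp
    ultimately show "AE \<xi> in M. norm ((X s \<xi> - x) * (X t \<xi> - x)) \<le> norm (2 * (X s \<xi>)\<^sup>2 + 2 * (X t \<xi>)\<^sup>2 + 4 * x\<^sup>2)"
      by (simp only: real_norm_def abs_of_nonneg) simp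
    show "(\<lambda>\<xi>. (X s \<xi> - x) * (X t \<xi> - x)) \<in> borel_measurable M" by measurable
  qed
  have "variance V = expectation (\<lambda>\<xi>. \<Sum>s\<in>J. \<Sum>t\<in>J. (c s * c t) * ((X s \<xi> - x) * (X t \<xi> - x)))"
    unfolding VE power2_eq_square sum_product by (simp add: mult_ac)
  also have "\<dots> = (\<Sum>s\<in>J. \<Sum>t\<in>J. (c s * c t) * expectation (\<lambda>\<xi>. (X s \<xi> - x) * (X t \<xi> - x)))"
    using int by (subst Bochner_Integration.integral_sum, simp, intro sum.cong refl,
        subst Bochner_Integration.integral_sum) auto
  also have "\<dots> = cov_form H J c c"
    unfolding cov_form_def fbm_cov_def using covariance mean ge by (intro sum.cong refl) auto
  finally have "variance V = cov_form H J c c" .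
  moreover have "gaussian_variable M V" unfolding V_def using gaussian_combination J by blast
  ultimately show ?thesis using gaussian_variable_moments(3)[of V] unfolding VE by simp
qed

end

text \<open>Both exponentials are measurable functionals on the product space, since they read
  finitely many times; independence of the two coordinate processes then factorises the
  expectation.\<close>

lemma (in complex_fractional_brownian_motion) centred_joint_char:
  assumes J: "finite J" "J \<subseteq> {0..}"
  shows "(CLINT \<xi>|M. iexp ((\<Sum>t\<in>J. a t * Re (B t \<xi> - z0)) + (\<Sum>t\<in>J. b t * Im (B t \<xi> - z0))))
      = of_real (exp (- (cov_form H J a a + cov_form H J b b) / 2))"
proof -
  define fr where "fr = (\<lambda>x. iexp (\<Sum>t\<in>J. a t * (x t - Re z0)))"
  define fi where "fi = (\<lambda>x. iexp (\<Sum>t\<in>J. b t * (x t - Im z0)))"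
  have fm[measurable]: "fr \<in> borel_measurable (\<Pi>\<^sub>M t\<in>{0..}. borel)" "fi \<in> borel_measurable (\<Pi>\<^sub>M t\<in>{0..}. borel)"
  proof -
    have [measurable]: "(\<lambda>x. x t) \<in> borel_measurable (\<Pi>\<^sub>M t\<in>{0::real..}. (borel :: real measure))" if "t \<in> J" for t
      using that J by (intro measurable_component_singleton) auto
    show "fr \<in> borel_measurable (\<Pi>\<^sub>M t\<in>{0..}. borel)" "fi \<in> borel_measurable (\<Pi>\<^sub>M t\<in>{0..}. borel)"
      unfolding fr_def fi_def by measurable
  qed
  let ?R = "\<lambda>\<xi>. fr (\<lambda>t\<in>{0..}. Re (B t \<xi>))"
  let ?I = "\<lambda>\<xi>. fi (\<lambda>t\<in>{0..}. Im (B t \<xi>))"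
  have ind: "indep_var borel ?R borel ?I"
    using indep_var_compose[OF indep_Re_Im fm] by (simp add: comp_def)
  have "integrable M ?R" "integrable M ?I"
    using indep_var_rv1[OF ind] indep_var_rv2[OF ind]
    by (auto intro!: integrable_const_bound[where B=1] simp: fr_def fi_def)
  then have "(CLINT \<xi>|M. ?R \<xi> * ?I \<xi>) = (CLINT \<xi>|M. ?R \<xi>) * (CLINT \<xi>|M. ?I \<xi>)"
    by (rule indep_var_lebesgue_integral[OF ind])
  moreover have R: "?R \<xi> = iexp (\<Sum>t\<in>J. a t * (Re (B t \<xi>) - Re z0))" for \<xi>
    using J unfolding fr_def by (auto intro!: arg_cong[where f=exp] arg_cong2[where f="(*)"] sum.cong)
  moreover have I: "?I \<xi> = iexp (\<Sum>t\<in>J. b t * (Im (B t \<xi>) - Im z0))" for \<xi>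
    using J unfolding fi_def by (auto intro!: arg_cong[where f=exp] arg_cong2[where f="(*)"] sum.cong)
  ultimately have "(CLINT \<xi>|M. iexp (\<Sum>t\<in>J. a t * (Re (B t \<xi>) - Re z0)) * iexp (\<Sum>t\<in>J. b t * (Im (B t \<xi>) - Im z0)))
     = of_real (exp (- cov_form H J a a / 2)) * of_real (exp (- cov_form H J b b / 2))"
    unfolding R I fractional_brownian_motion.centred_char[OF Re_fbm J]
      fractional_brownian_motion.centred_char[OF Im_fbm J] by simp
  then show ?thesis
    unfolding of_real_mult[symmetric] mult_exp_exp by (simp add: distrib_left[symmetric] add_divide_distrib)
qed

lemma (in complex_fractional_brownian_motion) centred_version:
  assumes "1 / 2 < H" "H < 1"
  obtains W where "centred_fbm M W H" "AE \<xi> in M. \<forall>t\<ge>0. B t \<xi> = z0 + W t \<xi>"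
proof -
  interpret R: fractional_brownian_motion M "\<lambda>t \<xi>. Re (B t \<xi>)" H "Re z0" by (rule Re_fbm)
  interpret I: fractional_brownian_motion M "\<lambda>t \<xi>. Im (B t \<xi>)" H "Im z0" by (rule Im_fbm)
  have Bm: "B t \<in> borel_measurable M" if "t \<ge> 0" for t
    using R.X_measurable[OF that] I.X_measurable[OF that] by (subst borel_measurable_complex_iff) auto
  have "AE \<xi> in M. continuous_on {0..} (\<lambda>t. B t \<xi>)"
    using R.continuous_paths I.continuous_paths
  proof eventually_elim
    case (elim \<xi>)
    then have "continuous_on {0..} (\<lambda>t. complex_of_real (Re (B t \<xi>)) + \<i> * complex_of_real (Im (B t \<xi>)))"
      by (intro continuous_on_add continuous_on_mult continuous_on_of_real continuous_on_const)
    then show ?case by (simp add: complex_eq[symmetric])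
  qed
  then obtain N where N: "N \<in> null_sets M" "\<And>\<xi>. \<xi> \<in> space M - N \<Longrightarrow> continuous_on {0..} (\<lambda>t. B t \<xi>)"
    by (elim AE_E) (auto simp: null_sets_def)
  have [measurable]: "N \<in> sets M" using N(1) by auto
  define W where "W = (\<lambda>t \<xi>. if \<xi> \<in> space M - N then B (max t 0) \<xi> - z0 else 0)"
  have AEN: "AE \<xi> in M. \<xi> \<in> space M - N"
    using AE_not_in[OF N(1)] AE_space by eventually_elim auto
  have eq: "AE \<xi> in M. \<forall>t\<ge>0. B t \<xi> = z0 + W t \<xi>"
    using AEN by eventually_elim (auto simp: W_def max_def)
  moreover have "centred_fbm M W H"
  proof
    show "W t \<in> borel_measurable M" for t
      using Bm[of "max t 0"] unfolding W_def by measurable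
    show "continuous_on UNIV (\<lambda>t. W t \<xi>)" for \<xi>
    proof (cases "\<xi> \<in> space M - N")
      case True
      have "continuous_on UNIV ((\<lambda>t. B t \<xi>) \<circ> (\<lambda>t. max t 0))"
        by (intro continuous_on_compose continuous_intros continuous_on_subset[OF N(2)[OF True]]) auto
      then show ?thesis using True by (auto simp: W_def comp_def intro!: continuous_intros)
    qed (auto simp: W_def)
    show "(CLINT \<xi>|M. iexp ((\<Sum>t\<in>J. a t * Re (W t \<xi>)) + (\<Sum>t\<in>J. b t * Im (W t \<xi>))))
         = of_real (exp (- (cov_form H J a a + cov_form H J b b) / 2))"
      if J: "finite J" "J \<subseteq> {0..}" for J a b
    proof -
      have ge: "t \<ge> 0" if "t \<in> J" for t using J that by auto
      have m1: "W t \<in> borel_measurable M" for t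
        using Bm[of "max t 0"] unfolding W_def by measurable
      have m2: "(\<lambda>\<xi>. B t \<xi> - z0) \<in> borel_measurable M" if "t \<in> J" for t
        using Bm[OF ge[OF that]] by measurable
      have "(CLINT \<xi>|M. iexp ((\<Sum>t\<in>J. a t * Re (W t \<xi>)) + (\<Sum>t\<in>J. b t * Im (W t \<xi>))))
        = (CLINT \<xi>|M. iexp ((\<Sum>t\<in>J. a t * Re (B t \<xi> - z0)) + (\<Sum>t\<in>J. b t * Im (B t \<xi> - z0))))"
      proof (rule integral_cong_AE)
        show "AE \<xi> in M. iexp ((\<Sum>t\<in>J. a t * Re (W t \<xi>)) + (\<Sum>t\<in>J. b t * Im (W t \<xi>)))
          = iexp ((\<Sum>t\<in>J. a t * Re (B t \<xi> - z0)) + (\<Sum>t\<in>J. b t * Im (B t \<xi> - z0)))"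
          using eq
        proof eventually_elim
          case (elim \<xi>)
          then have "(\<Sum>t\<in>J. a t * Re (W t \<xi>)) = (\<Sum>t\<in>J. a t * Re (B t \<xi> - z0))"
            "(\<Sum>t\<in>J. b t * Im (W t \<xi>)) = (\<Sum>t\<in>J. b t * Im (B t \<xi> - z0))"
            using ge by (auto intro!: sum.cong)
          then show ?case by simp
        qed
      qed (use m1 m2 in measurable)
      then show ?thesis using centred_joint_char[OF J] by simp
    qed
  qed (use assms in auto)
  ultimately show thesis using that by blast
qed

section \<open>Moment bounds\<close>

text \<open>Tonelli on the product law. Stated in \<open>ennreal\<close>, it applies to negative
  powers before their expectations are known to be finite.\<close>

lemma (in prob_space) indep_var_nn_integral:
  fixes X Y :: "'a \<Rightarrow> 'b::euclidean_space"
  assumes ind: "indep_var borel X borel Y"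
    and [measurable]: "f \<in> borel_measurable borel" "g \<in> borel_measurable borel"
  shows "(\<integral>\<^sup>+\<xi>. f (X \<xi>) * g (Y \<xi>) \<partial>M) = (\<integral>\<^sup>+\<xi>. f (X \<xi>) \<partial>M) * (\<integral>\<^sup>+\<xi>. g (Y \<xi>) \<partial>M)"
proof -
  have [measurable]: "X \<in> borel_measurable M" "Y \<in> borel_measurable M"
    using indep_var_rv1[OF ind] indep_var_rv2[OF ind] by auto
  interpret X: prob_space "distr M borel X" by (rule prob_space_distr) auto
  interpret Y: prob_space "distr M borel Y" by (rule prob_space_distr) auto
  interpret XY: pair_prob_space "distr M borel X" "distr M borel Y" ..
  have "(\<integral>\<^sup>+\<xi>. f (X \<xi>) * g (Y \<xi>) \<partial>M)
      = (\<integral>\<^sup>+p. f (fst p) * g (snd p) \<partial>distr M (borel \<Otimes>\<^sub>M borel) (\<lambda>\<xi>. (X \<xi>, Y \<xi>)))"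
    by (subst nn_integral_distr) auto
  also have "\<dots> = (\<integral>\<^sup>+p. f (fst p) * g (snd p) \<partial>(distr M borel X \<Otimes>\<^sub>M distr M borel Y))"
    using ind by (simp add: indep_var_distribution_eq)
  also have "\<dots> = (\<integral>\<^sup>+x. \<integral>\<^sup>+y. f x * g y \<partial>distr M borel Y \<partial>distr M borel X)"
    by (subst Y.nn_integral_fst[symmetric]) auto
  also have "\<dots> = (\<integral>\<^sup>+x. f x \<partial>distr M borel X) * (\<integral>\<^sup>+y. g y \<partial>distr M borel Y)"
    by (simp add: nn_integral_cmult nn_integral_multc)
  also have "\<dots> = (\<integral>\<^sup>+\<xi>. f (X \<xi>) \<partial>M) * (\<integral>\<^sup>+\<xi>. g (Y \<xi>) \<partial>M)"
    by (simp add: nn_integral_distr)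
  finally show ?thesis .
qed

lemma nn_integral_powr_near_zero:
  assumes "0 \<le> \<gamma>" "\<gamma> < 1"
  shows "(\<integral>\<^sup>+u. ennreal (indicator {-1..1} u * \<bar>u\<bar> powr (- \<gamma>)) \<partial>lborel) < \<infinity>"
proof -
  define g where "g = (\<lambda>u::real. ennreal (indicator {0..1} u * u powr (- \<gamma>)))"
  have [measurable]: "g \<in> borel_measurable borel" unfolding g_def by measurable
  have "((\<lambda>u. u powr (- \<gamma>)) has_integral (1 powr (- \<gamma> + 1) / (- \<gamma> + 1))) {0..1}"
    using assms by (intro has_integral_powr_from_0) auto
  then have fin: "integral\<^sup>N lborel g < \<infinity>"
    using nn_integral_has_integral_lebesgue[of "{0..1}" "\<lambda>u. u powr (- \<gamma>)"] unfolding g_def by simp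
  have "(\<integral>\<^sup>+u. ennreal (indicator {-1..1} u * \<bar>u\<bar> powr (- \<gamma>)) \<partial>lborel) \<le> (\<integral>\<^sup>+u. g u + g (- u) \<partial>lborel)"
    by (intro nn_integral_mono) (auto simp: g_def indicator_def)
  also have "\<dots> = integral\<^sup>N lborel g + (\<integral>\<^sup>+u. g (- u) \<partial>lborel)"
    by (intro nn_integral_add) auto
  also have "(\<integral>\<^sup>+u. g (- u) \<partial>lborel) = integral\<^sup>N lborel g"
    using nn_integral_real_affine[of g "-1" 0] by simp
  finally show ?thesis using fin by (simp add: order.strict_trans1)
qed

text \<open>Scaling pulls out \<open>\<sigma> powr (- \<gamma>)\<close>. Away from 0 the remaining
  power is at most 1; near 0 the normal density is at most 1 and Lebesgue measure is translation
  invariant, which makes the bound uniform in the shift \<open>x\<close>.\<close>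

lemma scaled_normal_negative_moment:
  assumes "0 \<le> \<gamma>" "\<gamma> < 1"
  shows "\<exists>C\<ge>0. \<forall>\<sigma>>0. \<forall>x. (\<integral>\<^sup>+y. ennreal (\<bar>x + \<sigma> * y\<bar> powr (- \<gamma>)) \<partial>std_normal_distribution)
     \<le> ennreal (C * \<sigma> powr (- \<gamma>))"
proof -
  define g where "g = (\<lambda>u::real. ennreal (indicator {-1..1} u * \<bar>u\<bar> powr (- \<gamma>)))"
  have [measurable]: "g \<in> borel_measurable borel" unfolding g_def by measurable
  define K where "K = enn2real (integral\<^sup>N lborel g)"
  have K: "integral\<^sup>N lborel g = ennreal K" "K \<ge> 0"
    using nn_integral_powr_near_zero[OF assms] unfolding K_def g_def by simp_all
  interpret N: prob_space std_normal_distribution by (simp add: prob_space_normal_density)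
  have dens: "std_normal_density y \<le> 1" for y
  proof -
    have "std_normal_density y \<le> 1 / sqrt (2 * pi) * 1"
      unfolding std_normal_density_def by (intro mult_left_mono) auto
    also have "sqrt (2 * pi) \<ge> 1" using pi_gt3 by simp
    then have "1 / sqrt (2 * pi) * 1 \<le> 1" by simp
    finally show ?thesis .
  qed
  have "(\<integral>\<^sup>+y. ennreal (\<bar>x + \<sigma> * y\<bar> powr (- \<gamma>)) \<partial>std_normal_distribution) \<le> ennreal ((K + 1) * \<sigma> powr (- \<gamma>))"
    if \<sigma>: "\<sigma> > 0" for \<sigma> x
  proof -
    have "ennreal (\<bar>x + \<sigma> * y\<bar> powr (- \<gamma>)) \<le> ennreal (\<sigma> powr (- \<gamma>)) * (g (x / \<sigma> + y) + 1)" for y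
    proof -
      have "\<bar>x + \<sigma> * y\<bar> = \<sigma> * \<bar>x / \<sigma> + y\<bar>" using \<sigma> by (simp add: abs_mult_pos' field_simps)
      then have "\<bar>x + \<sigma> * y\<bar> powr (- \<gamma>) = \<sigma> powr (- \<gamma>) * \<bar>x / \<sigma> + y\<bar> powr (- \<gamma>)"
        using \<sigma> by (simp add: powr_mult)
      moreover have "\<bar>x / \<sigma> + y\<bar> powr (- \<gamma>) \<le> indicator {-1..1} (x / \<sigma> + y) * \<bar>x / \<sigma> + y\<bar> powr (- \<gamma>) + 1"
      proof (cases "x / \<sigma> + y \<in> {-1..1}")
        case False
        then have "\<bar>x / \<sigma> + y\<bar> \<ge> 1" by auto
        then have "\<bar>x / \<sigma> + y\<bar> powr (- \<gamma>) \<le> \<bar>x / \<sigma> + y\<bar> powr 0"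
          using assms by (intro powr_mono) auto
        also have "\<dots> = 1" using \<open>\<bar>x / \<sigma> + y\<bar> \<ge> 1\<close> by auto
        finally show ?thesis by (simp add: add_increasing)
      qed auto
      ultimately have "\<bar>x + \<sigma> * y\<bar> powr (- \<gamma>)
          \<le> \<sigma> powr (- \<gamma>) * (indicator {-1..1} (x / \<sigma> + y) * \<bar>x / \<sigma> + y\<bar> powr (- \<gamma>) + 1)"
        by (simp add: mult_left_mono)
      then show ?thesis
        unfolding g_def by (subst ennreal_1[symmetric], subst ennreal_plus[symmetric], simp, simp,
            subst ennreal_mult[symmetric]) (auto intro!: ennreal_leI mult_left_mono)
    qed
    then have "(\<integral>\<^sup>+y. ennreal (\<bar>x + \<sigma> * y\<bar> powr (- \<gamma>)) \<partial>std_normal_distribution)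
       \<le> (\<integral>\<^sup>+y. ennreal (\<sigma> powr (- \<gamma>)) * (g (x / \<sigma> + y) + 1) \<partial>std_normal_distribution)"
      by (intro nn_integral_mono) auto
    also have "\<dots> = ennreal (\<sigma> powr (- \<gamma>)) * ((\<integral>\<^sup>+y. g (x / \<sigma> + y) \<partial>std_normal_distribution) + 1)"
      by (subst nn_integral_cmult, simp, subst nn_integral_add) (use N.emeasure_space_1 in auto)
    also have "(\<integral>\<^sup>+y. g (x / \<sigma> + y) \<partial>std_normal_distribution) = (\<integral>\<^sup>+y. ennreal (std_normal_density y) * g (x / \<sigma> + y) \<partial>lborel)"
      by (subst nn_integral_density) auto
    also have "\<dots> \<le> (\<integral>\<^sup>+y. g (x / \<sigma> + 1 * y) \<partial>lborel)"
    proof (intro nn_integral_mono)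
      fix y :: real
      have "ennreal (std_normal_density y) * g (x / \<sigma> + y) \<le> 1 * g (x / \<sigma> + y)"
        using dens[of y] by (intro mult_right_mono) auto
      then show "ennreal (std_normal_density y) * g (x / \<sigma> + y) \<le> g (x / \<sigma> + 1 * y)" by simp
    qed
    also have "\<dots> = ennreal K"
      using nn_integral_real_affine[of g 1 "x / \<sigma>"] K by simp
    finally have "(\<integral>\<^sup>+y. ennreal (\<bar>x + \<sigma> * y\<bar> powr (- \<gamma>)) \<partial>std_normal_distribution)
       \<le> ennreal (\<sigma> powr (- \<gamma>)) * (ennreal K + 1)"
      by (simp add: mult_left_mono add_right_mono)
    also have "\<dots> = ennreal ((K + 1) * \<sigma> powr (- \<gamma>))"
      using K(2) by (subst ennreal_1[symmetric], subst ennreal_plus[symmetric], simp, simp,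
            subst ennreal_mult[symmetric]) (auto simp: mult.commute)
    finally show ?thesis .
  qed
  then show ?thesis using K(2) by (intro exI[of _ "K + 1"]) auto
qed

lemma std_normal_abs_moment_finite:
  assumes "m \<ge> 0"
  shows "\<exists>C\<ge>0. (\<integral>\<^sup>+y. ennreal (\<bar>y\<bar> powr m) \<partial>std_normal_distribution) \<le> ennreal C"
proof -
  define k where "k = nat \<lceil>m\<rceil>"
  interpret N: prob_space std_normal_distribution by (simp add: prob_space_normal_density)
  have bnd: "\<bar>y\<bar> powr m \<le> 1 + y ^ (2 * k)" for y :: real
  proof (cases "\<bar>y\<bar> \<le> 1")
    case True
    then have "\<bar>y\<bar> powr m \<le> 1 powr m" using assms by (intro powr_mono2) auto
    moreover have "0 \<le> y ^ (2 * k)" unfolding power_mult by simp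
    ultimately show ?thesis unfolding powr_one_eq_one by linarith
  next
    case False
    have "\<bar>y\<bar> powr m \<le> \<bar>y\<bar> powr real (2 * k)"
      using False assms by (intro powr_mono) (auto simp: k_def, linarith)
    also have "\<dots> = y ^ (2 * k)" using False by (subst powr_realpow) (auto simp: power_mult)
    finally show ?thesis by simp
  qed
  have int: "integrable std_normal_distribution (\<lambda>y. y ^ (2 * k))"
    using integrable_std_normal_moment[of "2 * k"] by (subst integrable_real_density) auto
  have "(\<integral>\<^sup>+y. ennreal (\<bar>y\<bar> powr m) \<partial>std_normal_distribution)
      \<le> (\<integral>\<^sup>+y. ennreal (1 + y ^ (2 * k)) \<partial>std_normal_distribution)"
    using bnd by (intro nn_integral_mono ennreal_leI)
  also have "\<dots> = ennreal (\<integral>y. 1 + y ^ (2 * k) \<partial>std_normal_distribution)"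
    using int by (intro nn_integral_eq_integral) auto
  finally show ?thesis
    by (intro exI[of _ "\<integral>y. 1 + y ^ (2 * k) \<partial>std_normal_distribution"]) (auto intro!: integral_nonneg_AE)
qed

text \<open>A Young-type inequality that stands in for Hoelder's: either \<open>u powr a\<close> is
  at most \<open>v powr (b' - b)\<close>, or \<open>v powr b\<close> is bounded by a power of
  \<open>u\<close>. In the application \<open>v\<close> is the reciprocal of the path and
  \<open>b'\<close> an order, slightly above \<open>b\<close>, whose negative moment is still
  finite.\<close>

lemma powr_product_bound:
  fixes u v :: real
  assumes "u \<ge> 0" "v \<ge> 0" "a \<ge> 0" "b \<ge> 0" "b < b'"
  shows "u powr a * v powr b \<le> v powr b' + u powr (a + a * b / (b' - b))"
proof (cases "u = 0 \<or> v = 0")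
  case False
  then have "u > 0" "v > 0" using assms by auto
  show ?thesis
  proof (cases "u powr a \<le> v powr (b' - b)")
    case True
    then have "u powr a * v powr b \<le> v powr (b' - b) * v powr b" by (intro mult_right_mono) auto
    also have "\<dots> = v powr b'" by (simp add: powr_add[symmetric])
    finally show ?thesis by (simp add: add_increasing2)
  next
    case False
    then have "(v powr (b' - b)) powr (b / (b' - b)) \<le> (u powr a) powr (b / (b' - b))"
      using assms by (intro powr_mono2) auto
    then have "v powr b \<le> u powr (a * b / (b' - b))"
      using assms by (simp add: powr_powr)
    then have "u powr a * v powr b \<le> u powr a * u powr (a * b / (b' - b))" by (intro mult_left_mono) auto
    also have "\<dots> = u powr (a + a * b / (b' - b))" by (simp add: powr_add)
    finally show ?thesis by (simp add: add_increasing)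
  qed
qed auto

lemma sqrt_powr_double: "sqrt (x powr (2 * a)) = x powr a" for x a :: real
proof -
  have "x powr (2 * a) = (x powr a)\<^sup>2" by (simp add: power2_eq_square powr_add[symmetric])
  then show ?thesis by simp
qed

context centred_fbm
begin

lemma fbm_cov_diag: "s \<ge> 0 \<Longrightarrow> fbm_cov H s s = s powr (2 * H)"
  using H_gt by (simp add: fbm_cov_def)

lemma var_increment:
  assumes "finite J" "s \<in> J" "t \<in> J" "s \<ge> 0" "t \<ge> 0"
  shows "cov_form H J (\<lambda>u. indicator {t} u - indicator {s} u) (\<lambda>u. indicator {t} u - indicator {s} u)
     = \<bar>t - s\<bar> powr (2 * H)"
proof -
  have *: "(\<lambda>u. indicator {t} u - indicator {s} u :: real) = (\<lambda>u. (indicator {t} :: real \<Rightarrow> real) u - (indicator {s} :: real \<Rightarrow> real) u)" ..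
  show ?thesis
    unfolding cov_form_diff_left[of H J "indicator {t}" "indicator {s}"] cov_form_diff_right[of H J _ "indicator {t}" "indicator {s}"]
    using assms H_gt by (simp add: cov_form_indicator fbm_cov_def abs_minus_commute field_simps)
qed

lemma W_law:
  assumes "s \<ge> 0"
  shows "distr M borel (\<lambda>\<xi>. Re (W s \<xi>)) = distr std_normal_distribution borel (\<lambda>y. s powr H * y)"
    "distr M borel (\<lambda>\<xi>. Im (W s \<xi>)) = distr std_normal_distribution borel (\<lambda>y. s powr H * y)"
    "indep_var borel (\<lambda>\<xi>. Re (W s \<xi>)) borel (\<lambda>\<xi>. Im (W s \<xi>))"
proof -
  have J: "finite {s}" "{s} \<subseteq> {0..}" using assms by auto
  have sq: "sqrt (s powr (2 * H)) = s powr H"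
    by (rule sqrt_powr_double)
  show "distr M borel (\<lambda>\<xi>. Re (W s \<xi>)) = distr std_normal_distribution borel (\<lambda>y. s powr H * y)"
    using comb_law[OF J, of "indicator {s}" "\<lambda>_. 0"] assms
    by (simp add: comb_indicator comb_zero[OF J] cov_form_indicator fbm_cov_diag sq cov_form_def[of _ _ "\<lambda>_. 0"])
  show "distr M borel (\<lambda>\<xi>. Im (W s \<xi>)) = distr std_normal_distribution borel (\<lambda>y. s powr H * y)"
    using comb_law[OF J, of "\<lambda>_. 0" "indicator {s}"] assms
    by (simp add: comb_indicator comb_zero[OF J] cov_form_indicator fbm_cov_diag sq cov_form_def[of _ _ "\<lambda>_. 0"])
  show "indep_var borel (\<lambda>\<xi>. Re (W s \<xi>)) borel (\<lambda>\<xi>. Im (W s \<xi>))"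
    using comb_Re_Im_indep[OF J, of "indicator {s}"] by (simp add: comb_indicator)
qed

lemma increment_law:
  assumes "s \<ge> 0" "t \<ge> 0"
  shows "distr M borel (\<lambda>\<xi>. Re (W t \<xi> - W s \<xi>)) = distr std_normal_distribution borel (\<lambda>y. \<bar>t - s\<bar> powr H * y)"
    "distr M borel (\<lambda>\<xi>. Im (W t \<xi> - W s \<xi>)) = distr std_normal_distribution borel (\<lambda>y. \<bar>t - s\<bar> powr H * y)"
proof -
  have J: "finite {s, t}" "{s, t} \<subseteq> {0..}" using assms by auto
  let ?c = "\<lambda>u. indicator {t} u - indicator {s} u :: real"
  have sq: "sqrt (\<bar>t - s\<bar> powr (2 * H)) = \<bar>t - s\<bar> powr H"
    by (rule sqrt_powr_double)
  have c: "comb {s, t} ?c \<xi> = W t \<xi> - W s \<xi>" for \<xi>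
    unfolding comb_diff[of "{s, t}" "indicator {t}" "indicator {s}"] by (simp add: comb_indicator)
  have z: "cov_form H {s, t} (\<lambda>_. 0) (\<lambda>_. 0) = 0" by (simp add: cov_form_def)
  have v: "cov_form H {s, t} ?c ?c = \<bar>t - s\<bar> powr (2 * H)"
    using assms by (intro var_increment) auto
  show "distr M borel (\<lambda>\<xi>. Re (W t \<xi> - W s \<xi>)) = distr std_normal_distribution borel (\<lambda>y. \<bar>t - s\<bar> powr H * y)"
    using comb_law[OF J, of ?c "\<lambda>_. 0"] unfolding c comb_zero[OF J] z v
    by (simp add: sq)
  show "distr M borel (\<lambda>\<xi>. Im (W t \<xi> - W s \<xi>)) = distr std_normal_distribution borel (\<lambda>y. \<bar>t - s\<bar> powr H * y)"
    using comb_law[OF J, of "\<lambda>_. 0" ?c] unfolding c comb_zero[OF J] z v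
    by (simp add: sq)
qed

lemma AE_Re_nonzero:
  assumes "s > 0"
  shows "AE \<xi> in M. x + Re (W s \<xi>) \<noteq> 0" "AE \<xi> in M. x + Im (W s \<xi>) \<noteq> 0"
proof -
  let ?\<sigma> = "s powr H"
  have pos: "?\<sigma> > 0" using assms by simp
  have "AE y in std_normal_distribution. x + ?\<sigma> * y \<noteq> 0"
  proof -
    have "AE y in lborel. y \<noteq> - x / ?\<sigma>" by (rule AE_lborel_singleton)
    then have "AE y in lborel. x + ?\<sigma> * y \<noteq> 0"
      by eventually_elim (use pos in \<open>auto simp: field_simps\<close>)
    then show ?thesis by (subst AE_density) auto
  qed
  then have *: "AE y in distr std_normal_distribution borel (\<lambda>y. ?\<sigma> * y). x + y \<noteq> 0"
    by (subst AE_distr_iff) auto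
  show "AE \<xi> in M. x + Re (W s \<xi>) \<noteq> 0"
    using *[folded W_law(1)[OF less_imp_le[OF assms]]] by (subst (asm) AE_distr_iff) auto
  show "AE \<xi> in M. x + Im (W s \<xi>) \<noteq> 0"
    using *[folded W_law(2)[OF less_imp_le[OF assms]]] by (subst (asm) AE_distr_iff) auto
qed

lemma AE_nonzero: "s > 0 \<Longrightarrow> AE \<xi> in M. z + W s \<xi> \<noteq> 0"
  using AE_Re_nonzero(1)[of s "Re z"] by (auto simp: complex_eq_iff elim!: eventually_mono)

text \<open>Since \<open>\<bar>w\<bar>\<^sup>2 \<ge> \<bar>Re w\<bar> \<bar>Im w\<bar>\<close>, independence reduces negative moments of order below 2 to
  one-dimensional ones of order below 1.\<close>

lemma negative_moment:
  assumes "0 \<le> c" "c < 2"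
  shows "\<exists>C\<ge>0. \<forall>s>0. \<forall>z. (\<integral>\<^sup>+\<xi>. ennreal (norm (z + W s \<xi>) powr (- c)) \<partial>M) \<le> ennreal (C * s powr (- (H * c)))"
proof -
  define \<gamma> where "\<gamma> = c / 2"
  have \<gamma>: "0 \<le> \<gamma>" "\<gamma> < 1" using assms by (auto simp: \<gamma>_def)
  obtain C where C: "C \<ge> 0" "\<And>\<sigma> x. \<sigma> > 0 \<Longrightarrow> (\<integral>\<^sup>+y. ennreal (\<bar>x + \<sigma> * y\<bar> powr (- \<gamma>)) \<partial>std_normal_distribution)
     \<le> ennreal (C * \<sigma> powr (- \<gamma>))"
    using scaled_normal_negative_moment[OF \<gamma>] by blast
  have "(\<integral>\<^sup>+\<xi>. ennreal (norm (z + W s \<xi>) powr (- c)) \<partial>M) \<le> ennreal (C\<^sup>2 * s powr (- (H * c)))"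
    if s: "s > 0" for s z
  proof -
    let ?f = "\<lambda>x y. ennreal (\<bar>x + y\<bar> powr (- \<gamma>))"
    have s': "s \<ge> 0" using s by simp
    have sp: "s powr H > 0" using s by simp
    have "(\<integral>\<^sup>+\<xi>. ennreal (norm (z + W s \<xi>) powr (- c)) \<partial>M)
       \<le> (\<integral>\<^sup>+\<xi>. ?f (Re z) (Re (W s \<xi>)) * ?f (Im z) (Im (W s \<xi>)) \<partial>M)"
      using AE_Re_nonzero(1)[OF s, of "Re z"] AE_Re_nonzero(2)[OF s, of "Im z"]
    proof (intro nn_integral_mono_AE, eventually_elim)
      case (elim \<xi>)
      let ?x = "Re z + Re (W s \<xi>)" and ?y = "Im z + Im (W s \<xi>)"
      have "norm (z + W s \<xi>) powr (- c) = (norm (z + W s \<xi>) powr 2) powr (- \<gamma>)"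
        by (simp only: powr_powr \<gamma>_def) simp
      also have "\<dots> \<le> (\<bar>?x\<bar> * \<bar>?y\<bar>) powr (- \<gamma>)"
      proof (rule powr_mono2')
        have n2: "norm (z + W s \<xi>) powr 2 = ?x\<^sup>2 + ?y\<^sup>2"
          by (cases "z + W s \<xi> = 0") (auto simp: cmod_power2 powr_numeral complex_eq_iff)
        have "2 * (\<bar>?x\<bar> * \<bar>?y\<bar>) \<le> ?x\<^sup>2 + ?y\<^sup>2"
          using sum_squares_bound[of "\<bar>?x\<bar>" "\<bar>?y\<bar>"] by (simp add: mult.assoc)
        moreover have "0 \<le> \<bar>?x\<bar> * \<bar>?y\<bar>" by simp
        ultimately show "\<bar>?x\<bar> * \<bar>?y\<bar> \<le> norm (z + W s \<xi>) powr 2" unfolding n2 by linarith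
      qed (use \<gamma> elim in auto)
      also have "\<dots> = \<bar>?x\<bar> powr (- \<gamma>) * \<bar>?y\<bar> powr (- \<gamma>)" by (simp add: powr_mult)
      finally show ?case by (simp add: ennreal_mult[symmetric] ennreal_leI)
    qed
    also have "\<dots> = (\<integral>\<^sup>+\<xi>. ?f (Re z) (Re (W s \<xi>)) \<partial>M) * (\<integral>\<^sup>+\<xi>. ?f (Im z) (Im (W s \<xi>)) \<partial>M)"
      by (rule indep_var_nn_integral[OF W_law(3)[OF s']]) measurable
    also have "(\<integral>\<^sup>+\<xi>. ?f (Re z) (Re (W s \<xi>)) \<partial>M) = (\<integral>\<^sup>+y. ?f (Re z) (s powr H * y) \<partial>std_normal_distribution)"
      by (rule scaled_normal_nn_integral[OF _ W_law(1)[OF s']]) measurable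
    also have "(\<integral>\<^sup>+\<xi>. ?f (Im z) (Im (W s \<xi>)) \<partial>M) = (\<integral>\<^sup>+y. ?f (Im z) (s powr H * y) \<partial>std_normal_distribution)"
      by (rule scaled_normal_nn_integral[OF _ W_law(2)[OF s']]) measurable
    also have "(\<integral>\<^sup>+y. ?f (Re z) (s powr H * y) \<partial>std_normal_distribution) * (\<integral>\<^sup>+y. ?f (Im z) (s powr H * y) \<partial>std_normal_distribution)
      \<le> ennreal (C * (s powr H) powr (- \<gamma>)) * ennreal (C * (s powr H) powr (- \<gamma>))"
      by (intro mult_mono C(2)[OF sp]) auto
    also have "\<dots> = ennreal (C\<^sup>2 * s powr (- (H * c)))"
      using C(1) by (simp add: ennreal_mult[symmetric] powr_powr power2_eq_square \<gamma>_def mult_ac powr_add[symmetric])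
    finally show ?thesis .
  qed
  then show ?thesis by (intro exI[of _ "C\<^sup>2"]) auto
qed

lemma increment_moment:
  assumes "m \<ge> 0"
  shows "\<exists>C\<ge>0. \<forall>s\<ge>0. \<forall>t\<ge>0. (\<integral>\<^sup>+\<xi>. ennreal (norm (W t \<xi> - W s \<xi>) powr m) \<partial>M) \<le> ennreal (C * \<bar>t - s\<bar> powr (H * m))"
proof -
  obtain C where C: "C \<ge> 0" "(\<integral>\<^sup>+y. ennreal (\<bar>y\<bar> powr m) \<partial>std_normal_distribution) \<le> ennreal C"
    using std_normal_abs_moment_finite[OF assms] by blast
  have "(\<integral>\<^sup>+\<xi>. ennreal (norm (W t \<xi> - W s \<xi>) powr m) \<partial>M) \<le> ennreal ((2 powr m * (C + C)) * \<bar>t - s\<bar> powr (H * m))"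
    if st: "s \<ge> 0" "t \<ge> 0" for s t
  proof -
    let ?f = "\<lambda>y. ennreal (\<bar>y\<bar> powr m)"
    have one: "(\<integral>\<^sup>+y. ?f (\<bar>t - s\<bar> powr H * y) \<partial>std_normal_distribution) \<le> ennreal (\<bar>t - s\<bar> powr (H * m) * C)"
    proof -
      have "(\<integral>\<^sup>+y. ?f (\<bar>t - s\<bar> powr H * y) \<partial>std_normal_distribution)
        = (\<integral>\<^sup>+y. ennreal (\<bar>t - s\<bar> powr (H * m)) * ?f y \<partial>std_normal_distribution)"
        by (intro nn_integral_cong) (simp add: abs_mult powr_mult powr_powr ennreal_mult)
      also have "\<dots> = ennreal (\<bar>t - s\<bar> powr (H * m)) * (\<integral>\<^sup>+y. ?f y \<partial>std_normal_distribution)"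
        by (rule nn_integral_cmult) measurable
      also have "\<dots> \<le> ennreal (\<bar>t - s\<bar> powr (H * m)) * ennreal C"
        by (intro mult_left_mono C) auto
      finally show ?thesis using C(1) by (simp add: ennreal_mult)
    qed
    have "(\<integral>\<^sup>+\<xi>. ennreal (norm (W t \<xi> - W s \<xi>) powr m) \<partial>M)
       \<le> (\<integral>\<^sup>+\<xi>. ennreal (2 powr m) * (?f (Re (W t \<xi> - W s \<xi>)) + ?f (Im (W t \<xi> - W s \<xi>))) \<partial>M)"
    proof (intro nn_integral_mono)
      fix \<xi>
      define x where "x = Re (W t \<xi> - W s \<xi>)"
      define y where "y = Im (W t \<xi> - W s \<xi>)"
      have "norm (W t \<xi> - W s \<xi>) \<le> \<bar>x\<bar> + \<bar>y\<bar>" unfolding x_def y_def by (rule cmod_le)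
      also have "\<dots> \<le> 2 * max \<bar>x\<bar> \<bar>y\<bar>" by simp
      finally have "norm (W t \<xi> - W s \<xi>) powr m \<le> (2 * max \<bar>x\<bar> \<bar>y\<bar>) powr m"
        using assms by (intro powr_mono2) auto
      also have "\<dots> \<le> 2 powr m * (\<bar>x\<bar> powr m + \<bar>y\<bar> powr m)"
        by (subst powr_mult, intro mult_left_mono) (auto simp: max_def)
      finally show "ennreal (norm (W t \<xi> - W s \<xi>) powr m)
         \<le> ennreal (2 powr m) * (?f (Re (W t \<xi> - W s \<xi>)) + ?f (Im (W t \<xi> - W s \<xi>)))"
        unfolding x_def y_def by (simp add: ennreal_mult[symmetric] ennreal_plus[symmetric] ennreal_leI del: ennreal_plus)
    qed
    also have "\<dots> = ennreal (2 powr m) * ((\<integral>\<^sup>+\<xi>. ?f (Re (W t \<xi> - W s \<xi>)) \<partial>M) + (\<integral>\<^sup>+\<xi>. ?f (Im (W t \<xi> - W s \<xi>)) \<partial>M))"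
      by (subst nn_integral_cmult, measurable, subst nn_integral_add) measurable
    also have "(\<integral>\<^sup>+\<xi>. ?f (Re (W t \<xi> - W s \<xi>)) \<partial>M) = (\<integral>\<^sup>+y. ?f (\<bar>t - s\<bar> powr H * y) \<partial>std_normal_distribution)"
      by (rule scaled_normal_nn_integral[OF _ increment_law(1)[OF st]]) measurable
    also have "(\<integral>\<^sup>+\<xi>. ?f (Im (W t \<xi> - W s \<xi>)) \<partial>M) = (\<integral>\<^sup>+y. ?f (\<bar>t - s\<bar> powr H * y) \<partial>std_normal_distribution)"
      by (rule scaled_normal_nn_integral[OF _ increment_law(2)[OF st]]) measurable
    also have "ennreal (2 powr m) * ((\<integral>\<^sup>+y. ?f (\<bar>t - s\<bar> powr H * y) \<partial>std_normal_distribution) + (\<integral>\<^sup>+y. ?f (\<bar>t - s\<bar> powr H * y) \<partial>std_normal_distribution))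
       \<le> ennreal (2 powr m) * (ennreal (\<bar>t - s\<bar> powr (H * m) * C) + ennreal (\<bar>t - s\<bar> powr (H * m) * C))"
      by (intro mult_left_mono add_mono one) auto
    also have "\<dots> = ennreal ((2 powr m * (C + C)) * \<bar>t - s\<bar> powr (H * m))"
      using C(1) by (simp add: ennreal_mult[symmetric] ennreal_plus[symmetric] algebra_simps del: ennreal_plus)
    finally show ?thesis .
  qed
  then show ?thesis using C(1) by (intro exI[of _ "2 powr m * (C + C)"]) auto
qed

text \<open>Increment and base value are dependent. After both are divided by their scales
  \<open>\<sigma>\<close> and \<open>\<tau>\<close>, \<open>powr_product_bound\<close> separates
  them, at the price of a higher moment of the increment and of a negative moment whose order
  \<open>b'\<close>, the midpoint of \<open>b\<close> and 2, is still below 2.\<close>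

lemma mixed_moment:
  assumes a: "a \<ge> 0" and b: "0 \<le> b" "b < 2"
  shows "\<exists>C\<ge>0. \<forall>s\<ge>0. \<forall>t\<ge>0. \<forall>w>0. \<forall>z.
    (\<integral>\<^sup>+\<xi>. ennreal (norm (W t \<xi> - W s \<xi>) powr a * norm (z + W w \<xi>) powr (- b)) \<partial>M)
      \<le> ennreal (C * \<bar>t - s\<bar> powr (H * a) * w powr (- (H * b)))"
proof -
  define b' where "b' = (b + 2) / 2"
  define m where "m = a + a * b / (b' - b)"
  have b': "b < b'" "b' < 2" "0 \<le> b'" using b by (auto simp: b'_def)
  have m: "m \<ge> 0" using a b b' by (auto simp: m_def)
  obtain C1 where C1: "C1 \<ge> 0" "\<And>s z. s > 0 \<Longrightarrow> (\<integral>\<^sup>+\<xi>. ennreal (norm (z + W s \<xi>) powr (- b')) \<partial>M) \<le> ennreal (C1 * s powr (- (H * b')))"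
    using negative_moment[OF b'(3,2)] by blast
  obtain C2 where C2: "C2 \<ge> 0" "\<And>s t. s \<ge> 0 \<Longrightarrow> t \<ge> 0 \<Longrightarrow> (\<integral>\<^sup>+\<xi>. ennreal (norm (W t \<xi> - W s \<xi>) powr m) \<partial>M) \<le> ennreal (C2 * \<bar>t - s\<bar> powr (H * m))"
    using increment_moment[OF m] by blast
  have "(\<integral>\<^sup>+\<xi>. ennreal (norm (W t \<xi> - W s \<xi>) powr a * norm (z + W w \<xi>) powr (- b)) \<partial>M)
      \<le> ennreal ((C1 + C2) * \<bar>t - s\<bar> powr (H * a) * w powr (- (H * b)))"
    if st: "s \<ge> 0" "t \<ge> 0" and w: "w > 0" for s t w z
  proof (cases "s = t")
    case False
    define \<sigma> where "\<sigma> = \<bar>t - s\<bar> powr H"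
    define \<tau> where "\<tau> = w powr H"
    have pos: "\<sigma> > 0" "\<tau> > 0" using False w by (auto simp: \<sigma>_def \<tau>_def)
    let ?D = "\<lambda>\<xi>. norm (W t \<xi> - W s \<xi>)" and ?N = "\<lambda>\<xi>. norm (z + W w \<xi>)"
    have "(\<integral>\<^sup>+\<xi>. ennreal (?D \<xi> powr a * ?N \<xi> powr (- b)) \<partial>M)
       \<le> (\<integral>\<^sup>+\<xi>. ennreal (\<sigma> powr a * \<tau> powr (- b)) *
            (ennreal (\<tau> powr b') * ennreal (?N \<xi> powr (- b')) + ennreal (\<sigma> powr (- m)) * ennreal (?D \<xi> powr m)) \<partial>M)"
    proof (intro nn_integral_mono)
      fix \<xi>
      have "?D \<xi> powr a * ?N \<xi> powr (- b) = (\<sigma> powr a * \<tau> powr (- b)) * ((?D \<xi> / \<sigma>) powr a * (\<tau> / ?N \<xi>) powr b)"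
        using pos by (simp add: powr_divide powr_minus field_simps)
      also have "\<dots> \<le> (\<sigma> powr a * \<tau> powr (- b)) * ((\<tau> / ?N \<xi>) powr b' + (?D \<xi> / \<sigma>) powr m)"
        unfolding m_def using pos a b b' by (intro mult_left_mono powr_product_bound) auto
      also have "(\<tau> / ?N \<xi>) powr b' = \<tau> powr b' * ?N \<xi> powr (- b')"
        by (simp add: powr_divide powr_minus field_simps)
      also have "(?D \<xi> / \<sigma>) powr m = \<sigma> powr (- m) * ?D \<xi> powr m"
        by (simp add: powr_divide powr_minus field_simps)
      finally show "ennreal (?D \<xi> powr a * ?N \<xi> powr (- b)) \<le> ennreal (\<sigma> powr a * \<tau> powr (- b)) *
            (ennreal (\<tau> powr b') * ennreal (?N \<xi> powr (- b')) + ennreal (\<sigma> powr (- m)) * ennreal (?D \<xi> powr m))"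
        by (simp add: ennreal_mult[symmetric] ennreal_plus[symmetric] ennreal_leI del: ennreal_plus)
    qed
    also have "\<dots> = ennreal (\<sigma> powr a * \<tau> powr (- b)) *
       (ennreal (\<tau> powr b') * (\<integral>\<^sup>+\<xi>. ennreal (?N \<xi> powr (- b')) \<partial>M) + ennreal (\<sigma> powr (- m)) * (\<integral>\<^sup>+\<xi>. ennreal (?D \<xi> powr m) \<partial>M))"
      by (subst nn_integral_cmult, measurable, subst nn_integral_add, measurable,
          subst nn_integral_cmult, measurable, subst nn_integral_cmult) measurable
    also have "\<dots> \<le> ennreal (\<sigma> powr a * \<tau> powr (- b)) *
       (ennreal (\<tau> powr b') * ennreal (C1 * w powr (- (H * b'))) + ennreal (\<sigma> powr (- m)) * ennreal (C2 * \<bar>t - s\<bar> powr (H * m)))"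
      by (intro mult_left_mono add_mono C1(2) C2(2) w st) auto
    also have "\<dots> = ennreal ((\<sigma> powr a * \<tau> powr (- b)) * (\<tau> powr b' * (C1 * w powr (- (H * b'))) + \<sigma> powr (- m) * (C2 * \<bar>t - s\<bar> powr (H * m))))"
      using C1(1) C2(1) by (simp add: ennreal_mult[symmetric] ennreal_plus[symmetric] del: ennreal_plus)
    also have "\<tau> powr b' * (C1 * w powr (- (H * b'))) = C1"
      using w by (simp add: \<tau>_def powr_powr powr_add[symmetric] mult.left_commute[of _ C1])
    also have "\<sigma> powr (- m) * (C2 * \<bar>t - s\<bar> powr (H * m)) = C2"
      using False by (simp add: \<sigma>_def powr_powr powr_add[symmetric] mult.left_commute[of _ C2])
    finally show ?thesis
      by (simp add: \<sigma>_def \<tau>_def powr_powr mult_ac)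
  qed auto
  then show ?thesis using C1(1) C2(1) by (intro exI[of _ "C1 + C2"]) auto
qed

end

section \<open>Dyadic chaining and the logarithm as a Young integral\<close>

definition dyadic_floor :: "nat \<Rightarrow> real \<Rightarrow> nat" where
  "dyadic_floor i x = nat \<lfloor>2 ^ i * x\<rfloor>"

lemma dyadic_floor_Suc:
  assumes "0 \<le> x"
  shows "dyadic_floor (Suc i) x = 2 * dyadic_floor i x \<or> dyadic_floor (Suc i) x = 2 * dyadic_floor i x + 1"
proof -
  define n where "n = \<lfloor>2 ^ i * x\<rfloor>"
  have n: "n \<ge> 0" using assms by (simp add: n_def)
  have "of_int n \<le> 2 ^ i * x" "2 ^ i * x < of_int n + 1" unfolding n_def by linarith+
  then have "\<lfloor>2 ^ Suc i * x\<rfloor> = 2 * n \<or> \<lfloor>2 ^ Suc i * x\<rfloor> = 2 * n + 1"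
    by (simp only: power_Suc mult.assoc) linarith
  then show ?thesis unfolding dyadic_floor_def n_def[symmetric] using n by (auto simp: nat_mult_distrib nat_add_distrib)
qed

lemma dyadic_floor_le:
  assumes "0 \<le> x" "x \<le> 1"
  shows "dyadic_floor i x \<le> 2 ^ i"
proof -
  have "\<lfloor>2 ^ i * x\<rfloor> \<le> \<lfloor>(2::real) ^ i\<rfloor>" using assms by (intro floor_mono mult_left_le) auto
  also have "\<lfloor>(2::real) ^ i\<rfloor> = 2 ^ i" by (metis floor_of_int of_int_numeral of_int_power)
  finally show ?thesis unfolding dyadic_floor_def by (simp add: nat_le_iff)
qed

lemma dyadic_floor_bounds:
  assumes "0 \<le> x"
  shows "real (dyadic_floor i x) / 2 ^ i \<le> x" "x < real (dyadic_floor i x) / 2 ^ i + 1 / 2 ^ i"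
proof -
  have "0 \<le> \<lfloor>2 ^ i * x\<rfloor>" using assms by simp
  then have "real (dyadic_floor i x) = of_int \<lfloor>2 ^ i * x\<rfloor>" by (simp add: dyadic_floor_def)
  moreover have "of_int \<lfloor>2 ^ i * x\<rfloor> \<le> 2 ^ i * x" "2 ^ i * x < of_int \<lfloor>2 ^ i * x\<rfloor> + 1" by linarith+
  ultimately show "real (dyadic_floor i x) / 2 ^ i \<le> x" "x < real (dyadic_floor i x) / 2 ^ i + 1 / 2 ^ i"
    by (simp_all add: field_simps)
qed

lemma dyadic_floor_tendsto:
  assumes "0 \<le> x"
  shows "(\<lambda>i. real (dyadic_floor i x) / 2 ^ i) \<longlonglongrightarrow> x"
proof (rule tendsto_sandwich[where f="\<lambda>i. x - (1 / 2) ^ i" and h="\<lambda>_. x"])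
  show "\<forall>\<^sub>F i in sequentially. x - (1 / 2) ^ i \<le> real (dyadic_floor i x) / 2 ^ i"
  proof (intro always_eventually allI)
    fix i show "x - (1 / 2) ^ i \<le> real (dyadic_floor i x) / 2 ^ i"
      using dyadic_floor_bounds(2)[OF assms, of i] by (simp add: power_one_over)
  qed
  show "\<forall>\<^sub>F i in sequentially. real (dyadic_floor i x) / 2 ^ i \<le> x"
    using dyadic_floor_bounds(1)[OF assms] by simp
  have "(\<lambda>i. x - (1 / 2 :: real) ^ i) \<longlonglongrightarrow> x - 0"
    by (intro tendsto_diff tendsto_const LIMSEQ_realpow_zero) auto
  then show "(\<lambda>i. x - (1 / 2) ^ i) \<longlonglongrightarrow> x" by simp
qed auto

text \<open>From one level to the next the lower dyadic approximation of \<open>x\<close> either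
  stays or moves to its right neighbour, so each level costs at most one increment. The bound
  \<open>dyadic_floor_le\<close> ensures that this neighbour does not leave the unit
  interval.\<close>

lemma dyadic_chain:
  fixes f :: "real \<Rightarrow> 'b::real_normed_vector"
  assumes m: "\<And>i k. k < 2 ^ i \<Longrightarrow> norm (f (real (Suc k) / 2 ^ i) - f (real k / 2 ^ i)) \<le> m i"
    and x: "0 \<le> x" "x \<le> 1"
  shows "norm (f (real (dyadic_floor (j + n) x) / 2 ^ (j + n)) - f (real (dyadic_floor j x) / 2 ^ j))
     \<le> (\<Sum>i<n. m (Suc (j + i)))"
proof (induction n)
  case (Suc n)
  let ?p = "\<lambda>i. f (real (dyadic_floor i x) / 2 ^ i)"
  have m0: "0 \<le> m i" for i using order_trans[OF norm_ge_zero m[of 0 i]] by simp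
  have "norm (?p (Suc (j + n)) - ?p (j + n)) \<le> m (Suc (j + n))"
  proof -
    from dyadic_floor_Suc[OF x(1), of "j + n"] show ?thesis
    proof
      assume "dyadic_floor (Suc (j + n)) x = 2 * dyadic_floor (j + n) x"
      then have "?p (Suc (j + n)) = ?p (j + n)" by simp
      then show ?thesis using m0 by simp
    next
      assume e: "dyadic_floor (Suc (j + n)) x = 2 * dyadic_floor (j + n) x + 1"
      then have "2 * dyadic_floor (j + n) x < 2 ^ Suc (j + n)"
        using dyadic_floor_le[OF x, of "Suc (j + n)"] by linarith
      from m[OF this] show ?thesis unfolding e by simp
    qed
  qed
  then have "norm (?p (Suc (j + n)) - ?p j) \<le> m (Suc (j + n)) + (\<Sum>i<n. m (Suc (j + i)))"
    using norm_triangle_ineq[of "?p (Suc (j + n)) - ?p (j + n)" "?p (j + n) - ?p j"] Suc by simp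
  then show ?case by (simp add: add.commute)
qed simp

text \<open>Continuity lets the chain run through infinitely many levels. The \<open>Suc\<close> in
  the tail reflects that the first step leads from level \<open>j\<close> to level
  \<open>j + 1\<close>, so the bound at level \<open>j\<close> itself is not paid.\<close>

lemma dyadic_chain_limit:
  fixes f :: "real \<Rightarrow> 'b::real_normed_vector"
  assumes m: "\<And>i k. k < 2 ^ i \<Longrightarrow> norm (f (real (Suc k) / 2 ^ i) - f (real k / 2 ^ i)) \<le> m i"
    and x: "0 \<le> x" "x \<le> 1" and cont: "continuous_on {0..1} f" and sm: "summable m"
  shows "norm (f x - f (real (dyadic_floor j x) / 2 ^ j)) \<le> (\<Sum>i. m (Suc (j + i)))"
proof -
  have m0: "0 \<le> m i" for i using order_trans[OF norm_ge_zero m[of 0 i]] by simp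
  have sm': "summable (\<lambda>i. m (Suc (j + i)))"
    using summable_ignore_initial_segment[OF sm, of "Suc j"] by (simp add: add.commute)
  have d01: "real (dyadic_floor i x) / 2 ^ i \<in> {0..1}" for i
  proof -
    have "real (dyadic_floor i x) \<le> real (2 ^ i)" using dyadic_floor_le[OF x, of i] by (simp only: of_nat_le_iff)
    then show ?thesis by (simp add: field_simps)
  qed
  have "(\<lambda>i. f (real (dyadic_floor i x) / 2 ^ i)) \<longlonglongrightarrow> f x"
    using continuous_on_tendsto_compose[OF cont dyadic_floor_tendsto[OF x(1)]] x d01 by auto
  then have "(\<lambda>n. f (real (dyadic_floor (n + j) x) / 2 ^ (n + j))) \<longlonglongrightarrow> f x"
    by (rule LIMSEQ_ignore_initial_segment)
  then have "(\<lambda>n. norm (f (real (dyadic_floor (n + j) x) / 2 ^ (n + j)) - f (real (dyadic_floor j x) / 2 ^ j)))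
     \<longlonglongrightarrow> norm (f x - f (real (dyadic_floor j x) / 2 ^ j))"
    by (intro tendsto_intros)
  then show ?thesis
  proof (rule LIMSEQ_le_const2, intro exI allI impI)
    fix n
    have "norm (f (real (dyadic_floor (j + n) x) / 2 ^ (j + n)) - f (real (dyadic_floor j x) / 2 ^ j))
      \<le> (\<Sum>i<n. m (Suc (j + i)))"
      by (rule dyadic_chain[OF m x])
    also have "\<dots> \<le> (\<Sum>i. m (Suc (j + i)))"
      using m0 by (intro sum_le_suminf sm') auto
    finally show "norm (f (real (dyadic_floor (n + j) x) / 2 ^ (n + j)) - f (real (dyadic_floor j x) / 2 ^ j))
      \<le> (\<Sum>i. m (Suc (j + i)))" by (simp add: add.commute)
  qed
qed

text \<open>Kolmogorov's chaining: at the level \<open>j\<close> with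
  \<open>2 powr (- j - 1) < t - s \<le> 2 powr (- j)\<close> the dyadic approximations of
  \<open>s\<close> and \<open>t\<close> coincide or are neighbours, and both tails are
  geometric.\<close>

lemma holder_of_dyadic:
  fixes f :: "real \<Rightarrow> 'b::real_normed_vector"
  assumes \<gamma>: "\<gamma> > 0" and K: "K \<ge> 0"
    and m: "\<And>i k. k < 2 ^ i \<Longrightarrow> norm (f (real (Suc k) / 2 ^ i) - f (real k / 2 ^ i)) \<le> K * (2 powr (- \<gamma>)) ^ i"
    and cont: "continuous_on {0..1} f"
  shows "\<exists>C\<ge>0. \<forall>s\<in>{0..1}. \<forall>t\<in>{0..1}. norm (f t - f s) \<le> C * \<bar>t - s\<bar> powr \<gamma>"
proof -
  define r where "r = (2::real) powr (- \<gamma>)"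
  have r: "0 < r" "r < 1" using \<gamma> by (auto simp: r_def powr_less_one)
  have sm: "summable (\<lambda>i. K * r ^ i)" using r by (intro summable_mult summable_geometric) auto
  define T where "T = K / (1 - r)"
  have T: "T \<ge> 0" using K r by (simp add: T_def)
  have tail: "(\<Sum>i. K * r ^ (Suc (j + i))) \<le> T * r ^ j" for j
  proof -
    have "(\<Sum>i. K * r ^ (Suc (j + i))) = (\<Sum>i. (K * r ^ Suc j) * r ^ i)"
      by (simp add: power_add mult_ac)
    also have "\<dots> = (K * r ^ Suc j) * (1 / (1 - r))"
      using r by (subst suminf_mult) (auto simp: suminf_geometric summable_geometric)
    also have "\<dots> \<le> (K * r ^ j) * (1 / (1 - r))"
      using K r by (intro mult_right_mono mult_left_mono power_decreasing) auto
    finally show ?thesis by (simp add: T_def)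
  qed
  have main: "norm (f t - f s) \<le> ((2 * T + K) * 2 powr \<gamma>) * (t - s) powr \<gamma>" if st: "0 \<le> s" "s < t" "t \<le> 1" for s t
  proof -
    define j where "j = nat \<lfloor>- log 2 (t - s)\<rfloor>"
    have "log 2 (t - s) \<le> 0" using st by simp
    then have fj: "real j \<le> - log 2 (t - s)" "- log 2 (t - s) < real j + 1" unfolding j_def by linarith+
    have le: "t - s \<le> 1 / 2 ^ j"
    proof -
      have "t - s = 2 powr (log 2 (t - s))" using st by simp
      also have "\<dots> \<le> 2 powr (- real j)" using fj by (intro powr_mono) auto
      finally show ?thesis by (simp add: powr_minus powr_realpow field_simps)
    qed
    have "2 powr (- real j - 1) < 2 powr (log 2 (t - s))" using fj by (intro powr_less_mono) auto
    then have "2 powr (- real j - 1) < t - s" using st by simp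
    then have ge: "2 powr (- real j) \<le> 2 * (t - s)" by (simp add: powr_diff)
    have rj: "r ^ j \<le> 2 powr \<gamma> * (t - s) powr \<gamma>"
    proof -
      have "r ^ j = (2 powr (- real j)) powr \<gamma>" 
        by (simp add: r_def powr_realpow[symmetric] powr_powr mult.commute)
      also have "\<dots> \<le> (2 * (t - s)) powr \<gamma>" using ge \<gamma> by (intro powr_mono2) auto
      finally show ?thesis by (simp only: powr_mult)
    qed
    let ?p = "\<lambda>x. f (real (dyadic_floor j x) / 2 ^ j)"
    have a: "norm (f x - ?p x) \<le> T * r ^ j" if "0 \<le> x" "x \<le> 1" for x
      using dyadic_chain_limit[where f=f and m="\<lambda>i. K * r ^ i" and j=j, OF m[folded r_def] that cont sm] tail[of j] by simp
    have b: "norm (?p t - ?p s) \<le> K * r ^ j"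
    proof -
      have "2 ^ j * s < 2 ^ j * t" "2 ^ j * t \<le> 2 ^ j * s + 1" "0 \<le> 2 ^ j * s"
        using st le by (auto simp: field_simps)
      then have "\<lfloor>2 ^ j * t\<rfloor> = \<lfloor>2 ^ j * s\<rfloor> \<or> \<lfloor>2 ^ j * t\<rfloor> = \<lfloor>2 ^ j * s\<rfloor> + 1" "0 \<le> \<lfloor>2 ^ j * s\<rfloor>" by linarith+
      then have "dyadic_floor j t = dyadic_floor j s \<or> dyadic_floor j t = Suc (dyadic_floor j s)"
        unfolding dyadic_floor_def by (auto simp: nat_add_distrib)
      then show ?thesis
      proof
        assume e: "dyadic_floor j t = Suc (dyadic_floor j s)"
        then have "dyadic_floor j s < 2 ^ j" using dyadic_floor_le[of t j] st by linarith
        from m[OF this] show ?thesis unfolding e r_def .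
      qed (use K r in auto)
    qed
    have "norm (f t - f s) \<le> norm (f t - ?p t) + norm (?p t - ?p s) + norm (f s - ?p s)"
      using norm_triangle_ineq[of "f t - ?p t + (?p t - ?p s)" "?p s - f s"]
        norm_triangle_ineq[of "f t - ?p t" "?p t - ?p s"] by (simp add: norm_minus_commute)
    also have "\<dots> \<le> T * r ^ j + K * r ^ j + T * r ^ j"
      using a[of t] a[of s] b st by (intro add_mono) auto
    also have "\<dots> = (2 * T + K) * r ^ j" by (simp add: algebra_simps)
    also have "\<dots> \<le> (2 * T + K) * (2 powr \<gamma> * (t - s) powr \<gamma>)"
      using rj T K by (intro mult_left_mono) auto
    finally show ?thesis by (simp add: mult.assoc)
  qed
  have "norm (f t - f s) \<le> ((2 * T + K) * 2 powr \<gamma>) * \<bar>t - s\<bar> powr \<gamma>" if "s \<in> {0..1}" "t \<in> {0..1}" for s t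
  proof (cases s t rule: linorder_cases)
    case less
    then show ?thesis using main[of s t] that by auto
  next
    case greater
    then show ?thesis using main[of t s] that by (auto simp: norm_minus_commute)
  qed auto
  then show ?thesis using T K by (intro exI[of _ "(2 * T + K) * 2 powr \<gamma>"]) auto
qed

section \<open>Continuous logarithms of Hoelder paths\<close>

definition holder_on :: "real set \<Rightarrow> real \<Rightarrow> (real \<Rightarrow> 'b::real_normed_vector) \<Rightarrow> bool" where
  "holder_on S \<gamma> f \<longleftrightarrow> (\<exists>C\<ge>0. \<forall>s\<in>S. \<forall>t\<in>S. norm (f t - f s) \<le> C * \<bar>t - s\<bar> powr \<gamma>)"

text \<open>With \<open>w = L v - L u\<close> one has \<open>exp w - 1 = (B v - B u) / B u\<close>,
  so \<open>w\<close> differs from this quotient by a term quadratic in the increment; moving the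
  base point from \<open>u\<close> to an arbitrary tag \<open>x\<close> costs another product of two
  increments. Both errors have order \<open>2 * \<gamma> > 1\<close>.\<close>

lemma log_increment_bound:
  fixes B L :: "real \<Rightarrow> complex"
  assumes \<gamma>: "1 / 2 < \<gamma>" and hol: "holder_on {0..T} \<gamma> B" and L: "continuous_on {0..T} L"
    and BL: "\<And>s. s \<in> {0..T} \<Longrightarrow> B s = exp (L s)"
  shows "\<exists>C\<ge>0. \<exists>\<delta>>0. \<forall>u x v. 0 \<le> u \<longrightarrow> u \<le> x \<longrightarrow> x \<le> v \<longrightarrow> v \<le> T \<longrightarrow> v - u < \<delta> \<longrightarrow>
     norm (L v - L u - 1 / B x * (B v - B u)) \<le> C * (v - u) powr (2 * \<gamma>)"
proof (cases "0 \<le> T")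
  case True
  obtain K where K: "K \<ge> 0" "\<And>s t. s \<in> {0..T} \<Longrightarrow> t \<in> {0..T} \<Longrightarrow> norm (B t - B s) \<le> K * \<bar>t - s\<bar> powr \<gamma>"
    using hol unfolding holder_on_def by blast
  have "continuous_on {0..T} (\<lambda>s. norm (exp (L s)))" by (intro continuous_intros L)
  then obtain s0 where s0: "s0 \<in> {0..T}" "\<And>s. s \<in> {0..T} \<Longrightarrow> norm (exp (L s0)) \<le> norm (exp (L s))"
    using continuous_attains_inf[of "{0..T}" "\<lambda>s. norm (exp (L s))"] True by auto
  \<comment> \<open>By compactness the path stays at distance at least \<open>c\<close> from 0 on
    the interval.\<close>
  define c where "c = norm (exp (L s0))"
  have c: "c > 0" "\<And>s. s \<in> {0..T} \<Longrightarrow> c \<le> norm (B s)" using s0 by (auto simp: c_def BL)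
  have "uniformly_continuous_on {0..T} L"
    by (intro compact_uniformly_continuous L) auto
  \<comment> \<open>Increments of \<open>L\<close> below 1/4 make the remainder
    \<open>exp w - 1 - w\<close> at most half of \<open>norm w\<close>, so that
    \<open>norm w\<close> is controlled by the increment of \<open>B\<close>.\<close>
  then obtain \<delta> where \<delta>: "\<delta> > 0" "\<And>u v. u \<in> {0..T} \<Longrightarrow> v \<in> {0..T} \<Longrightarrow> dist v u < \<delta> \<Longrightarrow> dist (L v) (L u) < 1 / 4"
    unfolding uniformly_continuous_on_def by (metis zero_less_divide_1_iff zero_less_numeral)
  have "norm (L v - L u - 1 / B x * (B v - B u)) \<le> (9 * K\<^sup>2 / c\<^sup>2) * (v - u) powr (2 * \<gamma>)"
    if h: "0 \<le> u" "u \<le> x" "x \<le> v" "v \<le> T" "v - u < \<delta>" for u x v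
  proof -
    define w where "w = L v - L u"
    have in_T: "u \<in> {0..T}" "v \<in> {0..T}" "x \<in> {0..T}" using h by auto
    have w4: "norm w \<le> 1 / 4"
      using \<delta>(2)[OF in_T(1,2)] h unfolding w_def dist_norm by (simp add: dist_norm abs_if less_imp_le)
    have nz: "B u \<noteq> 0" "B x \<noteq> 0" using c in_T by fastforce+
    have ew: "exp w - 1 = (B v - B u) / B u"
      using nz in_T by (simp add: w_def exp_diff BL diff_divide_distrib)
    have "norm (exp w - (\<Sum>k\<le>1. w ^ k / fact k)) \<le> exp (norm w) * norm w ^ (Suc 1) / fact 1"
      by (rule Taylor_exp_field)
    then have t: "norm (exp w - 1 - w) \<le> exp (norm w) * (norm w)\<^sup>2"
      by (simp add: diff_diff_eq power2_eq_square numeral_eq_Suc)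
    have "exp (norm w) \<le> 2"
      using exp_bound_half[of "norm w"] w4 by simp
    then have t2: "norm (exp w - 1 - w) \<le> 2 * (norm w)\<^sup>2"
      using order_trans[OF t mult_right_mono] by auto
    have "2 * (norm w)\<^sup>2 \<le> norm w / 2"
      using mult_right_mono[OF w4, of "norm w"] by (simp add: power2_eq_square)
    moreover have "norm w \<le> norm (exp w - 1) + norm (exp w - 1 - w)"
      using norm_triangle_ineq4[of "exp w - 1" "exp w - 1 - w"] by simp
    ultimately have "norm w \<le> 2 * norm (exp w - 1)" using t2 by linarith
    then have "(norm w)\<^sup>2 \<le> (2 * norm (exp w - 1))\<^sup>2" by (intro power_mono) auto
    then have t3: "norm (exp w - 1 - w) \<le> 8 * (norm ((B v - B u) / B u))\<^sup>2"
      using t2 unfolding ew[symmetric] by (simp add: power_mult_distrib)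
    have Bvu: "norm (B v - B u) \<le> K * (v - u) powr \<gamma>" using K(2)[OF in_T(1,2)] h by simp
    have Bxu: "norm (B x - B u) \<le> K * (v - u) powr \<gamma>"
    proof -
      have "norm (B x - B u) \<le> K * \<bar>x - u\<bar> powr \<gamma>" using K(2) in_T by blast
      also have "\<dots> \<le> K * (v - u) powr \<gamma>" using h \<gamma> K(1) by (intro mult_left_mono powr_mono2) auto
      finally show ?thesis .
    qed
    have cu: "c \<le> norm (B u)" "c \<le> norm (B x)" using c in_T by auto
    have K0: "0 \<le> K * (v - u) powr \<gamma>" using K(1) by simp
    have "norm ((B v - B u) / B u) \<le> K * (v - u) powr \<gamma> / c"
      unfolding norm_divide using Bvu cu c(1) K0 by (intro frac_le) auto
    then have "(norm ((B v - B u) / B u))\<^sup>2 \<le> (K * (v - u) powr \<gamma> / c)\<^sup>2" by (intro power_mono) auto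
    then have p1: "norm (exp w - 1 - w) \<le> 8 * (K * (v - u) powr \<gamma> / c)\<^sup>2" using t3 by linarith
    have "(B v - B u) / B u - 1 / B x * (B v - B u) = (B v - B u) * (B x - B u) / (B u * B x)"
      using nz by (simp add: field_simps)
    also have "norm \<dots> \<le> ((K * (v - u) powr \<gamma>) * (K * (v - u) powr \<gamma>)) / (c * c)"
      unfolding norm_divide norm_mult using Bvu Bxu cu c(1) K0
      by (intro frac_le mult_mono) auto
    also have "\<dots> = (K * (v - u) powr \<gamma> / c)\<^sup>2" by (simp add: power2_eq_square)
    finally have p2: "norm ((B v - B u) / B u - 1 / B x * (B v - B u)) \<le> (K * (v - u) powr \<gamma> / c)\<^sup>2" .
    have "w - 1 / B x * (B v - B u) = ((B v - B u) / B u - 1 / B x * (B v - B u)) - (exp w - 1 - w)"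
      unfolding ew by simp
    then have "norm (w - 1 / B x * (B v - B u))
        \<le> norm ((B v - B u) / B u - 1 / B x * (B v - B u)) + norm (exp w - 1 - w)"
      by (simp only: norm_triangle_ineq4)
    \<comment> \<open>The factor 9 below is 8 from the Taylor remainder plus 1 from the change of
      base point.\<close>
    then have "norm (w - 1 / B x * (B v - B u)) \<le> (K * (v - u) powr \<gamma> / c)\<^sup>2 + 8 * (K * (v - u) powr \<gamma> / c)\<^sup>2"
      using p1 p2 by linarith
    also have "\<dots> = (9 * K\<^sup>2 / c\<^sup>2) * (v - u) powr (2 * \<gamma>)"
      using h by (simp add: power2_eq_square powr_add[symmetric] mult_2 algebra_simps)
    finally show ?thesis unfolding w_def .
  qed
  then show ?thesis using \<delta>(1) by (intro exI[of _ "9 * K\<^sup>2 / c\<^sup>2"] conjI exI[of _ \<delta>]) auto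
qed (auto intro!: exI[of _ 0] exI[of _ 1])

text \<open>Local errors of order \<open>2 * \<gamma> > 1\<close> are at most \<open>C * q\<close>
  times the length of the subinterval as soon as the mesh is small, and the lengths add up to
  \<open>T\<close>, while the increments of \<open>L\<close> telescope.\<close>

lemma has_rs_integral_log:
  fixes B L :: "real \<Rightarrow> complex"
  assumes T: "0 \<le> T" and \<gamma>: "1 / 2 < \<gamma>" and hol: "holder_on {0..T} \<gamma> B" and L: "continuous_on {0..T} L"
    and BL: "\<And>s. s \<in> {0..T} \<Longrightarrow> B s = exp (L s)"
  shows "has_rs_integral (\<lambda>s. 1 / B s) B 0 T (L T - L 0)"
  unfolding has_rs_integral_def
proof (intro allI impI)
  fix e :: real assume e: "e > 0"
  obtain C \<delta> where C: "C \<ge> 0" "\<delta> > 0" and b: "\<And>u x v. 0 \<le> u \<Longrightarrow> u \<le> x \<Longrightarrow> x \<le> v \<Longrightarrow> v \<le> T \<Longrightarrow> v - u < \<delta> \<Longrightarrow>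
     norm (L v - L u - 1 / B x * (B v - B u)) \<le> C * (v - u) powr (2 * \<gamma>)"
    using log_increment_bound[OF \<gamma> hol L BL] by blast
  define a where "a = 2 * \<gamma> - 1"
  have a: "a > 0" using \<gamma> by (simp add: a_def)
  define q where "q = e / ((C + 1) * (T + 1)) / 2"
  have q: "q > 0" using e C T by (simp add: q_def)
  \<comment> \<open>A subinterval inside a ball of radius \<open>d\<close> has length below
    \<open>2 * d\<close>, hence the halving.\<close>
  define d where "d = min \<delta> (q powr (1 / a)) / 2"
  have d: "d > 0" "2 * d \<le> \<delta>" "2 * d \<le> q powr (1 / a)" using C q by (auto simp: d_def)
  have da: "(2 * d) powr a \<le> q"
  proof -
    have "(2 * d) powr a \<le> (q powr (1 / a)) powr a" using d a by (intro powr_mono2) auto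
    then show ?thesis using a q by (simp add: powr_powr)
  qed
  show "\<exists>\<delta>>0. \<forall>p. p tagged_division_of {0..T} \<and> (\<lambda>x. ball x \<delta>) fine p \<longrightarrow>
        norm ((\<Sum>(x, K)\<in>p. 1 / B x * (B (Sup K) - B (Inf K))) - (L T - L 0)) < e"
  proof (intro exI[of _ d] conjI allI impI d(1), elim conjE)
    fix p assume p: "p tagged_division_of {0..T}" and f: "(\<lambda>x. ball x d) fine p"
    have tL: "(\<Sum>(x, K)\<in>p. L (Sup K) - L (Inf K)) = L T - L 0"
      by (rule additive_tagged_division_1[OF T p])
    have tid: "(\<Sum>(x, K)\<in>p. Sup K - Inf K) = T - 0"
      by (rule additive_tagged_division_1[OF T p, of "\<lambda>x. x"])
    have "norm ((\<Sum>(x, K)\<in>p. 1 / B x * (B (Sup K) - B (Inf K))) - (L T - L 0))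
      = norm (\<Sum>(x, K)\<in>p. (1 / B x * (B (Sup K) - B (Inf K))) - (L (Sup K) - L (Inf K)))"
      unfolding tL[symmetric] sum_subtractf[symmetric] by (simp add: case_prod_beta)
    also have "\<dots> \<le> (\<Sum>(x, K)\<in>p. (C * q) * (Sup K - Inf K))"
    proof (rule sum_norm_le, clarify)
      fix x K assume xK: "(x, K) \<in> p"
      obtain u v where uv: "K = {u..v}" using tagged_division_ofD(4)[OF p xK] by (metis interval_cbox)
      have "x \<in> K" "K \<subseteq> {0..T}" "K \<subseteq> ball x d"
        using tagged_division_ofD(2,3)[OF p xK] fineD[OF f xK] by auto
      then have h: "u \<le> x" "x \<le> v" "0 \<le> u" "v \<le> T" using uv by auto
      then have "u \<in> K" "v \<in> K" using uv by auto
      then have "u \<in> ball x d" "v \<in> ball x d" using \<open>K \<subseteq> ball x d\<close> by auto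
      then have vu: "v - u < 2 * d" by (auto simp: dist_real_def)
      have SI: "Sup K = v" "Inf K = u" using uv h by auto
      have "norm (1 / B x * (B (Sup K) - B (Inf K)) - (L (Sup K) - L (Inf K)))
        = norm (L v - L u - 1 / B x * (B v - B u))" unfolding SI by (rule norm_minus_commute)
      also have "\<dots> \<le> C * (v - u) powr (2 * \<gamma>)" using h vu d by (intro b) auto
      also have "(v - u) powr (2 * \<gamma>) = (v - u) powr a * (v - u)"
        using h by (cases "v = u") (auto simp: a_def powr_diff)
      also have "C * ((v - u) powr a * (v - u)) \<le> C * (q * (v - u))"
      proof (intro mult_left_mono mult_right_mono)
        show "(v - u) powr a \<le> q" using h vu a by (intro order_trans[OF powr_mono2 da]) auto
      qed (use h C in auto)
      finally show "norm (1 / B x * (B (Sup K) - B (Inf K)) - (L (Sup K) - L (Inf K))) \<le> (C * q) * (Sup K - Inf K)"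
        unfolding SI by (simp add: mult.assoc)
    qed
    also have "\<dots> = (C * q) * T"
      using tid by (simp add: sum_distrib_left[symmetric] case_prod_beta)
    also have "\<dots> \<le> ((C + 1) * q) * (T + 1)" using C q T by (intro mult_mono) auto
    also have "\<dots> = ((C + 1) * (T + 1)) * q" by (simp only: mult_ac)
    also have "\<dots> = e / 2"
    proof -
      have "(C + 1) * (T + 1) \<noteq> 0" using C T by auto
      then show ?thesis by (simp add: q_def)
    qed
    also have "\<dots> < e" using e by simp
    finally show "norm ((\<Sum>(x, K)\<in>p. 1 / B x * (B (Sup K) - B (Inf K))) - (L T - L 0)) < e" .
  qed
qed

section \<open>Sewing of dyadic Riemann sums\<close>

definition incr :: "(real \<Rightarrow> complex) \<Rightarrow> real \<Rightarrow> real \<Rightarrow> complex" where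
  "incr B u v = (B v - B u) / B u"

text \<open>The failure of additivity of \<open>incr\<close> when \<open>m\<close> is inserted
  between \<open>u\<close> and \<open>v\<close>: the second-order quantity that the sewing argument
  has to sum.\<close>

definition defect :: "(real \<Rightarrow> complex) \<Rightarrow> real \<Rightarrow> real \<Rightarrow> real \<Rightarrow> complex" where
  "defect B u m v = (B v - B m) * (1 / B m - 1 / B u)"

lemma incr_split: "incr B u m + incr B m v = incr B u v + defect B u m v"
  by (simp add: incr_def defect_def divide_inverse algebra_simps)

text \<open>All defects met when the cell of length \<open>h\<close> at \<open>s\<close> is bisected
  again and again. Valued in \<open>ennreal\<close>, its expectation can be bounded before
  convergence is known.\<close>

definition total_defect :: "(real \<Rightarrow> complex) \<Rightarrow> real \<Rightarrow> real \<Rightarrow> ennreal" where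
  "total_defect B s h = (\<Sum>j. \<Sum>k<2 ^ j. ennreal (norm (defect B (s + h * real (2 * k) / 2 ^ Suc j)
      (s + h * real (2 * k + 1) / 2 ^ Suc j) (s + h * real (2 * k + 2) / 2 ^ Suc j))))"

definition riemann_sum :: "(real \<Rightarrow> complex) \<Rightarrow> real \<Rightarrow> real \<Rightarrow> nat \<Rightarrow> complex" where
  "riemann_sum B s h j = (\<Sum>k<2 ^ j. incr B (s + h * real k / 2 ^ j) (s + h * real (Suc k) / 2 ^ j))"

lemma sum_double: "(\<Sum>k<2 * n. f k) = (\<Sum>k<n. f (2 * k) + f (2 * k + 1))" for f :: "nat \<Rightarrow> 'b::comm_monoid_add"
  by (induction n) (auto simp: add.assoc)

lemma riemann_sum_Suc:
  "riemann_sum B s h (Suc j) = riemann_sum B s h j + (\<Sum>k<2 ^ j. defect B (s + h * real (2 * k) / 2 ^ Suc j)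
      (s + h * real (2 * k + 1) / 2 ^ Suc j) (s + h * real (2 * k + 2) / 2 ^ Suc j))"
proof -
  have "riemann_sum B s h (Suc j) = (\<Sum>k<2 ^ j. incr B (s + h * real (2 * k) / 2 ^ Suc j) (s + h * real (2 * k + 1) / 2 ^ Suc j)
     + incr B (s + h * real (2 * k + 1) / 2 ^ Suc j) (s + h * real (2 * k + 2) / 2 ^ Suc j))"
    unfolding riemann_sum_def power_Suc sum_double by (intro sum.cong refl) simp
  also have "\<dots> = (\<Sum>k<2 ^ j. incr B (s + h * real (2 * k) / 2 ^ Suc j) (s + h * real (2 * k + 2) / 2 ^ Suc j)
     + defect B (s + h * real (2 * k) / 2 ^ Suc j)
      (s + h * real (2 * k + 1) / 2 ^ Suc j) (s + h * real (2 * k + 2) / 2 ^ Suc j))"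
    by (simp only: incr_split)
  also have "\<dots> = riemann_sum B s h j + (\<Sum>k<2 ^ j. defect B (s + h * real (2 * k) / 2 ^ Suc j)
      (s + h * real (2 * k + 1) / 2 ^ Suc j) (s + h * real (2 * k + 2) / 2 ^ Suc j))"
  proof -
    have "s + h * real (2 * k) / 2 ^ Suc j = s + h * real k / 2 ^ j"
      "s + h * real (2 * k + 2) / 2 ^ Suc j = s + h * real (Suc k) / 2 ^ j" for k
      by (auto simp: field_simps)
    then show ?thesis unfolding riemann_sum_def sum.distrib by simp
  qed
  finally show ?thesis .
qed

text \<open>The local estimate for \<open>L\<close> with left endpoints as tags:
  \<open>2 ^ j\<close> cells of length \<open>h / 2 ^ j\<close> leave a total error of order
  \<open>(h / 2 ^ j) powr (2 * \<gamma> - 1)\<close>.\<close>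

lemma riemann_sum_tendsto:
  fixes B L :: "real \<Rightarrow> complex"
  assumes \<gamma>: "1 / 2 < \<gamma>" and hol: "holder_on {0..T} \<gamma> B" and L: "continuous_on {0..T} L"
    and BL: "\<And>s. s \<in> {0..T} \<Longrightarrow> B s = exp (L s)"
    and s: "0 \<le> s" "0 \<le> h" "s + h \<le> T"
  shows "riemann_sum B s h \<longlonglongrightarrow> L (s + h) - L s"
proof -
  obtain C \<delta> where C: "C \<ge> 0" "\<delta> > 0" and b: "\<And>u x v. 0 \<le> u \<Longrightarrow> u \<le> x \<Longrightarrow> x \<le> v \<Longrightarrow> v \<le> T \<Longrightarrow> v - u < \<delta> \<Longrightarrow>
     norm (L v - L u - 1 / B x * (B v - B u)) \<le> C * (v - u) powr (2 * \<gamma>)"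
    using log_increment_bound[OF \<gamma> hol L BL] by blast
  have p0: "(\<lambda>j. h * (1 / 2 :: real) ^ j) \<longlonglongrightarrow> 0"
    by (intro tendsto_mult_right_zero LIMSEQ_realpow_zero) auto
  then have ev: "\<forall>\<^sub>F j in sequentially. h * (1 / 2) ^ j < \<delta>"
    using C(2) by (rule order_tendstoD(2))
  have "(\<lambda>j. riemann_sum B s h j - (L (s + h) - L s)) \<longlonglongrightarrow> 0"
  proof (rule Lim_null_comparison[where g="\<lambda>j. C * h * (h * (1 / 2) ^ j) powr (2 * \<gamma> - 1)"])
    have "(\<lambda>j. C * h * (h * (1 / 2) ^ j) powr (2 * \<gamma> - 1)) \<longlonglongrightarrow> C * h * 0 powr (2 * \<gamma> - 1)"
      using \<gamma> s by (intro tendsto_intros tendsto_powr' p0) auto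
    then show "(\<lambda>j. C * h * (h * (1 / 2) ^ j) powr (2 * \<gamma> - 1)) \<longlonglongrightarrow> 0" by simp
    show "\<forall>\<^sub>F j in sequentially. norm (riemann_sum B s h j - (L (s + h) - L s)) \<le> C * h * (h * (1 / 2) ^ j) powr (2 * \<gamma> - 1)"
      using ev
    proof eventually_elim
      case (elim j)
      let ?d = "\<lambda>k. s + h * real k / 2 ^ j"
      have dd: "?d (Suc k) - ?d k = h * (1 / 2) ^ j" for k by (simp add: field_simps power_one_over)
      have tel: "(\<Sum>k<2 ^ j. L (?d (Suc k)) - L (?d k)) = L (s + h) - L s"
        by (subst sum_lessThan_telescope) simp
      have "norm (riemann_sum B s h j - (L (s + h) - L s))
         = norm (\<Sum>k<2 ^ j. incr B (?d k) (?d (Suc k)) - (L (?d (Suc k)) - L (?d k)))"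
        unfolding riemann_sum_def tel[symmetric] sum_subtractf ..
      also have "\<dots> \<le> (\<Sum>k<(2::nat) ^ j. C * (h * (1 / 2) ^ j) powr (2 * \<gamma>))"
      proof (rule sum_norm_le)
        fix k assume "k \<in> {..<(2::nat) ^ j}"
        then have k: "real (Suc k) \<le> 2 ^ j" using of_nat_le_iff[of "Suc k" "2 ^ j", where 'a=real] by auto
        have "h * real (Suc k) / 2 ^ j \<le> h * 2 ^ j / 2 ^ j" using k s by (intro divide_right_mono mult_left_mono) auto
        then have T: "?d (Suc k) \<le> T" using s by simp
        have "norm (L (?d (Suc k)) - L (?d k) - 1 / B (?d k) * (B (?d (Suc k)) - B (?d k))) \<le> C * (?d (Suc k) - ?d k) powr (2 * \<gamma>)"
        proof (rule b)
          show "?d k \<le> ?d (Suc k)" using s by (intro add_left_mono divide_right_mono mult_left_mono) auto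
          show "?d (Suc k) - ?d k < \<delta>" unfolding dd by (rule elim)
          show "0 \<le> ?d k" using s by (intro add_nonneg_nonneg divide_nonneg_nonneg mult_nonneg_nonneg) auto
        qed (rule order.refl T)+
        then show "norm (incr B (?d k) (?d (Suc k)) - (L (?d (Suc k)) - L (?d k))) \<le> C * (h * (1 / 2) ^ j) powr (2 * \<gamma>)"
          unfolding dd incr_def by (simp add: norm_minus_commute)
      qed
      also have "\<dots> = C * h * (h * (1 / 2) ^ j) powr (2 * \<gamma> - 1)"
      proof (cases "h = 0")
        case False
        then have "h * (1 / 2) ^ j > 0" using s by simp
        then have "(h * (1 / 2) ^ j) powr (2 * \<gamma>) = (h * (1 / 2) ^ j) powr (2 * \<gamma> - 1) * (h * (1 / 2) ^ j)"
          by (simp add: powr_diff)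
        then show ?thesis by (simp add: field_simps power_one_over)
      qed simp
      finally show ?case .
    qed
  qed
  then show ?thesis by (rule LIM_zero_cancel)
qed

text \<open>Riemann sums of consecutive levels differ by the defects of that level, so the limit
  differs from the level-0 term \<open>incr B s (s + h)\<close> by at most the sum of all
  defects.\<close>

lemma sewing_bound:
  fixes B :: "real \<Rightarrow> complex"
  assumes lim: "riemann_sum B s h \<longlonglongrightarrow> l"
  shows "ennreal (norm (l - incr B s (s + h))) \<le> total_defect B s h"
proof -
  have S0: "riemann_sum B s h 0 = incr B s (s + h)" by (simp add: riemann_sum_def)
  define d where "d = (\<lambda>j. \<Sum>k<2 ^ j. defect B (s + h * real (2 * k) / 2 ^ Suc j)
      (s + h * real (2 * k + 1) / 2 ^ Suc j) (s + h * real (2 * k + 2) / 2 ^ Suc j))"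
  have Sn: "riemann_sum B s h n - incr B s (s + h) = (\<Sum>j<n. d j)" for n
    by (induction n) (simp_all add: S0 riemann_sum_Suc d_def)
  have "ennreal (norm (\<Sum>j<n. d j)) \<le> total_defect B s h" for n
  proof -
    have "ennreal (norm (\<Sum>j<n. d j)) \<le> ennreal (\<Sum>j<n. \<Sum>k<2 ^ j. norm (defect B (s + h * real (2 * k) / 2 ^ Suc j)
      (s + h * real (2 * k + 1) / 2 ^ Suc j) (s + h * real (2 * k + 2) / 2 ^ Suc j)))"
      unfolding d_def by (intro ennreal_leI sum_norm_le norm_sum)
    also have "\<dots> = (\<Sum>j<n. \<Sum>k<2 ^ j. ennreal (norm (defect B (s + h * real (2 * k) / 2 ^ Suc j)
      (s + h * real (2 * k + 1) / 2 ^ Suc j) (s + h * real (2 * k + 2) / 2 ^ Suc j))))"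
      by (simp add: sum_nonneg)
    also have "\<dots> \<le> total_defect B s h"
      unfolding total_defect_def by (intro sum_le_suminf) auto
    finally show ?thesis .
  qed
  moreover have "(\<lambda>n. ennreal (norm (\<Sum>j<n. d j))) \<longlonglongrightarrow> ennreal (norm (l - incr B s (s + h)))"
    unfolding Sn[symmetric] by (intro tendsto_ennrealI tendsto_norm tendsto_diff tendsto_const lim)
  ultimately show ?thesis by (intro LIMSEQ_le_const2[where X="\<lambda>n. ennreal (norm (\<Sum>j<n. d j))"]) blast+
qed

section \<open>Path regularity and avoidance of 0\<close>

lemma AE_suminf_finite:
  fixes f :: "nat \<Rightarrow> 'a \<Rightarrow> ennreal"
  assumes [measurable]: "\<And>n. f n \<in> borel_measurable M"
    and b: "\<And>n. (\<integral>\<^sup>+\<xi>. f n \<xi> \<partial>M) \<le> ennreal (g n)" and g: "summable g" "\<And>n. 0 \<le> g n"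
  shows "AE \<xi> in M. (\<Sum>n. f n \<xi>) \<noteq> \<infinity>"
proof (rule nn_integral_PInf_AE)
  have "(\<integral>\<^sup>+\<xi>. (\<Sum>n. f n \<xi>) \<partial>M) = (\<Sum>n. \<integral>\<^sup>+\<xi>. f n \<xi> \<partial>M)"
    by (rule nn_integral_suminf) measurable
  also have "\<dots> \<le> (\<Sum>n. ennreal (g n))" by (intro suminf_le b) auto
  also have "\<dots> = ennreal (suminf g)" using g by (rule suminf_ennreal2[rotated])
  finally show "(\<integral>\<^sup>+\<xi>. (\<Sum>n. f n \<xi>) \<partial>M) \<noteq> \<infinity>" by (auto simp: top_unique)
qed measurable

lemma AE_terms_bounded:
  fixes f :: "nat \<Rightarrow> 'a \<Rightarrow> real"
  assumes [measurable]: "\<And>n. f n \<in> borel_measurable M"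
    and b: "\<And>n. (\<integral>\<^sup>+\<xi>. ennreal (f n \<xi>) \<partial>M) \<le> ennreal (g n)" and g: "summable g" "\<And>n. 0 \<le> g n"
  shows "AE \<xi> in M. \<exists>K\<ge>0. \<forall>n. f n \<xi> \<le> K"
proof -
  have "AE \<xi> in M. (\<Sum>n. ennreal (f n \<xi>)) \<noteq> \<infinity>"
    by (rule AE_suminf_finite[OF _ b g]) measurable
  then show ?thesis
  proof eventually_elim
    case (elim \<xi>)
    show ?case
    proof (intro exI conjI allI)
      fix n
      have "ennreal (f n \<xi>) \<le> (\<Sum>n. ennreal (f n \<xi>))"
        using sum_le_suminf[of "\<lambda>n. ennreal (f n \<xi>)" "{n}"] by simp
      then have "enn2real (ennreal (f n \<xi>)) \<le> enn2real (\<Sum>n. ennreal (f n \<xi>))"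
        using elim by (intro enn2real_mono) (auto simp: top.not_eq_extremum)
      then show "f n \<xi> \<le> enn2real (\<Sum>n. ennreal (f n \<xi>))"
        by (cases "0 \<le> f n \<xi>") (auto intro: order_trans[OF _ enn2real_nonneg])
    qed simp
  qed
qed

lemma AE_terms_tendsto_0:
  fixes f :: "nat \<Rightarrow> 'a \<Rightarrow> ennreal"
  assumes [measurable]: "\<And>n. f n \<in> borel_measurable M"
    and b: "\<And>n. (\<integral>\<^sup>+\<xi>. f n \<xi> \<partial>M) \<le> ennreal (g n)" and g: "summable g" "\<And>n. 0 \<le> g n"
  shows "AE \<xi> in M. (\<forall>n. f n \<xi> < \<infinity>) \<and> (\<lambda>n. enn2real (f n \<xi>)) \<longlonglongrightarrow> 0"
proof -
  have "AE \<xi> in M. (\<Sum>n. f n \<xi>) \<noteq> \<infinity>"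
    by (rule AE_suminf_finite[OF _ b g]) measurable
  then show ?thesis
  proof eventually_elim
    case (elim \<xi>)
    have fin: "f n \<xi> < \<infinity>" for n
    proof -
      have "f n \<xi> \<le> (\<Sum>n. f n \<xi>)"
        using sum_le_suminf[of "\<lambda>n. f n \<xi>" "{n}"] by simp
      then show ?thesis using elim by (auto simp: top.not_eq_extremum)
    qed
    then have e: "ennreal (enn2real (f n \<xi>)) = f n \<xi>" for n by simp
    have "summable (\<lambda>n. enn2real (f n \<xi>))"
      using elim by (intro summable_suminf_not_top) (auto simp: e)
    then show ?case using fin summable_LIMSEQ_zero by blast
  qed
qed

text \<open>Kolmogorov's moment argument: the \<open>2 ^ i\<close> indices of level \<open>i\<close>
  use up the 1 in \<open>1 + \<epsilon>\<close>, and the weight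
  \<open>2 powr (\<eta> * p * i)\<close> leaves the geometric ratio
  \<open>2 powr (\<eta> * p - \<epsilon>) < 1\<close>.\<close>

lemma (in prob_space) AE_dyadic_bound:
  fixes a :: "nat \<Rightarrow> nat \<Rightarrow> 'a \<Rightarrow> real"
  assumes [measurable]: "\<And>i k. a i k \<in> borel_measurable M" and nn: "\<And>i k \<xi>. 0 \<le> a i k \<xi>"
    and p: "p > 0" and C: "C \<ge> 0" and \<eta>: "\<eta> * p < \<epsilon>"
    and b: "\<And>i k. k < 2 ^ i \<Longrightarrow> (\<integral>\<^sup>+\<xi>. ennreal (a i k \<xi> powr p) \<partial>M) \<le> ennreal (C * 2 powr (- (1 + \<epsilon>) * real i))"
  shows "AE \<xi> in M. \<exists>K\<ge>0. \<forall>i k. k < 2 ^ i \<longrightarrow> a i k \<xi> \<le> K * (2 powr (- \<eta>)) ^ i"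
proof -
  define f where "f = (\<lambda>i \<xi>. 2 powr (\<eta> * p * real i) * (\<Sum>k<2 ^ i. a i k \<xi> powr p))"
  have [measurable]: "f i \<in> borel_measurable M" for i unfolding f_def by measurable
  define r where "r = (2::real) powr (\<eta> * p - \<epsilon>)"
  have r: "0 < r" "r < 1" using \<eta> by (auto simp: r_def powr_less_one)
  have "(\<integral>\<^sup>+\<xi>. ennreal (f i \<xi>) \<partial>M) \<le> ennreal (C * r ^ i)" for i
  proof -
    have "(\<integral>\<^sup>+\<xi>. ennreal (f i \<xi>) \<partial>M) = (\<integral>\<^sup>+\<xi>. ennreal (2 powr (\<eta> * p * real i)) * (\<Sum>k<2 ^ i. ennreal (a i k \<xi> powr p)) \<partial>M)"
      unfolding f_def by (simp add: ennreal_mult sum_nonneg)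
    also have "\<dots> = ennreal (2 powr (\<eta> * p * real i)) * (\<Sum>k<2 ^ i. \<integral>\<^sup>+\<xi>. ennreal (a i k \<xi> powr p) \<partial>M)"
      by (subst nn_integral_cmult, measurable, subst nn_integral_sum) auto
    also have "\<dots> \<le> ennreal (2 powr (\<eta> * p * real i)) * (\<Sum>k<(2::nat) ^ i. ennreal (C * 2 powr (- (1 + \<epsilon>) * real i)))"
      by (intro mult_left_mono sum_mono b) auto
    also have "\<dots> = ennreal (2 powr (\<eta> * p * real i) * (2 ^ i * (C * 2 powr (- (1 + \<epsilon>) * real i))))"
      using C by (simp add: ennreal_mult ennreal_power[symmetric])
    also have "2 powr (\<eta> * p * real i) * (2 ^ i * (C * 2 powr (- (1 + \<epsilon>) * real i)))
      = C * (2 powr (\<eta> * p * real i) * 2 powr real i * 2 powr (- (1 + \<epsilon>) * real i))"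
      by (simp add: powr_realpow)
    also have "2 powr (\<eta> * p * real i) * 2 powr real i * 2 powr (- (1 + \<epsilon>) * real i) = r ^ i"
      unfolding r_def powr_add[symmetric] by (subst powr_realpow[symmetric]) (simp_all add: powr_powr algebra_simps)
    finally show ?thesis .
  qed
  moreover have "summable (\<lambda>i. C * r ^ i)" using r by (intro summable_mult summable_geometric) auto
  ultimately have "AE \<xi> in M. \<exists>K\<ge>0. \<forall>n. f n \<xi> \<le> K"
    using r C by (intro AE_terms_bounded[where g="\<lambda>i. C * r ^ i"]) auto
  then show ?thesis
  proof eventually_elim
    case (elim \<xi>)
    then obtain K where K: "K \<ge> 0" "\<And>i. f i \<xi> \<le> K" by blast
    show ?case
    proof (intro exI[of _ "K powr (1 / p)"] conjI allI impI)
      fix i k :: nat assume k: "k < 2 ^ i"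
      have "a i k \<xi> powr p \<le> (\<Sum>k<2 ^ i. a i k \<xi> powr p)"
        using k by (intro member_le_sum) auto
      then have "2 powr (\<eta> * p * real i) * a i k \<xi> powr p \<le> f i \<xi>"
        unfolding f_def by (intro mult_left_mono) auto
      then have "2 powr (\<eta> * p * real i) * a i k \<xi> powr p \<le> K" using K(2)[of i] by linarith
      then have "(2 powr (\<eta> * p * real i) * a i k \<xi> powr p) powr (1 / p) \<le> K powr (1 / p)"
        using p by (intro powr_mono2) auto
      then have "2 powr (\<eta> * real i) * a i k \<xi> \<le> K powr (1 / p)"
        using p nn[of i k \<xi>] by (simp add: powr_mult powr_powr)
      then have "2 powr (- (\<eta> * real i)) * (2 powr (\<eta> * real i) * a i k \<xi>) \<le> 2 powr (- (\<eta> * real i)) * K powr (1 / p)"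
        by (intro mult_left_mono) auto
      moreover have "(2::real) powr (- (\<eta> * real i)) * 2 powr (\<eta> * real i) = 1"
        unfolding powr_add[symmetric] by simp
      moreover have "(2::real) powr (- (\<eta> * real i)) = (2 powr (- \<eta>)) ^ i"
        by (subst powr_realpow[symmetric]) (simp_all add: powr_powr)
      ultimately show "a i k \<xi> \<le> K powr (1 / p) * (2 powr (- \<eta>)) ^ i"
        by (metis mult.assoc mult.commute mult_1)
    qed simp
  qed
qed

context centred_fbm
begin

lemma AE_holder:
  assumes \<gamma>: "0 < \<gamma>" "\<gamma> < H"
  shows "AE \<xi> in M. \<forall>T. holder_on {0..T} \<gamma> (\<lambda>t. W t \<xi>)"
proof -
  \<comment> \<open>The order \<open>m\<close> is chosen with \<open>(H - \<gamma>) * m = 2\<close>,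
    so that \<open>\<gamma> * m = H * m - 2\<close> stays below the available exponent
    \<open>H * m - 1\<close>.\<close>
  define m where "m = 2 / (H - \<gamma>)"
  have "H - \<gamma> \<noteq> 0" "H - \<gamma> > 0" using \<gamma> by auto
  then have m: "m > 0" "(H - \<gamma>) * m = 2"
    unfolding m_def by (simp, metis nonzero_mult_div_cancel_left times_divide_eq_right)
  obtain C where C: "C \<ge> 0" "\<And>s t. s \<ge> 0 \<Longrightarrow> t \<ge> 0 \<Longrightarrow>
      (\<integral>\<^sup>+\<xi>. ennreal (norm (W t \<xi> - W s \<xi>) powr m) \<partial>M) \<le> ennreal (C * \<bar>t - s\<bar> powr (H * m))"
    using increment_moment[OF less_imp_le[OF m(1)]] by blast
  have one: "AE \<xi> in M. holder_on {0..real (Suc N)} \<gamma> (\<lambda>t. W t \<xi>)" for N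
  proof -
    define n where "n = real (Suc N)"
    have n: "n > 0" by (simp add: n_def)
    define a where "a = (\<lambda>(i::nat) (k::nat) \<xi>. norm (W (n * (real (Suc k) / 2 ^ i)) \<xi> - W (n * (real k / 2 ^ i)) \<xi>))"
    have "AE \<xi> in M. \<exists>K\<ge>0. \<forall>i k. k < 2 ^ i \<longrightarrow> a i k \<xi> \<le> K * (2 powr (- \<gamma>)) ^ i"
    proof (rule AE_dyadic_bound[where p=m and \<epsilon>="H * m - 1" and C="C * n powr (H * m)"])
      fix i k :: nat
      have "(\<integral>\<^sup>+\<xi>. ennreal (a i k \<xi> powr m) \<partial>M) \<le> ennreal (C * \<bar>n * (real (Suc k) / 2 ^ i) - n * (real k / 2 ^ i)\<bar> powr (H * m))"
        unfolding a_def using n by (intro C(2)) auto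
      also have "\<bar>n * (real (Suc k) / 2 ^ i) - n * (real k / 2 ^ i)\<bar> = n * 2 powr (- real i)"
        using n by (simp add: powr_minus powr_realpow field_simps)
      also have "C * (n * 2 powr (- real i)) powr (H * m) = C * n powr (H * m) * 2 powr (- (1 + (H * m - 1)) * real i)"
        by (simp add: powr_mult powr_powr mult_ac)
      finally show "(\<integral>\<^sup>+\<xi>. ennreal (a i k \<xi> powr m) \<partial>M) \<le> ennreal (C * n powr (H * m) * 2 powr (- (1 + (H * m - 1)) * real i))" .
    qed (use m C in \<open>auto simp: a_def algebra_simps\<close>)
    then show ?thesis
    proof eventually_elim
      case (elim \<xi>)
      then obtain K where K: "K \<ge> 0" "\<And>i k. k < 2 ^ i \<Longrightarrow> a i k \<xi> \<le> K * (2 powr (- \<gamma>)) ^ i" by blast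
      have "\<exists>C\<ge>0. \<forall>s\<in>{0..1}. \<forall>t\<in>{0..1}. norm (W (n * t) \<xi> - W (n * s) \<xi>) \<le> C * \<bar>t - s\<bar> powr \<gamma>"
      proof (rule holder_of_dyadic[OF \<gamma>(1) K(1)])
        show "norm (W (n * (real (Suc k) / 2 ^ i)) \<xi> - W (n * (real k / 2 ^ i)) \<xi>) \<le> K * (2 powr (- \<gamma>)) ^ i"
          if "k < 2 ^ i" for i k using K(2)[OF that] by (simp add: a_def)
        show "continuous_on {0..1} (\<lambda>t. W (n * t) \<xi>)"
          by (rule continuous_on_compose2[OF W_continuous]) (auto intro: continuous_intros)
      qed
      then obtain C where C: "C \<ge> 0" "\<And>s t. s \<in> {0..1} \<Longrightarrow> t \<in> {0..1} \<Longrightarrow> norm (W (n * t) \<xi> - W (n * s) \<xi>) \<le> C * \<bar>t - s\<bar> powr \<gamma>"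
        by blast
      show ?case unfolding holder_on_def n_def[symmetric]
      proof (intro exI[of _ "C * (1 / n) powr \<gamma>"] conjI ballI)
        fix s t assume "s \<in> {0..n}" "t \<in> {0..n}"
        then have "norm (W (n * (t / n)) \<xi> - W (n * (s / n)) \<xi>) \<le> C * \<bar>t / n - s / n\<bar> powr \<gamma>"
          using n by (intro C(2)) auto
        also have "\<bar>t / n - s / n\<bar> = (1 / n) * \<bar>t - s\<bar>" using n by (simp add: diff_divide_distrib[symmetric])
        finally show "norm (W t \<xi> - W s \<xi>) \<le> C * (1 / n) powr \<gamma> * \<bar>t - s\<bar> powr \<gamma>"
          using n by (simp only: powr_mult) (simp add: mult_ac)
      qed (use C in auto)
    qed
  qed
  have "AE \<xi> in M. \<forall>N. holder_on {0..real (Suc N)} \<gamma> (\<lambda>t. W t \<xi>)"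
    using one by (subst AE_all_countable) auto
  then show ?thesis
  proof eventually_elim
    case (elim \<xi>)
    show ?case
    proof
      fix T :: real
      obtain N where "T \<le> real N" using real_arch_simple by blast
      then have "{0..T} \<subseteq> {0..real (Suc N)}" by auto
      then show "holder_on {0..T} \<gamma> (\<lambda>t. W t \<xi>)"
        using elim[rule_format, of N] unfolding holder_on_def by (meson subsetD)
    qed
  qed
qed

text \<open>The midpoint of \<open>1 / H\<close> and 2. Only strict betweenness matters:
  \<open>q * H > 1\<close> gives summability over dyadic levels, \<open>q < 2\<close> gives
  integrability of the power \<open>- q\<close> of the path.\<close>

definition q :: real where "q = (1 / H + 2) / 2"

lemma q_bounds: "1 < q" "q < 2" "1 < q * H"
proof -
  have "0 < H" using H_gt by simp
  then have "1 / H < 2" "1 < 1 / H" using H_gt H_lt by (simp_all add: divide_less_eq less_divide_eq)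
  then show "1 < q" "q < 2" by (simp_all only: q_def less_divide_eq_numeral1 divide_less_eq_numeral1)
  have "q * H = (1 + 2 * H) / 2" using \<open>0 < H\<close> by (simp add: q_def distrib_right)
  then show "1 < q * H" using H_gt by simp
qed

text \<open>By self-similarity the bound depends only on the ratio of the time step to
  \<open>s\<close>. The base time \<open>w\<close> may be any time from \<open>s\<close> on, since
  the bound on the negative moment decreases in \<open>w\<close>.\<close>

lemma increment_over_path_moment:
  "\<exists>C\<ge>0. \<forall>u\<ge>0. \<forall>v\<ge>0. \<forall>w>0. \<forall>s>0. \<forall>z. s \<le> w \<longrightarrow>
    (\<integral>\<^sup>+\<xi>. ennreal (norm (W v \<xi> - W u \<xi>) powr q * norm (z + W w \<xi>) powr (- q)) \<partial>M)
      \<le> ennreal (C * (\<bar>v - u\<bar> / s) powr (q * H))"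
proof -
  obtain C where C: "C \<ge> 0" "\<And>s t w z. s \<ge> 0 \<Longrightarrow> t \<ge> 0 \<Longrightarrow> w > 0 \<Longrightarrow>
    (\<integral>\<^sup>+\<xi>. ennreal (norm (W t \<xi> - W s \<xi>) powr q * norm (z + W w \<xi>) powr (- q)) \<partial>M)
      \<le> ennreal (C * \<bar>t - s\<bar> powr (H * q) * w powr (- (H * q)))"
  proof -
    have "0 \<le> q" using q_bounds by simp
    from mixed_moment[OF this this q_bounds(2)] obtain C where "C \<ge> 0" "\<forall>s\<ge>0. \<forall>t\<ge>0. \<forall>w>0. \<forall>z.
      (\<integral>\<^sup>+\<xi>. ennreal (norm (W t \<xi> - W s \<xi>) powr q * norm (z + W w \<xi>) powr (- q)) \<partial>M)
      \<le> ennreal (C * \<bar>t - s\<bar> powr (H * q) * w powr (- (H * q)))" by (elim exE conjE)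
    then show thesis by (intro that[of C]) simp_all
  qed
  show ?thesis
  proof (intro exI[of _ C] conjI allI impI C(1))
    fix u v w s :: real and z
    assume h: "0 \<le> u" "0 \<le> v" "0 < w" "0 < s" "s \<le> w"
    have "(\<integral>\<^sup>+\<xi>. ennreal (norm (W v \<xi> - W u \<xi>) powr q * norm (z + W w \<xi>) powr (- q)) \<partial>M)
      \<le> ennreal (C * \<bar>v - u\<bar> powr (H * q) * w powr (- (H * q)))" using C(2) h by blast
    also have "\<dots> \<le> ennreal (C * \<bar>v - u\<bar> powr (H * q) * s powr (- (H * q)))"
      using h C(1) q_bounds H_gt by (intro ennreal_leI mult_left_mono powr_mono2') auto
    also have "C * \<bar>v - u\<bar> powr (H * q) * s powr (- (H * q)) = C * (\<bar>v - u\<bar> / s) powr (q * H)"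
      by (simp add: powr_divide powr_minus field_simps)
    finally show "(\<integral>\<^sup>+\<xi>. ennreal (norm (W v \<xi> - W u \<xi>) powr q * norm (z + W w \<xi>) powr (- q)) \<partial>M)
      \<le> ennreal (C * (\<bar>v - u\<bar> / s) powr (q * H))" .
  qed
qed

lemma ln_ratio_bound:
  fixes x y :: complex
  assumes "x \<noteq> 0" "y \<noteq> 0"
  shows "\<bar>ln (norm y) - ln (norm x)\<bar> \<le> norm (y - x) * (1 / norm x + 1 / norm y)"
proof -
  have *: "ln (norm y) - ln (norm x) \<le> norm (y - x) * (1 / norm x)" if "x \<noteq> 0" "y \<noteq> 0" for x y :: complex
  proof -
    have "ln (norm y) - ln (norm x) = ln (norm y / norm x)" using that by (simp add: ln_div)
    also have "\<dots> \<le> norm y / norm x - 1" using that by (intro ln_le_minus_one) auto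
    also have "\<dots> = (norm y - norm x) / norm x" using that by (simp add: field_simps)
    also have "\<dots> \<le> norm (y - x) / norm x" by (intro divide_right_mono norm_triangle_ineq2) auto
    finally show ?thesis by simp
  qed
  have "0 \<le> norm (y - x) * (1 / norm x)" "0 \<le> norm (y - x) * (1 / norm y)" by auto
  then show ?thesis
    using *[OF assms] *[OF assms(2,1)] unfolding distrib_left norm_minus_commute[of x y] by linarith
qed

lemma powr_sum_bound: "(x + y) powr p \<le> 2 powr p * (x powr p + y powr p)" if "0 \<le> x" "0 \<le> y" "0 \<le> p" for x y p :: real
proof -
  have "(x + y) powr p \<le> (2 * max x y) powr p" using that by (intro powr_mono2) auto
  also have "\<dots> \<le> 2 powr p * (x powr p + y powr p)"
    by (subst powr_mult, intro mult_left_mono) (auto simp: max_def)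
  finally show ?thesis .
qed

text \<open>Chaining applied to \<open>ln \<bar>B\<bar>\<close> along dyadic times bounds \<open>\<bar>B\<bar>\<close> away from 0.\<close>

lemma AE_nonzero_interval:
  assumes s: "s > 0"
  shows "AE \<xi> in M. \<forall>t\<in>{s..2 * s}. z + W t \<xi> \<noteq> 0"
proof -
  define d where "d = (\<lambda>(i::nat) (k::nat). s * (1 + real k / 2 ^ i))"
  have d: "d i k \<ge> s" "d i k > 0" "d i (Suc k) - d i k = s * 2 powr (- real i)" for i k
  proof -
    have "s * 1 \<le> d i k" unfolding d_def using s by (intro mult_left_mono) auto
    then show "d i k \<ge> s" "d i k > 0" using s by auto
    show "d i (Suc k) - d i k = s * 2 powr (- real i)"
      by (simp add: d_def powr_minus powr_realpow field_simps)
  qed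
  define a where "a = (\<lambda>i k \<xi>. norm (W (d i (Suc k)) \<xi> - W (d i k) \<xi>)
      * (1 / norm (z + W (d i k) \<xi>) + 1 / norm (z + W (d i (Suc k)) \<xi>)))"
  obtain C where C: "C \<ge> 0" "\<And>u v w z. 0 \<le> u \<Longrightarrow> 0 \<le> v \<Longrightarrow> 0 < w \<Longrightarrow> s \<le> w \<Longrightarrow>
    (\<integral>\<^sup>+\<xi>. ennreal (norm (W v \<xi> - W u \<xi>) powr q * norm (z + W w \<xi>) powr (- q)) \<partial>M)
      \<le> ennreal (C * (\<bar>v - u\<bar> / s) powr (q * H))"
    using increment_over_path_moment s by meson
  \<comment> \<open>Here \<open>\<epsilon> = q * H - 1\<close>, and the exponent
    \<open>(q * H - 1) / (2 * q)\<close> spends half of it.\<close>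
  have "AE \<xi> in M. \<exists>K\<ge>0. \<forall>i k. k < 2 ^ i \<longrightarrow> a i k \<xi> \<le> K * (2 powr (- ((q * H - 1) / (2 * q)))) ^ i"
  proof (rule AE_dyadic_bound[where p=q and \<epsilon>="q * H - 1" and C="2 powr q * (C + C)"])
    fix i k :: nat
    let ?D = "\<lambda>\<xi>. norm (W (d i (Suc k)) \<xi> - W (d i k) \<xi>)"
    have "(\<integral>\<^sup>+\<xi>. ennreal (a i k \<xi> powr q) \<partial>M) \<le>
      (\<integral>\<^sup>+\<xi>. ennreal (2 powr q) * (ennreal (?D \<xi> powr q * norm (z + W (d i k) \<xi>) powr (- q))
        + ennreal (?D \<xi> powr q * norm (z + W (d i (Suc k)) \<xi>) powr (- q))) \<partial>M)"
    proof (intro nn_integral_mono)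
      fix \<xi>
      have "a i k \<xi> powr q = (?D \<xi> * (1 / norm (z + W (d i k) \<xi>)) + ?D \<xi> * (1 / norm (z + W (d i (Suc k)) \<xi>))) powr q"
        by (simp add: a_def distrib_left)
      also have "\<dots> \<le> 2 powr q * ((?D \<xi> * (1 / norm (z + W (d i k) \<xi>))) powr q + (?D \<xi> * (1 / norm (z + W (d i (Suc k)) \<xi>))) powr q)"
        using q_bounds by (intro powr_sum_bound) auto
      also have "\<dots> = 2 powr q * (?D \<xi> powr q * norm (z + W (d i k) \<xi>) powr (- q) + ?D \<xi> powr q * norm (z + W (d i (Suc k)) \<xi>) powr (- q))"
        by (simp add: powr_divide powr_minus_divide powr_mult)
      finally show "ennreal (a i k \<xi> powr q) \<le> ennreal (2 powr q) * (ennreal (?D \<xi> powr q * norm (z + W (d i k) \<xi>) powr (- q))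
        + ennreal (?D \<xi> powr q * norm (z + W (d i (Suc k)) \<xi>) powr (- q)))"
        by (simp add: ennreal_mult[symmetric] ennreal_plus[symmetric] ennreal_leI del: ennreal_plus)
    qed
    also have "\<dots> = ennreal (2 powr q) * ((\<integral>\<^sup>+\<xi>. ennreal (?D \<xi> powr q * norm (z + W (d i k) \<xi>) powr (- q)) \<partial>M)
        + (\<integral>\<^sup>+\<xi>. ennreal (?D \<xi> powr q * norm (z + W (d i (Suc k)) \<xi>) powr (- q)) \<partial>M))"
      by (subst nn_integral_cmult, measurable, subst nn_integral_add) measurable
    also have "\<dots> \<le> ennreal (2 powr q) * (ennreal (C * (\<bar>d i (Suc k) - d i k\<bar> / s) powr (q * H))
        + ennreal (C * (\<bar>d i (Suc k) - d i k\<bar> / s) powr (q * H)))"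
      using d less_imp_le[OF d(2)] by (intro mult_left_mono add_mono C(2)) auto
    also have "\<dots> = ennreal (2 powr q * (C + C) * 2 powr (- (1 + (q * H - 1)) * real i))"
      using C(1) s unfolding d(3) by (simp add: ennreal_mult[symmetric] ennreal_plus[symmetric] powr_powr algebra_simps del: ennreal_plus)
    finally show "(\<integral>\<^sup>+\<xi>. ennreal (a i k \<xi> powr q) \<partial>M) \<le> ennreal (2 powr q * (C + C) * 2 powr (- (1 + (q * H - 1)) * real i))" .
  qed (use q_bounds C in \<open>auto simp: a_def mult.commute\<close>)
  moreover have "AE \<xi> in M. \<forall>i k. z + W (d i k) \<xi> \<noteq> 0"
    using AE_nonzero[OF d(2)] by (simp add: AE_all_countable)
  ultimately show ?thesis
  proof eventually_elim
    case (elim \<xi>)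
    define r where "r = (2::real) powr (- ((q * H - 1) / (2 * q)))"
    have r: "0 < r" "r < 1" using q_bounds by (auto simp: r_def powr_less_one)
    obtain K where K: "K \<ge> 0" "\<And>i k. k < 2 ^ i \<Longrightarrow> a i k \<xi> \<le> K * r ^ i"
      using elim(1) unfolding r_def by blast
    define f where "f = (\<lambda>x. ln (norm (z + W (s * (1 + x)) \<xi>)))"
    have m: "norm (f (real (Suc k) / 2 ^ i) - f (real k / 2 ^ i)) \<le> K * r ^ i" if "k < 2 ^ i" for i k
    proof -
      have "norm (f (real (Suc k) / 2 ^ i) - f (real k / 2 ^ i)) \<le> a i k \<xi>"
        using ln_ratio_bound[OF elim(2)[rule_format, of i k] elim(2)[rule_format, of i "Suc k"]]
        unfolding f_def a_def d_def by simp
      then show ?thesis using K(2)[OF that] by simp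
    qed
    have sm: "summable (\<lambda>i. K * r ^ i)" using r by (intro summable_mult summable_geometric) auto
    define S where "S = (\<Sum>i. K * r ^ i)"
    have S: "(\<Sum>i<n. K * r ^ Suc (0 + i)) \<le> S" for n
    proof -
      have "(\<Sum>i<n. K * r ^ Suc (0 + i)) \<le> (\<Sum>i<n. K * r ^ i)"
        using K(1) r by (intro sum_mono mult_left_mono) (auto simp: mult_left_le_one_le)
      also have "\<dots> \<le> S" unfolding S_def using K(1) r by (intro sum_le_suminf sm) auto
      finally show ?thesis .
    qed
    \<comment> \<open>\<open>c\<close> bounds the logarithm of the modulus at every dyadic time:
      \<open>K\<close> pays for a possible first step from 0 to 1, \<open>S\<close> for all finer
      levels. The lower bound \<open>exp (- c)\<close> on a dense set then passes to all times by
      continuity.\<close>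
    define c where "c = \<bar>f 0\<bar> + K + S"
    have dy: "exp (- c) \<le> norm (z + W (s * (1 + real (dyadic_floor n x) / 2 ^ n)) \<xi>)" if x: "0 \<le> x" "x \<le> 1" for n x
    proof -
      have 1: "norm (f (real (dyadic_floor (0 + n) x) / 2 ^ (0 + n)) - f (real (dyadic_floor 0 x) / 2 ^ 0)) \<le> S"
        by (rule order_trans[OF dyadic_chain[where m="\<lambda>i. K * r ^ i", OF m x] S])
      have "dyadic_floor 0 x = 0 \<or> dyadic_floor 0 x = 1"
        using dyadic_floor_le[OF x, of 0] by auto
      then have 2: "\<bar>f (real (dyadic_floor 0 x) / 2 ^ 0)\<bar> \<le> \<bar>f 0\<bar> + K"
        using m[of 0 0] K(1) by auto
      have "\<bar>f (real (dyadic_floor n x) / 2 ^ n)\<bar> \<le> c" using 1 2 by (simp add: c_def)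
      then have "- c \<le> f (real (dyadic_floor n x) / 2 ^ n)" by linarith
      moreover have "z + W (s * (1 + real (dyadic_floor n x) / 2 ^ n)) \<xi> \<noteq> 0"
        using elim(2) unfolding d_def by blast
      ultimately show ?thesis unfolding f_def by (simp add: ln_ge_iff)
    qed
    show ?case
    proof
      fix t assume t: "t \<in> {s..2 * s}"
      define x where "x = t / s - 1"
      have x: "0 \<le> x" "x \<le> 1" "s * (1 + x) = t" using s t by (auto simp: x_def field_simps)
      have "(\<lambda>n. norm (z + W (s * (1 + real (dyadic_floor n x) / 2 ^ n)) \<xi>)) \<longlonglongrightarrow> norm (z + W (s * (1 + x)) \<xi>)"
        by (intro tendsto_intros continuous_on_tendsto_compose[OF W_continuous] dyadic_floor_tendsto x) auto
      then have "exp (- c) \<le> norm (z + W (s * (1 + x)) \<xi>)"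
        by (rule LIMSEQ_le_const) (use dy[OF x(1,2)] in blast)
      then show "z + W t \<xi> \<noteq> 0" unfolding x(3) by (metis exp_gt_zero norm_zero not_less)
    qed
  qed
qed

lemma AE_start: "AE \<xi> in M. W 0 \<xi> = 0"
proof -
  have "(\<integral>\<^sup>+\<xi>. ennreal (\<bar>Re (W 0 \<xi>)\<bar>) \<partial>M) = 0" "(\<integral>\<^sup>+\<xi>. ennreal (\<bar>Im (W 0 \<xi>)\<bar>) \<partial>M) = 0"
    using scaled_normal_nn_integral[OF _ W_law(1)[of 0], of "\<lambda>x. ennreal \<bar>x\<bar>"]
      scaled_normal_nn_integral[OF _ W_law(2)[of 0], of "\<lambda>x. ennreal \<bar>x\<bar>"] by simp_all
  then have "AE \<xi> in M. ennreal (\<bar>Re (W 0 \<xi>)\<bar>) = 0" "AE \<xi> in M. ennreal (\<bar>Im (W 0 \<xi>)\<bar>) = 0"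
    by (simp_all add: nn_integral_0_iff_AE)
  then show ?thesis by eventually_elim (auto simp: complex_eq_iff)
qed

text \<open>The intervals \<open>{2 powi n..2 * 2 powi n}\<close> with integer \<open>n\<close>
  cover all positive times; at time 0, which they miss, the path equals \<open>z\<close>.\<close>

lemma AE_never_zero:
  assumes "z \<noteq> 0"
  shows "AE \<xi> in M. \<forall>t\<ge>0. z + W t \<xi> \<noteq> 0"
proof -
  have "AE \<xi> in M. \<forall>n::int. \<forall>t\<in>{2 powi n..2 * 2 powi n}. z + W t \<xi> \<noteq> 0"
    by (subst AE_all_countable) (auto intro!: AE_nonzero_interval)
  then show ?thesis using AE_start
  proof eventually_elim
    case (elim \<xi>)
    show ?case
    proof (intro allI impI)
      fix t :: real assume t: "t \<ge> 0"
      show "z + W t \<xi> \<noteq> 0"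
      proof (cases "t = 0")
        case False
        define n where "n = \<lfloor>log 2 t\<rfloor>"
        have n: "of_int n \<le> log 2 t" "log 2 t < of_int n + 1" unfolding n_def by linarith+
        have "2 powr (of_int n) \<le> 2 powr (log 2 t)" "2 powr (log 2 t) \<le> 2 powr (of_int n + 1)"
          using n by (auto intro!: powr_mono)
        then have "2 powi n \<le> t" "t \<le> 2 * 2 powi n"
          using False t by (auto simp: powr_add powr_real_of_int')
        then show ?thesis using elim(1) by auto
      qed (use elim(2) assms in auto)
    qed
  qed
qed

text \<open>Moments of order -1 and 1, weighted by the summable sequence \<open>e\<close>, confine
  the modulus at time \<open>2 ^ n\<close> to \<open>x n = (2 ^ n) powr H\<close> up to factors
  polynomial in \<open>n\<close>, whose logarithms disappear after division by
  \<open>n\<close>.\<close>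

lemma AE_log_modulus:
  assumes z: "z \<noteq> 0"
  shows "AE \<xi> in M. (\<lambda>n. ln (norm (z + W (2 ^ n) \<xi>)) / real n) \<longlonglongrightarrow> H * ln 2"
proof -
  obtain C1 where C1: "C1 \<ge> 0" "\<And>s z. s > 0 \<Longrightarrow> (\<integral>\<^sup>+\<xi>. ennreal (norm (z + W s \<xi>) powr (- 1)) \<partial>M) \<le> ennreal (C1 * s powr (- (H * 1)))"
    using negative_moment[of 1] by auto
  obtain C2 where C2: "C2 \<ge> 0" "\<And>s t. s \<ge> 0 \<Longrightarrow> t \<ge> 0 \<Longrightarrow>
      (\<integral>\<^sup>+\<xi>. ennreal (norm (W t \<xi> - W s \<xi>) powr 1) \<partial>M) \<le> ennreal (C2 * \<bar>t - s\<bar> powr (H * 1))"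
    using increment_moment[of 1] by auto
  define e where "e = (\<lambda>n. 1 / (real n + 1)\<^sup>2)"
  have e: "summable e" "\<And>n. 0 \<le> e n"
  proof -
    have "summable (\<lambda>n. 1 / (real (Suc n))\<^sup>2)"
      using inverse_power_summable[of 2, where 'a=real] by (subst summable_Suc_iff) (simp add: inverse_eq_divide)
    then show "summable e" by (simp add: e_def add.commute)
  qed (simp add: e_def)
  define x where "x = (\<lambda>n::nat. (2 ^ n) powr H)"
  have x: "x n > 0" for n by (simp add: x_def)
  have "AE \<xi> in M. \<exists>K\<ge>0. \<forall>n. e n * x n * norm (z + W (2 ^ n) \<xi>) powr (- 1) \<le> K"
  proof (rule AE_terms_bounded[where g="\<lambda>n. C1 * e n"])
    fix n
    have "(\<integral>\<^sup>+\<xi>. ennreal (e n * x n * norm (z + W (2 ^ n) \<xi>) powr (- 1)) \<partial>M)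
      = (\<integral>\<^sup>+\<xi>. ennreal (e n * x n) * ennreal (norm (z + W (2 ^ n) \<xi>) powr (- 1)) \<partial>M)"
      using e(2) less_imp_le[OF x] by (intro nn_integral_cong ennreal_mult) auto
    also have "\<dots> = ennreal (e n * x n) * (\<integral>\<^sup>+\<xi>. ennreal (norm (z + W (2 ^ n) \<xi>) powr (- 1)) \<partial>M)"
      by (rule nn_integral_cmult) measurable
    also have "\<dots> \<le> ennreal (e n * x n) * ennreal (C1 * (2 ^ n) powr (- (H * 1)))"
      by (intro mult_left_mono C1(2)) auto
    also have "\<dots> = ennreal ((e n * x n) * (C1 * (2 ^ n) powr (- (H * 1))))"
      using e(2) less_imp_le[OF x] C1(1) by (intro ennreal_mult[symmetric]) auto
    also have "(e n * x n) * (C1 * (2 ^ n) powr (- (H * 1))) = C1 * e n"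
      by (simp add: x_def powr_minus field_simps)
    finally show "(\<integral>\<^sup>+\<xi>. ennreal (e n * x n * norm (z + W (2 ^ n) \<xi>) powr (- 1)) \<partial>M) \<le> ennreal (C1 * e n)" .
  qed (use e C1 in \<open>auto intro!: summable_mult\<close>)
  moreover have "AE \<xi> in M. \<exists>K\<ge>0. \<forall>n. (e n / x n) * norm (W (2 ^ n) \<xi> - W 0 \<xi>) powr 1 \<le> K"
  proof (rule AE_terms_bounded[where g="\<lambda>n. C2 * e n"])
    fix n
    have ex: "0 \<le> e n / x n" using e x by (simp add: less_imp_le)
    have "(\<integral>\<^sup>+\<xi>. ennreal ((e n / x n) * norm (W (2 ^ n) \<xi> - W 0 \<xi>) powr 1) \<partial>M)
      = (\<integral>\<^sup>+\<xi>. ennreal (e n / x n) * ennreal (norm (W (2 ^ n) \<xi> - W 0 \<xi>) powr 1) \<partial>M)"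
      using ex by (intro nn_integral_cong ennreal_mult) auto
    also have "\<dots> = ennreal (e n / x n) * (\<integral>\<^sup>+\<xi>. ennreal (norm (W (2 ^ n) \<xi> - W 0 \<xi>) powr 1) \<partial>M)"
      by (rule nn_integral_cmult) measurable
    also have "\<dots> \<le> ennreal (e n / x n) * ennreal (C2 * \<bar>2 ^ n - 0\<bar> powr (H * 1))"
      by (intro mult_left_mono C2(2)) auto
    also have "\<dots> = ennreal ((e n / x n) * (C2 * \<bar>2 ^ n - 0\<bar> powr (H * 1)))"
      using ex C2(1) by (intro ennreal_mult[symmetric]) auto
    also have "(e n / x n) * (C2 * \<bar>2 ^ n - 0\<bar> powr (H * 1)) = C2 * e n"
      by (simp add: x_def)
    finally show "(\<integral>\<^sup>+\<xi>. ennreal ((e n / x n) * norm (W (2 ^ n) \<xi> - W 0 \<xi>) powr 1) \<partial>M) \<le> ennreal (C2 * e n)" .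
  qed (use e C2 in \<open>auto intro!: summable_mult\<close>)
  ultimately show ?thesis using AE_start AE_never_zero[OF z]
  proof eventually_elim
    case (elim \<xi>)
    obtain K1 where K1: "K1 \<ge> 0" "\<And>n. e n * x n * norm (z + W (2 ^ n) \<xi>) powr (- 1) \<le> K1" using elim(1) by blast
    obtain K2 where K2: "K2 \<ge> 0" "\<And>n. (e n / x n) * norm (W (2 ^ n) \<xi> - W 0 \<xi>) powr 1 \<le> K2" using elim(2) by blast
    let ?N = "\<lambda>n::nat. norm (z + W (2 ^ n) \<xi>)"
    have N: "?N n > 0" for n using elim(4) by simp
    have lnx: "ln (x n) = real n * (H * ln 2)" for n
      by (simp add: x_def ln_powr ln_realpow)
    have x1: "x n \<ge> 1" for n unfolding x_def using H_gt by (intro ge_one_powr_ge_zero) auto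
    have lower: "real n * (H * ln 2) - ln (K1 + 1) - 2 * ln (real n + 1) \<le> ln (?N n)" for n
    proof -
      have "x n \<le> ((K1 + 1) * (real n + 1)\<^sup>2) * ?N n"
      proof -
        have "e n * x n / ?N n \<le> K1 + 1" using K1(2)[of n] N[of n] by (simp add: powr_minus divide_inverse)
        then show ?thesis using N[of n] by (simp add: e_def field_simps)
      qed
      then have "ln (x n) \<le> ln (((K1 + 1) * (real n + 1)\<^sup>2) * ?N n)" using x by (subst ln_le_cancel_iff) (auto intro!: mult_pos_pos N simp: K1(1) add_nonneg_pos)
      also have "\<dots> = ln (K1 + 1) + 2 * ln (real n + 1) + ln (?N n)"
        using N[of n] K1(1) by (simp add: ln_mult ln_realpow add_nonneg_pos)
      finally show ?thesis unfolding lnx by simp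
    qed
    have upper: "ln (?N n) \<le> real n * (H * ln 2) + ln (norm z + K2 + 1) + 2 * ln (real n + 1)" for n
    proof -
      have "norm (W (2 ^ n) \<xi>) \<le> K2 * (real n + 1)\<^sup>2 * x n"
        using K2(2)[of n] x[of n] elim(3) by (simp add: e_def field_simps)
      moreover have "norm z \<le> norm z * ((real n + 1)\<^sup>2 * x n)"
      proof -
        have "1 * 1 \<le> (real n + 1)\<^sup>2 * x n" by (intro mult_mono x1) auto
        then show ?thesis by (simp add: mult_le_cancel_left1)
      qed
      moreover have "0 \<le> (real n + 1)\<^sup>2 * x n" using x[of n] by simp
      ultimately have "?N n \<le> (norm z + K2 + 1) * (real n + 1)\<^sup>2 * x n"
        using norm_triangle_ineq[of z "W (2 ^ n) \<xi>"] by (simp add: algebra_simps)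
      then have "ln (?N n) \<le> ln ((norm z + K2 + 1) * (real n + 1)\<^sup>2 * x n)"
        using N[of n] by (subst ln_le_cancel_iff) (auto intro!: mult_pos_pos x simp: K2(1) add_nonneg_pos)
      also have "\<dots> = ln (norm z + K2 + 1) + 2 * ln (real n + 1) + ln (x n)"
      proof -
        have "norm z + K2 + 1 > 0" using K2(1) by (intro add_nonneg_pos) auto
        then show ?thesis using x[of n] by (simp add: ln_mult ln_realpow)
      qed
      finally show ?thesis unfolding lnx by simp
    qed
    have lim: "(\<lambda>n. (c + 2 * ln (real n + 1)) / real n) \<longlonglongrightarrow> 0" for c by real_asymp
    show ?case
    proof (rule tendsto_sandwich[where f="\<lambda>n. H * ln 2 - (ln (K1 + 1) + 2 * ln (real n + 1)) / real n"
          and h="\<lambda>n. H * ln 2 + (ln (norm z + K2 + 1) + 2 * ln (real n + 1)) / real n"])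
      show "\<forall>\<^sub>F n in sequentially. H * ln 2 - (ln (K1 + 1) + 2 * ln (real n + 1)) / real n \<le> ln (?N n) / real n"
        using eventually_gt_at_top[of 0]
      proof eventually_elim
        case (elim n)
        then show ?case using divide_right_mono[OF lower[of n], of "real n"]
          by (simp add: diff_divide_distrib add_divide_distrib algebra_simps)
      qed
      show "\<forall>\<^sub>F n in sequentially. ln (?N n) / real n \<le> H * ln 2 + (ln (norm z + K2 + 1) + 2 * ln (real n + 1)) / real n"
        using eventually_gt_at_top[of 0]
      proof eventually_elim
        case (elim n)
        then show ?case using divide_right_mono[OF upper[of n], of "real n"]
          by (simp add: diff_divide_distrib add_divide_distrib algebra_simps)
      qed
      show "(\<lambda>n. H * ln 2 - (ln (K1 + 1) + 2 * ln (real n + 1)) / real n) \<longlonglongrightarrow> H * ln 2"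
        using tendsto_diff[OF tendsto_const lim] by simp
      show "(\<lambda>n. H * ln 2 + (ln (norm z + K2 + 1) + 2 * ln (real n + 1)) / real n) \<longlonglongrightarrow> H * ln 2"
        using tendsto_add[OF tendsto_const lim] by simp
    qed
  qed
qed

end

section \<open>Dyadic blocks\<close>

text \<open>\<open>2 ^ level n\<close> is \<open>(n + 1) powr (1 / 16)\<close> up to a factor 2.
  With 1/16 its fourth power, which is what double sums of covariances cost, stays below
  \<open>(n + 1) powr (1 / 4)\<close>, while a gain \<open>2 powr (- c * level n)\<close> remains a
  negative power of \<open>n\<close>.\<close>

definition level :: "nat \<Rightarrow> nat" where
  "level n = nat \<lfloor>log 2 (real n + 1) / 16\<rfloor>"

lemma level_le: "2 ^ level n \<le> (real n + 1) powr (1 / 16)"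
  and level_ge: "(real n + 1) powr (1 / 16) \<le> 2 * 2 ^ level n"
proof -
  have "0 \<le> log 2 (real n + 1)" by simp
  then have l: "real (level n) \<le> log 2 (real n + 1) / 16" "log 2 (real n + 1) / 16 \<le> real (level n) + 1"
    unfolding level_def by linarith+
  have e: "2 powr (log 2 (real n + 1) / 16) = (real n + 1) powr (1 / 16)"
    by (simp add: powr_def log_def)
  have "2 powr real (level n) \<le> 2 powr (log 2 (real n + 1) / 16)" using l by (intro powr_mono) auto
  then show "2 ^ level n \<le> (real n + 1) powr (1 / 16)" unfolding e by (simp add: powr_realpow)
  have "2 powr (log 2 (real n + 1) / 16) \<le> 2 powr (real (level n) + 1)" using l by (intro powr_mono) auto
  then show "(real n + 1) powr (1 / 16) \<le> 2 * 2 ^ level n" unfolding e by (simp add: powr_realpow powr_add)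
qed

lemma level_decay:
  assumes "c \<ge> 0"
  shows "2 powr (- c * real (level n)) \<le> 2 powr c * (real n + 1) powr (- c / 16)"
proof -
  have "((real n + 1) powr (1 / 16)) powr c \<le> (2 * 2 ^ level n) powr c"
    using assms level_ge by (intro powr_mono2) auto
  also have "\<dots> = 2 powr c * 2 powr (c * real (level n))"
    by (simp add: powr_mult powr_realpow[symmetric] powr_powr mult.commute)
  finally have "(real n + 1) powr (c / 16) \<le> 2 powr c * 2 powr (c * real (level n))" by (simp add: powr_powr)
  then show ?thesis by (simp add: powr_minus field_simps)
qed

lemma summable_shifted_powr:
  assumes "c > 0"
  shows "summable (\<lambda>n. (real n + 1) powr (- 1 - c))"
proof -
  have "summable (\<lambda>n. real (Suc n) powr (- 1 - c))"
    using assms by (subst summable_Suc_iff) (simp add: summable_real_powr_iff)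
  then show ?thesis by (simp add: add.commute)
qed

text \<open>Interpolates between the Lipschitz bound \<open>norm (y - x) / (norm x * norm y)\<close>
  and the trivial bound by the two reciprocals. The former alone would call for a negative moment of
  order 2; here only the order \<open>p < 2\<close> occurs, at the cost of the smaller power
  \<open>p - 1\<close> of the increment.\<close>

lemma inverse_difference_bound:
  fixes x y :: complex
  assumes nz: "x \<noteq> 0" "y \<noteq> 0" and p: "1 < p" "p < 2"
  shows "norm (1 / y - 1 / x) \<le> 2 * norm (y - x) powr (p - 1) * (norm x powr (- p) + norm y powr (- p))"
proof -
  have main: "norm (1 / y - 1 / x) \<le> 2 * norm (y - x) powr (p - 1) * norm x powr (- p)"
    if nz: "x \<noteq> 0" "y \<noteq> 0" and le: "norm x \<le> norm y" for x y :: complex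
  proof (cases "x = y")
    case False
    then have d: "norm (y - x) > 0" by simp
    have xy: "norm x > 0" "norm y > 0" using nz by auto
    \<comment> \<open>The surplus power \<open>2 - p\<close> of the difference is traded for a power
      of the larger modulus \<open>norm y\<close>; the exponent \<open>1 - p\<close> that remains on
      \<open>norm y\<close> is negative, so \<open>norm x\<close> may take its place.\<close>
    have "norm (y - x) \<le> 2 * norm y" using norm_triangle_ineq4[of y x] le by simp
    then have "norm (y - x) powr (2 - p) \<le> (2 * norm y) powr (2 - p)" using p by (intro powr_mono2) auto
    also have "\<dots> \<le> 2 * norm y powr (2 - p)"
    proof -
      have "(2::real) powr (2 - p) \<le> 2 powr 1" using p by (intro powr_mono) auto
      then show ?thesis by (simp add: powr_mult mult_right_mono)
    qed
    finally have a: "norm (y - x) powr (2 - p) \<le> 2 * norm y powr (2 - p)" .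
    have "norm (1 / y - 1 / x) = norm (y - x) / (norm x * norm y)"
    proof -
      have "1 / y - 1 / x = (x - y) / (x * y)" using nz by (simp add: field_simps)
      then show ?thesis by (simp add: norm_divide norm_mult norm_minus_commute)
    qed
    also have "norm (y - x) = norm (y - x) powr (p - 1) * norm (y - x) powr (2 - p)"
      using d by (simp add: powr_add[symmetric])
    also have "norm (y - x) powr (p - 1) * norm (y - x) powr (2 - p) / (norm x * norm y)
      \<le> norm (y - x) powr (p - 1) * (2 * norm y powr (2 - p)) / (norm x * norm y)"
      using a by (intro divide_right_mono mult_left_mono) auto
    also have "\<dots> = 2 * norm (y - x) powr (p - 1) * (norm y powr (1 - p) / norm x)"
      using xy by (simp add: powr_diff field_simps power2_eq_square)
    also have "\<dots> \<le> 2 * norm (y - x) powr (p - 1) * (norm x powr (1 - p) / norm x)"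
      using xy le p by (intro mult_left_mono divide_right_mono powr_mono2') auto
    also have "norm x powr (1 - p) / norm x = norm x powr (- p)"
      using xy by (simp add: powr_diff powr_minus_divide)
    finally show ?thesis .
  qed simp
  show ?thesis
  proof (cases "norm x \<le> norm y")
    case True
    have "2 * norm (y - x) powr (p - 1) * norm x powr (- p)
        \<le> 2 * norm (y - x) powr (p - 1) * (norm x powr (- p) + norm y powr (- p))"
      by (intro mult_left_mono) auto
    then show ?thesis using main[OF nz True] by linarith
  next
    case False
    then have "norm y \<le> norm x" by simp
    have "2 * norm (y - x) powr (p - 1) * norm y powr (- p)
        \<le> 2 * norm (y - x) powr (p - 1) * (norm x powr (- p) + norm y powr (- p))"
      by (intro mult_left_mono) auto
    then show ?thesis using main[OF nz(2,1) \<open>norm y \<le> norm x\<close>] by (simp add: norm_minus_commute)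
  qed
qed

lemma truncate_powr:
  fixes x c p :: real
  assumes "x \<ge> 0" "c > 0" "p > 1"
  shows "x \<le> c + c powr (1 - p) * x powr p"
proof (cases "x \<le> c")
  case False
  then have "x = x powr (1 - p) * x powr p" using assms by (simp add: powr_add[symmetric])
  also have "\<dots> \<le> c powr (1 - p) * x powr p" using False assms by (intro mult_right_mono powr_mono2') auto
  finally show ?thesis using assms by simp
qed (use assms in \<open>simp add: add_increasing2\<close>)

context centred_fbm
begin

section \<open>Moments of increments and defects along the path\<close>

definition traj :: "complex \<Rightarrow> 'a \<Rightarrow> real \<Rightarrow> complex" where
  "traj z \<xi> t = z + W t \<xi>"

lemma traj_measurable[measurable]: "(\<lambda>\<xi>. traj z \<xi> t) \<in> borel_measurable M"
  unfolding traj_def by measurable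

lemma traj_diff: "traj z \<xi> v - traj z \<xi> u = W v \<xi> - W u \<xi>"
  by (simp add: traj_def)

lemma incr_measurable[measurable]: "(\<lambda>\<xi>. incr (traj z \<xi>) u v) \<in> borel_measurable M"
  unfolding incr_def by measurable

lemma defect_measurable[measurable]: "(\<lambda>\<xi>. defect (traj z \<xi>) u m v) \<in> borel_measurable M"
  unfolding defect_def by measurable

lemma total_defect_measurable[measurable]: "(\<lambda>\<xi>. total_defect (traj z \<xi>) s h) \<in> borel_measurable M"
  unfolding total_defect_def by measurable

lemma incr_moment:
  "\<exists>C\<ge>0. \<forall>s>0. \<forall>u\<ge>s. \<forall>v\<ge>s. \<forall>z. (\<integral>\<^sup>+\<xi>. ennreal (norm (incr (traj z \<xi>) u v) powr q) \<partial>M) \<le> ennreal (C * (\<bar>v - u\<bar> / s) powr (q * H))"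
proof -
  obtain C where C: "C \<ge> 0" "\<And>u v w s z. 0 \<le> u \<Longrightarrow> 0 \<le> v \<Longrightarrow> 0 < w \<Longrightarrow> 0 < s \<Longrightarrow> s \<le> w \<Longrightarrow>
    (\<integral>\<^sup>+\<xi>. ennreal (norm (W v \<xi> - W u \<xi>) powr q * norm (z + W w \<xi>) powr (- q)) \<partial>M)
      \<le> ennreal (C * (\<bar>v - u\<bar> / s) powr (q * H))"
    using increment_over_path_moment by meson
  show ?thesis
  proof (intro exI[of _ C] conjI allI impI C(1))
    fix s u v :: real and z assume h: "0 < s" "s \<le> u" "s \<le> v"
    have e: "norm (incr (traj z \<xi>) u v) powr q = norm (W v \<xi> - W u \<xi>) powr q * norm (z + W u \<xi>) powr (- q)" for \<xi>
      unfolding incr_def traj_diff by (simp add: traj_def norm_divide powr_divide powr_minus_divide)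
    show "(\<integral>\<^sup>+\<xi>. ennreal (norm (incr (traj z \<xi>) u v) powr q) \<partial>M) \<le> ennreal (C * (\<bar>v - u\<bar> / s) powr (q * H))"
      unfolding e using h by (intro C(2)) auto
  qed
qed

text \<open>A defect is an increment times a difference of reciprocals.
  \<open>inverse_difference_bound\<close> with \<open>p = q\<close> makes it homogeneous of degree
  \<open>q\<close> in the increments and \<open>- q\<close> in the path, the balance for which
  \<open>increment_over_path_moment\<close> is scale free.\<close>

lemma defect_moment:
  "\<exists>C\<ge>0. \<forall>s>0. \<forall>h\<ge>0. \<forall>u\<ge>s. \<forall>z.
     (\<integral>\<^sup>+\<xi>. ennreal (norm (defect (traj z \<xi>) u (u + h) (u + 2 * h))) \<partial>M) \<le> ennreal (C * (h / s) powr (q * H))"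
proof -
  obtain C where C: "C \<ge> 0" "\<And>u v w s z. 0 \<le> u \<Longrightarrow> 0 \<le> v \<Longrightarrow> 0 < w \<Longrightarrow> 0 < s \<Longrightarrow> s \<le> w \<Longrightarrow>
    (\<integral>\<^sup>+\<xi>. ennreal (norm (W v \<xi> - W u \<xi>) powr q * norm (z + W w \<xi>) powr (- q)) \<partial>M)
      \<le> ennreal (C * (\<bar>v - u\<bar> / s) powr (q * H))"
    using increment_over_path_moment by meson
  show ?thesis
  \<comment> \<open>The 8 is a factor 2 from \<open>inverse_difference_bound\<close> times the four
    pairs of an increment and a base value.\<close>
  proof (intro exI[of _ "8 * C"] conjI allI impI)
    fix s h u :: real and z assume h: "0 < s" "0 \<le> h" "s \<le> u"
    define m v where "m = u + h" and "v = u + 2 * h"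
    have pos: "u > 0" "m > 0" "v > 0" "s \<le> m" using h by (auto simp: m_def v_def)
    let ?f = "\<lambda>x y w \<xi>. ennreal (norm (W y \<xi> - W x \<xi>) powr q * norm (z + W w \<xi>) powr (- q))"
    have d: "(\<integral>\<^sup>+\<xi>. ?f x y w \<xi> \<partial>M) \<le> ennreal (C * (h / s) powr (q * H))" if "x \<ge> 0" "y \<ge> 0" "w \<ge> s" "y - x = h" for x y w
    proof -
      have "\<bar>y - x\<bar> = h" using that h by simp
      then show ?thesis using C(2)[of x y w s z] that h by simp
    qed
    have AEle: "AE \<xi> in M. ennreal (norm (defect (traj z \<xi>) u m v))
       \<le> 2 * (?f m v u \<xi> + ?f m v m \<xi> + (?f u m u \<xi> + ?f u m m \<xi>))"
      using AE_nonzero[OF pos(1), of z] AE_nonzero[OF pos(2), of z]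
    proof eventually_elim
      case (elim \<xi>)
      define a where "a = norm (W v \<xi> - W m \<xi>)"
      define d where "d = norm (W m \<xi> - W u \<xi>)"
      define x where "x = norm (z + W u \<xi>) powr (- q)"
      define y where "y = norm (z + W m \<xi>) powr (- q)"
      have "norm (defect (traj z \<xi>) u m v) \<le> a * (2 * d powr (q - 1) * (x + y))"
        unfolding defect_def traj_diff norm_mult a_def d_def x_def y_def
        using inverse_difference_bound[OF elim(1,2) q_bounds(1,2)]
        by (intro mult_left_mono) (auto simp: traj_def)
      also have "\<dots> = 2 * ((a * d powr (q - 1)) * (x + y))" by simp
      also have "\<dots> \<le> 2 * ((a powr q + d powr q) * (x + y))"
      proof (intro mult_left_mono mult_right_mono)
        \<comment> \<open>Comparing the two increments separates them, so that each moment to be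
          bounded involves one increment and one base value.\<close>
        show "a * d powr (q - 1) \<le> a powr q + d powr q"
        proof (cases "a \<le> d")
          case True
          have "a * d powr (q - 1) \<le> d * d powr (q - 1)" using True by (intro mult_right_mono) auto
          also have "\<dots> = d powr q" using q_bounds by (cases "d = 0") (auto simp: powr_diff d_def)
          finally show ?thesis by (simp add: add_increasing)
        next
          case False
          then have "a * d powr (q - 1) \<le> a * a powr (q - 1)" using q_bounds
            by (intro mult_left_mono powr_mono2) (auto simp: a_def d_def)
          also have "\<dots> = a powr q" using q_bounds by (cases "a = 0") (auto simp: powr_diff a_def)
          finally show ?thesis by (simp add: add_increasing2)
        qed
      qed (auto simp: x_def y_def)
      also have "\<dots> = 2 * ((a powr q * x + a powr q * y) + (d powr q * x + d powr q * y))"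
        by (simp add: algebra_simps)
      finally have "norm (defect (traj z \<xi>) u m v) \<le> 2 * ((a powr q * x + a powr q * y) + (d powr q * x + d powr q * y))" .
      then have "ennreal (norm (defect (traj z \<xi>) u m v)) \<le> ennreal (2 * ((a powr q * x + a powr q * y) + (d powr q * x + d powr q * y)))"
        by (rule ennreal_leI)
      also have "\<dots> = 2 * (?f m v u \<xi> + ?f m v m \<xi> + (?f u m u \<xi> + ?f u m m \<xi>))"
        unfolding a_def d_def x_def y_def by (simp add: ennreal_mult ennreal_plus)
      finally show ?case .
    qed
    have "(\<integral>\<^sup>+\<xi>. ennreal (norm (defect (traj z \<xi>) u m v)) \<partial>M)
      \<le> (\<integral>\<^sup>+\<xi>. 2 * (?f m v u \<xi> + ?f m v m \<xi> + (?f u m u \<xi> + ?f u m m \<xi>)) \<partial>M)"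
      by (rule nn_integral_mono_AE[OF AEle])
    also have "\<dots> = 2 * ((\<integral>\<^sup>+\<xi>. ?f m v u \<xi> \<partial>M) + (\<integral>\<^sup>+\<xi>. ?f m v m \<xi> \<partial>M) + ((\<integral>\<^sup>+\<xi>. ?f u m u \<xi> \<partial>M) + (\<integral>\<^sup>+\<xi>. ?f u m m \<xi> \<partial>M)))"
      by (simp add: nn_integral_cmult nn_integral_add)
    also have "\<dots> \<le> 2 * (ennreal (C * (h / s) powr (q * H)) + ennreal (C * (h / s) powr (q * H))
         + (ennreal (C * (h / s) powr (q * H)) + ennreal (C * (h / s) powr (q * H))))"
      using h pos by (intro mult_left_mono add_mono d) (auto simp: m_def v_def)
    also have "\<dots> = ennreal (8 * C * (h / s) powr (q * H))"
    proof -
      have c0: "0 \<le> C * (h / s) powr (q * H)" using C(1) by simp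
      have "ennreal (8 * C * (h / s) powr (q * H)) = ennreal (2 * ((C * (h / s) powr (q * H) + C * (h / s) powr (q * H))
          + (C * (h / s) powr (q * H) + C * (h / s) powr (q * H))))" by (rule arg_cong[where f=ennreal]) simp
      also have "\<dots> = 2 * (ennreal (C * (h / s) powr (q * H)) + ennreal (C * (h / s) powr (q * H))
         + (ennreal (C * (h / s) powr (q * H)) + ennreal (C * (h / s) powr (q * H))))"
        using c0 by (simp only: ennreal_mult ennreal_plus add_nonneg_nonneg zero_le_numeral ennreal_numeral)
      finally show ?thesis by simp
    qed
    finally show "(\<integral>\<^sup>+\<xi>. ennreal (norm (defect (traj z \<xi>) u (u + h) (u + 2 * h))) \<partial>M) \<le> ennreal (8 * C * (h / s) powr (q * H))"
      unfolding m_def v_def .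
  qed (use C in auto)
qed

text \<open>Level \<open>j\<close> of the bisection has \<open>2 ^ j\<close> defects, each of order
  \<open>2 powr (- (q * H) * j)\<close> relative to the whole cell; as \<open>q * H > 1\<close>, the
  levels form a geometric series.\<close>

lemma total_defect_moment:
  "\<exists>C\<ge>0. \<forall>s>0. \<forall>h\<ge>0. \<forall>u\<ge>s. \<forall>z. (\<integral>\<^sup>+\<xi>. total_defect (traj z \<xi>) u h \<partial>M) \<le> ennreal (C * (h / s) powr (q * H))"
proof -
  obtain C where C: "C \<ge> 0" "\<And>s h u z. 0 < s \<Longrightarrow> 0 \<le> h \<Longrightarrow> s \<le> u \<Longrightarrow>
     (\<integral>\<^sup>+\<xi>. ennreal (norm (defect (traj z \<xi>) u (u + h) (u + 2 * h))) \<partial>M) \<le> ennreal (C * (h / s) powr (q * H))"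
    using defect_moment by meson
  define r where "r = (2::real) powr (1 - q * H)"
  have r: "0 < r" "r < 1" using q_bounds by (auto simp: r_def powr_less_one)
  have sm: "summable (\<lambda>j. r ^ j)" using r by (intro summable_geometric) auto
  show ?thesis
  proof (intro exI[of _ "C * suminf (\<lambda>j. r ^ j)"] conjI allI impI)
    fix s h u :: real and z assume h: "0 < s" "0 \<le> h" "s \<le> u"
    have piece: "(\<integral>\<^sup>+\<xi>. ennreal (norm (defect (traj z \<xi>) (u + h * real (2 * k) / 2 ^ Suc j)
      (u + h * real (2 * k + 1) / 2 ^ Suc j) (u + h * real (2 * k + 2) / 2 ^ Suc j))) \<partial>M)
      \<le> ennreal (C * (h / 2 ^ Suc j / s) powr (q * H))" for j k
    proof -
      define x where "x = u + h * real (2 * k) / 2 ^ Suc j"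
      have "u + h * real (2 * k + 1) / 2 ^ Suc j = x + h / 2 ^ Suc j"
        "u + h * real (2 * k + 2) / 2 ^ Suc j = x + 2 * (h / 2 ^ Suc j)"
        by (simp_all add: x_def field_simps)
      moreover have "s \<le> x"
      proof -
        have "0 \<le> h * real (2 * k) / 2 ^ Suc j" using h by (intro divide_nonneg_nonneg mult_nonneg_nonneg) auto
        then show ?thesis using h unfolding x_def by linarith
      qed
      ultimately show ?thesis using C(2)[of s "h / 2 ^ Suc j" x z] h unfolding x_def[symmetric] by simp
    qed
    have "(\<integral>\<^sup>+\<xi>. total_defect (traj z \<xi>) u h \<partial>M) = (\<Sum>j. \<Sum>k<2 ^ j. \<integral>\<^sup>+\<xi>. ennreal (norm (defect (traj z \<xi>) (u + h * real (2 * k) / 2 ^ Suc j)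
      (u + h * real (2 * k + 1) / 2 ^ Suc j) (u + h * real (2 * k + 2) / 2 ^ Suc j))) \<partial>M)"
      unfolding total_defect_def by (subst nn_integral_suminf, measurable, subst nn_integral_sum) auto
    also have "\<dots> \<le> (\<Sum>j. \<Sum>k<(2::nat) ^ j. ennreal (C * (h / 2 ^ Suc j / s) powr (q * H)))"
      by (intro suminf_le sum_mono piece) auto
    also have "\<dots> \<le> (\<Sum>j. ennreal ((C * (h / s) powr (q * H)) * r ^ j))"
    proof (intro suminf_le)
      fix j :: nat
      have "(\<Sum>k<(2::nat) ^ j. ennreal (C * (h / 2 ^ Suc j / s) powr (q * H))) = ennreal (2 ^ j * (C * (h / 2 ^ Suc j / s) powr (q * H)))"
        using C(1) by (simp add: ennreal_mult ennreal_power[symmetric])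
      also have "\<dots> \<le> ennreal ((C * (h / s) powr (q * H)) * r ^ j)"
      proof (rule ennreal_leI)
        have "(h / 2 ^ Suc j / s) powr (q * H) \<le> (h / 2 ^ j / s) powr (q * H)"
          using h q_bounds by (intro powr_mono2 divide_right_mono divide_left_mono) auto
        also have "\<dots> = (h / s * 2 powr (- real j)) powr (q * H)" by (simp add: powr_minus_divide powr_realpow mult.commute)
        also have "\<dots> = (h / s) powr (q * H) * 2 powr (- (q * H) * real j)" by (simp only: powr_mult powr_powr) (simp add: mult.commute)
        finally have "2 ^ j * (C * (h / 2 ^ Suc j / s) powr (q * H)) \<le> 2 ^ j * (C * ((h / s) powr (q * H) * 2 powr (- (q * H) * real j)))"
          using C(1) by (intro mult_left_mono) auto
        also have "\<dots> = (C * (h / s) powr (q * H)) * (2 powr real j * 2 powr (- (q * H) * real j))"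
          by (simp add: powr_realpow)
        also have "2 powr real j * 2 powr (- (q * H) * real j) = r ^ j"
          unfolding r_def powr_add[symmetric] by (subst powr_realpow[symmetric]) (simp_all add: powr_powr algebra_simps)
        finally show "2 ^ j * (C * (h / 2 ^ Suc j / s) powr (q * H)) \<le> (C * (h / s) powr (q * H)) * r ^ j" .
      qed
      finally show "(\<Sum>k<(2::nat) ^ j. ennreal (C * (h / 2 ^ Suc j / s) powr (q * H))) \<le> ennreal ((C * (h / s) powr (q * H)) * r ^ j)" .
    qed auto
    also have "\<dots> = ennreal (\<Sum>j. (C * (h / s) powr (q * H)) * r ^ j)"
      using sm C(1) r by (intro suminf_ennreal2 summable_mult) auto
    also have "(\<Sum>j. (C * (h / s) powr (q * H)) * r ^ j) = (C * (h / s) powr (q * H)) * suminf (\<lambda>j. r ^ j)"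
      by (rule suminf_mult[OF sm])
    finally show "(\<integral>\<^sup>+\<xi>. total_defect (traj z \<xi>) u h \<partial>M) \<le> ennreal (C * suminf (\<lambda>j. r ^ j) * (h / s) powr (q * H))"
      by (simp add: mult_ac)
  qed (use C r sm in \<open>auto intro!: mult_nonneg_nonneg suminf_nonneg\<close>)
qed

section \<open>Grids on a block and the modulus built from them\<close>

definition grid :: "nat \<Rightarrow> nat \<Rightarrow> nat \<Rightarrow> real" where
  "grid n i k = 2 ^ n + 2 ^ n * real k / 2 ^ i"

lemma grid_ge: "grid n i k \<ge> 2 ^ n" and grid_pos: "grid n i k > 0"
  and grid_step: "grid n i (Suc k) = grid n i k + 2 ^ n / 2 ^ i"
proof -
  show "grid n i k \<ge> 2 ^ n" by (simp add: grid_def)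
  then show "grid n i k > 0" by (rule less_le_trans[rotated]) simp
  show "grid n i (Suc k) = grid n i k + 2 ^ n / 2 ^ i" by (simp add: grid_def field_simps)
qed

definition q_variation :: "complex \<Rightarrow> nat \<Rightarrow> nat \<Rightarrow> 'a \<Rightarrow> ennreal" where
  "q_variation z n i \<xi> = (\<Sum>k<2 ^ i. ennreal (norm (incr (traj z \<xi>) (grid n i k) (grid n i (Suc k))) powr q))"

definition defect_sum :: "complex \<Rightarrow> nat \<Rightarrow> nat \<Rightarrow> 'a \<Rightarrow> ennreal" where
  "defect_sum z n i \<xi> = (\<Sum>k<2 ^ i. total_defect (traj z \<xi>) (grid n i k) (2 ^ n / 2 ^ i))"

lemma q_variation_measurable[measurable]: "q_variation z n i \<in> borel_measurable M"
  and defect_sum_measurable[measurable]: "defect_sum z n i \<in> borel_measurable M"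
  unfolding q_variation_def[abs_def] defect_sum_def[abs_def] by measurable

definition excess :: real where "excess = q * H - 1"

lemma excess_pos: "excess > 0" using q_bounds by (simp add: excess_def)

lemma block_sum_bound:
  assumes "C \<ge> 0"
  shows "(\<Sum>k<(2::nat) ^ i. ennreal (C * (2 ^ n / 2 ^ i / 2 ^ n) powr (q * H))) = ennreal (C * 2 powr (- excess * real i))"
proof -
  have e: "(2 ^ n / 2 ^ i / 2 ^ n :: real) = 2 powr (- real i)" by (simp add: powr_minus_divide powr_realpow)
  have "(\<Sum>k<(2::nat) ^ i. ennreal (C * (2 powr (- real i)) powr (q * H))) = ennreal (2 ^ i * (C * (2 powr (- real i)) powr (q * H)))"
    using assms by (simp add: ennreal_mult ennreal_power[symmetric])
  also have "2 ^ i * (C * (2 powr (- real i)) powr (q * H)) = C * (2 powr real i * 2 powr (- real i * (q * H)))"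
    by (simp add: powr_realpow powr_powr)
  also have "2 powr real i * 2 powr (- real i * (q * H)) = 2 powr (- excess * real i)"
    unfolding powr_add[symmetric] by (simp add: excess_def algebra_simps)
  finally show ?thesis unfolding e .
qed

text \<open>The grid step of block \<open>n\<close> relative to its starting time is
  \<open>2 powr (- i)\<close> whatever \<open>n\<close> is, so the bounds do not depend on the
  block.\<close>

lemma block_moments:
  "\<exists>C\<ge>0. \<forall>z n i. (\<integral>\<^sup>+\<xi>. q_variation z n i \<xi> \<partial>M) \<le> ennreal (C * 2 powr (- excess * real i))
     \<and> (\<integral>\<^sup>+\<xi>. defect_sum z n i \<xi> \<partial>M) \<le> ennreal (C * 2 powr (- excess * real i))"
proof -
  obtain C1 where C1: "C1 \<ge> 0" "\<And>s u v z. 0 < s \<Longrightarrow> s \<le> u \<Longrightarrow> s \<le> v \<Longrightarrow>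
    (\<integral>\<^sup>+\<xi>. ennreal (norm (incr (traj z \<xi>) u v) powr q) \<partial>M) \<le> ennreal (C1 * (\<bar>v - u\<bar> / s) powr (q * H))"
    using incr_moment by meson
  obtain C2 where C2: "C2 \<ge> 0" "\<And>s h u z. 0 < s \<Longrightarrow> 0 \<le> h \<Longrightarrow> s \<le> u \<Longrightarrow>
    (\<integral>\<^sup>+\<xi>. total_defect (traj z \<xi>) u h \<partial>M) \<le> ennreal (C2 * (h / s) powr (q * H))"
    using total_defect_moment by meson
  show ?thesis
  proof (intro exI[of _ "C1 + C2"] conjI allI)
    fix z n i
    have "(\<integral>\<^sup>+\<xi>. q_variation z n i \<xi> \<partial>M) = (\<Sum>k<2 ^ i. \<integral>\<^sup>+\<xi>. ennreal (norm (incr (traj z \<xi>) (grid n i k) (grid n i (Suc k))) powr q) \<partial>M)"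
      unfolding q_variation_def by (rule nn_integral_sum) measurable
    also have "\<dots> \<le> (\<Sum>k<(2::nat) ^ i. ennreal (C1 * (2 ^ n / 2 ^ i / 2 ^ n) powr (q * H)))"
    proof (intro sum_mono)
      fix k
      have "\<bar>grid n i (Suc k) - grid n i k\<bar> = 2 ^ n / 2 ^ i" by (simp add: grid_step)
      then show "(\<integral>\<^sup>+\<xi>. ennreal (norm (incr (traj z \<xi>) (grid n i k) (grid n i (Suc k))) powr q) \<partial>M)
         \<le> ennreal (C1 * (2 ^ n / 2 ^ i / 2 ^ n) powr (q * H))"
        using C1(2)[of "2 ^ n" "grid n i k" "grid n i (Suc k)" z] grid_ge by simp
    qed
    also have "\<dots> \<le> ennreal ((C1 + C2) * 2 powr (- excess * real i))"
      unfolding block_sum_bound[OF C1(1)] using C2(1) by (intro ennreal_leI mult_right_mono) auto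
    finally show "(\<integral>\<^sup>+\<xi>. q_variation z n i \<xi> \<partial>M) \<le> ennreal ((C1 + C2) * 2 powr (- excess * real i))" .
    have "(\<integral>\<^sup>+\<xi>. defect_sum z n i \<xi> \<partial>M) = (\<Sum>k<2 ^ i. \<integral>\<^sup>+\<xi>. total_defect (traj z \<xi>) (grid n i k) (2 ^ n / 2 ^ i) \<partial>M)"
      unfolding defect_sum_def by (rule nn_integral_sum) measurable
    also have "\<dots> \<le> (\<Sum>k<(2::nat) ^ i. ennreal (C2 * (2 ^ n / 2 ^ i / 2 ^ n) powr (q * H)))"
      by (intro sum_mono C2(2)) (auto simp: grid_ge)
    also have "\<dots> \<le> ennreal ((C1 + C2) * 2 powr (- excess * real i))"
      unfolding block_sum_bound[OF C2(1)] using C1(1) by (intro ennreal_leI mult_right_mono) auto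
    finally show "(\<integral>\<^sup>+\<xi>. defect_sum z n i \<xi> \<partial>M) \<le> ennreal ((C1 + C2) * 2 powr (- excess * real i))" .
  qed (use C1 C2 in auto)
qed

text \<open>By \<open>truncate_powr\<close>, the largest increment of a level is at most
  \<open>c + c\<^bsup>1-q\<^esup> q_variation\<close>, here with \<open>c = 2\<^bsup>-excess i/2\<^esup>\<close>.\<close>

definition level_modulus :: "complex \<Rightarrow> nat \<Rightarrow> nat \<Rightarrow> 'a \<Rightarrow> ennreal" where
  "level_modulus z n i \<xi> = ennreal (2 powr (- excess / 2 * real i))
     + ennreal ((2 powr (- excess / 2 * real i)) powr (1 - q)) * q_variation z n i \<xi> + defect_sum z n i \<xi>"

text \<open>Chaining starts at \<open>level n\<close>, so the expectation decays with the resolution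
  of the block; the path along the grid of that level is measured separately by
  \<open>coarse_variation\<close>.\<close>

definition fine_modulus :: "complex \<Rightarrow> nat \<Rightarrow> 'a \<Rightarrow> ennreal" where
  "fine_modulus z n \<xi> = (\<Sum>i. level_modulus z n (level n + i) \<xi>)"

lemma level_modulus_measurable[measurable]: "level_modulus z n i \<in> borel_measurable M"
  and fine_modulus_measurable[measurable]: "fine_modulus z n \<in> borel_measurable M"
  unfolding level_modulus_def[abs_def] fine_modulus_def[abs_def] by measurable

lemma fine_modulus_moment:
  "\<exists>C\<ge>0. \<forall>z n. (\<integral>\<^sup>+\<xi>. fine_modulus z n \<xi> \<partial>M) \<le> ennreal (C * 2 powr (- (excess / 2) * real (level n)))"
proof -
  obtain C where C: "C \<ge> 0" "\<And>z n i. (\<integral>\<^sup>+\<xi>. q_variation z n i \<xi> \<partial>M) \<le> ennreal (C * 2 powr (- excess * real i))"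
     "\<And>z n i. (\<integral>\<^sup>+\<xi>. defect_sum z n i \<xi> \<partial>M) \<le> ennreal (C * 2 powr (- excess * real i))"
    using block_moments by meson
  have lm: "(\<integral>\<^sup>+\<xi>. level_modulus z n i \<xi> \<partial>M) \<le> ennreal ((1 + 2 * C) * 2 powr (- (excess / 2) * real i))" for z n i
  proof -
    let ?c = "2 powr (- excess / 2 * real i)"
    have "(\<integral>\<^sup>+\<xi>. level_modulus z n i \<xi> \<partial>M) = ennreal ?c
       + ennreal (?c powr (1 - q)) * (\<integral>\<^sup>+\<xi>. q_variation z n i \<xi> \<partial>M) + (\<integral>\<^sup>+\<xi>. defect_sum z n i \<xi> \<partial>M)"
      unfolding level_modulus_def
      by (subst nn_integral_add, measurable, subst nn_integral_add, measurable, subst nn_integral_cmult, measurable)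
         (simp add: emeasure_space_1)
    also have "\<dots> \<le> ennreal ?c + ennreal (?c powr (1 - q)) * ennreal (C * 2 powr (- excess * real i)) + ennreal (C * 2 powr (- excess * real i))"
      by (intro add_mono mult_left_mono C) auto
    also have "\<dots> = ennreal (?c + ?c powr (1 - q) * (C * 2 powr (- excess * real i)) + C * 2 powr (- excess * real i))"
      using C(1) by (simp add: ennreal_mult ennreal_plus)
    also have "\<dots> \<le> ennreal ((1 + 2 * C) * 2 powr (- (excess / 2) * real i))"
    proof (rule ennreal_leI)
      \<comment> \<open>The factor \<open>?c powr (1 - q)\<close> grows only like the power
        \<open>(q - 1) / 2 < 1 / 2\<close> of the gain \<open>2 powr (excess * i)\<close>, so half
        of the gain survives.\<close>
      have "?c powr (1 - q) * 2 powr (- excess * real i) = 2 powr (- excess / 2 * real i * (1 - q) + - excess * real i)"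
        by (simp only: powr_powr powr_add)
      also have "\<dots> \<le> 2 powr (- (excess / 2) * real i)"
      proof (rule powr_mono)
        have "0 \<le> excess / 2 * real i * (2 - q)" using excess_pos q_bounds by simp
        then show "- excess / 2 * real i * (1 - q) + - excess * real i \<le> - (excess / 2) * real i" by (simp add: algebra_simps)
      qed simp
      finally have 1: "C * (?c powr (1 - q) * 2 powr (- excess * real i)) \<le> C * 2 powr (- (excess / 2) * real i)"
        using C(1) by (rule mult_left_mono)
      have "2 powr (- excess * real i) \<le> 2 powr (- (excess / 2) * real i)" using excess_pos by (intro powr_mono) (auto simp: mult_right_mono)
      then have 2: "C * 2 powr (- excess * real i) \<le> C * 2 powr (- (excess / 2) * real i)" using C(1) by (rule mult_left_mono)
      show "?c + ?c powr (1 - q) * (C * 2 powr (- excess * real i)) + C * 2 powr (- excess * real i) \<le> (1 + 2 * C) * 2 powr (- (excess / 2) * real i)"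
        using 1 2 by (simp add: algebra_simps)
    qed
    finally show ?thesis .
  qed
  define r where "r = (2::real) powr (- (excess / 2))"
  have r: "0 < r" "r < 1" using excess_pos by (auto simp: r_def powr_less_one)
  have ri: "2 powr (- (excess / 2) * real i) = r ^ i" for i
    unfolding r_def by (subst powr_realpow[symmetric]) (simp_all add: powr_powr)
  have sm: "summable (\<lambda>j. r ^ j)" using r by (intro summable_geometric) auto
  show ?thesis
  proof (intro exI[of _ "(1 + 2 * C) * suminf (\<lambda>j. r ^ j)"] conjI allI)
    fix z n
    have "(\<integral>\<^sup>+\<xi>. fine_modulus z n \<xi> \<partial>M) = (\<Sum>i. \<integral>\<^sup>+\<xi>. level_modulus z n (level n + i) \<xi> \<partial>M)"
      unfolding fine_modulus_def by (rule nn_integral_suminf) measurable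
    also have "\<dots> \<le> (\<Sum>i. ennreal (((1 + 2 * C) * r ^ level n) * r ^ i))"
    proof (intro suminf_le)
      show "(\<integral>\<^sup>+\<xi>. level_modulus z n (level n + i) \<xi> \<partial>M) \<le> ennreal (((1 + 2 * C) * r ^ level n) * r ^ i)" for i
        using lm[of z n "level n + i"] unfolding ri power_add by (simp add: mult.assoc)
    qed auto
    also have "\<dots> = ennreal (\<Sum>i. ((1 + 2 * C) * r ^ level n) * r ^ i)"
      using sm C(1) r by (intro suminf_ennreal2 summable_mult) auto
    also have "(\<Sum>i. ((1 + 2 * C) * r ^ level n) * r ^ i) = ((1 + 2 * C) * r ^ level n) * suminf (\<lambda>j. r ^ j)"
      by (rule suminf_mult[OF sm])
    finally show "(\<integral>\<^sup>+\<xi>. fine_modulus z n \<xi> \<partial>M) \<le> ennreal ((1 + 2 * C) * suminf (\<lambda>j. r ^ j) * 2 powr (- (excess / 2) * real (level n)))"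
      unfolding ri by (simp add: mult_ac)
  qed (use C r sm in \<open>auto intro!: mult_nonneg_nonneg suminf_nonneg\<close>)
qed

end

section \<open>Averages over blocks\<close>

text \<open>Kronecker's lemma for nonnegative terms: with \<open>c n = a n / (n + 1)\<close>, the
  part of the sum from \<open>m\<close> on is at most \<open>N\<close> times a piece of the
  convergent series, and the part before \<open>m\<close> is a constant.\<close>

lemma average_tendsto_0_of_summable:
  fixes a :: "nat \<Rightarrow> real"
  assumes nn: "\<And>n. 0 \<le> a n" and sm: "summable (\<lambda>n. a n / (real n + 1))"
  shows "(\<lambda>N. (\<Sum>n<N. a n) / real N) \<longlonglongrightarrow> 0"
proof (rule LIMSEQ_I)
  fix e :: real assume e: "e > 0"
  define c where "c = (\<lambda>n. a n / (real n + 1))"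
  have c: "0 \<le> c n" "a n = (real n + 1) * c n" for n using nn[of n] by (auto simp: c_def)
  have smc: "summable c" using sm by (simp add: c_def)
  obtain m where m: "\<And>k. k \<ge> m \<Longrightarrow> norm (sum c {m..<k}) < e / 2"
    using smc e unfolding summable_Cauchy by (metis half_gt_zero order.refl)
  have "(\<lambda>N. (\<Sum>n<m. a n) / real N) \<longlonglongrightarrow> 0"
    by (rule real_tendsto_divide_at_top[OF tendsto_const filterlim_real_sequentially])
  then obtain N0 where N0: "\<And>N. N \<ge> N0 \<Longrightarrow> norm ((\<Sum>n<m. a n) / real N) < e / 2"
    using e by (metis LIMSEQ_D diff_zero half_gt_zero)
  show "\<exists>no. \<forall>N\<ge>no. norm ((\<Sum>n<N. a n) / real N - 0) < e"
  proof (intro exI allI impI)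
    fix N assume N: "N \<ge> max (max N0 m) 1"
    have "(\<Sum>n<N. a n) = (\<Sum>n<m. a n) + sum a {m..<N}"
      using N sum.atLeastLessThan_concat[of 0 m N a] by (simp add: lessThan_atLeast0)
    moreover have "sum a {m..<N} \<le> real N * sum c {m..<N}"
      unfolding sum_distrib_left using c by (intro sum_mono) (auto intro!: mult_right_mono)
    moreover have "sum c {m..<N} < e / 2" using m[of N] N by auto
    ultimately have "(\<Sum>n<N. a n) / real N \<le> (\<Sum>n<m. a n) / real N + sum c {m..<N}"
      using N by (simp add: field_simps)
    moreover have "(\<Sum>n<m. a n) / real N < e / 2"
      using abs_less_iff[THEN iffD1, OF N0[of N, unfolded real_norm_def]] N by simp
    moreover have "0 \<le> (\<Sum>n<N. a n) / real N" using nn by (intro divide_nonneg_nonneg sum_nonneg) auto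
    ultimately show "norm ((\<Sum>n<N. a n) / real N - 0) < e" using \<open>sum c {m..<N} < e / 2\<close>
      by (subst diff_zero, subst real_norm_def, subst abs_of_nonneg) linarith+
  qed
qed

lemma geometric_distance_sum:
  fixes \<rho> :: real
  assumes "0 < \<rho>" "\<rho> < 1"
  shows "(\<Sum>m\<in>{k..<l}. \<rho> ^ nat \<bar>int n - int m\<bar>) \<le> 2 / (1 - \<rho>)"
proof -
  have g: "(\<Sum>i\<in>A. \<rho> ^ i) \<le> 1 / (1 - \<rho>)" if "finite A" for A :: "nat set"
    using sum_le_suminf[OF summable_geometric that, of \<rho>] suminf_geometric[of \<rho>] assms by simp
  have "(\<Sum>m\<in>{k..<l}. \<rho> ^ nat \<bar>int n - int m\<bar>)
      \<le> (\<Sum>m\<in>{k..<l} \<inter> {..n}. \<rho> ^ nat \<bar>int n - int m\<bar>) + (\<Sum>m\<in>{k..<l} \<inter> {n<..}. \<rho> ^ nat \<bar>int n - int m\<bar>)"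
    by (subst sum.union_disjoint[symmetric]) (auto intro!: sum_mono2 simp: assms(1) less_imp_le)
  also have "(\<Sum>m\<in>{k..<l} \<inter> {..n}. \<rho> ^ nat \<bar>int n - int m\<bar>) = (\<Sum>i\<in>(\<lambda>m. n - m) ` ({k..<l} \<inter> {..n}). \<rho> ^ i)"
    by (subst sum.reindex) (auto simp: inj_on_def intro!: sum.cong arg_cong[where f="\<lambda>i. \<rho> ^ i"])
  also have "(\<Sum>m\<in>{k..<l} \<inter> {n<..}. \<rho> ^ nat \<bar>int n - int m\<bar>) = (\<Sum>i\<in>(\<lambda>m. m - n) ` ({k..<l} \<inter> {n<..}). \<rho> ^ i)"
    by (subst sum.reindex) (auto simp: inj_on_def intro!: sum.cong arg_cong[where f="\<lambda>i. \<rho> ^ i"])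
  finally show ?thesis
    using g[of "(\<lambda>m. n - m) ` ({k..<l} \<inter> {..n})"] g[of "(\<lambda>m. m - n) ` ({k..<l} \<inter> {n<..})"] by simp
qed

text \<open>Second moments along the squares, and a crude union bound over each gap between consecutive
  squares.\<close>

lemma (in prob_space) strong_law_weak_correlation:
  fixes G :: "nat \<Rightarrow> 'a \<Rightarrow> real"
  assumes [measurable]: "\<And>n. G n \<in> borel_measurable M"
    and int: "\<And>n m. integrable M (\<lambda>\<xi>. G n \<xi> * G m \<xi>)"
    and \<rho>: "0 < \<rho>" "\<rho> < 1" and C: "C \<ge> 0"
    and cov: "\<And>n m. n \<le> m \<Longrightarrow> \<bar>expectation (\<lambda>\<xi>. G n \<xi> * G m \<xi>)\<bar> \<le> C * (real m + 1) powr (1 / 4) * \<rho> ^ (m - n)"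
  shows "AE \<xi> in M. (\<lambda>N. (\<Sum>n<N. G n \<xi>) / real N) \<longlonglongrightarrow> 0"
proof -
  define S where "S = (\<lambda>k l \<xi>. \<Sum>n\<in>{k..<l}. G n \<xi>)"
  have [measurable]: "S k l \<in> borel_measurable M" for k l unfolding S_def by measurable
  define D where "D = C * (2 / (1 - \<rho>))"
  have D: "D \<ge> 0" using C \<rho> by (simp add: D_def)
  have S2: "(\<lambda>\<xi>. (S k l \<xi>)\<^sup>2) = (\<lambda>\<xi>. \<Sum>n\<in>{k..<l}. \<Sum>m\<in>{k..<l}. G n \<xi> * G m \<xi>)" for k l
    by (simp add: S_def power2_eq_square sum_product)
  have iS: "integrable M (\<lambda>\<xi>. (S k l \<xi>)\<^sup>2)" for k l
    unfolding S2 by (intro Bochner_Integration.integrable_sum int)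
  have ES: "(\<integral>\<^sup>+\<xi>. ennreal ((S k l \<xi>)\<^sup>2) \<partial>M) \<le> ennreal (D * (real l + 1) powr (1 / 4) * real (l - k))" for k l
  proof -
    have cov': "expectation (\<lambda>\<xi>. G n \<xi> * G m \<xi>) \<le> C * (real l + 1) powr (1 / 4) * \<rho> ^ nat \<bar>int n - int m\<bar>"
      if nm: "n \<in> {k..<l}" "m \<in> {k..<l}" for n m
    proof -
      have main: "expectation (\<lambda>\<xi>. G n \<xi> * G m \<xi>) \<le> C * (real l + 1) powr (1 / 4) * \<rho> ^ (m - n)"
        if "n \<le> m" "m < l" for n m
      proof -
        have "expectation (\<lambda>\<xi>. G n \<xi> * G m \<xi>) \<le> C * (real m + 1) powr (1 / 4) * \<rho> ^ (m - n)"
          using cov[OF that(1)] by linarith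
        also have "\<dots> \<le> C * (real l + 1) powr (1 / 4) * \<rho> ^ (m - n)"
          using C \<rho> that by (intro mult_right_mono mult_left_mono powr_mono2) auto
        finally show ?thesis .
      qed
      show ?thesis
      proof (cases "n \<le> m")
        case True
        then have "nat \<bar>int n - int m\<bar> = m - n" by simp
        then show ?thesis using main[of n m] True nm by simp
      next
        case False
        then have "nat \<bar>int n - int m\<bar> = n - m" by simp
        then show ?thesis using main[of m n] False nm by (simp add: mult.commute)
      qed
    qed
    have "(\<integral>\<^sup>+\<xi>. ennreal ((S k l \<xi>)\<^sup>2) \<partial>M) = ennreal (expectation (\<lambda>\<xi>. (S k l \<xi>)\<^sup>2))"
      by (intro nn_integral_eq_integral iS) auto
    also have "expectation (\<lambda>\<xi>. (S k l \<xi>)\<^sup>2) = (\<Sum>n\<in>{k..<l}. \<Sum>m\<in>{k..<l}. expectation (\<lambda>\<xi>. G n \<xi> * G m \<xi>))"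
      unfolding S2 using int by (simp add: Bochner_Integration.integral_sum)
    also have "\<dots> \<le> (\<Sum>n\<in>{k..<l}. \<Sum>m\<in>{k..<l}. C * (real l + 1) powr (1 / 4) * \<rho> ^ nat \<bar>int n - int m\<bar>)"
      by (intro sum_mono cov')
    also have "\<dots> = (\<Sum>n\<in>{k..<l}. C * (real l + 1) powr (1 / 4) * (\<Sum>m\<in>{k..<l}. \<rho> ^ nat \<bar>int n - int m\<bar>))"
      by (simp add: sum_distrib_left)
    also have "\<dots> \<le> (\<Sum>n\<in>{k..<l}. C * (real l + 1) powr (1 / 4) * (2 / (1 - \<rho>)))"
      using C by (intro sum_mono mult_left_mono geometric_distance_sum \<rho>) auto
    also have "\<dots> = D * (real l + 1) powr (1 / 4) * real (l - k)" by (simp add: D_def)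
    finally show ?thesis by (simp add: ennreal_leI)
  qed
  \<comment> \<open>\<open>X j\<close> collects the squared sum up to \<open>j\<^sup>2\<close> and
    all squared partial sums over the following gap, normalised by the square of the time
    \<open>j\<^sup>2\<close>. The gap has \<open>2 * j + 1\<close> terms, each of expected order
    \<open>j powr (3 / 2)\<close>, so the expectation is of order
    \<open>j powr (5 / 2) / j ^ 4 = j powr (- 3 / 2)\<close>.\<close>
  define X where "X = (\<lambda>j \<xi>. ennreal (1 / (real j + 1) ^ 4) * (ennreal ((S 0 (j\<^sup>2) \<xi>)\<^sup>2)
     + (\<Sum>N\<in>{j\<^sup>2..<(Suc j)\<^sup>2}. ennreal ((S (j\<^sup>2) N \<xi>)\<^sup>2))))"
  have [measurable]: "X j \<in> borel_measurable M" for j unfolding X_def by measurable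
  have EX: "(\<integral>\<^sup>+\<xi>. X j \<xi> \<partial>M) \<le> ennreal (10 * D * (real j + 1) powr (- 1 - 1 / 2))" for j
  proof -
    define y where "y = real j + 1"
    have y: "y \<ge> 1" by (simp add: y_def)
    have p: "(real N + 1) powr (1 / 4) \<le> 2 * y powr (1 / 2)" if "real N \<le> y\<^sup>2" for N
    proof -
      have "(real N + 1) powr (1 / 4) \<le> (2 * y\<^sup>2) powr (1 / 4)"
      proof (intro powr_mono2)
        have "1 \<le> y\<^sup>2" using y by (rule one_le_power)
        then show "real N + 1 \<le> 2 * y\<^sup>2" using that by linarith
      qed auto
      also have "\<dots> = 2 powr (1 / 4) * y powr (1 / 2)"
        using y by (simp add: powr_mult powr_powr powr_numeral[symmetric] del: powr_numeral)
      also have "\<dots> \<le> 2 powr 1 * y powr (1 / 2)" by (intro mult_right_mono powr_mono) auto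
      finally show ?thesis by simp
    qed
    have t1: "(\<integral>\<^sup>+\<xi>. ennreal ((S 0 (j\<^sup>2) \<xi>)\<^sup>2) \<partial>M) \<le> ennreal (2 * D * y powr (1 / 2) * y\<^sup>2)"
    proof (rule order_trans[OF ES], rule ennreal_leI)
      have jy: "real (j\<^sup>2) \<le> y\<^sup>2" by (simp add: y_def)
      have "D * (real (j\<^sup>2) + 1) powr (1 / 4) * real (j\<^sup>2 - 0) \<le> D * (2 * y powr (1 / 2)) * y\<^sup>2"
        using D p[OF jy] jy by (intro mult_mono mult_left_mono) auto
      then show "D * (real (j\<^sup>2) + 1) powr (1 / 4) * real (j\<^sup>2 - 0) \<le> 2 * D * y powr (1 / 2) * y\<^sup>2" by simp
    qed
    have cardj: "(Suc j)\<^sup>2 - j\<^sup>2 = 2 * j + 1" by (simp add: power2_eq_square)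
    have t2: "(\<integral>\<^sup>+\<xi>. ennreal ((S (j\<^sup>2) N \<xi>)\<^sup>2) \<partial>M) \<le> ennreal (4 * D * y powr (1 / 2) * y)" if N: "N \<in> {j\<^sup>2..<(Suc j)\<^sup>2}" for N
    proof (rule order_trans[OF ES], rule ennreal_leI)
      have "real N \<le> real ((Suc j)\<^sup>2)" using N by (intro of_nat_mono) auto
      then have Ny: "real N \<le> y\<^sup>2" by (simp add: y_def add.commute)
      have "N - j\<^sup>2 \<le> 2 * j + 1" using N cardj by auto
      then have "real (N - j\<^sup>2) \<le> 2 * y" by (simp add: y_def)
      then have "D * (real N + 1) powr (1 / 4) * real (N - j\<^sup>2) \<le> D * (2 * y powr (1 / 2)) * (2 * y)"
        using D p[OF Ny] y by (intro mult_mono mult_left_mono) auto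
      then show "D * (real N + 1) powr (1 / 4) * real (N - j\<^sup>2) \<le> 4 * D * y powr (1 / 2) * y" by simp
    qed
    have "(\<integral>\<^sup>+\<xi>. X j \<xi> \<partial>M) = ennreal (1 / y ^ 4) * ((\<integral>\<^sup>+\<xi>. ennreal ((S 0 (j\<^sup>2) \<xi>)\<^sup>2) \<partial>M)
     + (\<Sum>N\<in>{j\<^sup>2..<(Suc j)\<^sup>2}. \<integral>\<^sup>+\<xi>. ennreal ((S (j\<^sup>2) N \<xi>)\<^sup>2) \<partial>M))"
      unfolding X_def y_def by (subst nn_integral_cmult, measurable, subst nn_integral_add, measurable, subst nn_integral_sum) auto
    also have "\<dots> \<le> ennreal (1 / y ^ 4) * (ennreal (2 * D * y powr (1 / 2) * y\<^sup>2)
     + (\<Sum>N\<in>{j\<^sup>2..<(Suc j)\<^sup>2}. ennreal (4 * D * y powr (1 / 2) * y)))"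
      by (intro mult_left_mono add_mono t1 sum_mono t2) auto
    also have "\<dots> = ennreal (1 / y ^ 4 * (2 * D * y powr (1 / 2) * y\<^sup>2 + real (2 * j + 1) * (4 * D * y powr (1 / 2) * y)))"
    proof -
      have "(\<Sum>N\<in>{j\<^sup>2..<(Suc j)\<^sup>2}. ennreal (4 * D * y powr (1 / 2) * y)) = ennreal (real (2 * j + 1) * (4 * D * y powr (1 / 2) * y))"
        using D y by (subst sum_ennreal) (simp_all only: sum_constant card_atLeastLessThan cardj, simp)
      then show ?thesis using D y by (simp only: ennreal_mult ennreal_plus) (subst ennreal_mult, simp, simp, simp add: ennreal_plus)
    qed
    also have "\<dots> \<le> ennreal (10 * D * y powr (- 1 - 1 / 2))"
    proof (rule ennreal_leI)
      have "1 / y ^ 4 * (2 * D * y powr (1 / 2) * y\<^sup>2 + real (2 * j + 1) * (4 * D * y powr (1 / 2) * y))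
        \<le> 1 / y ^ 4 * (2 * D * y powr (1 / 2) * y\<^sup>2 + (2 * y) * (4 * D * y powr (1 / 2) * y))"
        using D y by (intro mult_left_mono add_left_mono mult_right_mono) (auto simp: y_def)
      also have "\<dots> = 10 * D * (y powr (1 / 2) / y\<^sup>2)" using y by (simp add: field_simps power2_eq_square power4_eq_xxxx)
      also have "y powr (1 / 2) / y\<^sup>2 = y powr (- 1 - 1 / 2)"
        using y by (simp add: powr_numeral[symmetric] powr_diff[symmetric] del: powr_numeral)
      finally show "1 / y ^ 4 * (2 * D * y powr (1 / 2) * y\<^sup>2 + real (2 * j + 1) * (4 * D * y powr (1 / 2) * y)) \<le> 10 * D * y powr (- 1 - 1 / 2)" .
    qed
    finally show ?thesis by (simp add: y_def)
  qed
  have "AE \<xi> in M. (\<forall>n. X n \<xi> < \<infinity>) \<and> (\<lambda>n. enn2real (X n \<xi>)) \<longlonglongrightarrow> 0"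
  proof (rule AE_terms_tendsto_0[OF _ EX])
    show "summable (\<lambda>n. 10 * D * (real n + 1) powr (- 1 - 1 / 2))"
      by (intro summable_mult summable_shifted_powr) auto
  qed (use D in auto)
  then show ?thesis
  proof eventually_elim
    case (elim \<xi>)
    define x where "x = (\<lambda>j. enn2real (X j \<xi>))"
    have x: "x \<longlonglongrightarrow> 0" using elim by (simp add: x_def)
    have xx: "\<bar>S 0 (j\<^sup>2) \<xi>\<bar> \<le> sqrt (x j) * (real j + 1)\<^sup>2"
      "N \<in> {j\<^sup>2..<(Suc j)\<^sup>2} \<Longrightarrow> \<bar>S (j\<^sup>2) N \<xi>\<bar> \<le> sqrt (x j) * (real j + 1)\<^sup>2" for j N
    proof -
      have gen: "\<bar>s\<bar> \<le> sqrt (x j) * (real j + 1)\<^sup>2" if "ennreal (1 / (real j + 1) ^ 4) * ennreal (s\<^sup>2) \<le> X j \<xi>" for s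
      proof -
        have "ennreal (1 / (real j + 1) ^ 4 * s\<^sup>2) \<le> ennreal (x j)"
          using that elim by (subst ennreal_mult) (auto simp: x_def)
        then have "1 / (real j + 1) ^ 4 * s\<^sup>2 \<le> x j" by (simp add: x_def)
        then have "(\<bar>s\<bar> / (real j + 1)\<^sup>2)\<^sup>2 \<le> x j" by (simp add: power_divide power_mult[symmetric])
        then have "\<bar>s\<bar> / (real j + 1)\<^sup>2 \<le> sqrt (x j)" by (rule real_le_rsqrt)
        then show ?thesis by (simp add: field_simps)
      qed
      show "\<bar>S 0 (j\<^sup>2) \<xi>\<bar> \<le> sqrt (x j) * (real j + 1)\<^sup>2"
        by (rule gen) (auto simp: X_def intro!: mult_left_mono)
      show "\<bar>S (j\<^sup>2) N \<xi>\<bar> \<le> sqrt (x j) * (real j + 1)\<^sup>2" if N: "N \<in> {j\<^sup>2..<(Suc j)\<^sup>2}"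
      proof (rule gen)
        have "ennreal ((S (j\<^sup>2) N \<xi>)\<^sup>2) \<le> (\<Sum>N\<in>{j\<^sup>2..<(Suc j)\<^sup>2}. ennreal ((S (j\<^sup>2) N \<xi>)\<^sup>2))"
          by (rule member_le_sum[OF N]) auto
        also have "\<dots> \<le> ennreal ((S 0 (j\<^sup>2) \<xi>)\<^sup>2) + (\<Sum>N\<in>{j\<^sup>2..<(Suc j)\<^sup>2}. ennreal ((S (j\<^sup>2) N \<xi>)\<^sup>2))" by simp
        finally show "ennreal (1 / (real j + 1) ^ 4) * ennreal ((S (j\<^sup>2) N \<xi>)\<^sup>2) \<le> X j \<xi>"
          unfolding X_def by (rule mult_left_mono) simp
      qed
    qed
    \<comment> \<open>\<open>(J N)\<^sup>2\<close> is the largest square not exceeding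
      \<open>N\<close>; it is comparable to \<open>N\<close>, so bounds along squares transfer to
      all indices.\<close>
    define J where "J = (\<lambda>N. nat \<lfloor>sqrt (real N)\<rfloor>)"
    have J: "(J N)\<^sup>2 \<le> N" "N < (Suc (J N))\<^sup>2" for N
    proof -
      have j: "real (J N) \<le> sqrt (real N)" "sqrt (real N) < real (J N) + 1" unfolding J_def by simp_all
      have "(real (J N))\<^sup>2 \<le> real N" using power_mono[OF j(1), of 2] by simp
      then show "(J N)\<^sup>2 \<le> N" by (metis of_nat_le_iff of_nat_power)
      have "real N < (real (J N) + 1)\<^sup>2" using power_strict_mono[OF j(2), of 2] by simp
      then have "real N < real ((Suc (J N))\<^sup>2)" by (simp add: add.commute)
      then show "N < (Suc (J N))\<^sup>2" by (simp only: of_nat_less_iff)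
    qed
    have Jlim: "filterlim J at_top sequentially" unfolding J_def by real_asymp
    show ?case
    \<comment> \<open>The 8 is 2 * 4: two partial sums, and
      \<open>(J N + 1)\<^sup>2 \<le> 4 * N\<close>.\<close>
    proof (rule Lim_null_comparison[where g="\<lambda>N. 8 * sqrt (x (J N))"])
      show "\<forall>\<^sub>F N in sequentially. norm ((\<Sum>n<N. G n \<xi>) / real N) \<le> 8 * sqrt (x (J N))"
        using eventually_ge_at_top[of 1]
      proof eventually_elim
        case (elim N)
        have sp: "(\<Sum>n<N. G n \<xi>) = S 0 ((J N)\<^sup>2) \<xi> + S ((J N)\<^sup>2) N \<xi>"
          unfolding S_def lessThan_atLeast0 using J(1)[of N] by (intro sum.atLeastLessThan_concat[symmetric]) auto
        have J1: "1 \<le> J N"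
        proof -
          have "1 \<le> sqrt (real N)" using elim by simp
          then show ?thesis unfolding J_def by linarith
        qed
        have "(real (J N) + 1)\<^sup>2 \<le> (2 * real (J N))\<^sup>2" using J1 by (intro power_mono) auto
        also have "\<dots> \<le> 4 * real N" using J(1)[of N] by (simp add: power_mult_distrib)
        finally have N4: "(real (J N) + 1)\<^sup>2 \<le> 4 * real N" .
        have "x (J N) \<ge> 0" by (simp add: x_def)
        have "\<bar>\<Sum>n<N. G n \<xi>\<bar> \<le> 2 * (sqrt (x (J N)) * (real (J N) + 1)\<^sup>2)"
          using xx(1)[of "J N"] xx(2)[of N "J N"] J[of N] unfolding sp by auto
        also have "\<dots> \<le> 2 * (sqrt (x (J N)) * (4 * real N))"
          using N4 \<open>x (J N) \<ge> 0\<close> by (intro mult_left_mono) auto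
        finally show ?case using elim by (simp add: field_simps)
      qed
      have "(\<lambda>N. 8 * sqrt (x (J N))) \<longlonglongrightarrow> 8 * sqrt 0"
        by (intro tendsto_intros filterlim_compose[OF x Jlim])
      then show "(\<lambda>N. 8 * sqrt (x (J N))) \<longlonglongrightarrow> 0" by simp
    qed
  qed
qed

section \<open>Oscillation of the logarithm over a block\<close>

context centred_fbm
begin

definition coarse_variation :: "complex \<Rightarrow> nat \<Rightarrow> 'a \<Rightarrow> real" where
  "coarse_variation z n \<xi> = (\<Sum>k<2 ^ level n. norm (incr (traj z \<xi>) (grid n (level n) k) (grid n (level n) (Suc k))))"

text \<open>On each grid cell the sewing bound replaces the increment of \<open>L\<close> by
  \<open>incr\<close>. The walk along the grid of level \<open>level n\<close> costs
  \<open>coarse_variation\<close> plus one \<open>fine_modulus\<close>, and chaining from there to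
  the given time costs a second \<open>fine_modulus\<close>; over the complete block the errors of
  the cells add up to at most one.\<close>

lemma block_oscillation:
  assumes \<gamma>: "1 / 2 < \<gamma>" and hol: "\<And>T. holder_on {0..T} \<gamma> (\<lambda>t. W t \<xi>)"
    and L: "continuous_on {0..} L" and BL: "\<And>t. t \<ge> 0 \<Longrightarrow> traj z \<xi> t = exp (L t)"
    and fin: "fine_modulus z n \<xi> < \<infinity>"
  shows "x \<in> {0..1} \<Longrightarrow> norm (L (2 ^ n + 2 ^ n * x) - L (2 ^ n)) \<le> coarse_variation z n \<xi> + 2 * enn2real (fine_modulus z n \<xi>)"
    and "norm (L (2 ^ n + 2 ^ n) - L (2 ^ n) - riemann_sum (traj z \<xi>) (2 ^ n) (2 ^ n) (level n)) \<le> enn2real (fine_modulus z n \<xi>)"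
proof -
  define l where "l = level n"
  define f where "f = (\<lambda>x. L (2 ^ n + 2 ^ n * x))"
  have fg: "f (real k / 2 ^ i) = L (grid n i k)" for k i by (simp add: f_def grid_def)
  let ?A = "\<lambda>i k. incr (traj z \<xi>) (grid n i k) (grid n i (Suc k))"
  let ?D = "\<lambda>i k. total_defect (traj z \<xi>) (grid n i k) (2 ^ n / 2 ^ i)"
  have sew: "ennreal (norm (f (real (Suc k) / 2 ^ i) - f (real k / 2 ^ i) - ?A i k)) \<le> ?D i k" for i k
  proof -
    have "riemann_sum (traj z \<xi>) (grid n i k) (2 ^ n / 2 ^ i) \<longlonglongrightarrow> L (grid n i k + 2 ^ n / 2 ^ i) - L (grid n i k)"
    proof (rule riemann_sum_tendsto[OF \<gamma>])
      show "holder_on {0..grid n i k + 2 ^ n / 2 ^ i} \<gamma> (traj z \<xi>)"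
        using hol[of "grid n i k + 2 ^ n / 2 ^ i"] unfolding holder_on_def traj_diff .
      show "continuous_on {0..grid n i k + 2 ^ n / 2 ^ i} L" by (rule continuous_on_subset[OF L]) auto
    qed (use BL grid_pos[of n i k] in auto)
    from sewing_bound[OF this] show ?thesis unfolding fg grid_step .
  qed
  have lm_fin: "level_modulus z n (l + i) \<xi> < \<infinity>" for i
  proof -
    have "level_modulus z n (l + i) \<xi> \<le> fine_modulus z n \<xi>"
      using sum_le_suminf[of "\<lambda>i. level_modulus z n (level n + i) \<xi>" "{i}"] by (simp add: fine_modulus_def l_def)
    then show ?thesis using fin by (rule le_less_trans)
  qed
  have step: "ennreal (norm (f (real (Suc k) / 2 ^ i) - f (real k / 2 ^ i))) \<le> level_modulus z n i \<xi>" if k: "k < 2 ^ i" for i k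
  proof -
    let ?c = "2 powr (- excess / 2 * real i)"
    have "norm (f (real (Suc k) / 2 ^ i) - f (real k / 2 ^ i)) \<le> norm (?A i k) + norm (f (real (Suc k) / 2 ^ i) - f (real k / 2 ^ i) - ?A i k)"
      using norm_triangle_ineq[of "?A i k" "f (real (Suc k) / 2 ^ i) - f (real k / 2 ^ i) - ?A i k"] by simp
    then have "ennreal (norm (f (real (Suc k) / 2 ^ i) - f (real k / 2 ^ i)))
       \<le> ennreal (norm (?A i k)) + ennreal (norm (f (real (Suc k) / 2 ^ i) - f (real k / 2 ^ i) - ?A i k))"
      unfolding ennreal_plus[OF norm_ge_zero norm_ge_zero, symmetric] by (rule ennreal_leI)
    also have "\<dots> \<le> ennreal (?c + ?c powr (1 - q) * norm (?A i k) powr q) + ?D i k"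
      using q_bounds by (intro add_mono sew ennreal_leI truncate_powr) auto
    also have "ennreal (?c + ?c powr (1 - q) * norm (?A i k) powr q) = ennreal ?c + ennreal (?c powr (1 - q)) * ennreal (norm (?A i k) powr q)"
      by (simp add: ennreal_plus ennreal_mult)
    also have "\<dots> + ?D i k \<le> ennreal ?c + ennreal (?c powr (1 - q)) * q_variation z n i \<xi> + defect_sum z n i \<xi>"
      unfolding q_variation_def defect_sum_def using k
      by (intro add_mono mult_left_mono order.refl member_le_sum[of k "{..<2 ^ i}" "\<lambda>k. ennreal (norm (?A i k) powr q)"]
          member_le_sum[of k "{..<2 ^ i}" "?D i"]) auto
    also have "\<dots> = level_modulus z n i \<xi>" by (simp add: level_modulus_def)
    finally show ?thesis .
  qed
  have dsum: "(\<Sum>k<2 ^ l. ennreal (norm (f (real (Suc k) / 2 ^ l) - f (real k / 2 ^ l) - ?A l k))) \<le> fine_modulus z n \<xi>"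
  proof -
    have "(\<Sum>k<2 ^ l. ennreal (norm (f (real (Suc k) / 2 ^ l) - f (real k / 2 ^ l) - ?A l k))) \<le> defect_sum z n l \<xi>"
      unfolding defect_sum_def by (intro sum_mono sew)
    also have "\<dots> \<le> level_modulus z n l \<xi>" by (simp add: level_modulus_def add_increasing)
    also have "\<dots> \<le> fine_modulus z n \<xi>"
      using sum_le_suminf[of "\<lambda>i. level_modulus z n (level n + i) \<xi>" "{0}"] by (simp add: fine_modulus_def l_def)
    finally show ?thesis .
  qed
  have fm: "ennreal (enn2real (fine_modulus z n \<xi>)) = fine_modulus z n \<xi>" using fin by simp
  have dsum': "(\<Sum>k<2 ^ l. norm (f (real (Suc k) / 2 ^ l) - f (real k / 2 ^ l) - ?A l k)) \<le> enn2real (fine_modulus z n \<xi>)"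
    using dsum by (subst ennreal_le_iff[symmetric]) (auto simp: fm sum_nonneg)
  have tel: "(\<Sum>k<K. f (real (Suc k) / 2 ^ l) - f (real k / 2 ^ l)) = f (real K / 2 ^ l) - f 0" for K
    by (subst sum_lessThan_telescope[where f="\<lambda>k. f (real k / 2 ^ l)"]) simp
  have rs: "riemann_sum (traj z \<xi>) (2 ^ n) (2 ^ n) l = (\<Sum>k<2 ^ l. ?A l k)"
    by (simp add: riemann_sum_def grid_def)
  have "norm (f 1 - f 0 - riemann_sum (traj z \<xi>) (2 ^ n) (2 ^ n) l)
     = norm (\<Sum>k<2 ^ l. f (real (Suc k) / 2 ^ l) - f (real k / 2 ^ l) - ?A l k)"
    unfolding rs sum_subtractf[of _ "?A l"] tel by simp
  also have "\<dots> \<le> enn2real (fine_modulus z n \<xi>)" by (rule order_trans[OF norm_sum dsum'])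
  finally show "norm (L (2 ^ n + 2 ^ n) - L (2 ^ n) - riemann_sum (traj z \<xi>) (2 ^ n) (2 ^ n) (level n)) \<le> enn2real (fine_modulus z n \<xi>)"
    by (simp add: f_def l_def)
  show "norm (L (2 ^ n + 2 ^ n * x) - L (2 ^ n)) \<le> coarse_variation z n \<xi> + 2 * enn2real (fine_modulus z n \<xi>)" if x: "x \<in> {0..1}"
  proof -
    have x01: "0 \<le> x" "x \<le> 1" using x by auto
    \<comment> \<open>The chaining lemma asks for a bound at every level. Below \<open>l\<close> any
      bound serves, and the full sum of increments is taken, because only the terms beyond level
      \<open>l\<close> enter the tail.\<close>
    define m where "m = (\<lambda>i. if i < l then (\<Sum>k<2 ^ i. norm (f (real (Suc k) / 2 ^ i) - f (real k / 2 ^ i))) else enn2real (level_modulus z n i \<xi>))"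
    have mb: "norm (f (real (Suc k) / 2 ^ i) - f (real k / 2 ^ i)) \<le> m i" if k: "k < 2 ^ i" for i k
    proof (cases "i < l")
      case True
      have "norm (f (real (Suc k) / 2 ^ i) - f (real k / 2 ^ i)) \<le> (\<Sum>k<2 ^ i. norm (f (real (Suc k) / 2 ^ i) - f (real k / 2 ^ i)))"
        using k by (intro member_le_sum[where f="\<lambda>k. norm (f (real (Suc k) / 2 ^ i) - f (real k / 2 ^ i))"]) auto
      then show ?thesis using True by (simp only: m_def if_True)
    next
      case False
      then have "level_modulus z n i \<xi> < \<infinity>" using lm_fin[of "i - l"] by simp
      then show ?thesis using step[OF k] False unfolding m_def
        by (subst ennreal_le_iff[symmetric]) auto
    qed
    have em: "ennreal (enn2real (level_modulus z n (l + i) \<xi>)) = level_modulus z n (l + i) \<xi>" for i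
      using lm_fin[of i] by simp
    have sm: "summable (\<lambda>i. enn2real (level_modulus z n (l + i) \<xi>))"
      using fin by (intro summable_suminf_not_top) (auto simp: em[unfolded l_def] fine_modulus_def l_def)
    have sml: "(\<Sum>i. enn2real (level_modulus z n (l + i) \<xi>)) = enn2real (fine_modulus z n \<xi>)"
    proof -
      have "ennreal (\<Sum>i. enn2real (level_modulus z n (l + i) \<xi>)) = fine_modulus z n \<xi>"
        using suminf_ennreal2[OF _ sm] by (simp add: em[unfolded l_def] fine_modulus_def l_def)
      then show ?thesis by (metis enn2real_ennreal suminf_nonneg sm enn2real_nonneg)
    qed
    have smm: "summable m"
    proof (rule summable_offset[where k=l])
      show "summable (\<lambda>i. m (i + l))" using sm by (simp add: m_def add.commute)
    qed
    have "norm (f x - f (real (dyadic_floor l x) / 2 ^ l)) \<le> (\<Sum>i. m (Suc (l + i)))"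
    proof (rule dyadic_chain_limit[OF mb x01 _ smm])
      show "continuous_on {0..1} f" unfolding f_def
        by (rule continuous_on_compose2[OF L]) (auto intro!: continuous_intros)
    qed
    also have "(\<Sum>i. m (Suc (l + i))) = (\<Sum>i. enn2real (level_modulus z n (l + Suc i) \<xi>))"
      by (simp add: m_def)
    also have "\<dots> \<le> (\<Sum>i. enn2real (level_modulus z n (l + i) \<xi>))"
      using suminf_split_head[OF sm] by simp
    finally have 1: "norm (f x - f (real (dyadic_floor l x) / 2 ^ l)) \<le> enn2real (fine_modulus z n \<xi>)"
      unfolding sml .
    define K where "K = dyadic_floor l x"
    have K: "K \<le> 2 ^ l" unfolding K_def by (rule dyadic_floor_le[OF x01])
    have "norm (f (real K / 2 ^ l) - f 0) \<le> (\<Sum>k<K. norm (f (real (Suc k) / 2 ^ l) - f (real k / 2 ^ l)))"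
      unfolding tel[symmetric] by (rule norm_sum)
    also have "\<dots> \<le> (\<Sum>k<2 ^ l. norm (f (real (Suc k) / 2 ^ l) - f (real k / 2 ^ l)))"
      using K by (intro sum_mono2) auto
    also have "\<dots> \<le> (\<Sum>k<2 ^ l. norm (?A l k) + norm (f (real (Suc k) / 2 ^ l) - f (real k / 2 ^ l) - ?A l k))"
    proof (rule sum_mono)
      fix k
      show "norm (f (real (Suc k) / 2 ^ l) - f (real k / 2 ^ l)) \<le> norm (?A l k) + norm (f (real (Suc k) / 2 ^ l) - f (real k / 2 ^ l) - ?A l k)"
        using norm_triangle_ineq[of "?A l k" "f (real (Suc k) / 2 ^ l) - f (real k / 2 ^ l) - ?A l k"] by simp
    qed
    also have "\<dots> \<le> coarse_variation z n \<xi> + enn2real (fine_modulus z n \<xi>)"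
      unfolding sum.distrib coarse_variation_def l_def[symmetric] using dsum' by simp
    finally have 2: "norm (f (real K / 2 ^ l) - f 0) \<le> coarse_variation z n \<xi> + enn2real (fine_modulus z n \<xi>)" .
    have "norm (f x - f 0) \<le> norm (f x - f (real K / 2 ^ l)) + norm (f (real K / 2 ^ l) - f 0)"
      using norm_triangle_ineq[of "f x - f (real K / 2 ^ l)" "f (real K / 2 ^ l) - f 0"] by simp
    then show ?thesis using 1 2 by (simp add: K_def f_def)
  qed
qed

text \<open>Dividing by \<open>n + 1\<close> turns the slow decay of the expectations into a
  convergent series; its almost sure convergence gives finiteness as well as the form required by
  Kronecker's lemma.\<close>

lemma AE_fine_modulus:
  "AE \<xi> in M. (\<forall>n. fine_modulus z n \<xi> < \<infinity>) \<and> summable (\<lambda>n. enn2real (fine_modulus z n \<xi>) / (real n + 1))"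
proof -
  obtain C where C: "C \<ge> 0" "\<And>z n. (\<integral>\<^sup>+\<xi>. fine_modulus z n \<xi> \<partial>M) \<le> ennreal (C * 2 powr (- (excess / 2) * real (level n)))"
    using fine_modulus_moment by meson
  define c where "c = excess / 2"
  have c: "c > 0" using excess_pos by (simp add: c_def)
  let ?g = "\<lambda>n. C * 2 powr c * (real n + 1) powr (- 1 - c / 16)"
  have "AE \<xi> in M. (\<Sum>n. ennreal (1 / (real n + 1)) * fine_modulus z n \<xi>) \<noteq> \<infinity>"
  proof (rule AE_suminf_finite[where g="?g"])
    fix n
    have "(\<integral>\<^sup>+\<xi>. ennreal (1 / (real n + 1)) * fine_modulus z n \<xi> \<partial>M) = ennreal (1 / (real n + 1)) * (\<integral>\<^sup>+\<xi>. fine_modulus z n \<xi> \<partial>M)"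
      by (rule nn_integral_cmult) measurable
    also have "\<dots> \<le> ennreal (1 / (real n + 1)) * ennreal (C * 2 powr (- c * real (level n)))"
      unfolding c_def by (intro mult_left_mono C(2)) auto
    also have "\<dots> = ennreal (1 / (real n + 1) * (C * 2 powr (- c * real (level n))))"
      using C(1) by (intro ennreal_mult[symmetric]) auto
    also have "\<dots> \<le> ennreal (1 / (real n + 1) * (C * (2 powr c * (real n + 1) powr (- c / 16))))"
      using C(1) c by (intro ennreal_leI mult_left_mono level_decay) auto
    also have "1 / (real n + 1) * (C * (2 powr c * (real n + 1) powr (- c / 16))) = ?g n"
    proof -
      have "(real n + 1) powr (- 1 - c / 16) = (real n + 1) powr (- 1) * (real n + 1) powr (- c / 16)"
        unfolding powr_add[symmetric] by simp
      then show ?thesis by (simp add: powr_minus_divide)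
    qed
    finally show "(\<integral>\<^sup>+\<xi>. ennreal (1 / (real n + 1)) * fine_modulus z n \<xi> \<partial>M) \<le> ennreal (?g n)" .
  qed (use C(1) c in \<open>auto intro!: summable_mult summable_shifted_powr\<close>)
  then show ?thesis
  proof eventually_elim
    case (elim \<xi>)
    have fin: "fine_modulus z n \<xi> < \<infinity>" for n
    proof -
      have "ennreal (1 / (real n + 1)) * fine_modulus z n \<xi> \<le> (\<Sum>n. ennreal (1 / (real n + 1)) * fine_modulus z n \<xi>)"
        using sum_le_suminf[of "\<lambda>n. ennreal (1 / (real n + 1)) * fine_modulus z n \<xi>" "{n}"] by simp
      then have "ennreal (1 / (real n + 1)) * fine_modulus z n \<xi> \<noteq> \<infinity>" using elim by (auto simp: top_unique)
      then show ?thesis by (auto simp: ennreal_mult_eq_top_iff top.not_eq_extremum)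
    qed
    have e: "ennreal (enn2real (fine_modulus z n \<xi>) / (real n + 1)) = ennreal (1 / (real n + 1)) * fine_modulus z n \<xi>" for n
    proof -
      have "ennreal (enn2real (fine_modulus z n \<xi>) / (real n + 1)) = ennreal (1 / (real n + 1) * enn2real (fine_modulus z n \<xi>))" by simp
      also have "\<dots> = ennreal (1 / (real n + 1)) * ennreal (enn2real (fine_modulus z n \<xi>))" by (rule ennreal_mult) auto
      finally show ?thesis using fin by simp
    qed
    have "summable (\<lambda>n. enn2real (fine_modulus z n \<xi>) / (real n + 1))"
      using elim by (intro summable_suminf_not_top) (auto simp: e)
    then show ?case using fin by blast
  qed
qed

text \<open>Each increment is truncated at \<open>y powr (1 / 2)\<close> with
  \<open>y = n + 1\<close>. The truncated parts total at most
  \<open>y powr (1 / 16 + 1 / 2)\<close>, of lower order than \<open>y\<close>; the rest is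
  \<open>q_variation\<close> weighted by \<open>y powr (- c)\<close> with
  \<open>c = (q - 1) / 2\<close>, whose expectations divided by \<open>y\<close> are
  summable.\<close>

lemma AE_coarse_variation: "AE \<xi> in M. (\<lambda>n. coarse_variation z n \<xi> / (real n + 1)) \<longlonglongrightarrow> 0"
proof -
  obtain C where C: "C \<ge> 0" "\<And>z n i. (\<integral>\<^sup>+\<xi>. q_variation z n i \<xi> \<partial>M) \<le> ennreal (C * 2 powr (- excess * real i))"
    using block_moments by meson
  define c where "c = (q - 1) / 2"
  have c: "c > 0" using q_bounds by (simp add: c_def)
  let ?g = "\<lambda>n. C * (real n + 1) powr (- 1 - c)"
  let ?f = "\<lambda>n \<xi>. ennreal ((real n + 1) powr (- 1 - c)) * q_variation z n (level n) \<xi>"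
  have "AE \<xi> in M. (\<forall>n. ?f n \<xi> < \<infinity>) \<and> (\<lambda>n. enn2real (?f n \<xi>)) \<longlonglongrightarrow> 0"
  proof (rule AE_terms_tendsto_0[where g="?g"])
    fix n
    have "(\<integral>\<^sup>+\<xi>. ?f n \<xi> \<partial>M) = ennreal ((real n + 1) powr (- 1 - c)) * (\<integral>\<^sup>+\<xi>. q_variation z n (level n) \<xi> \<partial>M)"
      by (rule nn_integral_cmult) measurable
    also have "\<dots> \<le> ennreal ((real n + 1) powr (- 1 - c)) * ennreal C"
    proof (intro mult_left_mono order_trans[OF C(2)] ennreal_leI)
      have "2 powr (- excess * real (level n)) \<le> 2 powr 0" using excess_pos by (intro powr_mono) auto
      then have "C * 2 powr (- excess * real (level n)) \<le> C * 1" using C(1) by (intro mult_left_mono) auto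
      then show "C * 2 powr (- excess * real (level n)) \<le> C" by simp
    qed auto
    also have "\<dots> = ennreal (?g n)" using C(1) by (simp add: ennreal_mult[symmetric] mult.commute)
    finally show "(\<integral>\<^sup>+\<xi>. ?f n \<xi> \<partial>M) \<le> ennreal (?g n)" .
  qed (use C(1) c in \<open>auto intro!: summable_mult summable_shifted_powr\<close>)
  then show ?thesis
  proof eventually_elim
    case (elim \<xi>)
    have bnd: "coarse_variation z n \<xi> / (real n + 1) \<le> (real n + 1) powr (- 1 / 4) + enn2real (?f n \<xi>)" for n
    proof -
      define y where "y = real n + 1"
      have y: "y \<ge> 1" by (simp add: y_def)
      let ?A = "\<lambda>k. norm (incr (traj z \<xi>) (grid n (level n) k) (grid n (level n) (Suc k)))"
      have "coarse_variation z n \<xi> \<le> (\<Sum>k<(2::nat) ^ level n. y powr (1 / 2) + (y powr (1 / 2)) powr (1 - q) * ?A k powr q)"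
        unfolding coarse_variation_def using q_bounds y by (intro sum_mono truncate_powr) auto
      also have "\<dots> = 2 ^ level n * y powr (1 / 2) + (y powr (1 / 2)) powr (1 - q) * (\<Sum>k<2 ^ level n. ?A k powr q)"
        by (simp add: sum.distrib sum_distrib_left)
      also have "\<dots> \<le> y powr (1 / 16) * y powr (1 / 2) + y powr (- c) * (\<Sum>k<2 ^ level n. ?A k powr q)"
      proof (intro add_mono mult_right_mono)
        show "2 ^ level n \<le> y powr (1 / 16)" unfolding y_def by (rule level_le)
        have "(1 / 2) * (1 - q) = - c" by (simp add: c_def field_simps)
        then show "(y powr (1 / 2)) powr (1 - q) \<le> y powr (- c)" by (simp only: powr_powr order.refl)
      qed (auto intro!: sum_nonneg)
      finally have "coarse_variation z n \<xi> / y \<le> (y powr (1 / 16) * y powr (1 / 2) + y powr (- c) * (\<Sum>k<2 ^ level n. ?A k powr q)) / y"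
        using y by (intro divide_right_mono) auto
      also have "\<dots> = y powr (1 / 16 + 1 / 2 - 1) + y powr (- 1 - c) * (\<Sum>k<2 ^ level n. ?A k powr q)"
      proof -
        have "y powr (1 / 16 + 1 / 2 - 1) = y powr (1 / 16) * y powr (1 / 2) / y"
          using y by (simp only: powr_diff powr_add) simp
        moreover have "y powr (- 1 - c) = y powr (- c) / y"
        proof -
          have e: "- 1 - c = - c - 1" by simp
          show ?thesis unfolding e powr_diff using y by simp
        qed
        ultimately show ?thesis by (simp add: add_divide_distrib)
      qed
      also have "y powr (1 / 16 + 1 / 2 - 1) \<le> y powr (- 1 / 4)" using y by (intro powr_mono) auto
      also have "y powr (- 1 - c) * (\<Sum>k<2 ^ level n. ?A k powr q) = enn2real (?f n \<xi>)"
      proof -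
        have "?f n \<xi> = ennreal (y powr (- 1 - c) * (\<Sum>k<2 ^ level n. ?A k powr q))"
          unfolding q_variation_def y_def by (simp add: ennreal_mult sum_nonneg)
        then show ?thesis by (simp add: sum_nonneg)
      qed
      finally show ?thesis by (simp add: y_def)
    qed
    have "(\<lambda>n. (real n + 1) powr (- 1 / 4) + enn2real (?f n \<xi>)) \<longlonglongrightarrow> 0 + 0"
    proof (rule tendsto_add)
      show "(\<lambda>n. (real n + 1) powr (- 1 / 4)) \<longlonglongrightarrow> 0" by real_asymp
    qed (use elim in auto)
    then have "(\<lambda>n. (real n + 1) powr (- 1 / 4) + enn2real (?f n \<xi>)) \<longlonglongrightarrow> 0" by simp
    moreover have "0 \<le> coarse_variation z n \<xi> / (real n + 1)" for n
      unfolding coarse_variation_def by (intro divide_nonneg_nonneg sum_nonneg) auto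
    ultimately show ?case
      using bnd by (intro tendsto_sandwich[where f="\<lambda>_. 0" and g="\<lambda>n. coarse_variation z n \<xi> / (real n + 1)"
        and h="\<lambda>n. (real n + 1) powr (- 1 / 4) + enn2real (?f n \<xi>)"] always_eventually allI tendsto_const)
  qed
qed

end

section \<open>Decay of correlations\<close>

lemma fbm_cov_nonneg:
  assumes "0 \<le> x" "0 \<le> y" "0 < H"
  shows "0 \<le> fbm_cov H x y"
proof -
  have "\<bar>y - x\<bar> powr (2 * H) \<le> max (x powr (2 * H)) (y powr (2 * H))"
  proof (cases "x \<le> y")
    case True
    then have "\<bar>y - x\<bar> powr (2 * H) \<le> y powr (2 * H)" using assms by (intro powr_mono2) auto
    then show ?thesis by simp
  next
    case False
    then have "\<bar>y - x\<bar> powr (2 * H) \<le> x powr (2 * H)" using assms by (intro powr_mono2) auto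
    then show ?thesis by simp
  qed
  moreover have "max (x powr (2 * H)) (y powr (2 * H)) \<le> x powr (2 * H) + y powr (2 * H)" by simp
  ultimately have "\<bar>y - x\<bar> powr (2 * H) \<le> x powr (2 * H) + y powr (2 * H)" by (rule order_trans)
  then show ?thesis by (simp add: fbm_cov_def)
qed

lemma fbm_cov_le_variances: "fbm_cov H x y \<le> (x powr (2 * H) + y powr (2 * H)) / 2"
  by (simp add: fbm_cov_def)

text \<open>With \<open>r = 1 - x / y\<close>, the inequality \<open>2 * H < 2\<close> gives
  \<open>r\<^sup>2 \<le> r powr (2 * H)\<close>, so the difference of the two large terms is at most
  \<open>2 * x * y powr (2 * H - 1)\<close>; the small term \<open>x powr (2 * H)\<close> is of no
  larger order. Relative to \<open>x powr H * y powr H\<close> the bound decays like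
  \<open>(x / y) powr (1 - H)\<close>.\<close>

lemma fbm_cov_decay:
  assumes xy: "0 < x" "x \<le> y" and H: "1 / 2 < H" "H < 1"
  shows "fbm_cov H x y \<le> 2 * x * y powr (2 * H - 1)"
proof -
  define r where "r = (y - x) / y"
  have y: "y > 0" using xy by simp
  have r: "0 \<le> r" "r \<le> 1" using xy y by (auto simp: r_def)
  have "r powr 2 \<le> r powr (2 * H)" using r H by (intro powr_mono') auto
  then have "1 - r powr (2 * H) \<le> 1 - r\<^sup>2" using r by (cases "r = 0") (auto simp: powr_numeral)
  also have "\<dots> \<le> 2 * (1 - r)" using zero_le_power2[of "1 - r"] by (simp add: power2_eq_square algebra_simps)
  also have "\<dots> = 2 * (x / y)" using y by (simp add: r_def field_simps)
  finally have "y powr (2 * H) * (1 - r powr (2 * H)) \<le> y powr (2 * H) * (2 * (x / y))" by (intro mult_left_mono) auto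
  moreover have "y powr (2 * H) * r powr (2 * H) = (y - x) powr (2 * H)"
    unfolding powr_mult[symmetric] r_def using y by simp
  moreover have "y powr (2 * H) * (2 * (x / y)) = 2 * x * y powr (2 * H - 1)"
    using y by (simp add: powr_diff)
  ultimately have 1: "y powr (2 * H) - (y - x) powr (2 * H) \<le> 2 * x * y powr (2 * H - 1)"
    by (simp add: right_diff_distrib)
  have "x powr (2 * H) = x * x powr (2 * H - 1)" using xy by (simp add: powr_diff)
  also have "\<dots> \<le> x * y powr (2 * H - 1)" using xy H by (intro mult_left_mono powr_mono2) auto
  finally have 2: "x powr (2 * H) \<le> x * y powr (2 * H - 1)" .
  have "0 \<le> x * y powr (2 * H - 1)" using xy by simp
  then have "x powr (2 * H) + y powr (2 * H) - (y - x) powr (2 * H) \<le> 2 * (2 * x * y powr (2 * H - 1))"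
    using 1 2 unfolding mult.assoc by linarith
  then show ?thesis using xy by (simp add: fbm_cov_def)
qed

context centred_fbm
begin

definition scale :: "nat \<Rightarrow> real" where "scale n = 2 powr (H * real n)"

text \<open>The factor by which the bound on correlations drops from one block to the next; below 1
  because \<open>H < 1\<close>.\<close>

definition \<rho> :: real where "\<rho> = 2 powr (- (1 - H))"

lemma scale_pos: "scale n > 0" and scale_ge_1: "scale n \<ge> 1"
  and scale_pow: "(2 ^ n) powr H = scale n"
  using H_gt by (auto simp: scale_def ge_one_powr_ge_zero powr_realpow[symmetric] powr_powr mult.commute)

lemma rho_bounds: "0 < \<rho>" "\<rho> < 1"
  using H_lt by (auto simp: \<rho>_def powr_less_one)

lemma rho_power: "\<rho> ^ k = 2 powr (- (1 - H) * real k)"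
  unfolding \<rho>_def by (subst powr_realpow[symmetric]) (simp_all add: powr_powr)

text \<open>With \<open>x\<close> of order \<open>2 ^ n\<close> and \<open>y\<close> of order
  \<open>2 ^ m\<close>, \<open>x * y powr (2 * H - 1)\<close> is of the order of the product of the
  two scales times \<open>2 powr (- (1 - H) * (m - n))\<close>. The constant 8 is 2 from
  \<open>fbm_cov_decay\<close> and 2 from each of the two ranges.\<close>

lemma cov_block_decay:
  assumes nm: "n < m" and x: "x \<in> {2 ^ n..2 * 2 ^ n}" and y: "y \<in> {2 ^ m..2 * 2 ^ m}"
  shows "\<bar>fbm_cov H x y\<bar> \<le> 8 * \<rho> ^ (m - n) * (scale n * scale m)"
proof -
  have x0: "x > 0" "y > 0" using x y by (auto intro: less_le_trans[of 0 "2 ^ n"] less_le_trans[of 0 "2 ^ m"])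
  have "x \<le> 2 * 2 ^ n" using x by simp
  also have "\<dots> = 2 ^ Suc n" by simp
  also have "\<dots> \<le> (2::real) ^ m" using nm by (intro power_increasing) auto
  finally have xy: "x \<le> y" using y by simp
  have "\<bar>fbm_cov H x y\<bar> = fbm_cov H x y" using fbm_cov_nonneg[of x y H] x0 H_gt by simp
  also have "\<dots> \<le> 2 * x * y powr (2 * H - 1)" by (rule fbm_cov_decay[OF x0(1) xy H_gt H_lt])
  also have "\<dots> \<le> 2 * (2 * 2 ^ n) * (2 * 2 powr ((2 * H - 1) * real m))"
  proof (intro mult_mono)
    have "y powr (2 * H - 1) \<le> (2 * 2 ^ m) powr (2 * H - 1)" using y x0 H_gt by (intro powr_mono2) auto
    also have "\<dots> = 2 powr (2 * H - 1) * 2 powr ((2 * H - 1) * real m)"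
      by (simp add: powr_mult powr_realpow[symmetric] powr_powr mult.commute)
    also have "\<dots> \<le> 2 powr 1 * 2 powr ((2 * H - 1) * real m)"
      using H_lt by (intro mult_right_mono powr_mono) auto
    finally show "y powr (2 * H - 1) \<le> 2 * 2 powr ((2 * H - 1) * real m)" by simp
  qed (use x in auto)
  also have "\<dots> = 8 * (2 powr real n * 2 powr ((2 * H - 1) * real m))" by (simp add: powr_realpow)
  also have "2 powr real n * 2 powr ((2 * H - 1) * real m) = \<rho> ^ (m - n) * (scale n * scale m)"
    unfolding rho_power scale_def powr_add[symmetric] using nm by (simp add: of_nat_diff algebra_simps)
  finally show ?thesis by simp
qed

lemma cov_block_bound:
  assumes x: "x \<in> {2 ^ n..2 * 2 ^ n}" and y: "y \<in> {2 ^ n..2 * 2 ^ n}"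
  shows "\<bar>fbm_cov H x y\<bar> \<le> 4 * (scale n)\<^sup>2" "(scale n)\<^sup>2 \<le> fbm_cov H x x"
proof -
  have p: "w powr (2 * H) \<le> 4 * (scale n)\<^sup>2" "(scale n)\<^sup>2 \<le> w powr (2 * H)" if w: "w \<in> {2 ^ n..2 * 2 ^ n}" for w
  proof -
    have w0: "w > 0" using w by (auto intro: less_le_trans[of 0 "2 ^ n"])
    have s2: "(scale n)\<^sup>2 = (2 ^ n) powr (2 * H)"
      unfolding scale_pow[symmetric] by (simp add: power2_eq_square powr_add[symmetric])
    have "w powr (2 * H) \<le> (2 * 2 ^ n) powr (2 * H)" using w w0 H_gt by (intro powr_mono2) auto
    also have "\<dots> = 2 powr (2 * H) * (scale n)\<^sup>2" by (simp add: powr_mult s2)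
    also have "\<dots> \<le> 2 powr 2 * (scale n)\<^sup>2" using H_lt by (intro mult_right_mono powr_mono) auto
    finally show "w powr (2 * H) \<le> 4 * (scale n)\<^sup>2" by simp
    show "(scale n)\<^sup>2 \<le> w powr (2 * H)" unfolding s2 using w H_gt by (intro powr_mono2) auto
  qed
  have x0: "x \<ge> 0" "y \<ge> 0" using x y by (auto intro: order_trans[of 0 "2 ^ n"])
  then show "\<bar>fbm_cov H x y\<bar> \<le> 4 * (scale n)\<^sup>2"
    using fbm_cov_nonneg[of x y H] fbm_cov_le_variances[of H x y] p(1)[OF x] p(1)[OF y] H_gt by auto
  show "(scale n)\<^sup>2 \<le> fbm_cov H x x" using p(2)[OF x] x0 by (simp add: fbm_cov_diag)
qed

context
  fixes J :: "real set"
  assumes J: "finite J" "J \<subseteq> {0..}"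
begin

lemma comb_indep_expectation:
  fixes f g :: "complex \<times> complex \<Rightarrow> real"
  assumes 0: "cov_form H J a1 b1 = 0" "cov_form H J a1 b2 = 0" "cov_form H J a2 b1 = 0" "cov_form H J a2 b2 = 0"
    and fg: "f \<in> borel_measurable borel" "g \<in> borel_measurable borel"
    and int: "integrable M (\<lambda>\<xi>. f (comb J a1 \<xi>, comb J a2 \<xi>))" "integrable M (\<lambda>\<xi>. g (comb J b1 \<xi>, comb J b2 \<xi>))"
  shows "integrable M (\<lambda>\<xi>. f (comb J a1 \<xi>, comb J a2 \<xi>) * g (comb J b1 \<xi>, comb J b2 \<xi>))"
    "expectation (\<lambda>\<xi>. f (comb J a1 \<xi>, comb J a2 \<xi>) * g (comb J b1 \<xi>, comb J b2 \<xi>))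
      = expectation (\<lambda>\<xi>. f (comb J a1 \<xi>, comb J a2 \<xi>)) * expectation (\<lambda>\<xi>. g (comb J b1 \<xi>, comb J b2 \<xi>))"
proof -
  have "indep_var borel (f \<circ> (\<lambda>\<xi>. (comb J a1 \<xi>, comb J a2 \<xi>))) borel (g \<circ> (\<lambda>\<xi>. (comb J b1 \<xi>, comb J b2 \<xi>)))"
    by (rule indep_var_compose[OF comb_indep[OF J 0] fg])
  then have ind: "indep_var borel (\<lambda>\<xi>. f (comb J a1 \<xi>, comb J a2 \<xi>)) borel (\<lambda>\<xi>. g (comb J b1 \<xi>, comb J b2 \<xi>))"
    by (simp add: comp_def)
  show "integrable M (\<lambda>\<xi>. f (comb J a1 \<xi>, comb J a2 \<xi>) * g (comb J b1 \<xi>, comb J b2 \<xi>))"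
    by (rule indep_var_integrable[OF ind int])
  show "expectation (\<lambda>\<xi>. f (comb J a1 \<xi>, comb J a2 \<xi>) * g (comb J b1 \<xi>, comb J b2 \<xi>))
      = expectation (\<lambda>\<xi>. f (comb J a1 \<xi>, comb J a2 \<xi>)) * expectation (\<lambda>\<xi>. g (comb J b1 \<xi>, comb J b2 \<xi>))"
    by (rule indep_var_lebesgue_integral[OF ind int])
qed

lemma comb_norm_moment:
  "integrable M (\<lambda>\<xi>. (norm (comb J a \<xi>))\<^sup>2)" "expectation (\<lambda>\<xi>. (norm (comb J a \<xi>))\<^sup>2) = 2 * cov_form H J a a"
  using comb_Re_moments[OF J, of a] comb_Im_moments[OF J, of a] by (simp_all add: cmod_power2)

lemma comb_norm_integrable:
  "integrable M (\<lambda>\<xi>. norm (comb J a \<xi>))"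
  "integrable M (\<lambda>\<xi>. norm (comb J a \<xi>) * norm (comb J c \<xi>))"
proof -
  have b: "x * y \<le> x\<^sup>2 + y\<^sup>2" if "x \<ge> 0" "y \<ge> 0" for x y :: real
    using sum_squares_bound[of x y] zero_le_power2[of x] zero_le_power2[of y] mult_nonneg_nonneg[OF that] by linarith
  show "integrable M (\<lambda>\<xi>. norm (comb J a \<xi>))"
  proof (rule Bochner_Integration.integrable_bound[of _ "\<lambda>\<xi>. 1 + (norm (comb J a \<xi>))\<^sup>2"])
    show "AE \<xi> in M. norm (norm (comb J a \<xi>)) \<le> norm (1 + (norm (comb J a \<xi>))\<^sup>2)"
      using b[of 1 "norm (comb J a _)"] by simp
  qed (use comb_norm_moment in auto)
  show "integrable M (\<lambda>\<xi>. norm (comb J a \<xi>) * norm (comb J c \<xi>))"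
  proof (rule Bochner_Integration.integrable_bound[of _ "\<lambda>\<xi>. (norm (comb J a \<xi>))\<^sup>2 + (norm (comb J c \<xi>))\<^sup>2"])
    show "AE \<xi> in M. norm (norm (comb J a \<xi>) * norm (comb J c \<xi>)) \<le> norm ((norm (comb J a \<xi>))\<^sup>2 + (norm (comb J c \<xi>))\<^sup>2)"
      using b[of "norm (comb J a _)" "norm (comb J c _)"] by (simp add: abs_mult)
  qed (use comb_norm_moment in auto)
qed

text \<open>Both increments are regressed on the pair of base points \<open>(P, Q)\<close>; the residuals are
  centred and independent of the pair, so only the residual covariance and the (small) cross
  coefficients contribute.\<close>

lemma increment_functional_covariance:
  fixes p Q d1 d2 :: "real \<Rightarrow> real" and \<phi>1 \<phi>2 :: "complex \<Rightarrow> complex"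
  assumes K: "1 \<le> K" and \<kappa>: "0 \<le> \<kappa>" "\<kappa> \<le> 1 / 2" and R: "0 \<le> R" and \<zeta>: "0 \<le> \<zeta>1" "0 \<le> \<zeta>2"
    and pp: "1 \<le> cov_form H J p p" "cov_form H J p p \<le> K"
    and QQ: "1 \<le> cov_form H J Q Q" "cov_form H J Q Q \<le> K"
    and pQ: "\<bar>cov_form H J p Q\<bar> \<le> \<kappa>" and d1Q: "\<bar>cov_form H J d1 Q\<bar> \<le> \<kappa>"
    and d2p: "\<bar>cov_form H J d2 p\<bar> \<le> \<kappa>" and d1d2: "\<bar>cov_form H J d1 d2\<bar> \<le> \<kappa>"
    and d1p: "\<bar>cov_form H J d1 p\<bar> \<le> K" and d2Q: "\<bar>cov_form H J d2 Q\<bar> \<le> K"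
    and [measurable]: "\<phi>1 \<in> borel_measurable borel" "\<phi>2 \<in> borel_measurable borel"
    and bnd: "\<And>w. norm (\<phi>1 w) \<le> R" "\<And>w. norm (\<phi>2 w) \<le> R"
    and im: "\<And>w. \<bar>Im (w * \<phi>1 w)\<bar> \<le> \<zeta>1 * R" "\<And>w. \<bar>Im (w * \<phi>2 w)\<bar> \<le> \<zeta>2 * R"
  shows "\<bar>expectation (\<lambda>\<xi>. Im (comb J d1 \<xi> * \<phi>1 (comb J p \<xi>)) * Im (comb J d2 \<xi> * \<phi>2 (comb J Q \<xi>)))\<bar>
    \<le> (6 * (2 * K\<^sup>2 + 2) * K * \<kappa> + (2 * K\<^sup>2 + 2)\<^sup>2 * (4 * K) * ((\<zeta>1 + \<kappa>) * (\<zeta>2 + \<kappa>))) * R\<^sup>2"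
proof -
  define A where "A = 2 * K\<^sup>2 + 2"
  define c where "c = cov_form H J p Q"
  \<comment> \<open>The Gram determinant of the base points: variances at least 1 and a covariance
    at most 1/2 keep it at least 3/4, whence the factors 4/3 below.\<close>
  define det where "det = cov_form H J p p * cov_form H J Q Q - c\<^sup>2"
  have K2: "K \<le> K\<^sup>2" using K by (simp add: power2_eq_square)
  have A: "A \<ge> 4" using K2 K by (simp add: A_def)
  have A3K: "3 * K \<le> A" using zero_le_power2[of "K - 1"] K by (simp add: A_def power2_eq_square algebra_simps)
  have c\<kappa>: "\<bar>c\<bar> \<le> \<kappa>" using pQ by (simp add: c_def)
  have "c\<^sup>2 \<le> \<kappa>\<^sup>2" using power_mono[OF c\<kappa>, of 2] by simp
  also have "\<dots> \<le> (1 / 2)\<^sup>2" using \<kappa> by (intro power_mono) auto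
  finally have c2: "c\<^sup>2 \<le> 1 / 4" by (simp add: power2_eq_square)
  have "1 * 1 \<le> cov_form H J p p * cov_form H J Q Q" using pp QQ by (intro mult_mono) auto
  then have det: "det \<ge> 3 / 4" using c2 by (simp add: det_def)
  \<comment> \<open>Cramer's rule for the normal equations. The bounds are kept asymmetric, so that
    the coefficient of the remote base point turns out to be of order
    \<open>\<kappa>\<close>.\<close>
  have reg: "\<exists>\<alpha> \<beta>. \<alpha> * cov_form H J p p + \<beta> * c = e1 \<and> \<alpha> * c + \<beta> * cov_form H J Q Q = e2 \<and>
      \<bar>\<alpha>\<bar> \<le> (4 / 3) * (\<bar>e1\<bar> * K + \<bar>e2\<bar> * \<kappa>) \<and> \<bar>\<beta>\<bar> \<le> (4 / 3) * (\<bar>e2\<bar> * K + \<bar>e1\<bar> * \<kappa>)" for e1 e2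
  proof (intro exI conjI)
    let ?\<alpha> = "(e1 * cov_form H J Q Q - e2 * c) / det" and ?\<beta> = "(e2 * cov_form H J p p - e1 * c) / det"
    have d0: "det \<noteq> 0" using det by linarith
    have "?\<alpha> * cov_form H J p p + ?\<beta> * c = (e1 * det) / det"
      unfolding add_divide_distrib[symmetric] times_divide_eq_left by (simp add: det_def algebra_simps power2_eq_square)
    then show "?\<alpha> * cov_form H J p p + ?\<beta> * c = e1" using d0 by simp
    have "?\<alpha> * c + ?\<beta> * cov_form H J Q Q = (e2 * det) / det"
      unfolding add_divide_distrib[symmetric] times_divide_eq_left by (simp add: det_def algebra_simps power2_eq_square)
    then show "?\<alpha> * c + ?\<beta> * cov_form H J Q Q = e2" using d0 by simp
    have dv: "\<bar>x / det\<bar> \<le> (4 / 3) * y" if "\<bar>x\<bar> \<le> y" for x y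
    proof -
      have "\<bar>x / det\<bar> = \<bar>x\<bar> / det" using det by simp
      also have "\<dots> \<le> y / (3 / 4)" using that det by (intro frac_le) auto
      finally show ?thesis by simp
    qed
    have "\<bar>e1 * cov_form H J Q Q - e2 * c\<bar> \<le> \<bar>e1\<bar> * cov_form H J Q Q + \<bar>e2\<bar> * \<bar>c\<bar>"
      using abs_triangle_ineq4[of "e1 * cov_form H J Q Q" "e2 * c"] QQ by (simp add: abs_mult)
    also have "\<dots> \<le> \<bar>e1\<bar> * K + \<bar>e2\<bar> * \<kappa>" using QQ c\<kappa> by (intro add_mono mult_left_mono) auto
    finally show "\<bar>?\<alpha>\<bar> \<le> (4 / 3) * (\<bar>e1\<bar> * K + \<bar>e2\<bar> * \<kappa>)" by (rule dv)
    have "\<bar>e2 * cov_form H J p p - e1 * c\<bar> \<le> \<bar>e2\<bar> * cov_form H J p p + \<bar>e1\<bar> * \<bar>c\<bar>"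
      using abs_triangle_ineq4[of "e2 * cov_form H J p p" "e1 * c"] pp by (simp add: abs_mult)
    also have "\<dots> \<le> \<bar>e2\<bar> * K + \<bar>e1\<bar> * \<kappa>" using pp c\<kappa> by (intro add_mono mult_left_mono) auto
    finally show "\<bar>?\<beta>\<bar> \<le> (4 / 3) * (\<bar>e2\<bar> * K + \<bar>e1\<bar> * \<kappa>)" by (rule dv)
  qed
  have small: "(4 / 3) * (e * K + e' * \<kappa>) \<le> A * \<kappa>" if "0 \<le> e" "e \<le> \<kappa>" "0 \<le> e'" "e' \<le> K" for e e'
  proof -
    have "e * K + e' * \<kappa> \<le> \<kappa> * K + K * \<kappa>" using that K \<kappa> by (intro add_mono mult_right_mono) auto
    then have "e * K + e' * \<kappa> \<le> 2 * (K * \<kappa>)" by (simp add: mult.commute)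
    moreover have "0 \<le> K * \<kappa>" using K \<kappa> by simp
    moreover have "(4 / 3) * X \<le> 3 * Y" if "X \<le> 2 * Y" "0 \<le> Y" for X Y :: real
      using that by linarith
    ultimately have "(4 / 3) * (e * K + e' * \<kappa>) \<le> 3 * (K * \<kappa>)" by blast
    then have "(4 / 3) * (e * K + e' * \<kappa>) \<le> (3 * K) * \<kappa>" by simp
    also have "\<dots> \<le> A * \<kappa>" using A3K \<kappa> by (intro mult_right_mono) auto
    finally show ?thesis .
  qed
  have large: "(4 / 3) * (e * K + e' * \<kappa>) \<le> A" if "0 \<le> e" "e \<le> K" "0 \<le> e'" "e' \<le> \<kappa>" for e e'
  proof -
    have "e * K + e' * \<kappa> \<le> K * K + (1 / 2) * (1 / 2)" using that K \<kappa> by (intro add_mono mult_mono) auto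
    then have "e * K + e' * \<kappa> \<le> K\<^sup>2 + 1 / 4" by (simp add: power2_eq_square)
    moreover have "(4 / 3) * X \<le> 2 * Y + 2" if "X \<le> Y + 1 / 4" "0 \<le> Y" for X Y :: real
      using that by linarith
    ultimately show ?thesis unfolding A_def using zero_le_power2[of K] by blast
  qed
  obtain \<alpha> \<beta> where ab: "\<alpha> * cov_form H J p p + \<beta> * c = cov_form H J d1 p" "\<alpha> * c + \<beta> * cov_form H J Q Q = cov_form H J d1 Q"
      "\<bar>\<alpha>\<bar> \<le> (4 / 3) * (\<bar>cov_form H J d1 p\<bar> * K + \<bar>cov_form H J d1 Q\<bar> * \<kappa>)"
      "\<bar>\<beta>\<bar> \<le> (4 / 3) * (\<bar>cov_form H J d1 Q\<bar> * K + \<bar>cov_form H J d1 p\<bar> * \<kappa>)"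
    using reg[of "cov_form H J d1 p" "cov_form H J d1 Q"] by blast
  have a: "\<bar>\<alpha>\<bar> \<le> A" "\<bar>\<beta>\<bar> \<le> A * \<kappa>"
    using order_trans[OF ab(3) large] order_trans[OF ab(4) small] d1p d1Q by auto
  obtain \<alpha>' \<beta>' where ab': "\<alpha>' * cov_form H J p p + \<beta>' * c = cov_form H J d2 p" "\<alpha>' * c + \<beta>' * cov_form H J Q Q = cov_form H J d2 Q"
      "\<bar>\<alpha>'\<bar> \<le> (4 / 3) * (\<bar>cov_form H J d2 p\<bar> * K + \<bar>cov_form H J d2 Q\<bar> * \<kappa>)"
      "\<bar>\<beta>'\<bar> \<le> (4 / 3) * (\<bar>cov_form H J d2 Q\<bar> * K + \<bar>cov_form H J d2 p\<bar> * \<kappa>)"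
    using reg[of "cov_form H J d2 p" "cov_form H J d2 Q"] by blast
  have a': "\<bar>\<alpha>'\<bar> \<le> A * \<kappa>" "\<bar>\<beta>'\<bar> \<le> A"
    using order_trans[OF ab'(3) small] order_trans[OF ab'(4) large] d2p d2Q by auto
  define z1 where "z1 = (\<lambda>t. d1 t - (\<alpha> * p t + \<beta> * Q t))"
  define z2 where "z2 = (\<lambda>t. d2 t - (\<alpha>' * p t + \<beta>' * Q t))"
  have Qp: "cov_form H J Q p = c" by (simp add: c_def cov_form_commute)
  have z0: "cov_form H J z1 p = 0" "cov_form H J z1 Q = 0" "cov_form H J z2 p = 0" "cov_form H J z2 Q = 0"
    using ab(1,2) ab'(1,2) by (simp_all add: z1_def z2_def cov_form_simps Qp c_def[symmetric])
  \<comment> \<open>The residuals are orthogonal to both base points, so their covariance can be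
    computed with one of them replaced by the original increment.\<close>
  define c12 where "c12 = cov_form H J z1 z2"
  have "c12 = cov_form H J z1 d2" unfolding c12_def z2_def by (simp add: cov_form_simps z0)
  also have "\<dots> = cov_form H J d1 d2 - (\<alpha> * cov_form H J d2 p + \<beta> * cov_form H J d2 Q)"
    unfolding z1_def by (simp add: cov_form_simps cov_form_commute[of _ _ p d2] cov_form_commute[of _ _ Q d2])
  finally have "\<bar>c12\<bar> \<le> \<bar>cov_form H J d1 d2\<bar> + (\<bar>\<alpha>\<bar> * \<bar>cov_form H J d2 p\<bar> + \<bar>\<beta>\<bar> * \<bar>cov_form H J d2 Q\<bar>)"
    using abs_triangle_ineq4[of "cov_form H J d1 d2" "\<alpha> * cov_form H J d2 p + \<beta> * cov_form H J d2 Q"]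
      abs_triangle_ineq[of "\<alpha> * cov_form H J d2 p" "\<beta> * cov_form H J d2 Q"] by (simp add: abs_mult)
  also have "\<dots> \<le> \<kappa> + (A * \<kappa> + (A * \<kappa>) * K)"
    using d1d2 d2p d2Q a A \<kappa> by (intro add_mono mult_mono) auto
  also have "\<dots> \<le> 3 * A * K * \<kappa>"
  proof -
    have "1 \<le> A * K" using A K mult_mono[of 1 A 1 K] by simp
    moreover have "A \<le> A * K" using A K by simp
    ultimately have "1 + (A + A * K) \<le> 3 * A * K" by simp
    then have "(1 + (A + A * K)) * \<kappa> \<le> (3 * A * K) * \<kappa>" using \<kappa> by (intro mult_right_mono) auto
    then show ?thesis by (simp add: algebra_simps)
  qed
  finally have c12: "\<bar>c12\<bar> \<le> 3 * A * K * \<kappa>" .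
  define P where "P = comb J p"
  define S where "S = comb J Q"
  define Z1 where "Z1 = comb J z1"
  define Z2 where "Z2 = comb J z2"
  have [measurable]: "P \<in> borel_measurable M" "S \<in> borel_measurable M" "Z1 \<in> borel_measurable M" "Z2 \<in> borel_measurable M"
    unfolding P_def S_def Z1_def Z2_def by measurable
  have D1: "comb J d1 \<xi> = (\<alpha> *\<^sub>R P \<xi> + \<beta> *\<^sub>R S \<xi>) + Z1 \<xi>" for \<xi>
    unfolding Z1_def z1_def P_def S_def by (simp add: comb_simps)
  have D2: "comb J d2 \<xi> = (\<alpha>' *\<^sub>R P \<xi> + \<beta>' *\<^sub>R S \<xi>) + Z2 \<xi>" for \<xi>
    unfolding Z2_def z2_def P_def S_def by (simp add: comb_simps)
  \<comment> \<open>\<open>u1\<close> and \<open>u2\<close> are the parts predicted by the base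
    points, \<open>v1\<close> and \<open>v2\<close> the parts carried by the independent
    residuals.\<close>
  define u1 where "u1 = (\<lambda>\<xi>. Im ((\<alpha> *\<^sub>R P \<xi> + \<beta> *\<^sub>R S \<xi>) * \<phi>1 (P \<xi>)))"
  define u2 where "u2 = (\<lambda>\<xi>. Im ((\<alpha>' *\<^sub>R P \<xi> + \<beta>' *\<^sub>R S \<xi>) * \<phi>2 (S \<xi>)))"
  define v1 where "v1 = (\<lambda>\<xi>. Re (Z1 \<xi>) * Im (\<phi>1 (P \<xi>)) + Im (Z1 \<xi>) * Re (\<phi>1 (P \<xi>)))"
  define v2 where "v2 = (\<lambda>\<xi>. Re (Z2 \<xi>) * Im (\<phi>2 (S \<xi>)) + Im (Z2 \<xi>) * Re (\<phi>2 (S \<xi>)))"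
  have [measurable]: "u1 \<in> borel_measurable M" "u2 \<in> borel_measurable M" unfolding u1_def u2_def by measurable
  have X1: "Im (comb J d1 \<xi> * \<phi>1 (P \<xi>)) = u1 \<xi> + v1 \<xi>" for \<xi>
    unfolding D1 u1_def v1_def by (simp add: algebra_simps)
  have X2: "Im (comb J d2 \<xi> * \<phi>2 (S \<xi>)) = u2 \<xi> + v2 \<xi>" for \<xi>
    unfolding D2 u2_def v2_def by (simp add: algebra_simps)
  have nP: "integrable M (\<lambda>\<xi>. (norm (P \<xi>))\<^sup>2)" "expectation (\<lambda>\<xi>. (norm (P \<xi>))\<^sup>2) \<le> 2 * K"
    "integrable M (\<lambda>\<xi>. (norm (S \<xi>))\<^sup>2)" "expectation (\<lambda>\<xi>. (norm (S \<xi>))\<^sup>2) \<le> 2 * K"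
    using comb_norm_moment[of p] comb_norm_moment[of Q] pp QQ by (auto simp: P_def S_def)
  have nP1: "integrable M (\<lambda>\<xi>. norm (P \<xi>))" "integrable M (\<lambda>\<xi>. norm (S \<xi>))"
    using comb_norm_integrable(1)[of p] comb_norm_integrable(1)[of Q] by (auto simp: P_def S_def)
  \<comment> \<open>The large coefficient multiplies the increment's own base point, where
    \<open>Im (w * \<phi>)\<close> is at most \<open>\<zeta> * R\<close>; the other base point comes
    with a coefficient of order \<open>\<kappa>\<close>. This is the place where taking the
    imaginary part is essential.\<close>
  have ub: "\<bar>Im ((x *\<^sub>R w + y *\<^sub>R w') * \<phi>)\<bar> \<le> A * R * (\<zeta> + \<kappa> * norm w')"
    if xy: "\<bar>x\<bar> \<le> A" "\<bar>y\<bar> \<le> A * \<kappa>" and i: "\<bar>Im (w * \<phi>)\<bar> \<le> \<zeta> * R" and b: "norm \<phi> \<le> R" for x y \<zeta> w w' \<phi>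
  proof -
    have "Im ((x *\<^sub>R w + y *\<^sub>R w') * \<phi>) = x * Im (w * \<phi>) + y * Im (w' * \<phi>)" by (simp add: algebra_simps)
    then have "\<bar>Im ((x *\<^sub>R w + y *\<^sub>R w') * \<phi>)\<bar> \<le> \<bar>x\<bar> * \<bar>Im (w * \<phi>)\<bar> + \<bar>y\<bar> * \<bar>Im (w' * \<phi>)\<bar>"
      by (metis abs_mult abs_triangle_ineq)
    also have "\<dots> \<le> A * (\<zeta> * R) + (A * \<kappa>) * (norm w' * R)"
    proof (intro add_mono mult_mono xy i)
      have "\<bar>Im (w' * \<phi>)\<bar> \<le> norm (w' * \<phi>)" by (rule abs_Im_le_cmod)
      also have "\<dots> \<le> norm w' * R" unfolding norm_mult by (intro mult_left_mono b) auto
      finally show "\<bar>Im (w' * \<phi>)\<bar> \<le> norm w' * R" .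
    qed (use A \<kappa> in auto)
    finally show ?thesis by (simp add: algebra_simps)
  qed
  have u1b: "\<bar>u1 \<xi>\<bar> \<le> A * R * (\<zeta>1 + \<kappa> * norm (S \<xi>))" for \<xi>
    unfolding u1_def by (rule ub[OF a im(1) bnd(1)])
  have u2b: "\<bar>u2 \<xi>\<bar> \<le> A * R * (\<zeta>2 + \<kappa> * norm (P \<xi>))" for \<xi>
    unfolding u2_def add.commute[of "\<alpha>' *\<^sub>R P \<xi>"] by (rule ub[OF a'(2,1) im(2) bnd(2)])
  define T where "T = (A * R)\<^sup>2 * (4 * K) * ((\<zeta>1 + \<kappa>) * (\<zeta>2 + \<kappa>))"
  have u12b: "\<bar>u1 \<xi> * u2 \<xi>\<bar> \<le> (A * R)\<^sup>2 * ((\<zeta>1 + \<kappa> * norm (S \<xi>)) * (\<zeta>2 + \<kappa> * norm (P \<xi>)))" for \<xi>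
  proof -
    have "\<bar>u1 \<xi> * u2 \<xi>\<bar> \<le> (A * R * (\<zeta>1 + \<kappa> * norm (S \<xi>))) * (A * R * (\<zeta>2 + \<kappa> * norm (P \<xi>)))"
      unfolding abs_mult using A R \<zeta> \<kappa> by (intro mult_mono u1b u2b) auto
    then show ?thesis by (simp add: power2_eq_square algebra_simps)
  qed
  define k where "k = (\<lambda>\<xi>. (A * R)\<^sup>2 * (\<zeta>1 * \<zeta>2 + \<zeta>1 * \<kappa> * (1 + (norm (P \<xi>))\<^sup>2) + \<kappa> * \<zeta>2 * (1 + (norm (S \<xi>))\<^sup>2)
     + \<kappa> * \<kappa> * ((norm (P \<xi>))\<^sup>2 + (norm (S \<xi>))\<^sup>2)))"
  have u12k: "\<bar>u1 \<xi> * u2 \<xi>\<bar> \<le> k \<xi>" for \<xi>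
  proof -
    have b: "x * y \<le> x\<^sup>2 + y\<^sup>2" if "x \<ge> 0" "y \<ge> 0" for x y :: real
      using sum_squares_bound[of x y] zero_le_power2[of x] zero_le_power2[of y] mult_nonneg_nonneg[OF that] by linarith
    have "(\<zeta>1 + \<kappa> * norm (S \<xi>)) * (\<zeta>2 + \<kappa> * norm (P \<xi>))
      = \<zeta>1 * \<zeta>2 + \<zeta>1 * \<kappa> * norm (P \<xi>) + \<kappa> * \<zeta>2 * norm (S \<xi>) + \<kappa> * \<kappa> * (norm (P \<xi>) * norm (S \<xi>))"
      by (simp add: algebra_simps)
    also have "\<dots> \<le> \<zeta>1 * \<zeta>2 + \<zeta>1 * \<kappa> * (1 + (norm (P \<xi>))\<^sup>2) + \<kappa> * \<zeta>2 * (1 + (norm (S \<xi>))\<^sup>2)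
     + \<kappa> * \<kappa> * ((norm (P \<xi>))\<^sup>2 + (norm (S \<xi>))\<^sup>2)"
      using b[of 1 "norm (P \<xi>)"] b[of 1 "norm (S \<xi>)"] b[of "norm (P \<xi>)" "norm (S \<xi>)"] \<zeta> \<kappa>
      by (intro add_mono mult_left_mono order.refl) auto
    finally show ?thesis using order_trans[OF u12b mult_left_mono] unfolding k_def by auto
  qed
  have ik: "integrable M k" unfolding k_def using nP
    by (intro integrable_mult_right Bochner_Integration.integrable_add integrable_const)
  have iu12: "integrable M (\<lambda>\<xi>. u1 \<xi> * u2 \<xi>)"
    by (rule Bochner_Integration.integrable_bound[OF ik]) (use u12k in \<open>auto intro: order_trans[OF _ abs_ge_self]\<close>)
  have Ek: "expectation k \<le> T"
  proof -
    have "expectation k = (A * R)\<^sup>2 * (\<zeta>1 * \<zeta>2 + \<zeta>1 * \<kappa> * (1 + expectation (\<lambda>\<xi>. (norm (P \<xi>))\<^sup>2)) + \<kappa> * \<zeta>2 * (1 + expectation (\<lambda>\<xi>. (norm (S \<xi>))\<^sup>2))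
     + \<kappa> * \<kappa> * (expectation (\<lambda>\<xi>. (norm (P \<xi>))\<^sup>2) + expectation (\<lambda>\<xi>. (norm (S \<xi>))\<^sup>2)))"
      unfolding k_def using nP by (simp add: prob_space)
    also have "\<dots> \<le> (A * R)\<^sup>2 * (\<zeta>1 * \<zeta>2 * (4 * K) + \<zeta>1 * \<kappa> * (4 * K) + \<kappa> * \<zeta>2 * (4 * K) + \<kappa> * \<kappa> * (4 * K))"
    proof (intro mult_left_mono add_mono)
      show "\<zeta>1 * \<zeta>2 \<le> \<zeta>1 * \<zeta>2 * (4 * K)" using mult_left_mono[of 1 "4 * K" "\<zeta>1 * \<zeta>2"] mult_nonneg_nonneg[OF \<zeta>] K by simp
    qed (use nP K \<zeta> \<kappa> in auto)
    also have "\<dots> = T" unfolding T_def by (simp add: algebra_simps)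
    finally show ?thesis .
  qed
  have E1: "\<bar>expectation (\<lambda>\<xi>. u1 \<xi> * u2 \<xi>)\<bar> \<le> T"
  proof -
    have "\<bar>expectation (\<lambda>\<xi>. u1 \<xi> * u2 \<xi>)\<bar> \<le> expectation (\<lambda>\<xi>. \<bar>u1 \<xi> * u2 \<xi>\<bar>)"
      by (rule integral_abs_bound)
    also have "\<dots> \<le> expectation k" using iu12 ik u12k by (intro integral_mono) auto
    finally show ?thesis using Ek by linarith
  qed
  have ipR: "integrable M (\<lambda>\<xi>. Re (Z1 \<xi>))" "integrable M (\<lambda>\<xi>. Im (Z1 \<xi>))" "integrable M (\<lambda>\<xi>. Re (Z2 \<xi>))" "integrable M (\<lambda>\<xi>. Im (Z2 \<xi>))"
    "expectation (\<lambda>\<xi>. Re (Z1 \<xi>)) = 0" "expectation (\<lambda>\<xi>. Im (Z1 \<xi>)) = 0" "expectation (\<lambda>\<xi>. Re (Z2 \<xi>)) = 0" "expectation (\<lambda>\<xi>. Im (Z2 \<xi>)) = 0"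
    using comb_Re_moments[OF J, of z1] comb_Im_moments[OF J, of z1] comb_Re_moments[OF J, of z2] comb_Im_moments[OF J, of z2]
    by (auto simp: Z1_def Z2_def)
  note ind = comb_indep_expectation[OF z0, folded P_def S_def Z1_def Z2_def]
  have ibd: "integrable M (\<lambda>\<xi>. u \<xi> * f \<xi>)" if [measurable]: "u \<in> borel_measurable M" "f \<in> borel_measurable M"
    and b: "\<And>\<xi>. \<bar>u \<xi>\<bar> \<le> A * R * (\<zeta> + \<kappa> * norm (V \<xi>))" "\<And>\<xi>. \<bar>f \<xi>\<bar> \<le> R" and \<zeta>: "0 \<le> \<zeta>" and V: "integrable M (\<lambda>\<xi>. norm (V \<xi>))"
    for u f and V :: "'a \<Rightarrow> complex" and \<zeta>
  proof -
    have "\<bar>u \<xi> * f \<xi>\<bar> \<le> (A * R * (\<zeta> + \<kappa> * norm (V \<xi>))) * R" for \<xi>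
      unfolding abs_mult using A R \<zeta> \<kappa> by (intro mult_mono b) auto
    then have bound: "AE \<xi> in M. norm (u \<xi> * f \<xi>) \<le> norm ((A * R * (\<zeta> + \<kappa> * norm (V \<xi>))) * R)"
      by (intro AE_I2) (simp only: real_norm_def, rule order_trans[OF _ abs_ge_self])
    have int: "integrable M (\<lambda>\<xi>. (A * R * (\<zeta> + \<kappa> * norm (V \<xi>))) * R)"
      by (intro integrable_mult_left integrable_mult_right Bochner_Integration.integrable_add integrable_const V)
    show ?thesis by (rule Bochner_Integration.integrable_bound[OF int _ bound]) measurable
  qed
  have iu1: "integrable M (\<lambda>\<xi>. u1 \<xi> * f (S \<xi>))" and iu2: "integrable M (\<lambda>\<xi>. u2 \<xi> * f (P \<xi>))"
    if [measurable]: "f \<in> borel_measurable borel" and fb: "\<And>w. \<bar>f w\<bar> \<le> R" for f :: "complex \<Rightarrow> real"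
    by (rule ibd[OF _ _ u1b fb \<zeta>(1) nP1(2)]; measurable) (rule ibd[OF _ _ u2b fb \<zeta>(2) nP1(1)]; measurable)
  have fbs: "\<bar>Re (\<phi>1 w)\<bar> \<le> R" "\<bar>Im (\<phi>1 w)\<bar> \<le> R" "\<bar>Re (\<phi>2 w)\<bar> \<le> R" "\<bar>Im (\<phi>2 w)\<bar> \<le> R" for w
    using order_trans[OF abs_Re_le_cmod bnd(1)] order_trans[OF abs_Im_le_cmod bnd(1)]
      order_trans[OF abs_Re_le_cmod bnd(2)] order_trans[OF abs_Im_le_cmod bnd(2)] by auto
  have u1m: "(\<lambda>x. Im ((\<alpha> *\<^sub>R fst x + \<beta> *\<^sub>R snd x) * \<phi>1 (fst x)) * f (snd x)) \<in> borel_measurable borel"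
    and u2m: "(\<lambda>x. Im ((\<alpha>' *\<^sub>R fst x + \<beta>' *\<^sub>R snd x) * \<phi>2 (snd x)) * f (fst x)) \<in> borel_measurable borel"
    if [measurable]: "f \<in> borel_measurable borel" for f :: "complex \<Rightarrow> real"
    unfolding borel_prod[symmetric] by measurable
  have zm: "(\<lambda>x. Re (fst x)) \<in> borel_measurable (borel :: (complex \<times> complex) measure)"
    "(\<lambda>x. Im (fst x)) \<in> borel_measurable (borel :: (complex \<times> complex) measure)"
    "(\<lambda>x. Re (snd x)) \<in> borel_measurable (borel :: (complex \<times> complex) measure)"
    "(\<lambda>x. Im (snd x)) \<in> borel_measurable (borel :: (complex \<times> complex) measure)"
    unfolding borel_prod[symmetric] by measurable
  have mRI: "(\<lambda>w. Re (\<phi>1 w)) \<in> borel_measurable borel" "(\<lambda>w. Im (\<phi>1 w)) \<in> borel_measurable borel"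
    "(\<lambda>w. Re (\<phi>2 w)) \<in> borel_measurable borel" "(\<lambda>w. Im (\<phi>2 w)) \<in> borel_measurable borel" by measurable
  \<comment> \<open>A residual factor is centred and independent of everything built from the base
    points, so the mixed products have mean zero.\<close>
  have E2: "integrable M (\<lambda>\<xi>. u1 \<xi> * v2 \<xi>) \<and> expectation (\<lambda>\<xi>. u1 \<xi> * v2 \<xi>) = 0"
  proof -
    have e: "(\<lambda>\<xi>. u1 \<xi> * v2 \<xi>) = (\<lambda>\<xi>. Re (Z2 \<xi>) * (u1 \<xi> * Im (\<phi>2 (S \<xi>))) + Im (Z2 \<xi>) * (u1 \<xi> * Re (\<phi>2 (S \<xi>))))"
      by (simp add: v2_def algebra_simps fun_eq_iff)
    note i1 = ind[OF zm(3) u1m[OF mRI(4)], unfolded fst_conv snd_conv, OF ipR(3) iu1[OF mRI(4) fbs(4), unfolded u1_def]]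
    note i2 = ind[OF zm(4) u1m[OF mRI(3)], unfolded fst_conv snd_conv, OF ipR(4) iu1[OF mRI(3) fbs(3), unfolded u1_def]]
    show ?thesis unfolding e using i1 i2 ipR by (simp add: u1_def)
  qed
  have E3: "integrable M (\<lambda>\<xi>. v1 \<xi> * u2 \<xi>) \<and> expectation (\<lambda>\<xi>. v1 \<xi> * u2 \<xi>) = 0"
  proof -
    have e: "(\<lambda>\<xi>. v1 \<xi> * u2 \<xi>) = (\<lambda>\<xi>. Re (Z1 \<xi>) * (u2 \<xi> * Im (\<phi>1 (P \<xi>))) + Im (Z1 \<xi>) * (u2 \<xi> * Re (\<phi>1 (P \<xi>))))"
      by (simp add: v1_def algebra_simps fun_eq_iff)
    note i1 = ind[OF zm(1) u2m[OF mRI(2)], unfolded fst_conv snd_conv, OF ipR(1) iu2[OF mRI(2) fbs(2), unfolded u2_def]]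
    note i2 = ind[OF zm(2) u2m[OF mRI(1)], unfolded fst_conv snd_conv, OF ipR(2) iu2[OF mRI(1) fbs(1), unfolded u2_def]]
    show ?thesis unfolding e using i1 i2 ipR by (simp add: u2_def)
  qed
  have zz: "integrable M (\<lambda>\<xi>. Re (Z1 \<xi>) * Re (Z2 \<xi>))" "expectation (\<lambda>\<xi>. Re (Z1 \<xi>) * Re (Z2 \<xi>)) = c12"
    "integrable M (\<lambda>\<xi>. Im (Z1 \<xi>) * Im (Z2 \<xi>))" "expectation (\<lambda>\<xi>. Im (Z1 \<xi>) * Im (Z2 \<xi>)) = c12"
    "integrable M (\<lambda>\<xi>. Re (Z1 \<xi>) * Im (Z2 \<xi>))" "expectation (\<lambda>\<xi>. Re (Z1 \<xi>) * Im (Z2 \<xi>)) = 0"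
    "integrable M (\<lambda>\<xi>. Im (Z1 \<xi>) * Re (Z2 \<xi>))" "expectation (\<lambda>\<xi>. Im (Z1 \<xi>) * Re (Z2 \<xi>)) = 0"
    using comb_products[OF J, of z1 z2] comb_products[OF J, of z2 z1] by (simp_all add: Z1_def Z2_def c12_def mult.commute)
  \<comment> \<open>The four products of residual coordinates factor from the bounded functions of
    the base points; only the two with equal coordinates can have nonzero mean, \<open>c12\<close>
    each.\<close>
  have E4: "integrable M (\<lambda>\<xi>. v1 \<xi> * v2 \<xi>) \<and> \<bar>expectation (\<lambda>\<xi>. v1 \<xi> * v2 \<xi>)\<bar> \<le> 2 * \<bar>c12\<bar> * R\<^sup>2"
  proof -
    have prod: "integrable M (\<lambda>\<xi>. (f1 (Z1 \<xi>) * f2 (Z2 \<xi>)) * (g1 (P \<xi>) * g2 (S \<xi>))) \<and>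
       expectation (\<lambda>\<xi>. (f1 (Z1 \<xi>) * f2 (Z2 \<xi>)) * (g1 (P \<xi>) * g2 (S \<xi>))) = expectation (\<lambda>\<xi>. f1 (Z1 \<xi>) * f2 (Z2 \<xi>)) * expectation (\<lambda>\<xi>. g1 (P \<xi>) * g2 (S \<xi>))
       \<and> \<bar>expectation (\<lambda>\<xi>. g1 (P \<xi>) * g2 (S \<xi>))\<bar> \<le> R\<^sup>2"
      if [measurable]: "f1 \<in> borel_measurable borel" "f2 \<in> borel_measurable borel" "g1 \<in> borel_measurable borel" "g2 \<in> borel_measurable borel"
        and i: "integrable M (\<lambda>\<xi>. f1 (Z1 \<xi>) * f2 (Z2 \<xi>))" and gb: "\<And>w. \<bar>g1 w\<bar> \<le> R" "\<And>w. \<bar>g2 w\<bar> \<le> R"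
      for f1 f2 g1 g2 :: "complex \<Rightarrow> real"
    proof -
      have fm: "(\<lambda>x. f1 (fst x) * f2 (snd x)) \<in> borel_measurable borel" "(\<lambda>x. g1 (fst x) * g2 (snd x)) \<in> borel_measurable borel"
        unfolding borel_prod[symmetric] by measurable
      have gg: "\<bar>g1 w * g2 w'\<bar> \<le> R\<^sup>2" for w w'
        unfolding abs_mult power2_eq_square using R by (intro mult_mono gb) auto
      have ig: "integrable M (\<lambda>\<xi>. g1 (P \<xi>) * g2 (S \<xi>))"
        by (rule integrable_const_bound[where B="R\<^sup>2"]) (use gg in auto)
      have "\<bar>expectation (\<lambda>\<xi>. g1 (P \<xi>) * g2 (S \<xi>))\<bar> \<le> expectation (\<lambda>\<xi>. R\<^sup>2)"
        by (rule order_trans[OF integral_abs_bound integral_mono]) (use gg ig in auto)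
      then show ?thesis using ind[OF fm, unfolded fst_conv snd_conv, OF i ig] by (simp add: prob_space)
    qed
    have e: "(\<lambda>\<xi>. v1 \<xi> * v2 \<xi>) = (\<lambda>\<xi>. (Re (Z1 \<xi>) * Re (Z2 \<xi>)) * (Im (\<phi>1 (P \<xi>)) * Im (\<phi>2 (S \<xi>)))
       + (Im (Z1 \<xi>) * Im (Z2 \<xi>)) * (Re (\<phi>1 (P \<xi>)) * Re (\<phi>2 (S \<xi>)))
       + ((Re (Z1 \<xi>) * Im (Z2 \<xi>)) * (Im (\<phi>1 (P \<xi>)) * Re (\<phi>2 (S \<xi>)))
       + (Im (Z1 \<xi>) * Re (Z2 \<xi>)) * (Re (\<phi>1 (P \<xi>)) * Im (\<phi>2 (S \<xi>)))))"
      by (simp add: v1_def v2_def algebra_simps fun_eq_iff)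
    have RI: "Re \<in> borel_measurable borel" "Im \<in> borel_measurable borel" by measurable
    note p1 = prod[OF RI(1) RI(1) mRI(2) mRI(4) zz(1) fbs(2) fbs(4), unfolded zz]
    note p2 = prod[OF RI(2) RI(2) mRI(1) mRI(3) zz(3) fbs(1) fbs(3), unfolded zz]
    note p3 = prod[OF RI(1) RI(2) mRI(2) mRI(3) zz(5) fbs(2) fbs(3), unfolded zz]
    note p4 = prod[OF RI(2) RI(1) mRI(1) mRI(4) zz(7) fbs(1) fbs(4), unfolded zz]
    have "expectation (\<lambda>\<xi>. v1 \<xi> * v2 \<xi>) = c12 * expectation (\<lambda>\<xi>. Im (\<phi>1 (P \<xi>)) * Im (\<phi>2 (S \<xi>)))
       + c12 * expectation (\<lambda>\<xi>. Re (\<phi>1 (P \<xi>)) * Re (\<phi>2 (S \<xi>)))"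
      unfolding e using p1 p2 p3 p4 by simp
    also have "\<bar>\<dots>\<bar> \<le> \<bar>c12\<bar> * R\<^sup>2 + \<bar>c12\<bar> * R\<^sup>2"
      using p1 p2 by (intro order_trans[OF abs_triangle_ineq] add_mono) (auto simp: abs_mult intro!: mult_left_mono)
    finally have "\<bar>expectation (\<lambda>\<xi>. v1 \<xi> * v2 \<xi>)\<bar> \<le> 2 * \<bar>c12\<bar> * R\<^sup>2" by simp
    moreover have "integrable M (\<lambda>\<xi>. v1 \<xi> * v2 \<xi>)" unfolding e using p1 p2 p3 p4 by simp
    ultimately show ?thesis by blast
  qed
  have "expectation (\<lambda>\<xi>. Im (comb J d1 \<xi> * \<phi>1 (P \<xi>)) * Im (comb J d2 \<xi> * \<phi>2 (S \<xi>)))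
    = expectation (\<lambda>\<xi>. u1 \<xi> * u2 \<xi> + u1 \<xi> * v2 \<xi> + v1 \<xi> * u2 \<xi> + v1 \<xi> * v2 \<xi>)"
    unfolding X1 X2 by (simp add: algebra_simps)
  also have "\<dots> = expectation (\<lambda>\<xi>. u1 \<xi> * u2 \<xi>) + expectation (\<lambda>\<xi>. v1 \<xi> * v2 \<xi>)"
    using iu12 E2 E3 E4 by simp
  finally have "\<bar>expectation (\<lambda>\<xi>. Im (comb J d1 \<xi> * \<phi>1 (P \<xi>)) * Im (comb J d2 \<xi> * \<phi>2 (S \<xi>)))\<bar> \<le> T + 2 * \<bar>c12\<bar> * R\<^sup>2"
    using E1 E4 by linarith
  also have "\<dots> \<le> T + 2 * (3 * A * K * \<kappa>) * R\<^sup>2" using c12 by (intro add_left_mono mult_right_mono mult_left_mono) auto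
  also have "\<dots> = (6 * A * K * \<kappa> + A\<^sup>2 * (4 * K) * ((\<zeta>1 + \<kappa>) * (\<zeta>2 + \<kappa>))) * R\<^sup>2"
    unfolding T_def by (simp add: power_mult_distrib algebra_simps)
  finally show ?thesis unfolding A_def P_def S_def .
qed

end

end

section \<open>Winding over the blocks\<close>

text \<open>A regularised reciprocal, close to \<open>1 / w\<close> for \<open>w\<close> large
  against \<open>\<epsilon>\<close> and bounded near 0. Keeping it a positive multiple of
  \<open>cnj w\<close> makes \<open>w * trunc_inv \<epsilon> w\<close> real.\<close>

definition trunc_inv :: "real \<Rightarrow> complex \<Rightarrow> complex" where
  "trunc_inv \<epsilon> w = cnj w / of_real ((norm w)\<^sup>2 + \<epsilon>\<^sup>2)"

lemma trunc_inv_measurable[measurable]: "trunc_inv \<epsilon> \<in> borel_measurable borel"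
proof -
  have "cnj \<in> borel_measurable borel" by (intro borel_measurable_continuous_onI continuous_intros)
  then show ?thesis unfolding trunc_inv_def by measurable
qed

lemma trunc_inv_norm: "\<epsilon> > 0 \<Longrightarrow> norm (trunc_inv \<epsilon> w) \<le> 1 / (2 * \<epsilon>)"
proof -
  assume \<epsilon>: "\<epsilon> > 0"
  have "2 * norm w * \<epsilon> \<le> (norm w)\<^sup>2 + \<epsilon>\<^sup>2" by (rule sum_squares_bound)
  moreover have "(norm w)\<^sup>2 + \<epsilon>\<^sup>2 > 0" using \<epsilon> by (simp add: add_nonneg_pos)
  moreover have "norm (trunc_inv \<epsilon> w) = norm w / ((norm w)\<^sup>2 + \<epsilon>\<^sup>2)"
    using \<epsilon> by (simp add: trunc_inv_def norm_divide del: of_real_add of_real_power)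
  ultimately show ?thesis using \<epsilon> by (simp add: pos_divide_le_eq pos_le_divide_eq mult_ac)
qed

lemma trunc_inv_Im_cancel: "Im (w * trunc_inv \<epsilon> w) = 0"
proof -
  have "w * trunc_inv \<epsilon> w = of_real ((norm w)\<^sup>2 / ((norm w)\<^sup>2 + \<epsilon>\<^sup>2))"
    unfolding trunc_inv_def of_real_divide complex_norm_square[symmetric] times_divide_eq_right ..
  then show ?thesis by simp
qed

text \<open>The path starts at \<open>z\<close>, so the base value is \<open>z + w\<close> while
  increments are regressed on \<open>w\<close> alone. The cancellation at \<open>z + w\<close>
  leaves only a term in \<open>z\<close>, which becomes negligible after rescaling.\<close>

lemma trunc_inv_Im_bound: "\<epsilon> > 0 \<Longrightarrow> \<bar>Im (w * trunc_inv \<epsilon> (z + w))\<bar> \<le> norm z * (1 / (2 * \<epsilon>))"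
proof -
  assume \<epsilon>: "\<epsilon> > 0"
  have "Im (w * trunc_inv \<epsilon> (z + w)) = - Im (z * trunc_inv \<epsilon> (z + w))"
    using trunc_inv_Im_cancel[of "z + w" \<epsilon>] by (simp add: distrib_right del: times_complex.sel)
  then have "\<bar>Im (w * trunc_inv \<epsilon> (z + w))\<bar> \<le> norm (z * trunc_inv \<epsilon> (z + w))"
    by (metis abs_Im_le_cmod abs_minus_cancel)
  also have "\<dots> \<le> norm z * (1 / (2 * \<epsilon>))" unfolding norm_mult by (intro mult_left_mono trunc_inv_norm \<epsilon>) auto
  finally show ?thesis .
qed

text \<open>With \<open>x = norm w\<close> the error is exactly
  \<open>\<epsilon>\<^sup>2 / (x\<^sup>2 + \<epsilon>\<^sup>2) / x\<close>. Bounding the first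
  quotient by the power \<open>p - 1\<close> of \<open>\<epsilon> / x\<close>, and not by its
  square, keeps the negative power of \<open>x\<close> below order 2.\<close>

lemma trunc_inv_error:
  assumes \<epsilon>: "\<epsilon> > 0" and w: "w \<noteq> 0" and p: "1 < p" "p < 2"
  shows "norm (1 / w - trunc_inv \<epsilon> w) \<le> \<epsilon> powr (p - 1) * norm w powr (- p)"
proof -
  define x where "x = norm w"
  have x: "x > 0" using w by (simp add: x_def)
  have s: "x\<^sup>2 + \<epsilon>\<^sup>2 > 0" using \<epsilon> by (simp add: add_nonneg_pos)
  have cx: "cnj w = of_real (x\<^sup>2) / w" using w unfolding x_def complex_norm_square by simp
  have "1 / w - trunc_inv \<epsilon> w = of_real (\<epsilon>\<^sup>2 / (x\<^sup>2 + \<epsilon>\<^sup>2)) / w"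
  proof -
    have "of_real (x\<^sup>2 + \<epsilon>\<^sup>2) \<noteq> (0::complex)" using s by (metis less_irrefl of_real_eq_0_iff)
    then have "1 / w - trunc_inv \<epsilon> w = (of_real (x\<^sup>2 + \<epsilon>\<^sup>2) - of_real (x\<^sup>2)) / (w * of_real (x\<^sup>2 + \<epsilon>\<^sup>2))"
      using w unfolding trunc_inv_def cx x_def[symmetric] by (simp add: field_simps del: of_real_add of_real_power)
    then show ?thesis by (simp add: mult.commute)
  qed
  then have e: "norm (1 / w - trunc_inv \<epsilon> w) = \<epsilon>\<^sup>2 / (x\<^sup>2 + \<epsilon>\<^sup>2) / x"
    using s by (simp add: norm_divide x_def del: of_real_add of_real_power of_real_divide)
  have "\<epsilon>\<^sup>2 / (x\<^sup>2 + \<epsilon>\<^sup>2) \<le> (\<epsilon> / x) powr (p - 1)"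
  proof (cases "\<epsilon> \<le> x")
    case True
    have "\<epsilon>\<^sup>2 / (x\<^sup>2 + \<epsilon>\<^sup>2) \<le> \<epsilon>\<^sup>2 / x\<^sup>2" using x by (intro divide_left_mono) (auto intro!: mult_pos_pos simp: s)
    also have "\<dots> = (\<epsilon> / x) powr 2" using \<epsilon> x by (simp add: powr_numeral power_divide)
    also have "\<dots> \<le> (\<epsilon> / x) powr (p - 1)" using True \<epsilon> x p by (intro powr_mono') auto
    finally show ?thesis .
  next
    case False
    have "\<epsilon>\<^sup>2 / (x\<^sup>2 + \<epsilon>\<^sup>2) \<le> 1" using s by simp
    also have "\<dots> \<le> (\<epsilon> / x) powr (p - 1)" using False \<epsilon> x p by (intro ge_one_powr_ge_zero) auto
    finally show ?thesis .
  qed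
  then have "norm (1 / w - trunc_inv \<epsilon> w) \<le> (\<epsilon> / x) powr (p - 1) / x" unfolding e using x by (intro divide_right_mono) auto
  also have "\<dots> = \<epsilon> powr (p - 1) * x powr (- p)"
  proof -
    have "x powr (- p) = 1 / x powr (p - 1) / x" using x by (simp add: powr_minus_divide powr_diff)
    then show ?thesis by (simp add: powr_divide)
  qed
  finally show ?thesis by (simp add: x_def)
qed

lemma level_mono: "n \<le> m \<Longrightarrow> level n \<le> level m"
  unfolding level_def by (intro nat_mono floor_mono divide_right_mono) auto

lemma level_pow4: "(2 ^ level m) ^ 4 \<le> (real m + 1) powr (1 / 4)"
proof -
  have "(2 ^ level m) ^ 4 \<le> ((real m + 1) powr (1 / 16)) ^ 4" by (intro power_mono level_le) auto
  also have "\<dots> = ((real m + 1) powr (1 / 16)) powr (real 4)" by (rule powr_realpow[symmetric]) simp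
  also have "\<dots> = (real m + 1) powr (1 / 4)" by (simp add: powr_powr)
  finally show ?thesis .
qed

context centred_fbm
begin

section \<open>Truncated Riemann sums and their correlations\<close>

lemma grid_in_block: "k \<le> 2 ^ i \<Longrightarrow> grid n i k \<in> {2 ^ n..2 * 2 ^ n}"
proof -
  assume "k \<le> 2 ^ i"
  then have "real k \<le> 2 ^ i" by (metis numeral_power_eq_of_nat_cancel_iff of_nat_le_iff)
  then have "2 ^ n * real k / 2 ^ i \<le> 2 ^ n * 2 ^ i / 2 ^ i" by (intro divide_right_mono mult_left_mono) auto
  then show ?thesis using grid_ge[of n i k] by (simp add: grid_def)
qed

text \<open>Increment and base value are both divided by \<open>scale n\<close>, which leaves their
  quotient unchanged, so the truncation acts at the fraction \<open>1 / 2 ^ level n\<close> of the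
  typical size of the path on the block.\<close>

definition trunc_incr :: "complex \<Rightarrow> nat \<Rightarrow> nat \<Rightarrow> 'a \<Rightarrow> real" where
  "trunc_incr z n k \<xi> = Im (((1 / scale n) *\<^sub>R (W (grid n (level n) (Suc k)) \<xi> - W (grid n (level n) k) \<xi>))
     * trunc_inv (1 / 2 ^ level n) ((1 / scale n) *\<^sub>R (z + W (grid n (level n) k) \<xi>)))"

lemma trunc_incr_measurable[measurable]: "trunc_incr z n k \<in> borel_measurable M"
  unfolding trunc_incr_def[abs_def] by measurable

lemma trunc_incr_bound:
  "\<bar>trunc_incr z n k \<xi>\<bar> \<le> 2 ^ level n * norm ((1 / scale n) *\<^sub>R (W (grid n (level n) (Suc k)) \<xi> - W (grid n (level n) k) \<xi>))"
proof -
  have "norm (trunc_inv (1 / 2 ^ level n) w) \<le> 2 ^ level n" for w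
  proof -
    have "norm (trunc_inv (1 / 2 ^ level n) w) \<le> 2 ^ level n / 2" using trunc_inv_norm[of "1 / 2 ^ level n" w] by simp
    moreover have "(2 ^ level n / 2 :: real) \<le> 2 ^ level n" by simp
    ultimately show ?thesis by (rule order_trans)
  qed
  then show ?thesis unfolding trunc_incr_def
    by (intro order_trans[OF abs_Im_le_cmod], subst norm_mult, subst mult.commute, intro mult_right_mono) auto
qed

lemma increment_second_moment:
  assumes "0 \<le> s" "0 \<le> t"
  shows "integrable M (\<lambda>\<xi>. (norm (W t \<xi> - W s \<xi>))\<^sup>2)" "expectation (\<lambda>\<xi>. (norm (W t \<xi> - W s \<xi>))\<^sup>2) = 2 * \<bar>t - s\<bar> powr (2 * H)"
proof -
  have J: "finite {s, t}" "{s, t} \<subseteq> {0..}" using assms by auto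
  let ?c = "\<lambda>u. indicator {t} u - indicator {s} u :: real"
  have c: "comb {s, t} ?c \<xi> = W t \<xi> - W s \<xi>" for \<xi>
    unfolding comb_diff[of "{s, t}" "indicator {t}" "indicator {s}"] by (simp add: comb_indicator)
  have v: "cov_form H {s, t} ?c ?c = \<bar>t - s\<bar> powr (2 * H)"
    using assms by (intro var_increment) auto
  show "integrable M (\<lambda>\<xi>. (norm (W t \<xi> - W s \<xi>))\<^sup>2)" "expectation (\<lambda>\<xi>. (norm (W t \<xi> - W s \<xi>))\<^sup>2) = 2 * \<bar>t - s\<bar> powr (2 * H)"
    using comb_norm_moment[OF J, of ?c] unfolding c v by auto
qed

text \<open>The truncation bounds the reciprocal by \<open>2 ^ level n\<close>, so the second moment
  is controlled by that of the rescaled increment, whose time step is at most the length of the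
  block.\<close>

lemma trunc_incr_square:
  "integrable M (\<lambda>\<xi>. (trunc_incr z n k \<xi>)\<^sup>2)" "expectation (\<lambda>\<xi>. (trunc_incr z n k \<xi>)\<^sup>2) \<le> 2 * (2 ^ level n)\<^sup>2"
proof -
  let ?D = "\<lambda>\<xi>. W (grid n (level n) (Suc k)) \<xi> - W (grid n (level n) k) \<xi>"
  let ?R = "(2 ^ level n)\<^sup>2 / (scale n)\<^sup>2 :: real"
  have D: "integrable M (\<lambda>\<xi>. (norm (?D \<xi>))\<^sup>2)" "expectation (\<lambda>\<xi>. (norm (?D \<xi>))\<^sup>2) = 2 * \<bar>grid n (level n) (Suc k) - grid n (level n) k\<bar> powr (2 * H)"
    using increment_second_moment[OF less_imp_le[OF grid_pos] less_imp_le[OF grid_pos]] by blast+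
  have b: "(trunc_incr z n k \<xi>)\<^sup>2 \<le> ?R * (norm (?D \<xi>))\<^sup>2" for \<xi>
  proof -
    have "(trunc_incr z n k \<xi>)\<^sup>2 \<le> (2 ^ level n * norm ((1 / scale n) *\<^sub>R ?D \<xi>))\<^sup>2"
      using power_mono[OF trunc_incr_bound[of z n k \<xi>], of 2] by simp
    then show ?thesis by (simp add: power_mult_distrib power_divide)
  qed
  show i: "integrable M (\<lambda>\<xi>. (trunc_incr z n k \<xi>)\<^sup>2)"
  proof (rule Bochner_Integration.integrable_bound)
    show "integrable M (\<lambda>\<xi>. ?R * (norm (?D \<xi>))\<^sup>2)" by (intro integrable_mult_right D)
    show "AE \<xi> in M. norm ((trunc_incr z n k \<xi>)\<^sup>2) \<le> norm (?R * (norm (?D \<xi>))\<^sup>2)"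
      using b by (intro AE_I2) (auto intro: order_trans[OF _ abs_ge_self])
  qed measurable
  have "expectation (\<lambda>\<xi>. (trunc_incr z n k \<xi>)\<^sup>2) \<le> expectation (\<lambda>\<xi>. ?R * (norm (?D \<xi>))\<^sup>2)"
    using b i D by (intro integral_mono integrable_mult_right) auto
  also have "\<dots> = ?R * (2 * \<bar>grid n (level n) (Suc k) - grid n (level n) k\<bar> powr (2 * H))"
    using D by simp
  also have "\<dots> \<le> ?R * (2 * (scale n)\<^sup>2)"
  proof -
    have "\<bar>grid n (level n) (Suc k) - grid n (level n) k\<bar> \<le> 2 ^ n"
      using mult_left_mono[of 1 "2 ^ level n :: real" "2 ^ n"] by (simp add: grid_step divide_le_eq)
    then have "\<bar>grid n (level n) (Suc k) - grid n (level n) k\<bar> powr (2 * H) \<le> (2 ^ n) powr (2 * H)"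
      using H_gt by (intro powr_mono2) auto
    also have "\<dots> = (scale n)\<^sup>2" unfolding scale_pow[symmetric] by (simp add: power2_eq_square powr_add[symmetric])
    finally show ?thesis by (intro mult_left_mono) auto
  qed
  also have "\<dots> = 2 * (2 ^ level n)\<^sup>2" using scale_pos[of n] by simp
  finally show "expectation (\<lambda>\<xi>. (trunc_incr z n k \<xi>)\<^sup>2) \<le> 2 * (2 ^ level n)\<^sup>2" .
qed

lemma trunc_incr_product:
  assumes "n \<le> m"
  shows "integrable M (\<lambda>\<xi>. trunc_incr z n k \<xi> * trunc_incr z m l \<xi>)"
    "\<bar>expectation (\<lambda>\<xi>. trunc_incr z n k \<xi> * trunc_incr z m l \<xi>)\<bar> \<le> 2 * (2 ^ level m)\<^sup>2"
proof -
  have b: "\<bar>x * y\<bar> \<le> (x\<^sup>2 + y\<^sup>2) / 2" for x y :: real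
    using sum_squares_bound[of "\<bar>x\<bar>" "\<bar>y\<bar>"] by (simp add: abs_mult)
  have ib: "integrable M (\<lambda>\<xi>. ((trunc_incr z n k \<xi>)\<^sup>2 + (trunc_incr z m l \<xi>)\<^sup>2) / 2)"
    by (intro integrable_divide Bochner_Integration.integrable_add trunc_incr_square)
  show i: "integrable M (\<lambda>\<xi>. trunc_incr z n k \<xi> * trunc_incr z m l \<xi>)"
    by (rule Bochner_Integration.integrable_bound[OF ib])
      (use b in \<open>auto intro!: AE_I2 intro: order_trans[OF _ abs_ge_self]\<close>)
  have "\<bar>expectation (\<lambda>\<xi>. trunc_incr z n k \<xi> * trunc_incr z m l \<xi>)\<bar> \<le> expectation (\<lambda>\<xi>. \<bar>trunc_incr z n k \<xi> * trunc_incr z m l \<xi>\<bar>)"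
    by (rule integral_abs_bound)
  also have "\<dots> \<le> expectation (\<lambda>\<xi>. ((trunc_incr z n k \<xi>)\<^sup>2 + (trunc_incr z m l \<xi>)\<^sup>2) / 2)"
    using i ib b by (intro integral_mono) auto
  also have "\<dots> = (expectation (\<lambda>\<xi>. (trunc_incr z n k \<xi>)\<^sup>2) + expectation (\<lambda>\<xi>. (trunc_incr z m l \<xi>)\<^sup>2)) / 2"
    using trunc_incr_square by simp
  also have "\<dots> \<le> (2 * (2 ^ level n)\<^sup>2 + 2 * (2 ^ level m)\<^sup>2) / 2"
    by (intro divide_right_mono add_mono trunc_incr_square) auto
  also have "\<dots> \<le> (2 * (2 ^ level m)\<^sup>2 + 2 * (2 ^ level m)\<^sup>2) / 2"
    using level_mono[OF assms] by (intro divide_right_mono add_mono mult_left_mono power_mono power_increasing) auto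
  finally show "\<bar>expectation (\<lambda>\<xi>. trunc_incr z n k \<xi> * trunc_incr z m l \<xi>)\<bar> \<le> 2 * (2 ^ level m)\<^sup>2" by simp
qed

text \<open>Rests on \<open>1 - H \<le> H\<close>: the influence of the starting point, of order
  \<open>1 / scale m\<close>, fades at least as fast as the bound on correlations between
  blocks.\<close>

lemma inverse_scale_le: "n \<le> m \<Longrightarrow> 1 / scale m \<le> \<rho> ^ (m - n)"
proof -
  assume nm: "n \<le> m"
  have "(1 - H) * real (m - n) \<le> H * real m" using H_gt H_lt nm by (intro mult_mono) auto
  then have "2 powr (- (H * real m)) \<le> 2 powr (- (1 - H) * real (m - n))"
    by (intro powr_mono) (auto simp: algebra_simps)
  then show ?thesis by (simp add: rho_power scale_def powr_minus_divide)
qed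

text \<open>The general covariance bound is applied to rescaled combinations at the four grid times
  involved. Distant blocks supply the small parameter; for blocks so close that
  \<open>32 * \<rho> ^ (m - n)\<close> exceeds 1/2, the bound by second moments suffices.\<close>

lemma trunc_incr_covariance:
  "\<exists>C\<ge>0. \<forall>n m k l. n \<le> m \<longrightarrow> k < 2 ^ level n \<longrightarrow> l < 2 ^ level m \<longrightarrow>
     \<bar>expectation (\<lambda>\<xi>. trunc_incr z n k \<xi> * trunc_incr z m l \<xi>)\<bar> \<le> C * \<rho> ^ (m - n) * (2 ^ level m)\<^sup>2"
proof -
  \<comment> \<open>This is the bound of \<open>increment_functional_covariance\<close> for
    \<open>K = 8\<close>, where \<open>2 * K\<^sup>2 + 2 = 130\<close>, with
    \<open>\<kappa> = 32 * \<rho> ^ (m - n)\<close> and the two \<open>\<zeta>\<close> equal to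
    \<open>norm z\<close> divided by the scales. Its value exceeds 128, which serves the case of
    close blocks.\<close>
  define C where "C = 6 * 130 * 8 * 32 + 130\<^sup>2 * (4 * 8) * ((norm z + 1) * (norm z + 32))"
  have "130\<^sup>2 * (4 * 8) * ((norm z + 1) * (norm z + 32)) \<ge> 0" by simp
  then have C: "C \<ge> 128" by (simp add: C_def)
  have "\<bar>expectation (\<lambda>\<xi>. trunc_incr z n k \<xi> * trunc_incr z m l \<xi>)\<bar> \<le> C * \<rho> ^ (m - n) * (2 ^ level m)\<^sup>2"
    if nm: "n \<le> m" and k: "k < 2 ^ level n" and l: "l < 2 ^ level m" for n m k l
  proof (cases "32 * \<rho> ^ (m - n) \<le> 1 / 2")
    case False
    have "2 * (2 ^ level m)\<^sup>2 \<le> (C * \<rho> ^ (m - n)) * (2 ^ level m)\<^sup>2"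
    proof (rule mult_right_mono)
      have "128 * \<rho> ^ (m - n) \<le> C * \<rho> ^ (m - n)" using C rho_bounds by (intro mult_right_mono) auto
      then show "2 \<le> C * \<rho> ^ (m - n)" using False by linarith
    qed simp
    then show ?thesis using trunc_incr_product(2)[OF nm, of z k l] by linarith
  next
    case True
    then have "n \<noteq> m" by auto
    then have nm': "n < m" using nm by simp
    define x where "x = grid n (level n) k"
    define x' where "x' = grid n (level n) (Suc k)"
    define y where "y = grid m (level m) l"
    define y' where "y' = grid m (level m) (Suc l)"
    have xb: "x \<in> {2 ^ n..2 * 2 ^ n}" "x' \<in> {2 ^ n..2 * 2 ^ n}" "y \<in> {2 ^ m..2 * 2 ^ m}" "y' \<in> {2 ^ m..2 * 2 ^ m}"
      unfolding x_def x'_def y_def y'_def using k l by (auto intro!: grid_in_block simp del: atLeastAtMost_iff)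
    have x0: "x > 0" "x' > 0" "y > 0" "y' > 0" unfolding x_def x'_def y_def y'_def by (simp_all add: grid_pos)
    define J where "J = {x, x', y, y'}"
    have J: "finite J" "J \<subseteq> {0..}" using x0 by (auto simp: J_def)
    have inJ: "x \<in> J" "x' \<in> J" "y \<in> J" "y' \<in> J" by (auto simp: J_def)
    define s where "s = 1 / scale n"
    define t where "t = 1 / scale m"
    have st: "s > 0" "t > 0" "s \<le> 1" using scale_pos scale_ge_1 by (auto simp: s_def t_def)
    define p where "p = (\<lambda>u. s * indicator {x} u :: real)"
    define Q where "Q = (\<lambda>u. t * indicator {y} u :: real)"
    define d1 where "d1 = (\<lambda>u. s * ((indicator {x'} :: real \<Rightarrow> real) u - (indicator {x} :: real \<Rightarrow> real) u))"
    define d2 where "d2 = (\<lambda>u. t * ((indicator {y'} :: real \<Rightarrow> real) u - (indicator {y} :: real \<Rightarrow> real) u))"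
    \<comment> \<open>Each rescaled covariance between the two blocks is at most
      \<open>8 * \<rho> ^ (m - n)\<close>, and \<open>cov_form H J d1 d2\<close> involves four of
      them.\<close>
    define \<kappa> where "\<kappa> = 32 * \<rho> ^ (m - n)"
    have \<kappa>: "0 \<le> \<kappa>" "\<kappa> \<le> 1 / 2" using True rho_bounds by (auto simp: \<kappa>_def)
    have far: "s * t * \<bar>fbm_cov H u v\<bar> \<le> \<kappa> / 4" if "u \<in> {2 ^ n..2 * 2 ^ n}" "v \<in> {2 ^ m..2 * 2 ^ m}" for u v
    proof -
      have "s * t * \<bar>fbm_cov H u v\<bar> \<le> s * t * (8 * \<rho> ^ (m - n) * (scale n * scale m))"
        using st by (intro mult_left_mono cov_block_decay nm' that) auto
      also have "\<dots> = \<kappa> / 4" using scale_pos[of n] scale_pos[of m] by (simp add: s_def t_def \<kappa>_def)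
      finally show ?thesis .
    qed
    have near: "s * s * \<bar>fbm_cov H u v\<bar> \<le> 4" if "u \<in> {2 ^ n..2 * 2 ^ n}" "v \<in> {2 ^ n..2 * 2 ^ n}" for u v
    proof -
      have "s * s * \<bar>fbm_cov H u v\<bar> \<le> s * s * (4 * (scale n)\<^sup>2)"
        using st by (intro mult_left_mono cov_block_bound(1) that) auto
      also have "\<dots> = 4" using scale_pos[of n] by (simp add: s_def power2_eq_square)
      finally show ?thesis .
    qed
    have near': "t * t * \<bar>fbm_cov H u v\<bar> \<le> 4" if "u \<in> {2 ^ m..2 * 2 ^ m}" "v \<in> {2 ^ m..2 * 2 ^ m}" for u v
    proof -
      have "t * t * \<bar>fbm_cov H u v\<bar> \<le> t * t * (4 * (scale m)\<^sup>2)"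
        using st by (intro mult_left_mono cov_block_bound(1) that) auto
      also have "\<dots> = 4" using scale_pos[of m] by (simp add: t_def power2_eq_square)
      finally show ?thesis .
    qed
    have ge: "1 \<le> s * s * fbm_cov H x x" "1 \<le> t * t * fbm_cov H y y"
    proof -
      have "s * s * (scale n)\<^sup>2 \<le> s * s * fbm_cov H x x" using st by (intro mult_left_mono cov_block_bound(2)[OF xb(1) xb(1)]) auto
      then show "1 \<le> s * s * fbm_cov H x x" using scale_pos[of n] by (simp add: s_def power2_eq_square)
      have "t * t * (scale m)\<^sup>2 \<le> t * t * fbm_cov H y y" using st by (intro mult_left_mono cov_block_bound(2)[OF xb(3) xb(3)]) auto
      then show "1 \<le> t * t * fbm_cov H y y" using scale_pos[of m] by (simp add: t_def power2_eq_square)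
    qed
    have ind: "cov_form H J (indicator {u}) (indicator {v}) = fbm_cov H u v" if "u \<in> J" "v \<in> J" for u v
      using that J by (intro cov_form_indicator) auto
    have forms: "cov_form H J p p = s * s * fbm_cov H x x" "cov_form H J Q Q = t * t * fbm_cov H y y"
      "cov_form H J p Q = s * t * fbm_cov H x y" "cov_form H J d1 Q = s * t * fbm_cov H x' y - s * t * fbm_cov H x y"
      "cov_form H J d2 p = s * t * fbm_cov H x y' - s * t * fbm_cov H x y"
      "cov_form H J d1 d2 = s * t * fbm_cov H x' y' - s * t * fbm_cov H x' y - s * t * fbm_cov H x y' + s * t * fbm_cov H x y"
      "cov_form H J d1 p = s * s * fbm_cov H x' x - s * s * fbm_cov H x x"
      "cov_form H J d2 Q = t * t * fbm_cov H y' y - t * t * fbm_cov H y y"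
      unfolding p_def Q_def d1_def d2_def
      by (simp_all only: cov_form_scale_left cov_form_scale_right cov_form_diff_left[of _ _ "indicator _" "indicator _"]
          cov_form_diff_right[of _ _ _ "indicator _" "indicator _"])
        (simp_all add: ind inJ fbm_cov_commute[of _ y' x] fbm_cov_commute[of _ y x] algebra_simps)
    have R: "1 / (2 * (1 / 2 ^ level n)) \<le> (2 ^ level m :: real)" "1 / (2 * (1 / 2 ^ level m)) \<le> (2 ^ level m :: real)"
    proof -
      have "(2 ^ level n :: real) \<le> 2 ^ level m" using level_mono[OF nm] by (intro power_increasing) auto
      moreover have "1 / (2 * (1 / 2 ^ level n)) = (2 ^ level n / 2 :: real)" "1 / (2 * (1 / 2 ^ level m)) = (2 ^ level m / 2 :: real)" by simp_all
      moreover have "(0::real) \<le> 2 ^ level n" by simp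
      ultimately show "1 / (2 * (1 / 2 ^ level n)) \<le> (2 ^ level m :: real)" "1 / (2 * (1 / 2 ^ level m)) \<le> (2 ^ level m :: real)"
        by linarith+
    qed
    let ?\<phi>1 = "\<lambda>w. trunc_inv (1 / 2 ^ level n) (s *\<^sub>R z + w)"
    let ?\<phi>2 = "\<lambda>w. trunc_inv (1 / 2 ^ level m) (t *\<^sub>R z + w)"
    have main: "\<bar>expectation (\<lambda>\<xi>. Im (comb J d1 \<xi> * ?\<phi>1 (comb J p \<xi>)) * Im (comb J d2 \<xi> * ?\<phi>2 (comb J Q \<xi>)))\<bar>
      \<le> (6 * (2 * 8\<^sup>2 + 2) * 8 * \<kappa> + (2 * 8\<^sup>2 + 2)\<^sup>2 * (4 * 8) * ((norm z * s + \<kappa>) * (norm z * t + \<kappa>))) * (2 ^ level m)\<^sup>2"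
    proof (rule increment_functional_covariance[OF J])
      show "1 \<le> cov_form H J p p" "1 \<le> cov_form H J Q Q" using ge by (simp_all add: forms)
      show "cov_form H J p p \<le> 8" "cov_form H J Q Q \<le> 8"
        using near[OF xb(1) xb(1)] near'[OF xb(3) xb(3)] st
          abs_ge_self[of "fbm_cov H x x"] abs_ge_self[of "fbm_cov H y y"] unfolding forms
        by (auto intro: order_trans[OF mult_left_mono[OF abs_ge_self]])
      have ab: "\<bar>s * t * u\<bar> = s * t * \<bar>u\<bar>" "\<bar>s * s * u\<bar> = s * s * \<bar>u\<bar>" "\<bar>t * t * u\<bar> = t * t * \<bar>u\<bar>" for u
        using st by (simp_all add: abs_mult)
      note f = far[OF xb(1) xb(3), folded ab] far[OF xb(2) xb(3), folded ab] far[OF xb(1) xb(4), folded ab] far[OF xb(2) xb(4), folded ab]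
      show "\<bar>cov_form H J p Q\<bar> \<le> \<kappa>" "\<bar>cov_form H J d1 Q\<bar> \<le> \<kappa>" "\<bar>cov_form H J d2 p\<bar> \<le> \<kappa>" "\<bar>cov_form H J d1 d2\<bar> \<le> \<kappa>"
        unfolding forms using f \<kappa> by linarith+
      show "\<bar>cov_form H J d1 p\<bar> \<le> 8"
        unfolding forms using near[OF xb(2) xb(1), folded ab] near[OF xb(1) xb(1), folded ab] by linarith
      show "\<bar>cov_form H J d2 Q\<bar> \<le> 8"
        unfolding forms using near'[OF xb(4) xb(3), folded ab] near'[OF xb(3) xb(3), folded ab] by linarith
      show "norm (?\<phi>1 w) \<le> 2 ^ level m" "norm (?\<phi>2 w) \<le> 2 ^ level m" for w
        by (rule order_trans[OF trunc_inv_norm R(1)], simp, rule order_trans[OF trunc_inv_norm R(2)], simp)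
      show "\<bar>Im (w * ?\<phi>1 w)\<bar> \<le> norm z * s * 2 ^ level m" for w
      proof (rule order_trans[OF trunc_inv_Im_bound])
        have "norm (s *\<^sub>R z) = norm z * s" using st by simp
        then show "norm (s *\<^sub>R z) * (1 / (2 * (1 / 2 ^ level n))) \<le> norm z * s * 2 ^ level m"
          using st by (simp only:) (intro mult_left_mono R, simp)
      qed simp
      show "\<bar>Im (w * ?\<phi>2 w)\<bar> \<le> norm z * t * 2 ^ level m" for w
      proof (rule order_trans[OF trunc_inv_Im_bound])
        have "norm (t *\<^sub>R z) = norm z * t" using st by simp
        then show "norm (t *\<^sub>R z) * (1 / (2 * (1 / 2 ^ level m))) \<le> norm z * t * 2 ^ level m"
          using st by (simp only:) (intro mult_left_mono R, simp)
      qed simp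
      show "?\<phi>1 \<in> borel_measurable borel" "?\<phi>2 \<in> borel_measurable borel" by measurable
    qed (use \<kappa> st in auto)
    have cb: "comb J d1 \<xi> = s *\<^sub>R (W x' \<xi> - W x \<xi>)" "comb J d2 \<xi> = t *\<^sub>R (W y' \<xi> - W y \<xi>)"
      "comb J p \<xi> = s *\<^sub>R W x \<xi>" "comb J Q \<xi> = t *\<^sub>R W y \<xi>" for \<xi>
      unfolding p_def Q_def d1_def d2_def comb_scale comb_diff[of J "indicator _" "indicator _"]
      using J inJ by (simp_all add: comb_indicator)
    have eq: "trunc_incr z n k \<xi> * trunc_incr z m l \<xi> = Im (comb J d1 \<xi> * ?\<phi>1 (comb J p \<xi>)) * Im (comb J d2 \<xi> * ?\<phi>2 (comb J Q \<xi>))" for \<xi>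
      unfolding cb trunc_incr_def x_def x'_def y_def y'_def s_def t_def scaleR_add_right ..
    have zs: "norm z * s + \<kappa> \<le> norm z + 1" using \<kappa> st mult_left_mono[of s 1 "norm z"] by simp
    have zt: "norm z * t + \<kappa> \<le> (norm z + 32) * \<rho> ^ (m - n)"
      using mult_left_mono[OF inverse_scale_le[OF nm], of "norm z"] by (simp add: t_def \<kappa>_def algebra_simps)
    have "(6 * (2 * 8\<^sup>2 + 2) * 8 * \<kappa> + (2 * 8\<^sup>2 + 2)\<^sup>2 * (4 * 8) * ((norm z * s + \<kappa>) * (norm z * t + \<kappa>))) * (2 ^ level m)\<^sup>2
      \<le> (6 * 130 * 8 * (32 * \<rho> ^ (m - n)) + 130\<^sup>2 * (4 * 8) * ((norm z + 1) * ((norm z + 32) * \<rho> ^ (m - n)))) * (2 ^ level m)\<^sup>2"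
    proof (intro mult_right_mono add_mono)
      show "(2 * 8\<^sup>2 + 2)\<^sup>2 * (4 * 8) * ((norm z * s + \<kappa>) * (norm z * t + \<kappa>)) \<le> 130\<^sup>2 * (4 * 8) * ((norm z + 1) * ((norm z + 32) * \<rho> ^ (m - n)))"
        using mult_mono[OF zs zt] \<kappa> st by simp
    qed (simp_all add: \<kappa>_def)
    also have "\<dots> = C * \<rho> ^ (m - n) * (2 ^ level m)\<^sup>2" unfolding C_def by (simp add: algebra_simps)
    finally show ?thesis using main unfolding eq by linarith
  qed
  then show ?thesis using C by (intro exI[of _ C]) auto
qed

definition trunc_sum :: "complex \<Rightarrow> nat \<Rightarrow> 'a \<Rightarrow> real" where
  "trunc_sum z n \<xi> = (\<Sum>k<2 ^ level n. trunc_incr z n k \<xi>)"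

lemma trunc_sum_measurable[measurable]: "trunc_sum z n \<in> borel_measurable M"
  unfolding trunc_sum_def[abs_def] by measurable

text \<open>There are \<open>2 ^ level n * 2 ^ level m\<close> pairs of increments, each covariance
  costing \<open>(2 ^ level m)\<^sup>2\<close>; the resulting fourth power is absorbed by the
  allowance \<open>(m + 1) powr (1 / 4)\<close> of the strong law.\<close>

lemma AE_trunc_sum_average: "AE \<xi> in M. (\<lambda>N. (\<Sum>n<N. trunc_sum z n \<xi>) / real N) \<longlonglongrightarrow> 0"
proof -
  obtain C where C: "C \<ge> 0" "\<And>n m k l. n \<le> m \<Longrightarrow> k < 2 ^ level n \<Longrightarrow> l < 2 ^ level m \<Longrightarrow>
     \<bar>expectation (\<lambda>\<xi>. trunc_incr z n k \<xi> * trunc_incr z m l \<xi>)\<bar> \<le> C * \<rho> ^ (m - n) * (2 ^ level m)\<^sup>2"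
    using trunc_incr_covariance[of z] by blast
  have pi: "integrable M (\<lambda>\<xi>. trunc_incr z n k \<xi> * trunc_incr z m l \<xi>)" for n m k l
  proof (cases "n \<le> m")
    case False
    then show ?thesis using trunc_incr_product(1)[of m n z l k] by (simp add: mult.commute)
  qed (rule trunc_incr_product(1))
  have e: "(\<lambda>\<xi>. trunc_sum z n \<xi> * trunc_sum z m \<xi>) = (\<lambda>\<xi>. \<Sum>k<2 ^ level n. \<Sum>l<2 ^ level m. trunc_incr z n k \<xi> * trunc_incr z m l \<xi>)" for n m
    by (simp add: trunc_sum_def sum_product)
  show ?thesis
  proof (rule strong_law_weak_correlation[OF _ _ rho_bounds C(1)])
    show "integrable M (\<lambda>\<xi>. trunc_sum z n \<xi> * trunc_sum z m \<xi>)" for n m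
      unfolding e by (intro Bochner_Integration.integrable_sum pi)
    show "\<bar>expectation (\<lambda>\<xi>. trunc_sum z n \<xi> * trunc_sum z m \<xi>)\<bar> \<le> C * (real m + 1) powr (1 / 4) * \<rho> ^ (m - n)" if nm: "n \<le> m" for n m
    proof -
      have "expectation (\<lambda>\<xi>. trunc_sum z n \<xi> * trunc_sum z m \<xi>)
        = (\<Sum>k<2 ^ level n. \<Sum>l<2 ^ level m. expectation (\<lambda>\<xi>. trunc_incr z n k \<xi> * trunc_incr z m l \<xi>))"
        unfolding e using pi by (simp add: Bochner_Integration.integral_sum)
      also have "\<bar>\<dots>\<bar> \<le> (\<Sum>k<(2::nat) ^ level n. \<Sum>l<(2::nat) ^ level m. C * \<rho> ^ (m - n) * (2 ^ level m)\<^sup>2)"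
        using nm by (intro order_trans[OF sum_abs] sum_mono C(2)) auto
      also have "\<dots> = (C * \<rho> ^ (m - n)) * (2 ^ level n * 2 ^ level m * (2 ^ level m)\<^sup>2)" by simp
      also have "\<dots> \<le> (C * \<rho> ^ (m - n)) * (2 ^ level m * 2 ^ level m * (2 ^ level m)\<^sup>2)"
        using level_mono[OF nm] C(1) rho_bounds by (intro mult_left_mono mult_right_mono power_increasing) auto
      also have "\<dots> = (C * \<rho> ^ (m - n)) * (2 ^ level m) ^ 4" by (simp add: power2_eq_square power4_eq_xxxx)
      also have "\<dots> \<le> (C * \<rho> ^ (m - n)) * (real m + 1) powr (1 / 4)"
        using C(1) rho_bounds by (intro mult_left_mono level_pow4) auto
      finally show ?thesis by (simp add: mult_ac)
    qed
  qed measurable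
qed

text \<open>With \<open>l = level n\<close>, truncation contributes
  \<open>2 powr (- (q - 1) * l)\<close> per cell and the increment \<open>2 powr (- H * l)\<close>,
  while the powers of \<open>scale n\<close> cancel; multiplying by the \<open>2 ^ l\<close> cells
  leaves \<open>2 powr (- (H + q - 2) * l)\<close>.\<close>

lemma trunc_sum_error:
  "\<exists>C\<ge>0. \<forall>n. (\<integral>\<^sup>+\<xi>. ennreal \<bar>Im (riemann_sum (traj z \<xi>) (2 ^ n) (2 ^ n) (level n)) - trunc_sum z n \<xi>\<bar> \<partial>M)
     \<le> ennreal (C * 2 powr (- (H + q - 2) * real (level n)))"
proof -
  have "0 \<le> q" using q_bounds by simp
  from mixed_moment[of 1 q, OF zero_le_one this q_bounds(2)]
  obtain C where C: "C \<ge> 0" "\<And>s t w z. s \<ge> 0 \<Longrightarrow> t \<ge> 0 \<Longrightarrow> w > 0 \<Longrightarrow>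
    (\<integral>\<^sup>+\<xi>. ennreal (norm (W t \<xi> - W s \<xi>) powr 1 * norm (z + W w \<xi>) powr (- q)) \<partial>M)
      \<le> ennreal (C * \<bar>t - s\<bar> powr (H * 1) * w powr (- (H * q)))" by (elim exE conjE) blast
  have "(\<integral>\<^sup>+\<xi>. ennreal \<bar>Im (riemann_sum (traj z \<xi>) (2 ^ n) (2 ^ n) (level n)) - trunc_sum z n \<xi>\<bar> \<partial>M)
     \<le> ennreal (C * 2 powr (- (H + q - 2) * real (level n)))" for n
  proof -
    define l where "l = level n"
    define g where "g = grid n l"
    have g0: "g k > 0" "g k \<ge> 2 ^ n" "0 \<le> g k" for k
      unfolding g_def by (rule grid_pos, rule grid_ge, rule less_imp_le[OF grid_pos])
    define c where "c = (1 / 2 ^ l) powr (q - 1) * scale n powr (q - 1)"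
    have c: "c \<ge> 0" by (simp add: c_def)
    have one: "AE \<xi> in M. \<bar>Im (incr (traj z \<xi>) (g k) (g (Suc k))) - trunc_incr z n k \<xi>\<bar>
        \<le> c * (norm (W (g (Suc k)) \<xi> - W (g k) \<xi>) powr 1 * norm (z + W (g k) \<xi>) powr (- q))" for k
      using AE_nonzero[OF g0(1), of z k]
    proof eventually_elim
      case (elim \<xi>)
      define \<delta> where "\<delta> = (1 / scale n) *\<^sub>R (W (g (Suc k)) \<xi> - W (g k) \<xi>)"
      define w where "w = (1 / scale n) *\<^sub>R (z + W (g k) \<xi>)"
      have sp: "scale n > 0" by (rule scale_pos)
      have w: "w \<noteq> 0" using elim sp by (simp add: w_def)
      have "incr (traj z \<xi>) (g k) (g (Suc k)) = \<delta> * (1 / w)"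
        unfolding incr_def traj_diff using sp by (simp add: traj_def \<delta>_def w_def scaleR_conv_of_real)
      moreover have "trunc_incr z n k \<xi> = Im (\<delta> * trunc_inv (1 / 2 ^ l) w)"
        unfolding trunc_incr_def \<delta>_def w_def g_def l_def ..
      ultimately have "\<bar>Im (incr (traj z \<xi>) (g k) (g (Suc k))) - trunc_incr z n k \<xi>\<bar> = \<bar>Im (\<delta> * (1 / w - trunc_inv (1 / 2 ^ l) w))\<bar>"
        by (simp add: right_diff_distrib del: times_complex.sel)
      also have "\<dots> \<le> norm (\<delta> * (1 / w - trunc_inv (1 / 2 ^ l) w))" by (rule abs_Im_le_cmod)
      also have "\<dots> \<le> norm \<delta> * ((1 / 2 ^ l) powr (q - 1) * norm w powr (- q))"
        unfolding norm_mult using q_bounds w by (intro mult_left_mono trunc_inv_error) auto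
      also have "\<dots> = c * (norm (W (g (Suc k)) \<xi> - W (g k) \<xi>) powr 1 * norm (z + W (g k) \<xi>) powr (- q))"
      proof -
        have "norm \<delta> = (1 / scale n) * norm (W (g (Suc k)) \<xi> - W (g k) \<xi>)" using sp by (simp add: \<delta>_def)
        moreover have "norm w powr (- q) = scale n powr q * norm (z + W (g k) \<xi>) powr (- q)"
        proof -
          have "norm w = norm (z + W (g k) \<xi>) / scale n" unfolding w_def norm_scaleR using sp by simp
          then show ?thesis by (simp add: powr_divide powr_minus_divide)
        qed
        moreover have "scale n powr (q - 1) = (1 / scale n) * scale n powr q" using sp by (simp add: powr_diff)
        ultimately show ?thesis by (simp add: c_def)
      qed
      finally show ?case .
    qed
    have int1: "(\<integral>\<^sup>+\<xi>. ennreal \<bar>Im (incr (traj z \<xi>) (g k) (g (Suc k))) - trunc_incr z n k \<xi>\<bar> \<partial>M)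
        \<le> ennreal (C * 2 powr (- (H + q - 1) * real l))" for k
    proof -
      have "(\<integral>\<^sup>+\<xi>. ennreal \<bar>Im (incr (traj z \<xi>) (g k) (g (Suc k))) - trunc_incr z n k \<xi>\<bar> \<partial>M)
        \<le> (\<integral>\<^sup>+\<xi>. ennreal c * ennreal (norm (W (g (Suc k)) \<xi> - W (g k) \<xi>) powr 1 * norm (z + W (g k) \<xi>) powr (- q)) \<partial>M)"
        using one[of k] c by (intro nn_integral_mono_AE) (auto simp: ennreal_mult[symmetric] elim!: eventually_mono intro!: ennreal_leI)
      also have "\<dots> = ennreal c * (\<integral>\<^sup>+\<xi>. ennreal (norm (W (g (Suc k)) \<xi> - W (g k) \<xi>) powr 1 * norm (z + W (g k) \<xi>) powr (- q)) \<partial>M)"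
        by (rule nn_integral_cmult) measurable
      also have "\<dots> \<le> ennreal c * ennreal (C * \<bar>g (Suc k) - g k\<bar> powr (H * 1) * g k powr (- (H * q)))"
        by (intro mult_left_mono C(2) g0) auto
      also have "\<dots> = ennreal (c * (C * \<bar>g (Suc k) - g k\<bar> powr (H * 1) * g k powr (- (H * q))))"
        using c C(1) by (intro ennreal_mult[symmetric]) auto
      also have "\<dots> \<le> ennreal (c * (C * (2 ^ n / 2 ^ l) powr H * (2 ^ n) powr (- (H * q))))"
      proof (intro ennreal_leI mult_left_mono mult_mono)
        show "\<bar>g (Suc k) - g k\<bar> powr (H * 1) \<le> (2 ^ n / 2 ^ l) powr H" by (simp add: g_def grid_step)
        show "g k powr (- (H * q)) \<le> (2 ^ n) powr (- (H * q))" using g0 q_bounds H_gt by (intro powr_mono2') auto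
      qed (use c C in auto)
      also have "c * (C * (2 ^ n / 2 ^ l) powr H * (2 ^ n) powr (- (H * q))) = C * 2 powr (- (H + q - 1) * real l)"
      proof -
        have "(2 ^ n / 2 ^ l :: real) powr H = scale n * 2 powr (- H * real l)"
          by (simp add: scale_def powr_divide powr_minus_divide powr_realpow[symmetric] powr_powr mult.commute)
        moreover have "(2 ^ n :: real) powr (- (H * q)) = scale n powr (- q)"
          unfolding scale_pow[symmetric] powr_powr by simp
        moreover have "(1 / 2 ^ l :: real) powr (q - 1) = 2 powr (- (q - 1) * real l)"
        proof -
          have "(1 / 2 ^ l :: real) = 2 powr (- real l)" by (simp add: powr_minus_divide powr_realpow)
          then show ?thesis by (simp only: powr_powr) (simp add: algebra_simps)
        qed
        ultimately have "c * (C * (2 ^ n / 2 ^ l) powr H * (2 ^ n) powr (- (H * q)))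
          = C * (2 powr (- (q - 1) * real l) * 2 powr (- H * real l)) * (scale n powr (q - 1) * scale n * scale n powr (- q))"
          by (simp add: c_def)
        also have "scale n powr (q - 1) * scale n * scale n powr (- q) = 1"
          using scale_pos[of n] by (simp add: powr_diff powr_minus_divide)
        also have "2 powr (- (q - 1) * real l) * 2 powr (- H * real l) = (2::real) powr (- (H + q - 1) * real l)"
          unfolding powr_add[symmetric] by (simp add: algebra_simps)
        finally show ?thesis by simp
      qed
      finally show ?thesis .
    qed
    have "riemann_sum (traj z \<xi>) (2 ^ n) (2 ^ n) l = (\<Sum>k<2 ^ l. incr (traj z \<xi>) (g k) (g (Suc k)))" for \<xi>
      by (simp add: riemann_sum_def g_def grid_def)
    then have "(\<integral>\<^sup>+\<xi>. ennreal \<bar>Im (riemann_sum (traj z \<xi>) (2 ^ n) (2 ^ n) (level n)) - trunc_sum z n \<xi>\<bar> \<partial>M)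
      = (\<integral>\<^sup>+\<xi>. ennreal \<bar>\<Sum>k<2 ^ l. Im (incr (traj z \<xi>) (g k) (g (Suc k))) - trunc_incr z n k \<xi>\<bar> \<partial>M)"
      by (simp add: trunc_sum_def l_def[symmetric] sum_subtractf)
    also have "\<dots> \<le> (\<integral>\<^sup>+\<xi>. (\<Sum>k<2 ^ l. ennreal \<bar>Im (incr (traj z \<xi>) (g k) (g (Suc k))) - trunc_incr z n k \<xi>\<bar>) \<partial>M)"
      by (intro nn_integral_mono) (auto intro!: ennreal_leI)
    also have "\<dots> = (\<Sum>k<2 ^ l. \<integral>\<^sup>+\<xi>. ennreal \<bar>Im (incr (traj z \<xi>) (g k) (g (Suc k))) - trunc_incr z n k \<xi>\<bar> \<partial>M)"
      by (rule nn_integral_sum) measurable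
    also have "\<dots> \<le> (\<Sum>k<(2::nat) ^ l. ennreal (C * 2 powr (- (H + q - 1) * real l)))" by (intro sum_mono int1)
    also have "\<dots> = ennreal (2 ^ l * (C * 2 powr (- (H + q - 1) * real l)))"
      using C(1) by (simp add: ennreal_mult ennreal_power[symmetric])
    also have "2 ^ l * (C * 2 powr (- (H + q - 1) * real l)) = C * (2 powr real l * 2 powr (- (H + q - 1) * real l))"
      by (simp add: powr_realpow)
    also have "2 powr real l * 2 powr (- (H + q - 1) * real l) = (2::real) powr (- (H + q - 2) * real l)"
      unfolding powr_add[symmetric] by (simp add: algebra_simps)
    finally show ?thesis unfolding l_def .
  qed
  then show ?thesis using C(1) by (intro exI[of _ C]) auto
qed

text \<open>This exponent makes the truncation error over a block vanish as the resolution grows;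
  for the midpoint \<open>q\<close> its positivity reduces to that of a sum of squares.\<close>

lemma H_plus_q: "H + q - 2 > 0"
proof -
  have "0 < H" using H_gt by simp
  have "H + q - 2 = (H\<^sup>2 + (1 - H)\<^sup>2) / (2 * H)" using \<open>0 < H\<close> by (simp add: q_def field_simps power2_eq_square)
  moreover have "0 < H\<^sup>2 + (1 - H)\<^sup>2" using \<open>0 < H\<close> by (simp add: add_pos_nonneg)
  ultimately show ?thesis using \<open>0 < H\<close> by simp
qed

text \<open>An expectation that decays with \<open>level n\<close> decays like a negative power of
  \<open>n\<close>, so Kronecker's lemma applies almost surely.\<close>

lemma AE_error_average:
  fixes f :: "nat \<Rightarrow> 'a \<Rightarrow> real"
  assumes [measurable]: "\<And>n. f n \<in> borel_measurable M" and C: "C \<ge> 0" and c: "c > 0"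
    and b: "\<And>n. (\<integral>\<^sup>+\<xi>. ennreal \<bar>f n \<xi>\<bar> \<partial>M) \<le> ennreal (C * 2 powr (- c * real (level n)))"
  shows "AE \<xi> in M. (\<lambda>N. (\<Sum>n<N. f n \<xi>) / real N) \<longlonglongrightarrow> 0"
proof -
  let ?g = "\<lambda>n. C * 2 powr c * (real n + 1) powr (- 1 - c / 16)"
  have "AE \<xi> in M. (\<Sum>n. ennreal (1 / (real n + 1) * \<bar>f n \<xi>\<bar>)) \<noteq> \<infinity>"
  proof (rule AE_suminf_finite[where g="?g"])
    fix n
    have "(\<integral>\<^sup>+\<xi>. ennreal (1 / (real n + 1) * \<bar>f n \<xi>\<bar>) \<partial>M) = (\<integral>\<^sup>+\<xi>. ennreal (1 / (real n + 1)) * ennreal \<bar>f n \<xi>\<bar> \<partial>M)"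
      by (intro nn_integral_cong ennreal_mult) auto
    also have "\<dots> = ennreal (1 / (real n + 1)) * (\<integral>\<^sup>+\<xi>. ennreal \<bar>f n \<xi>\<bar> \<partial>M)"
      by (rule nn_integral_cmult) measurable
    also have "\<dots> \<le> ennreal (1 / (real n + 1)) * ennreal (C * 2 powr (- c * real (level n)))"
      by (intro mult_left_mono b) auto
    also have "\<dots> = ennreal (1 / (real n + 1) * (C * 2 powr (- c * real (level n))))"
      using C by (intro ennreal_mult[symmetric]) auto
    also have "\<dots> \<le> ennreal (1 / (real n + 1) * (C * (2 powr c * (real n + 1) powr (- c / 16))))"
      using C c by (intro ennreal_leI mult_left_mono level_decay) auto
    also have "1 / (real n + 1) * (C * (2 powr c * (real n + 1) powr (- c / 16))) = ?g n"
    proof -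
      have "(real n + 1) powr (- 1 - c / 16) = (real n + 1) powr (- 1) * (real n + 1) powr (- c / 16)"
        unfolding powr_add[symmetric] by simp
      then show ?thesis by (simp add: powr_minus_divide)
    qed
    finally show "(\<integral>\<^sup>+\<xi>. ennreal (1 / (real n + 1) * \<bar>f n \<xi>\<bar>) \<partial>M) \<le> ennreal (?g n)" .
  qed (use C c in \<open>auto intro!: summable_mult summable_shifted_powr\<close>)
  then show ?thesis
  proof eventually_elim
    case (elim \<xi>)
    have "summable (\<lambda>n. 1 / (real n + 1) * \<bar>f n \<xi>\<bar>)"
      using elim by (intro summable_suminf_not_top) auto
    then have "(\<lambda>N. (\<Sum>n<N. \<bar>f n \<xi>\<bar>) / real N) \<longlonglongrightarrow> 0"
      by (intro average_tendsto_0_of_summable) auto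
    then show ?case
      by (rule Lim_null_comparison[rotated]) (auto intro!: always_eventually divide_right_mono sum_abs)
  qed
qed

lemma AE_Im_riemann_average:
  "AE \<xi> in M. (\<lambda>N. (\<Sum>n<N. Im (riemann_sum (traj z \<xi>) (2 ^ n) (2 ^ n) (level n))) / real N) \<longlonglongrightarrow> 0"
proof -
  obtain C where C: "C \<ge> 0" "\<And>n. (\<integral>\<^sup>+\<xi>. ennreal \<bar>Im (riemann_sum (traj z \<xi>) (2 ^ n) (2 ^ n) (level n)) - trunc_sum z n \<xi>\<bar> \<partial>M)
     \<le> ennreal (C * 2 powr (- (H + q - 2) * real (level n)))"
    using trunc_sum_error by blast
  have [measurable]: "(\<lambda>\<xi>. riemann_sum (traj z \<xi>) (2 ^ n) (2 ^ n) (level n)) \<in> borel_measurable M" for n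
    unfolding riemann_sum_def by measurable
  have "AE \<xi> in M. (\<lambda>N. (\<Sum>n<N. Im (riemann_sum (traj z \<xi>) (2 ^ n) (2 ^ n) (level n)) - trunc_sum z n \<xi>) / real N) \<longlonglongrightarrow> 0"
    by (rule AE_error_average[OF _ C(1) H_plus_q C(2)]) measurable
  then show ?thesis using AE_trunc_sum_average[of z]
  proof eventually_elim
    case (elim \<xi>)
    show ?case using tendsto_add[OF elim] by (simp add: sum_subtractf add_divide_distrib[symmetric])
  qed
qed

end

section \<open>Exact negative moments and decorrelation of Lipschitz functionals\<close>

text \<open>A negative power as a mixture of exponentials, obtained from Euler's integral by the
  substitution \<open>t = x * l\<close>.\<close>

lemma nn_integral_Gamma_scaled:
  assumes s: "s > (0::real)" and x: "x > 0"
  shows "(\<integral>\<^sup>+l. ennreal (indicator {0..} l * l powr (s - 1) * exp (- (l * x))) \<partial>lborel) = ennreal (Gamma s * x powr (- s))"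
proof -
  define f where "f = (\<lambda>t::real. ennreal (indicator {0..} t * t powr (s - 1) / exp t))"
  define I where "I = (\<integral>\<^sup>+l. ennreal (indicator {0..} l * l powr (s - 1) * exp (- (l * x))) \<partial>lborel)"
  have "ennreal (Gamma s) = (\<integral>\<^sup>+t. f t \<partial>lborel)" unfolding f_def by (rule Gamma_conv_nn_integral_real[OF s])
  also have "\<dots> = ennreal \<bar>x\<bar> * (\<integral>\<^sup>+l. f (0 + x * l) \<partial>lborel)"
    using x by (intro nn_integral_real_affine) (auto simp: f_def)
  also have "(\<integral>\<^sup>+l. f (0 + x * l) \<partial>lborel) = (\<integral>\<^sup>+l. ennreal (x powr (s - 1)) * ennreal (indicator {0..} l * l powr (s - 1) * exp (- (l * x))) \<partial>lborel)"
    unfolding f_def using x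
    by (intro nn_integral_cong) (auto simp: indicator_def zero_le_mult_iff powr_mult exp_minus ennreal_mult[symmetric] field_simps)
  also have "\<dots> = ennreal (x powr (s - 1)) * I" unfolding I_def by (rule nn_integral_cmult) measurable
  finally have "ennreal (Gamma s) = ennreal (x powr s) * I"
    using x by (simp add: mult.assoc[symmetric] ennreal_mult[symmetric] powr_diff)
  then have "ennreal (x powr (- s)) * ennreal (Gamma s) = ennreal (x powr (- s)) * ennreal (x powr s) * I"
    by (simp add: mult.assoc)
  also have "ennreal (x powr (- s)) * ennreal (x powr s) = 1"
    using x by (simp add: ennreal_mult[symmetric] powr_add[symmetric])
  finally have "I = ennreal (x powr (- s)) * ennreal (Gamma s)" by simp
  also have "\<dots> = ennreal (Gamma s * x powr (- s))"
    using Gamma_real_pos[OF s] by (simp add: ennreal_mult[symmetric] mult.commute)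
  finally show ?thesis unfolding I_def .
qed

text \<open>The exponential turns the standard density into \<open>\<sigma>\<close> times the
  centred normal density of variance \<open>\<sigma>\<^sup>2 = 1 / (1 + \<kappa>)\<close>.\<close>

lemma std_normal_Laplace:
  assumes "\<kappa> \<ge> 0"
  shows "(\<integral>\<^sup>+y. ennreal (exp (- (\<kappa> * y\<^sup>2 / 2))) \<partial>std_normal_distribution) = ennreal (1 / sqrt (1 + \<kappa>))"
proof -
  define \<sigma> where "\<sigma> = 1 / sqrt (1 + \<kappa>)"
  have \<sigma>: "\<sigma> > 0" "\<sigma>\<^sup>2 = 1 / (1 + \<kappa>)" using assms by (auto simp: \<sigma>_def power_divide)
  have "(\<integral>\<^sup>+y. ennreal (exp (- (\<kappa> * y\<^sup>2 / 2))) \<partial>std_normal_distribution)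
    = (\<integral>\<^sup>+y. ennreal (std_normal_density y) * ennreal (exp (- (\<kappa> * y\<^sup>2 / 2))) \<partial>lborel)"
    by (rule nn_integral_density) measurable
  also have "\<dots> = (\<integral>\<^sup>+y. ennreal \<sigma> * ennreal (normal_density 0 \<sigma> y) \<partial>lborel)"
  proof (intro nn_integral_cong)
    fix y :: real
    have "std_normal_density y * exp (- (\<kappa> * y\<^sup>2 / 2)) = 1 / sqrt (2 * pi) * exp (- (y\<^sup>2 * (1 + \<kappa>) / 2))"
      unfolding std_normal_density_def by (simp add: mult_exp_exp field_simps)
    also have "\<dots> = \<sigma> * normal_density 0 \<sigma> y"
    proof -
      have "y\<^sup>2 * (1 + \<kappa>) / 2 = y\<^sup>2 / (2 * \<sigma>\<^sup>2)" using \<sigma>(2) by simp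
      moreover have "sqrt (2 * pi * \<sigma>\<^sup>2) = sqrt (2 * pi) * \<sigma>" using \<sigma>(1) by (simp add: real_sqrt_mult)
      ultimately show ?thesis using \<sigma>(1) by (simp add: normal_density_def)
    qed
    finally show "ennreal (std_normal_density y) * ennreal (exp (- (\<kappa> * y\<^sup>2 / 2))) = ennreal \<sigma> * ennreal (normal_density 0 \<sigma> y)"
      using \<sigma>(1) by (simp add: ennreal_mult[symmetric])
  qed
  also have "\<dots> = ennreal \<sigma> * (\<integral>\<^sup>+y. ennreal (normal_density 0 \<sigma> y) \<partial>lborel)" by (rule nn_integral_cmult) measurable
  also have "(\<integral>\<^sup>+y. ennreal (normal_density 0 \<sigma> y) \<partial>lborel) = ennreal (\<integral>y. normal_density 0 \<sigma> y \<partial>lborel)"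
    using \<sigma>(1) by (intro nn_integral_eq_integral) auto
  finally show ?thesis using \<sigma>(1) by (simp add: \<sigma>_def)
qed

context centred_fbm
begin

text \<open>\<open>\<bar>W t\<bar>\<^sup>2 / (2 t\<^bsup>2H\<^esup>)\<close> has the Laplace transform \<open>1 / (1 + l)\<close> of an exponential variable; negative moments
  are recovered by integrating the transform against \<open>l\<^bsup>\<alpha>-1\<^esup>\<close>.\<close>

lemma exact_negative_moment:
  assumes t: "t > 0" and \<alpha>: "0 < \<alpha>" "\<alpha> < 1"
  shows "(\<integral>\<^sup>+\<xi>. ennreal (norm (W t \<xi>) powr (- (2 * \<alpha>))) \<partial>M)
    = ennreal (2 powr (- \<alpha>) * t powr (- (2 * H * \<alpha>)) * Gamma (1 - \<alpha>))"
proof -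
  define v where "v = t powr (2 * H)"
  have v: "v > 0" using t by (simp add: v_def)
  have t0: "t \<ge> 0" using t by simp
  let ?Q = "\<lambda>\<xi>. (norm (W t \<xi>))\<^sup>2 / 2"
  let ?g = "\<lambda>l. ennreal (indicator {0..} l * l powr (\<alpha> - 1))"
  have GS: "(\<integral>\<^sup>+l. ?g l * ennreal (exp (- (l * x))) \<partial>lborel) = ennreal (Gamma \<alpha> * x powr (- \<alpha>))" if "x > 0" for x
    using nn_integral_Gamma_scaled[OF \<alpha>(1) that] by (simp add: ennreal_mult)
  have lap: "(\<integral>\<^sup>+\<xi>. ennreal (exp (- (l * ?Q \<xi>))) \<partial>M) = ennreal (1 / (1 + l * v))" if l: "l \<ge> 0" for l
  proof -
    have "(\<integral>\<^sup>+\<xi>. ennreal (exp (- (l * ?Q \<xi>))) \<partial>M)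
      = (\<integral>\<^sup>+\<xi>. ennreal (exp (- (l * (Re (W t \<xi>))\<^sup>2 / 2))) * ennreal (exp (- (l * (Im (W t \<xi>))\<^sup>2 / 2))) \<partial>M)"
      by (intro nn_integral_cong) (simp add: ennreal_mult[symmetric] mult_exp_exp cmod_power2 field_simps)
    also have "\<dots> = (\<integral>\<^sup>+\<xi>. ennreal (exp (- (l * (Re (W t \<xi>))\<^sup>2 / 2))) \<partial>M) * (\<integral>\<^sup>+\<xi>. ennreal (exp (- (l * (Im (W t \<xi>))\<^sup>2 / 2))) \<partial>M)"
      by (rule indep_var_nn_integral[OF W_law(3)[OF t0], of "\<lambda>x. ennreal (exp (- (l * x\<^sup>2 / 2)))" "\<lambda>x. ennreal (exp (- (l * x\<^sup>2 / 2)))"]) measurable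
    also have "(\<integral>\<^sup>+\<xi>. ennreal (exp (- (l * (Re (W t \<xi>))\<^sup>2 / 2))) \<partial>M) = (\<integral>\<^sup>+y. ennreal (exp (- (l * (t powr H * y)\<^sup>2 / 2))) \<partial>std_normal_distribution)"
      by (rule scaled_normal_nn_integral[OF _ W_law(1)[OF t0], of "\<lambda>x. ennreal (exp (- (l * x\<^sup>2 / 2)))"]) measurable
    also have "(\<integral>\<^sup>+\<xi>. ennreal (exp (- (l * (Im (W t \<xi>))\<^sup>2 / 2))) \<partial>M) = (\<integral>\<^sup>+y. ennreal (exp (- (l * (t powr H * y)\<^sup>2 / 2))) \<partial>std_normal_distribution)"
      by (rule scaled_normal_nn_integral[OF _ W_law(2)[OF t0], of "\<lambda>x. ennreal (exp (- (l * x\<^sup>2 / 2)))"]) measurable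
    also have "(\<lambda>y. ennreal (exp (- (l * (t powr H * y)\<^sup>2 / 2)))) = (\<lambda>y. ennreal (exp (- ((l * v) * y\<^sup>2 / 2))))"
    proof -
      have "(t powr H)\<^sup>2 = v" by (simp add: v_def power2_eq_square powr_add[symmetric])
      then show ?thesis by (simp add: power_mult_distrib mult.assoc)
    qed
    also have "(\<integral>\<^sup>+y. ennreal (exp (- ((l * v) * y\<^sup>2 / 2))) \<partial>std_normal_distribution) = ennreal (1 / sqrt (1 + l * v))"
      using l v by (intro std_normal_Laplace) auto
    also have "ennreal (1 / sqrt (1 + l * v)) * ennreal (1 / sqrt (1 + l * v)) = ennreal (1 / (1 + l * v))"
      using l v by (simp add: ennreal_mult[symmetric])
    finally show ?thesis .
  qed
  interpret P: pair_sigma_finite M lborel ..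
  have G0: "Gamma \<alpha> > 0" using \<alpha>(1) by (rule Gamma_real_pos)
  have "ennreal (Gamma \<alpha>) * (\<integral>\<^sup>+\<xi>. ennreal (?Q \<xi> powr (- \<alpha>)) \<partial>M) = (\<integral>\<^sup>+\<xi>. ennreal (Gamma \<alpha>) * ennreal (?Q \<xi> powr (- \<alpha>)) \<partial>M)"
    by (rule nn_integral_cmult[symmetric]) measurable
  also have "\<dots> = (\<integral>\<^sup>+\<xi>. (\<integral>\<^sup>+l. ?g l * ennreal (exp (- (l * ?Q \<xi>))) \<partial>lborel) \<partial>M)"
  proof (rule nn_integral_cong_AE)
    show "AE \<xi> in M. ennreal (Gamma \<alpha>) * ennreal (?Q \<xi> powr (- \<alpha>)) = (\<integral>\<^sup>+l. ?g l * ennreal (exp (- (l * ?Q \<xi>))) \<partial>lborel)"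
      using AE_nonzero[OF t, of 0]
    proof eventually_elim
      case (elim \<xi>)
      then have "?Q \<xi> > 0" by simp
      from GS[OF this] show ?case using G0 by (simp add: ennreal_mult)
    qed
  qed
  also have "\<dots> = (\<integral>\<^sup>+l. (\<integral>\<^sup>+\<xi>. ?g l * ennreal (exp (- (l * ?Q \<xi>))) \<partial>M) \<partial>lborel)"
    by (rule P.Fubini'[symmetric]) measurable
  also have "\<dots> = (\<integral>\<^sup>+l. ?g l * ennreal (1 / (1 + l * v)) \<partial>lborel)"
  proof (intro nn_integral_cong)
    fix l :: real
    show "(\<integral>\<^sup>+\<xi>. ?g l * ennreal (exp (- (l * ?Q \<xi>))) \<partial>M) = ?g l * ennreal (1 / (1 + l * v))"
    proof (cases "l \<ge> 0")
      case True
      then show ?thesis by (subst nn_integral_cmult) (auto simp: lap[OF True, simplified])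
    qed simp
  qed
  \<comment> \<open>Writing \<open>1 / (1 + l * v)\<close> as an exponential integral over
    \<open>\<mu>\<close> and exchanging the integrals brings back a Gamma integral in
    \<open>l\<close>. This yields \<open>Gamma \<alpha> * Gamma (1 - \<alpha>)\<close> without
    evaluating a Beta integral, and \<open>Gamma \<alpha>\<close> cancels against the left-hand
    side.\<close>
  also have "\<dots> = (\<integral>\<^sup>+l. (\<integral>\<^sup>+\<mu>. ?g l * ennreal (indicator {0..} \<mu> * exp (- (\<mu> * (1 + l * v)))) \<partial>lborel) \<partial>lborel)"
  proof (intro nn_integral_cong)
    fix l :: real
    show "?g l * ennreal (1 / (1 + l * v)) = (\<integral>\<^sup>+\<mu>. ?g l * ennreal (indicator {0..} \<mu> * exp (- (\<mu> * (1 + l * v)))) \<partial>lborel)"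
    proof (cases "l \<ge> 0")
      case True
      then have p: "1 + l * v > 0" using v by (simp add: add_pos_nonneg)
      have "(\<integral>\<^sup>+\<mu>. ennreal (indicator {0..} \<mu> * exp (- (\<mu> * (1 + l * v)))) \<partial>lborel)
         = (\<integral>\<^sup>+\<mu>. ennreal (indicator {0..} \<mu> * \<mu> powr (1 - 1) * exp (- (\<mu> * (1 + l * v)))) \<partial>lborel)"
        by (rule nn_integral_cong_AE, use AE_lborel_singleton[of "0::real"] in eventually_elim) auto
      also have "\<dots> = ennreal (1 / (1 + l * v))"
        using nn_integral_Gamma_scaled[of 1 "1 + l * v"] p by (simp add: powr_minus_divide)
      finally show ?thesis by (subst nn_integral_cmult) auto
    qed simp
  qed
  also have "\<dots> = (\<integral>\<^sup>+\<mu>. (\<integral>\<^sup>+l. ?g l * ennreal (indicator {0..} \<mu> * exp (- (\<mu> * (1 + l * v)))) \<partial>lborel) \<partial>lborel)"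
    by (rule lborel_pair.Fubini'[symmetric]) measurable
  also have "\<dots> = (\<integral>\<^sup>+\<mu>. ennreal (Gamma \<alpha> * v powr (- \<alpha>)) * ennreal (indicator {0..} \<mu> * \<mu> powr ((1 - \<alpha>) - 1) * exp (- (\<mu> * 1))) \<partial>lborel)"
  proof (rule nn_integral_cong_AE, use AE_lborel_singleton[of "0::real"] in eventually_elim)
    case (elim \<mu>)
    show ?case
    proof (cases "\<mu> > 0")
      case True
      have "(\<integral>\<^sup>+l. ?g l * ennreal (indicator {0..} \<mu> * exp (- (\<mu> * (1 + l * v)))) \<partial>lborel)
        = (\<integral>\<^sup>+l. ennreal (exp (- \<mu>)) * (?g l * ennreal (exp (- (l * (\<mu> * v))))) \<partial>lborel)"
        using True by (intro nn_integral_cong) (simp add: ennreal_mult[symmetric] mult_exp_exp algebra_simps)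
      also have "\<dots> = ennreal (exp (- \<mu>)) * ennreal (Gamma \<alpha> * (\<mu> * v) powr (- \<alpha>))"
        using True v GS[of "\<mu> * v"] by (subst nn_integral_cmult) auto
      also have "\<dots> = ennreal (Gamma \<alpha> * v powr (- \<alpha>)) * ennreal (indicator {0..} \<mu> * \<mu> powr ((1 - \<alpha>) - 1) * exp (- (\<mu> * 1)))"
        using True G0 by (simp add: ennreal_mult[symmetric] powr_mult mult_ac)
      finally show ?thesis .
    qed (use elim in simp)
  qed
  also have "\<dots> = ennreal (Gamma \<alpha> * v powr (- \<alpha>)) * ennreal (Gamma (1 - \<alpha>))"
    using nn_integral_Gamma_scaled[of "1 - \<alpha>" 1] \<alpha> by (subst nn_integral_cmult) auto
  finally have eq: "ennreal (Gamma \<alpha>) * (\<integral>\<^sup>+\<xi>. ennreal (?Q \<xi> powr (- \<alpha>)) \<partial>M) = ennreal (Gamma \<alpha>) * ennreal (v powr (- \<alpha>) * Gamma (1 - \<alpha>))"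
    using G0 Gamma_real_pos[of "1 - \<alpha>"] \<alpha> by (simp add: ennreal_mult[symmetric] mult.assoc)
  have "(\<integral>\<^sup>+\<xi>. ennreal (?Q \<xi> powr (- \<alpha>)) \<partial>M) = ennreal (v powr (- \<alpha>) * Gamma (1 - \<alpha>))"
    using eq G0 by (subst (asm) ennreal_mult_cancel_left) auto
  moreover have "(\<integral>\<^sup>+\<xi>. ennreal (norm (W t \<xi>) powr (- (2 * \<alpha>))) \<partial>M) = (\<integral>\<^sup>+\<xi>. ennreal (2 powr (- \<alpha>)) * ennreal (?Q \<xi> powr (- \<alpha>)) \<partial>M)"
  proof (rule nn_integral_cong_AE, use AE_nonzero[OF t, of 0] in eventually_elim)
    case (elim \<xi>)
    then have "norm (W t \<xi>) > 0" by simp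
    then have "norm (W t \<xi>) powr (- (2 * \<alpha>)) = ((norm (W t \<xi>))\<^sup>2) powr (- \<alpha>)"
      by (simp add: powr_powr flip: powr_numeral)
    also have "\<dots> = (2 * ?Q \<xi>) powr (- \<alpha>)" by simp
    also have "\<dots> = 2 powr (- \<alpha>) * ?Q \<xi> powr (- \<alpha>)" by (rule powr_mult)
    finally show ?case by (simp add: ennreal_mult)
  qed
  moreover have "\<dots> = ennreal (2 powr (- \<alpha>)) * (\<integral>\<^sup>+\<xi>. ennreal (?Q \<xi> powr (- \<alpha>)) \<partial>M)"
    by (rule nn_integral_cmult) measurable
  moreover have "v powr (- \<alpha>) = t powr (- (2 * H * \<alpha>))" by (simp add: v_def powr_powr)
  ultimately show ?thesis using Gamma_real_pos[of "1 - \<alpha>"] \<alpha> by (simp add: ennreal_mult[symmetric] mult.assoc)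
qed

text \<open>Continuity in time makes \<open>W\<close> the pointwise limit of its values at the
  dyadic time below, and each such approximation involves countably many times only.\<close>

lemma W_jointly_measurable: "(\<lambda>x. W (snd x) (fst x)) \<in> borel_measurable (M \<Otimes>\<^sub>M borel)"
proof (rule borel_measurable_LIMSEQ_metric)
  fix i :: nat
  have 1: "(\<lambda>x. W (real_of_int k / 2 ^ i) (fst x)) \<in> borel_measurable (M \<Otimes>\<^sub>M borel)" for k :: int
    by measurable
  have 2: "(\<lambda>x. \<lfloor>(2::real) ^ i * snd x\<rfloor>) \<in> (M \<Otimes>\<^sub>M borel) \<rightarrow>\<^sub>M count_space UNIV" by measurable
  show "(\<lambda>x. W (real_of_int \<lfloor>(2::real) ^ i * snd x\<rfloor> / 2 ^ i) (fst x)) \<in> borel_measurable (M \<Otimes>\<^sub>M borel)"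
    by (rule measurable_compose_countable[OF 1 2])
next
  fix x :: "'a \<times> real"
  have "(\<lambda>i. real_of_int \<lfloor>2 ^ i * snd x\<rfloor> / 2 ^ i) \<longlonglongrightarrow> snd x"
  proof (rule tendsto_sandwich[where f="\<lambda>i. snd x - (1 / 2) ^ i" and h="\<lambda>_. snd x"])
    show "\<forall>\<^sub>F i in sequentially. snd x - (1 / 2) ^ i \<le> real_of_int \<lfloor>2 ^ i * snd x\<rfloor> / 2 ^ i"
    proof (intro always_eventually allI)
      fix i :: nat
      have "2 ^ i * snd x - 1 \<le> real_of_int \<lfloor>2 ^ i * snd x\<rfloor>" by linarith
      then have "(2 ^ i * snd x - 1) / 2 ^ i \<le> real_of_int \<lfloor>2 ^ i * snd x\<rfloor> / 2 ^ i" by (intro divide_right_mono) auto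
      then show "snd x - (1 / 2) ^ i \<le> real_of_int \<lfloor>2 ^ i * snd x\<rfloor> / 2 ^ i" by (simp add: diff_divide_distrib power_one_over)
    qed
    show "\<forall>\<^sub>F i in sequentially. real_of_int \<lfloor>2 ^ i * snd x\<rfloor> / 2 ^ i \<le> snd x"
    proof (intro always_eventually allI)
      fix i :: nat
      have "real_of_int \<lfloor>2 ^ i * snd x\<rfloor> / 2 ^ i \<le> (2 ^ i * snd x) / 2 ^ i" by (intro divide_right_mono) auto
      then show "real_of_int \<lfloor>2 ^ i * snd x\<rfloor> / 2 ^ i \<le> snd x" by simp
    qed
    have "(\<lambda>i. snd x - (1 / 2 :: real) ^ i) \<longlonglongrightarrow> snd x - 0"
      by (intro tendsto_diff tendsto_const LIMSEQ_realpow_zero) auto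
    then show "(\<lambda>i. snd x - (1 / 2) ^ i) \<longlonglongrightarrow> snd x" by simp
  qed auto
  then show "(\<lambda>i. W (real_of_int \<lfloor>2 ^ i * snd x\<rfloor> / 2 ^ i) (fst x)) \<longlonglongrightarrow> W (snd x) (fst x)"
    by (intro continuous_on_tendsto_compose[OF W_continuous]) auto
qed

text \<open>\<open>comb J Q\<close> is \<open>r\<close> times \<open>comb J p\<close> plus an
  independent residual, with \<open>\<bar>r\<bar> \<le> \<kappa>\<close>. Replacing it by the
  residual inside the Lipschitz function \<open>g\<close> costs \<open>L * \<kappa>\<close> times
  the mean modulus of \<open>comb J p\<close>, once in the joint expectation and once in the product
  of expectations.\<close>

lemma lipschitz_decorrelation:
  fixes f g :: "complex \<Rightarrow> real"
  assumes J: "finite J" "J \<subseteq> {0..}"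
    and pp: "1 \<le> cov_form H J p p" "cov_form H J p p \<le> 4" and pQ: "\<bar>cov_form H J p Q\<bar> \<le> \<kappa>"
    and [measurable]: "f \<in> borel_measurable borel" "g \<in> borel_measurable borel"
    and f: "\<And>w. \<bar>f w\<bar> \<le> K" and g: "\<And>w. \<bar>g w\<bar> \<le> K'" and lip: "\<And>w w'. \<bar>g w - g w'\<bar> \<le> L * norm (w - w')" and L: "L \<ge> 0"
  shows "\<bar>expectation (\<lambda>\<xi>. f (comb J p \<xi>) * g (comb J Q \<xi>)) - expectation (\<lambda>\<xi>. f (comb J p \<xi>)) * expectation (\<lambda>\<xi>. g (comb J Q \<xi>))\<bar>
    \<le> 18 * K * L * \<kappa>"
proof -
  have K: "K \<ge> 0" using f[of 0] by linarith
  define r where "r = cov_form H J p Q / cov_form H J p p"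
  have "\<bar>r\<bar> \<le> \<kappa> / 1" unfolding r_def abs_divide using pp pQ by (intro frac_le) auto
  then have r: "\<bar>r\<bar> \<le> \<kappa>" by simp
  have \<kappa>: "\<kappa> \<ge> 0" using r by linarith
  define z where "z = (\<lambda>t. Q t - r * p t)"
  have z0: "cov_form H J p z = 0" proof -
    have "cov_form H J p z = cov_form H J p Q - r * cov_form H J p p" unfolding z_def by (simp only: cov_form_diff_right cov_form_scale_right)
    then show ?thesis using pp by (simp add: r_def)
  qed
  define P where "P = comb J p"
  define S where "S = comb J Q"
  define Z where "Z = comb J z"
  have [measurable]: "P \<in> borel_measurable M" "S \<in> borel_measurable M" "Z \<in> borel_measurable M" unfolding P_def S_def Z_def by measurable
  have SZ: "S \<xi> = r *\<^sub>R P \<xi> + Z \<xi>" for \<xi> unfolding S_def P_def Z_def z_def by (simp add: comb_simps)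
  have iP: "integrable M (\<lambda>\<xi>. norm (P \<xi>))" unfolding P_def by (rule comb_norm_integrable[OF J])
  \<comment> \<open>The 9 is 1 + 2 * 4, from \<open>norm w \<le> 1 + (norm w)\<^sup>2\<close> and
    the variance bound 4 in each of two coordinates; used twice it gives the constant 18.\<close>
  have EP: "expectation (\<lambda>\<xi>. norm (P \<xi>)) \<le> 9"
  proof -
    have "expectation (\<lambda>\<xi>. norm (P \<xi>)) \<le> expectation (\<lambda>\<xi>. 1 + (norm (P \<xi>))\<^sup>2)"
    proof (rule integral_mono[OF iP])
      show "integrable M (\<lambda>\<xi>. 1 + (norm (P \<xi>))\<^sup>2)" using comb_norm_moment(1)[OF J, of p] by (simp add: P_def)
      show "norm (P \<xi>) \<le> 1 + (norm (P \<xi>))\<^sup>2" for \<xi>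
        using sum_squares_bound[of 1 "norm (P \<xi>)"] zero_le_power2[of "norm (P \<xi>)"] norm_ge_zero[of "P \<xi>"] unfolding power_one by linarith
    qed
    also have "\<dots> = 1 + 2 * cov_form H J p p" using comb_norm_moment[OF J, of p] by (simp add: P_def prob_space)
    finally show ?thesis using pp by simp
  qed
  have gi: "integrable M (\<lambda>\<xi>. g (S \<xi>))" "integrable M (\<lambda>\<xi>. g (Z \<xi>))" "integrable M (\<lambda>\<xi>. f (P \<xi>))"
    "integrable M (\<lambda>\<xi>. f (P \<xi>) * g (S \<xi>))" "integrable M (\<lambda>\<xi>. f (P \<xi>) * g (Z \<xi>))"
    by (rule integrable_const_bound[where B=K'] integrable_const_bound[where B=K] integrable_const_bound[where B="K * K'"];
        use f g K in \<open>auto simp: abs_mult intro!: mult_mono\<close>)+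
  have d: "\<bar>g (S \<xi>) - g (Z \<xi>)\<bar> \<le> L * \<kappa> * norm (P \<xi>)" for \<xi>
  proof -
    have "\<bar>g (S \<xi>) - g (Z \<xi>)\<bar> \<le> L * (\<bar>r\<bar> * norm (P \<xi>))" using lip[of "S \<xi>" "Z \<xi>"] by (simp add: SZ)
    also have "\<dots> \<le> L * (\<kappa> * norm (P \<xi>))" using r L by (intro mult_left_mono mult_right_mono) auto
    finally show ?thesis by simp
  qed
  have LkE: "expectation (\<lambda>\<xi>. L * \<kappa> * norm (P \<xi>)) \<le> 9 * L * \<kappa>"
    using mult_left_mono[OF EP, of "L * \<kappa>"] L \<kappa> by simp
  have 1: "\<bar>expectation (\<lambda>\<xi>. g (S \<xi>)) - expectation (\<lambda>\<xi>. g (Z \<xi>))\<bar> \<le> 9 * L * \<kappa>"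
  proof -
    have "\<bar>expectation (\<lambda>\<xi>. g (S \<xi>)) - expectation (\<lambda>\<xi>. g (Z \<xi>))\<bar> = \<bar>expectation (\<lambda>\<xi>. g (S \<xi>) - g (Z \<xi>))\<bar>" using gi by simp
    also have "\<dots> \<le> expectation (\<lambda>\<xi>. \<bar>g (S \<xi>) - g (Z \<xi>)\<bar>)" by (rule integral_abs_bound)
    also have "\<dots> \<le> expectation (\<lambda>\<xi>. L * \<kappa> * norm (P \<xi>))" using gi iP d by (intro integral_mono) auto
    finally show ?thesis using LkE by linarith
  qed
  have 2: "\<bar>expectation (\<lambda>\<xi>. f (P \<xi>) * g (S \<xi>)) - expectation (\<lambda>\<xi>. f (P \<xi>) * g (Z \<xi>))\<bar> \<le> K * (9 * L * \<kappa>)"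
  proof -
    have "\<bar>expectation (\<lambda>\<xi>. f (P \<xi>) * g (S \<xi>)) - expectation (\<lambda>\<xi>. f (P \<xi>) * g (Z \<xi>))\<bar> = \<bar>expectation (\<lambda>\<xi>. f (P \<xi>) * g (S \<xi>) - f (P \<xi>) * g (Z \<xi>))\<bar>" using gi by simp
    also have "\<dots> \<le> expectation (\<lambda>\<xi>. \<bar>f (P \<xi>) * g (S \<xi>) - f (P \<xi>) * g (Z \<xi>)\<bar>)" by (rule integral_abs_bound)
    also have "\<dots> \<le> expectation (\<lambda>\<xi>. K * (L * \<kappa> * norm (P \<xi>)))"
    proof (rule integral_mono)
      show "integrable M (\<lambda>\<xi>. \<bar>f (P \<xi>) * g (S \<xi>) - f (P \<xi>) * g (Z \<xi>)\<bar>)"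
        by (intro integrable_abs Bochner_Integration.integrable_diff gi)
      show "integrable M (\<lambda>\<xi>. K * (L * \<kappa> * norm (P \<xi>)))" by (intro integrable_mult_right iP)
      show "\<bar>f (P \<xi>) * g (S \<xi>) - f (P \<xi>) * g (Z \<xi>)\<bar> \<le> K * (L * \<kappa> * norm (P \<xi>))" for \<xi>
        unfolding right_diff_distrib[symmetric] abs_mult using f d K by (intro mult_mono) auto
    qed
    also have "\<dots> \<le> K * (9 * L * \<kappa>)" using LkE K by (simp add: mult_left_mono)
    finally show ?thesis .
  qed
  have "(\<lambda>x. f (fst x)) \<in> borel_measurable (borel :: (complex \<times> complex) measure)"
    "(\<lambda>x. g (fst x)) \<in> borel_measurable (borel :: (complex \<times> complex) measure)"
    unfolding borel_prod[symmetric] by measurable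
  from comb_indep_expectation(2)[OF J z0 z0 z0 z0 this, unfolded fst_conv, folded P_def Z_def, OF gi(3,2)]
  have 3: "expectation (\<lambda>\<xi>. f (P \<xi>) * g (Z \<xi>)) = expectation (\<lambda>\<xi>. f (P \<xi>)) * expectation (\<lambda>\<xi>. g (Z \<xi>))" .
  have "\<bar>expectation (\<lambda>\<xi>. f (P \<xi>))\<bar> \<le> expectation (\<lambda>\<xi>. K)"
    using f gi by (intro order_trans[OF integral_abs_bound integral_mono]) auto
  then have Ef: "\<bar>expectation (\<lambda>\<xi>. f (P \<xi>))\<bar> \<le> K" by (simp add: prob_space)
  have "\<bar>expectation (\<lambda>\<xi>. f (P \<xi>)) * (expectation (\<lambda>\<xi>. g (Z \<xi>)) - expectation (\<lambda>\<xi>. g (S \<xi>)))\<bar> \<le> K * (9 * L * \<kappa>)"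
    unfolding abs_mult using Ef 1 K by (intro mult_mono) (auto simp: abs_minus_commute)
  then show ?thesis using 2 unfolding P_def[symmetric] S_def[symmetric] 3 right_diff_distrib by linarith
qed

end

section \<open>Mass of the blocks\<close>

text \<open>Blocks are parametrised by \<open>{1..2}\<close>, which has length 1, so integration
  over a block is an expectation and the product with \<open>M\<close> is again a probability
  space.\<close>

definition unit_block :: "real measure" where
  "unit_block = restrict_space lborel {1..2}"

lemma space_unit_block[simp]: "space unit_block = {1..2}"
  by (simp add: unit_block_def space_restrict_space)

lemma measurable_unit_block: "f \<in> borel_measurable borel \<Longrightarrow> f \<in> borel_measurable unit_block"
  unfolding unit_block_def by (intro measurable_restrict_space1) auto

lemma prob_space_unit_block: "prob_space unit_block"
proof
  show "emeasure unit_block (space unit_block) = 1"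
    by (simp add: unit_block_def space_restrict_space emeasure_restrict_space)
qed

interpretation unit_block: prob_space unit_block by (rule prob_space_unit_block)

lemma unit_block_integral_bound:
  fixes f :: "real \<Rightarrow> real"
  assumes "\<And>u. u \<in> {1..2} \<Longrightarrow> \<bar>f u\<bar> \<le> C"
  shows "\<bar>integral\<^sup>L unit_block f\<bar> \<le> C"
proof (cases "integrable unit_block f")
  case True
  have "\<bar>integral\<^sup>L unit_block f\<bar> \<le> (\<integral>u. \<bar>f u\<bar> \<partial>unit_block)" by (rule integral_abs_bound)
  also have "\<dots> \<le> (\<integral>u. C \<partial>unit_block)" using True assms by (intro integral_mono) auto
  finally show ?thesis using unit_block.prob_space by simp
next
  case False
  \<comment> \<open>The Bochner integral of a non-integrable function is 0 by convention, and
    \<open>C\<close> is nonnegative by the hypothesis at \<open>u = 1\<close>.\<close>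
  then show ?thesis using assms[of 1] by (simp add: not_integrable_integral_eq)
qed

lemma unit_block_integral_inverse: "(\<integral>u. c / u \<partial>unit_block) = c * ln 2"
proof -
  have "(\<integral>u. c / u \<partial>unit_block) = (\<integral>u. indicator {1..2} u *\<^sub>R (c / u) \<partial>lborel)"
    unfolding unit_block_def by (subst integral_restrict_space) auto
  also have "\<dots> = c * ln 2 - c * ln 1"
  proof (rule integral_FTC_Icc)
    show "((\<lambda>x. c * ln x) has_vector_derivative c / x) (at x within {1..2})" if "1 \<le> x" "x \<le> 2" for x :: real
      using that by (auto intro!: derivative_eq_intros simp: has_real_derivative_iff_has_vector_derivative[symmetric])
    show "continuous_on {1..2} (\<lambda>u. c / u)" by (intro continuous_intros) auto
  qed simp
  finally show ?thesis by simp
qed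

lemma level_decay_summable:
  assumes "c > 0"
  shows "summable (\<lambda>n. 2 powr (- c * real (level n)) / (real n + 1))"
proof (rule summable_comparison_test'[where N=0])
  show "summable (\<lambda>n. 2 powr c * (real n + 1) powr (- 1 - c / 16))"
    using assms by (intro summable_mult summable_shifted_powr) auto
  fix n :: nat
  have "2 powr (- c * real (level n)) / (real n + 1) \<le> (2 powr c * (real n + 1) powr (- c / 16)) / (real n + 1)"
    using assms by (intro divide_right_mono level_decay) auto
  also have "\<dots> = 2 powr c * (real n + 1) powr (- 1 - c / 16)"
  proof -
    have "(real n + 1) powr (- 1 - c / 16) = (real n + 1) powr (- 1) * (real n + 1) powr (- c / 16)"
      unfolding powr_add[symmetric] by simp
    then show ?thesis by (simp add: powr_minus_divide)
  qed
  finally show "norm (2 powr (- c * real (level n)) / (real n + 1)) \<le> 2 powr c * (real n + 1) powr (- 1 - c / 16)" by simp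
qed

definition trunc_pow :: "real \<Rightarrow> real \<Rightarrow> complex \<Rightarrow> real" where
  "trunc_pow a \<epsilon> w = max (norm w) \<epsilon> powr (- a)"

lemma trunc_pow_measurable[measurable]: "trunc_pow a \<epsilon> \<in> borel_measurable borel"
  unfolding trunc_pow_def by measurable

lemma trunc_pow_bounds:
  assumes "1 \<le> a" "a \<le> 2" "0 < \<epsilon>" "\<epsilon> \<le> 1"
  shows "0 \<le> trunc_pow a \<epsilon> w" "trunc_pow a \<epsilon> w \<le> \<epsilon> powr (- 2)"
proof -
  show "0 \<le> trunc_pow a \<epsilon> w" by (simp add: trunc_pow_def)
  have "trunc_pow a \<epsilon> w \<le> \<epsilon> powr (- a)" unfolding trunc_pow_def using assms by (intro powr_mono2') auto
  also have "\<dots> \<le> \<epsilon> powr (- 2)" using assms by (intro powr_mono') auto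
  finally show "trunc_pow a \<epsilon> w \<le> \<epsilon> powr (- 2)" .
qed

lemma trunc_pow_lipschitz:
  assumes a: "1 \<le> a" "a \<le> 2" and \<epsilon>: "0 < \<epsilon>" "\<epsilon> \<le> 1"
  shows "\<bar>trunc_pow a \<epsilon> w - trunc_pow a \<epsilon> w'\<bar> \<le> 2 * \<epsilon> powr (- 3) * norm (w - w')"
proof -
  have main: "\<bar>y powr (- a) - x powr (- a)\<bar> \<le> 2 * \<epsilon> powr (- 3) * (y - x)" if x: "\<epsilon> \<le> x" "x < y" for x y
  proof -
    have "\<exists>z. x < z \<and> z < y \<and> y powr (- a) - x powr (- a) = (y - x) * (- a * z powr (- a - 1))"
      using x \<epsilon> has_real_derivative_powr[of _ "- a"] by (intro MVT2) auto
    then obtain z where z: "x < z" "z < y" "y powr (- a) - x powr (- a) = (y - x) * (- a * z powr (- a - 1))" by blast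
    have "z powr (- a - 1) \<le> \<epsilon> powr (- a - 1)" using z x \<epsilon> a by (intro powr_mono2') auto
    also have "\<dots> \<le> \<epsilon> powr (- 3)" using \<epsilon> a by (intro powr_mono') auto
    finally have "a * z powr (- a - 1) \<le> 2 * \<epsilon> powr (- 3)" using a by (intro mult_mono) auto
    then have "(y - x) * (a * z powr (- a - 1)) \<le> (y - x) * (2 * \<epsilon> powr (- 3))" using x by (intro mult_left_mono) auto
    moreover have "\<bar>y powr (- a) - x powr (- a)\<bar> = (y - x) * (a * z powr (- a - 1))"
      unfolding z(3) using x a by (simp add: abs_mult)
    ultimately show ?thesis by (simp add: mult.commute)
  qed
  define x where "x = max (norm w) \<epsilon>"
  define y where "y = max (norm w') \<epsilon>"
  have xy: "\<epsilon> \<le> x" "\<epsilon> \<le> y" by (auto simp: x_def y_def)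
  have "\<bar>x - y\<bar> \<le> \<bar>norm w - norm w'\<bar>" unfolding x_def y_def by (auto simp: max_def)
  also have "\<dots> \<le> norm (w - w')" by (rule norm_triangle_ineq3)
  finally have d: "\<bar>x - y\<bar> \<le> norm (w - w')" .
  have "\<bar>x powr (- a) - y powr (- a)\<bar> \<le> 2 * \<epsilon> powr (- 3) * \<bar>x - y\<bar>"
  proof (cases x y rule: linorder_cases)
    case less
    then show ?thesis using main[OF xy(1) less] by (simp add: abs_minus_commute)
  next
    case greater
    then show ?thesis using main[OF xy(2) greater] by simp
  qed simp
  also have "\<dots> \<le> 2 * \<epsilon> powr (- 3) * norm (w - w')" using d by (intro mult_left_mono) auto
  finally show ?thesis by (simp add: trunc_pow_def x_def y_def)
qed

lemma trunc_pow_excess: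
  assumes "0 < \<epsilon>" "0 \<le> a" "0 \<le> c"
  shows "max 0 (norm w powr (- a) - trunc_pow a \<epsilon> w) \<le> \<epsilon> powr c * norm w powr (- (a + c))"
proof (cases "norm w < \<epsilon> \<and> w \<noteq> 0")
  case True
  then have w: "norm w > 0" "norm w < \<epsilon>" by auto
  have "norm w powr (- a) = norm w powr c * norm w powr (- (a + c))" by (simp add: powr_add[symmetric])
  also have "\<dots> \<le> \<epsilon> powr c * norm w powr (- (a + c))" using w assms by (intro mult_right_mono powr_mono2) auto
  finally have "norm w powr (- a) \<le> \<epsilon> powr c * norm w powr (- (a + c))" .
  moreover have "0 \<le> trunc_pow a \<epsilon> w" by (simp add: trunc_pow_def)
  ultimately show ?thesis by simp
next
  case False
  \<comment> \<open>At \<open>w = 0\<close> the power of 0 is 0 by convention, so the truncated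
    power is the larger one there.\<close>
  then have "w = 0 \<or> norm w \<ge> \<epsilon>" by auto
  then have "norm w powr (- a) - trunc_pow a \<epsilon> w \<le> 0" by (auto simp: trunc_pow_def)
  then show ?thesis by simp
qed

context centred_fbm
begin

section \<open>Truncated mass of a rescaled block\<close>

definition blk :: "complex \<Rightarrow> nat \<Rightarrow> real \<Rightarrow> 'a \<Rightarrow> complex" where
  "blk z n u \<xi> = (1 / scale n) *\<^sub>R (z + W (2 ^ n * u) \<xi>)"

text \<open>The square root of \<open>1 / 2 ^ level n\<close>: the truncated power is then at most
  \<open>2 ^ level n\<close> and its Lipschitz constant at most
  \<open>2 * (2 ^ level n)\<^sup>2\<close>.\<close>

definition cutoff :: "nat \<Rightarrow> real" where "cutoff n = 2 powr (- real (level n) / 2)"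

definition tp :: "nat \<Rightarrow> complex \<Rightarrow> real" where "tp n = trunc_pow (1 / H) (cutoff n)"

lemma blk_measurable[measurable]: "blk z n u \<in> borel_measurable M"
  unfolding blk_def[abs_def] by measurable

lemma blk_joint: "(\<lambda>x. blk z n (snd x) (fst x)) \<in> borel_measurable (M \<Otimes>\<^sub>M unit_block)"
proof -
  have "(\<lambda>x. (fst x, 2 ^ n * snd x)) \<in> M \<Otimes>\<^sub>M unit_block \<rightarrow>\<^sub>M M \<Otimes>\<^sub>M borel"
  proof (rule measurable_Pair)
    show "(\<lambda>x. 2 ^ n * snd x) \<in> borel_measurable (M \<Otimes>\<^sub>M unit_block)"
      by (rule measurable_compose[OF measurable_snd measurable_unit_block]) measurable
  qed measurable
  from measurable_compose[OF this W_jointly_measurable]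
  have "(\<lambda>x. W (2 ^ n * snd x) (fst x)) \<in> borel_measurable (M \<Otimes>\<^sub>M unit_block)" by simp
  then show ?thesis unfolding blk_def by measurable
qed

lemma invH: "1 \<le> 1 / H" "1 / H < 2" "1 / H \<le> 2"
proof -
  have "0 < H" using H_gt by simp
  then show "1 \<le> 1 / H" "1 / H < 2" "1 / H \<le> 2" using H_gt H_lt by (auto simp: field_simps)
qed

lemma cutoff_bounds: "0 < cutoff n" "cutoff n \<le> 1"
proof -
  have "2 powr (- real (level n) / 2) \<le> 2 powr 0" by (intro powr_mono) auto
  then show "cutoff n \<le> 1" by (simp add: cutoff_def)
qed (simp add: cutoff_def)

lemma tp_bounds:
  "0 \<le> tp n w" "tp n w \<le> 2 ^ level n" "\<bar>tp n w\<bar> \<le> 2 ^ level n" "\<bar>tp n w - tp n w'\<bar> \<le> 2 * (2 ^ level n)\<^sup>2 * norm (w - w')"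
proof -
  have c2: "cutoff n powr (- 2) = 2 ^ level n"
  proof -
    have "cutoff n powr (- 2) = 2 powr real (level n)" unfolding cutoff_def powr_powr by (rule arg_cong[where f="\<lambda>x. 2 powr x"]) simp
    also have "\<dots> = 2 ^ level n" by (rule powr_realpow) simp
    finally show ?thesis .
  qed
  have c3: "cutoff n powr (- 3) \<le> (2 ^ level n)\<^sup>2"
  proof -
    have "cutoff n powr (- 3) \<le> 2 powr (2 * real (level n))"
      unfolding cutoff_def powr_powr by (intro powr_mono) auto
    also have "\<dots> = 2 powr real (2 * level n)" by simp
    also have "\<dots> = 2 ^ (2 * level n)" by (rule powr_realpow) simp
    also have "\<dots> = (2 ^ level n)\<^sup>2" by (simp only: power_even_eq)
    finally show ?thesis .
  qed
  show "0 \<le> tp n w" "tp n w \<le> 2 ^ level n"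
    unfolding tp_def using trunc_pow_bounds[OF invH(1,3) cutoff_bounds, of n w] c2 by auto
  then show "\<bar>tp n w\<bar> \<le> 2 ^ level n" by simp
  have "\<bar>tp n w - tp n w'\<bar> \<le> 2 * cutoff n powr (- 3) * norm (w - w')"
    unfolding tp_def by (rule trunc_pow_lipschitz[OF invH(1,3) cutoff_bounds])
  also have "\<dots> \<le> 2 * (2 ^ level n)\<^sup>2 * norm (w - w')" using c3 by (intro mult_right_mono) auto
  finally show "\<bar>tp n w - tp n w'\<bar> \<le> 2 * (2 ^ level n)\<^sup>2 * norm (w - w')" .
qed

lemma tp_measurable[measurable]: "tp n \<in> borel_measurable borel"
  unfolding tp_def by measurable

definition mean_mass :: "complex \<Rightarrow> nat \<Rightarrow> real \<Rightarrow> real" where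
  "mean_mass z n u = expectation (\<lambda>\<xi>. tp n (blk z n u \<xi>))"

lemma tp_integrable: "integrable M (\<lambda>\<xi>. tp n (blk z n u \<xi>))"
  by (rule integrable_const_bound[where B="2 ^ level n"]) (use tp_bounds(3) in auto)

lemma mean_mass_bound: "\<bar>mean_mass z n u\<bar> \<le> 2 ^ level n"
proof -
  have "\<bar>mean_mass z n u\<bar> \<le> expectation (\<lambda>\<xi>. \<bar>tp n (blk z n u \<xi>)\<bar>)" unfolding mean_mass_def by (rule integral_abs_bound)
  also have "\<dots> \<le> expectation (\<lambda>\<xi>. 2 ^ level n)" using tp_integrable tp_bounds(3) by (intro integral_mono) auto
  finally show ?thesis by (simp add: prob_space)
qed

definition centred_mass :: "complex \<Rightarrow> nat \<Rightarrow> real \<Rightarrow> 'a \<Rightarrow> real" where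
  "centred_mass z n u \<xi> = tp n (blk z n u \<xi>) - mean_mass z n u"

lemma centred_mass_bound: "\<bar>centred_mass z n u \<xi>\<bar> \<le> 2 * 2 ^ level n"
  using tp_bounds(3)[of n "blk z n u \<xi>"] mean_mass_bound[of z n u] by (simp add: centred_mass_def)

lemma centred_mass_measurable[measurable]: "centred_mass z n u \<in> borel_measurable M"
  unfolding centred_mass_def[abs_def] by measurable

lemma tp_joint: "(\<lambda>x. tp n (blk z n (snd x) (fst x))) \<in> borel_measurable (M \<Otimes>\<^sub>M unit_block)"
  by (rule measurable_compose[OF blk_joint tp_measurable])

lemma mean_mass_measurable[measurable]: "mean_mass z n \<in> borel_measurable unit_block"
proof -
  have "(\<lambda>x. tp n (blk z n (fst x) (snd x))) \<in> borel_measurable (unit_block \<Otimes>\<^sub>M M)"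
    using measurable_compose[OF measurable_pair_swap' tp_joint] by (simp add: case_prod_beta)
  then have "case_prod (\<lambda>u \<xi>. tp n (blk z n u \<xi>)) \<in> borel_measurable (unit_block \<Otimes>\<^sub>M M)" by (simp add: case_prod_beta')
  then show ?thesis unfolding mean_mass_def[abs_def] by (rule borel_measurable_lebesgue_integral)
qed

lemma centred_mass_joint: "(\<lambda>x. centred_mass z n (snd x) (fst x)) \<in> borel_measurable (M \<Otimes>\<^sub>M unit_block)"
  unfolding centred_mass_def by (intro borel_measurable_diff tp_joint measurable_compose[OF measurable_snd mean_mass_measurable])

text \<open>\<open>lipschitz_decorrelation\<close> with the bound \<open>2 ^ level n\<close> on the
  earlier block, the Lipschitz constant \<open>2 * (2 ^ level m)\<^sup>2\<close> on the later one
  and the covariance bound \<open>8 * \<rho> ^ (m - n)\<close>; hence 288 = 18 * 2 * 8.\<close>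

lemma centred_mass_covariance:
  assumes nm: "n \<le> m" and uv: "u \<in> {1..2}" "v \<in> {1..2}"
  shows "\<bar>expectation (\<lambda>\<xi>. centred_mass z n u \<xi> * centred_mass z m v \<xi>)\<bar> \<le> 288 * \<rho> ^ (m - n) * (2 ^ level m) ^ 4"
proof -
  define x where "x = 2 ^ n * u"
  define y where "y = 2 ^ m * v"
  have xb: "x \<in> {2 ^ n..2 * 2 ^ n}" "y \<in> {2 ^ m..2 * 2 ^ m}" using uv by (auto simp: x_def y_def)
  have x0: "x > 0" "y > 0" using uv by (auto simp: x_def y_def)
  define J where "J = {x, y}"
  have J: "finite J" "J \<subseteq> {0..}" "x \<in> J" "y \<in> J" using x0 by (auto simp: J_def)
  define s where "s = 1 / scale n"
  define t where "t = 1 / scale m"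
  have st: "s > 0" "t > 0" using scale_pos by (auto simp: s_def t_def)
  define p where "p = (\<lambda>w. s * indicator {x} w :: real)"
  define Q where "Q = (\<lambda>w. t * indicator {y} w :: real)"
  have cb: "comb J p \<xi> = s *\<^sub>R W x \<xi>" "comb J Q \<xi> = t *\<^sub>R W y \<xi>" for \<xi>
    unfolding p_def Q_def comb_scale using J by (simp_all add: comb_indicator)
  have forms: "cov_form H J p p = s * (s * fbm_cov H x x)" "cov_form H J p Q = t * (s * fbm_cov H x y)"
    unfolding p_def Q_def cov_form_scale_left cov_form_scale_right using J by (simp_all add: cov_form_indicator)
  have "s * (s * (scale n)\<^sup>2) \<le> s * (s * fbm_cov H x x)" using st by (intro mult_left_mono cov_block_bound(2)[OF xb(1) xb(1)]) auto
  then have pp1: "1 \<le> cov_form H J p p" unfolding forms using scale_pos[of n] by (simp add: s_def power2_eq_square)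
  have "fbm_cov H x x \<le> 4 * (scale n)\<^sup>2" using cov_block_bound(1)[OF xb(1) xb(1)] by linarith
  then have "s * (s * fbm_cov H x x) \<le> s * (s * (4 * (scale n)\<^sup>2))" using st by (intro mult_left_mono) auto
  then have pp2: "cov_form H J p p \<le> 4" unfolding forms using scale_pos[of n] by (simp add: s_def power2_eq_square)
  have cov: "\<bar>fbm_cov H x y\<bar> \<le> 8 * \<rho> ^ (m - n) * (scale n * scale m)"
  proof (cases "n = m")
    case True
    then have "\<bar>fbm_cov H x y\<bar> \<le> 4 * (scale n)\<^sup>2" using xb by (intro cov_block_bound(1)) auto
    also have "\<dots> \<le> 8 * \<rho> ^ (m - n) * (scale n * scale m)" using True by (simp add: power2_eq_square)
    finally show ?thesis .
  next
    case False
    then show ?thesis using nm xb by (intro cov_block_decay) auto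
  qed
  have pQ: "\<bar>cov_form H J p Q\<bar> \<le> 8 * \<rho> ^ (m - n)"
  proof -
    have "\<bar>cov_form H J p Q\<bar> = t * (s * \<bar>fbm_cov H x y\<bar>)" unfolding forms using st by (simp add: abs_mult)
    also have "\<dots> \<le> t * (s * (8 * \<rho> ^ (m - n) * (scale n * scale m)))" using st cov by (intro mult_left_mono) auto
    also have "\<dots> = 8 * \<rho> ^ (m - n)" using scale_pos[of n] scale_pos[of m] by (simp add: s_def t_def)
    finally show ?thesis .
  qed
  let ?f = "\<lambda>w. tp n (s *\<^sub>R z + w)" and ?g = "\<lambda>w. tp m (t *\<^sub>R z + w)"
  have main: "\<bar>expectation (\<lambda>\<xi>. ?f (comb J p \<xi>) * ?g (comb J Q \<xi>)) - expectation (\<lambda>\<xi>. ?f (comb J p \<xi>)) * expectation (\<lambda>\<xi>. ?g (comb J Q \<xi>))\<bar>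
    \<le> 18 * 2 ^ level n * (2 * (2 ^ level m)\<^sup>2) * (8 * \<rho> ^ (m - n))"
  proof (rule lipschitz_decorrelation[OF J(1,2) pp1 pp2 pQ])
    show "\<bar>?f w\<bar> \<le> 2 ^ level n" "\<bar>?g w\<bar> \<le> 2 ^ level m" for w by (rule tp_bounds(3))+
    show "\<bar>?g w - ?g w'\<bar> \<le> 2 * (2 ^ level m)\<^sup>2 * norm (w - w')" for w w'
      using tp_bounds(4)[of m "t *\<^sub>R z + w" "t *\<^sub>R z + w'"] by simp
  qed measurable
  have fb: "?f (comb J p \<xi>) = tp n (blk z n u \<xi>)" "?g (comb J Q \<xi>) = tp m (blk z m v \<xi>)" for \<xi>
    unfolding cb blk_def x_def y_def s_def t_def scaleR_add_right by simp_all
  have i: "integrable M (\<lambda>\<xi>. tp n (blk z n u \<xi>) * tp m (blk z m v \<xi>))"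
    by (rule integrable_const_bound[where B="2 ^ level n * 2 ^ level m"]) (use tp_bounds in \<open>auto simp: abs_mult intro!: mult_mono\<close>)
  have "expectation (\<lambda>\<xi>. centred_mass z n u \<xi> * centred_mass z m v \<xi>)
    = expectation (\<lambda>\<xi>. tp n (blk z n u \<xi>) * tp m (blk z m v \<xi>)) - mean_mass z n u * mean_mass z m v"
  proof -
    have e: "(\<lambda>\<xi>. centred_mass z n u \<xi> * centred_mass z m v \<xi>) = (\<lambda>\<xi>. tp n (blk z n u \<xi>) * tp m (blk z m v \<xi>)
       - mean_mass z m v * tp n (blk z n u \<xi>) - mean_mass z n u * tp m (blk z m v \<xi>) + mean_mass z n u * mean_mass z m v)"
      by (simp add: centred_mass_def algebra_simps fun_eq_iff)
    show ?thesis unfolding e using i tp_integrable[of n z u] tp_integrable[of m z v]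
      by (simp add: mean_mass_def prob_space)
  qed
  then have "\<bar>expectation (\<lambda>\<xi>. centred_mass z n u \<xi> * centred_mass z m v \<xi>)\<bar> \<le> 18 * 2 ^ level n * (2 * (2 ^ level m)\<^sup>2) * (8 * \<rho> ^ (m - n))"
    using main unfolding fb mean_mass_def by simp
  also have "\<dots> = 288 * \<rho> ^ (m - n) * (2 ^ level n * (2 ^ level m)\<^sup>2)" by simp
  also have "\<dots> \<le> 288 * \<rho> ^ (m - n) * (2 ^ level m) ^ 4"
  proof (intro mult_left_mono)
    have "(2 ^ level n * (2 ^ level m)\<^sup>2 :: real) \<le> (2 ^ level m)\<^sup>2 * (2 ^ level m)\<^sup>2"
    proof (intro mult_right_mono)
      have "(2 ^ level n :: real) \<le> 2 ^ level m" using level_mono[OF nm] by (intro power_increasing) auto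
      also have "\<dots> \<le> (2 ^ level m)\<^sup>2" by (simp add: power2_eq_square)
      finally show "(2 ^ level n :: real) \<le> (2 ^ level m)\<^sup>2" .
    qed simp
    then show "(2 ^ level n * (2 ^ level m)\<^sup>2 :: real) \<le> (2 ^ level m) ^ 4" by (simp add: power2_eq_square power4_eq_xxxx mult.assoc)
  qed (use rho_bounds in auto)
  finally show ?thesis .
qed

text \<open>Fubini for bounded integrands. The factor \<open>V\<close> is there so that the lemma
  can be applied twice in succession, once for each block of a covariance.\<close>

lemma expectation_unit_block_swap:
  fixes h :: "real \<Rightarrow> 'a \<Rightarrow> real"
  assumes h: "(\<lambda>x. h (snd x) (fst x)) \<in> borel_measurable (M \<Otimes>\<^sub>M unit_block)" "\<And>u \<xi>. \<bar>h u \<xi>\<bar> \<le> C"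
    and V[measurable]: "V \<in> borel_measurable M" and Vb: "\<And>\<xi>. \<bar>V \<xi>\<bar> \<le> D"
  shows "expectation (\<lambda>\<xi>. V \<xi> * (\<integral>u. h u \<xi> \<partial>unit_block)) = (\<integral>u. expectation (\<lambda>\<xi>. V \<xi> * h u \<xi>) \<partial>unit_block)"
proof -
  interpret P: pair_prob_space M unit_block ..
  have "integrable (M \<Otimes>\<^sub>M unit_block) (\<lambda>x. V (fst x) * h (snd x) (fst x))"
  proof (rule P.integrable_const_bound[where B="D * C"])
    have "D \<ge> 0" using Vb[of undefined] by linarith
    then show "AE x in M \<Otimes>\<^sub>M unit_block. norm (V (fst x) * h (snd x) (fst x)) \<le> D * C"
      using h Vb by (intro AE_I2) (auto simp: abs_mult intro!: mult_mono)
  qed (use h in measurable)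
  then have "integrable (M \<Otimes>\<^sub>M unit_block) (case_prod (\<lambda>\<xi> u. V \<xi> * h u \<xi>))" by (simp add: case_prod_beta')
  from P.Fubini_integral[OF this] show ?thesis by simp
qed

definition block_fluctuation :: "complex \<Rightarrow> nat \<Rightarrow> 'a \<Rightarrow> real" where
  "block_fluctuation z n \<xi> = (\<integral>u. centred_mass z n u \<xi> \<partial>unit_block)"

lemma block_fluctuation_bound: "\<bar>block_fluctuation z n \<xi>\<bar> \<le> 2 * 2 ^ level n"
  unfolding block_fluctuation_def by (intro unit_block_integral_bound centred_mass_bound)

lemma block_fluctuation_measurable[measurable]: "block_fluctuation z n \<in> borel_measurable M"
proof -
  have "case_prod (\<lambda>\<xi> u. centred_mass z n u \<xi>) \<in> borel_measurable (M \<Otimes>\<^sub>M unit_block)"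
    using centred_mass_joint by (simp add: case_prod_beta')
  then show ?thesis unfolding block_fluctuation_def[abs_def] by (rule unit_block.borel_measurable_lebesgue_integral)
qed

text \<open>The covariance of two block averages is the average of covariances over pairs of times,
  so the bound at fixed times carries over to the blocks.\<close>

lemma AE_block_fluctuation_average: "AE \<xi> in M. (\<lambda>N. (\<Sum>n<N. block_fluctuation z n \<xi>) / real N) \<longlonglongrightarrow> 0"
proof (rule strong_law_weak_correlation[where C=288, OF _ _ rho_bounds])
  show "integrable M (\<lambda>\<xi>. block_fluctuation z n \<xi> * block_fluctuation z m \<xi>)" for n m
  proof (rule integrable_const_bound[where B="(2 * 2 ^ level n) * (2 * 2 ^ level m)"])
    have "norm (block_fluctuation z n \<xi> * block_fluctuation z m \<xi>) \<le> (2 * 2 ^ level n) * (2 * 2 ^ level m)" for \<xi>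
      unfolding real_norm_def abs_mult by (intro mult_mono block_fluctuation_bound) auto
    then show "AE \<xi> in M. norm (block_fluctuation z n \<xi> * block_fluctuation z m \<xi>) \<le> (2 * 2 ^ level n) * (2 * 2 ^ level m)" by (rule AE_I2)
  qed measurable
  show "\<bar>expectation (\<lambda>\<xi>. block_fluctuation z n \<xi> * block_fluctuation z m \<xi>)\<bar> \<le> 288 * (real m + 1) powr (1 / 4) * \<rho> ^ (m - n)"
    if nm: "n \<le> m" for n m
  proof -
    let ?B = "288 * \<rho> ^ (m - n) * (2 ^ level m) ^ 4"
    have 1: "expectation (\<lambda>\<xi>. centred_mass z n u \<xi> * block_fluctuation z m \<xi>) = (\<integral>v. expectation (\<lambda>\<xi>. centred_mass z n u \<xi> * centred_mass z m v \<xi>) \<partial>unit_block)" for u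
      unfolding block_fluctuation_def by (rule expectation_unit_block_swap[OF centred_mass_joint centred_mass_bound centred_mass_measurable centred_mass_bound])
    have 2: "expectation (\<lambda>\<xi>. block_fluctuation z m \<xi> * block_fluctuation z n \<xi>) = (\<integral>u. expectation (\<lambda>\<xi>. block_fluctuation z m \<xi> * centred_mass z n u \<xi>) \<partial>unit_block)"
      by (subst (2) block_fluctuation_def) (rule expectation_unit_block_swap[OF centred_mass_joint centred_mass_bound block_fluctuation_measurable block_fluctuation_bound])
    have "\<bar>expectation (\<lambda>\<xi>. block_fluctuation z m \<xi> * block_fluctuation z n \<xi>)\<bar> \<le> ?B"
      unfolding 2
    proof (rule unit_block_integral_bound)
      fix u :: real assume u: "u \<in> {1..2}"
      show "\<bar>expectation (\<lambda>\<xi>. block_fluctuation z m \<xi> * centred_mass z n u \<xi>)\<bar> \<le> ?B"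
        unfolding mult.commute[of "block_fluctuation z m _"] 1
        by (intro unit_block_integral_bound centred_mass_covariance nm u)
    qed
    also have "\<dots> \<le> 288 * \<rho> ^ (m - n) * (real m + 1) powr (1 / 4)"
      using rho_bounds by (intro mult_left_mono level_pow4) auto
    finally show ?thesis by (simp add: mult_ac)
  qed
qed auto

text \<open>The maximum matters only where the path vanishes: elsewhere the truncated power is at
  most the full one.\<close>

definition excess_mass :: "complex \<Rightarrow> nat \<Rightarrow> real \<Rightarrow> 'a \<Rightarrow> real" where
  "excess_mass z n u \<xi> = max 0 (norm (blk z n u \<xi>) powr (- (1 / H)) - tp n (blk z n u \<xi>))"

lemma excess_mass_measurable[measurable]: "excess_mass z n u \<in> borel_measurable M"
  unfolding excess_mass_def[abs_def] by measurable

text \<open>A quarter of the gap between \<open>1 / H\<close> and 2: half of the gap is spent as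
  extra order of the negative moment, and \<open>cutoff n\<close>, being a square root, halves the
  resulting gain.\<close>

definition tail_exponent :: real where "tail_exponent = (2 - 1 / H) / 4"

lemma tail_exponent_pos: "tail_exponent > 0"
  using invH by (simp add: tail_exponent_def)

lemma excess_mass_moment:
  "\<exists>C\<ge>0. \<forall>z n. \<forall>u\<in>{1..2}. (\<integral>\<^sup>+\<xi>. ennreal (excess_mass z n u \<xi>) \<partial>M) \<le> ennreal (C * 2 powr (- tail_exponent * real (level n)))"
proof -
  define c where "c = 2 * tail_exponent"
  define e where "e = 1 / H + c"
  have c: "c > 0" using tail_exponent_pos by (simp add: c_def)
  have e: "0 \<le> e" "e < 2" using invH c H_gt by (auto simp: e_def c_def tail_exponent_def field_simps)
  obtain C where C: "C \<ge> 0" "\<And>s z. s > 0 \<Longrightarrow> (\<integral>\<^sup>+\<xi>. ennreal (norm (z + W s \<xi>) powr (- e)) \<partial>M) \<le> ennreal (C * s powr (- (H * e)))"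
    using negative_moment[OF e] by blast
  have "(\<integral>\<^sup>+\<xi>. ennreal (excess_mass z n u \<xi>) \<partial>M) \<le> ennreal (C * 2 powr (- tail_exponent * real (level n)))"
    if u: "u \<in> {1..2}" for z n u
  proof -
    have p: "2 ^ n * u > 0" "2 ^ n \<le> 2 ^ n * u" using u by auto
    have "(\<integral>\<^sup>+\<xi>. ennreal (excess_mass z n u \<xi>) \<partial>M) \<le> (\<integral>\<^sup>+\<xi>. ennreal (cutoff n powr c * scale n powr e) * ennreal (norm (z + W (2 ^ n * u) \<xi>) powr (- e)) \<partial>M)"
    proof (intro nn_integral_mono)
      fix \<xi>
      have "excess_mass z n u \<xi> \<le> cutoff n powr c * norm (blk z n u \<xi>) powr (- e)"
        unfolding excess_mass_def tp_def e_def using cutoff_bounds invH c H_gt by (intro trunc_pow_excess) auto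
      also have "norm (blk z n u \<xi>) powr (- e) = scale n powr e * norm (z + W (2 ^ n * u) \<xi>) powr (- e)"
      proof -
        have "norm (blk z n u \<xi>) = norm (z + W (2 ^ n * u) \<xi>) / scale n" unfolding blk_def norm_scaleR using scale_pos[of n] by simp
        then show ?thesis by (simp add: powr_divide powr_minus_divide)
      qed
      finally show "ennreal (excess_mass z n u \<xi>) \<le> ennreal (cutoff n powr c * scale n powr e) * ennreal (norm (z + W (2 ^ n * u) \<xi>) powr (- e))"
        by (simp add: ennreal_mult[symmetric] mult.assoc ennreal_leI)
    qed
    also have "\<dots> = ennreal (cutoff n powr c * scale n powr e) * (\<integral>\<^sup>+\<xi>. ennreal (norm (z + W (2 ^ n * u) \<xi>) powr (- e)) \<partial>M)"
      by (rule nn_integral_cmult) measurable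
    also have "\<dots> \<le> ennreal (cutoff n powr c * scale n powr e) * ennreal (C * (2 ^ n * u) powr (- (H * e)))"
      by (intro mult_left_mono C(2) p) auto
    also have "\<dots> \<le> ennreal (cutoff n powr c * scale n powr e) * ennreal (C * (2 ^ n) powr (- (H * e)))"
      using p C(1) e H_gt by (intro mult_left_mono ennreal_leI powr_mono2') auto
    also have "\<dots> = ennreal (cutoff n powr c * scale n powr e * (C * (2 ^ n) powr (- (H * e))))"
      using C(1) by (intro ennreal_mult[symmetric]) auto
    also have "cutoff n powr c * scale n powr e * (C * (2 ^ n) powr (- (H * e))) = C * 2 powr (- tail_exponent * real (level n))"
    proof -
      have "(2 ^ n :: real) powr (- (H * e)) = scale n powr (- e)" unfolding scale_pow[symmetric] powr_powr by simp
      moreover have "scale n powr e * scale n powr (- e) = 1" unfolding powr_add[symmetric] using scale_pos[of n] by simp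
      moreover have "cutoff n powr c = 2 powr (- tail_exponent * real (level n))"
        unfolding cutoff_def powr_powr by (simp add: c_def mult.commute)
      ultimately show ?thesis by (simp add: mult.left_commute[of _ C])
    qed
    finally show ?thesis .
  qed
  then show ?thesis using C(1) by (intro exI[of _ C]) auto
qed

section \<open>Exact means and their averages\<close>

definition mass_constant :: real where
  "mass_constant = Gamma (1 - 1 / (2 * H)) / 2 powr (1 / (2 * H))"

lemma mass_constant_pos: "mass_constant > 0"
proof -
  have "1 / (2 * H) < 1" using H_gt by (simp add: field_simps)
  then show ?thesis unfolding mass_constant_def by (intro divide_pos_pos Gamma_real_pos) auto
qed

text \<open>With \<open>\<alpha> = 1 / (2 * H)\<close> the time exponent
  \<open>2 * H * \<alpha>\<close> equals 1. The mean is thus proportional to \<open>1 / u\<close>,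
  whose integral over a block is \<open>ln 2\<close>; this is the source of the logarithmic
  growth.\<close>

lemma exact_block_moment:
  assumes u: "u \<in> {1..2}"
  shows "(\<integral>\<^sup>+\<xi>. ennreal (norm (blk 0 n u \<xi>) powr (- (1 / H))) \<partial>M) = ennreal (mass_constant / u)"
proof -
  have H0: "H > 0" using H_gt by simp
  define \<alpha> where "\<alpha> = 1 / (2 * H)"
  have \<alpha>: "0 < \<alpha>" "\<alpha> < 1" "2 * \<alpha> = 1 / H" "2 * H * \<alpha> = 1" using H_gt by (auto simp: \<alpha>_def field_simps)
  have t: "2 ^ n * u > 0" using u by simp
  have b: "norm (blk 0 n u \<xi>) powr (- (1 / H)) = 2 ^ n * norm (W (2 ^ n * u) \<xi>) powr (- (2 * \<alpha>))" for \<xi>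
  proof -
    have "norm (blk 0 n u \<xi>) = norm (W (2 ^ n * u) \<xi>) / scale n" unfolding blk_def norm_scaleR using scale_pos[of n] by simp
    moreover have "scale n powr (1 / H) = 2 ^ n" unfolding scale_def powr_powr using H0 by (simp add: powr_realpow)
    ultimately show ?thesis using \<alpha>(3) by (simp add: powr_divide powr_minus_divide)
  qed
  have "(\<integral>\<^sup>+\<xi>. ennreal (norm (blk 0 n u \<xi>) powr (- (1 / H))) \<partial>M) = (\<integral>\<^sup>+\<xi>. ennreal (2 ^ n) * ennreal (norm (W (2 ^ n * u) \<xi>) powr (- (2 * \<alpha>))) \<partial>M)"
    unfolding b by (simp add: ennreal_mult)
  also have "\<dots> = ennreal (2 ^ n) * (\<integral>\<^sup>+\<xi>. ennreal (norm (W (2 ^ n * u) \<xi>) powr (- (2 * \<alpha>))) \<partial>M)" by (rule nn_integral_cmult) measurable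
  also have "\<dots> = ennreal (2 ^ n) * ennreal (2 powr (- \<alpha>) * (2 ^ n * u) powr (- 1) * Gamma (1 - \<alpha>))"
    unfolding exact_negative_moment[OF t \<alpha>(1,2)] \<alpha>(4) ..
  also have "\<dots> = ennreal (2 ^ n * (2 powr (- \<alpha>) * (2 ^ n * u) powr (- 1) * Gamma (1 - \<alpha>)))"
    using Gamma_real_pos[of "1 - \<alpha>"] \<alpha> by (intro ennreal_mult[symmetric]) auto
  also have "2 ^ n * (2 powr (- \<alpha>) * (2 ^ n * u) powr (- 1) * Gamma (1 - \<alpha>)) = mass_constant / u"
    using t u by (simp add: mass_constant_def \<alpha>_def[symmetric] powr_minus_divide)
  finally show ?thesis .
qed

text \<open>For start 0 the truncated mean lies below the exact mean, by at most the expected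
  excess. Moving the start to \<open>z\<close> shifts the rescaled path by
  \<open>norm z / scale n\<close>, at the price of the Lipschitz constant.\<close>

lemma mean_mass_limit:
  "\<exists>C\<ge>0. \<forall>n. \<forall>u\<in>{1..2}. \<bar>mean_mass z n u - mass_constant / u\<bar>
     \<le> 2 * (2 ^ level n)\<^sup>2 * norm z / scale n + C * 2 powr (- tail_exponent * real (level n))"
proof -
  obtain C where C: "C \<ge> 0" "\<And>z n u. u \<in> {1..2} \<Longrightarrow> (\<integral>\<^sup>+\<xi>. ennreal (excess_mass z n u \<xi>) \<partial>M) \<le> ennreal (C * 2 powr (- tail_exponent * real (level n)))"
    using excess_mass_moment by blast
  have "\<bar>mean_mass z n u - mass_constant / u\<bar> \<le> 2 * (2 ^ level n)\<^sup>2 * norm z / scale n + C * 2 powr (- tail_exponent * real (level n))"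
    if u: "u \<in> {1..2}" for n u
  proof -
    let ?e = "C * 2 powr (- tail_exponent * real (level n))"
    have t: "2 ^ n * u > 0" using u by simp
    have m0: "mean_mass 0 n u \<ge> 0" unfolding mean_mass_def by (intro integral_nonneg_AE AE_I2 tp_bounds)
    have mm: "ennreal (mean_mass 0 n u) = (\<integral>\<^sup>+\<xi>. ennreal (tp n (blk 0 n u \<xi>)) \<partial>M)"
      unfolding mean_mass_def using tp_integrable tp_bounds by (intro nn_integral_eq_integral[symmetric]) auto
    have AEb: "AE \<xi> in M. blk 0 n u \<xi> \<noteq> 0"
      using AE_nonzero[OF t, of 0] by eventually_elim (use scale_pos[of n] in \<open>auto simp: blk_def\<close>)
    have le: "tp n w \<le> norm w powr (- (1 / H))" if "w \<noteq> 0" for w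
      unfolding tp_def trunc_pow_def using that invH H_gt by (intro powr_mono2') auto
    have c0: "0 \<le> mass_constant / u" using mass_constant_pos u by simp
    have "ennreal (mean_mass 0 n u) \<le> ennreal (mass_constant / u)"
      unfolding mm exact_block_moment[OF u, of n, symmetric]
      using AEb by (intro nn_integral_mono_AE) (auto elim!: eventually_mono intro!: ennreal_leI le)
    then have 1: "mean_mass 0 n u \<le> mass_constant / u" using c0 by simp
    have "ennreal (mass_constant / u) \<le> (\<integral>\<^sup>+\<xi>. ennreal (tp n (blk 0 n u \<xi>)) + ennreal (excess_mass 0 n u \<xi>) \<partial>M)"
      unfolding exact_block_moment[OF u, of n, symmetric]
    proof (intro nn_integral_mono)
      fix \<xi>
      show "ennreal (norm (blk 0 n u \<xi>) powr (- (1 / H))) \<le> ennreal (tp n (blk 0 n u \<xi>)) + ennreal (excess_mass 0 n u \<xi>)"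
        proof -
        have "norm (blk 0 n u \<xi>) powr (- (1 / H)) \<le> tp n (blk 0 n u \<xi>) + excess_mass 0 n u \<xi>" by (simp add: excess_mass_def)
        from ennreal_leI[OF this] show ?thesis
          using tp_bounds(1)[of n "blk 0 n u \<xi>"] by (subst (asm) ennreal_plus) (simp_all add: excess_mass_def)
      qed
    qed
    also have "\<dots> = ennreal (mean_mass 0 n u) + (\<integral>\<^sup>+\<xi>. ennreal (excess_mass 0 n u \<xi>) \<partial>M)"
      unfolding mm by (rule nn_integral_add) measurable
    also have "\<dots> \<le> ennreal (mean_mass 0 n u) + ennreal ?e" using C(2)[OF u] by (intro add_left_mono)
    also have "\<dots> = ennreal (mean_mass 0 n u + ?e)" using m0 C(1) by (intro ennreal_plus[symmetric]) auto
    finally have 2: "mass_constant / u \<le> mean_mass 0 n u + ?e" using m0 C(1) by (subst (asm) ennreal_le_iff) auto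
    have 3: "\<bar>mean_mass z n u - mean_mass 0 n u\<bar> \<le> 2 * (2 ^ level n)\<^sup>2 * norm z / scale n"
    proof -
      have "\<bar>mean_mass z n u - mean_mass 0 n u\<bar> = \<bar>expectation (\<lambda>\<xi>. tp n (blk z n u \<xi>) - tp n (blk 0 n u \<xi>))\<bar>"
        unfolding mean_mass_def using tp_integrable by simp
      also have "\<dots> \<le> expectation (\<lambda>\<xi>. \<bar>tp n (blk z n u \<xi>) - tp n (blk 0 n u \<xi>)\<bar>)" by (rule integral_abs_bound)
      also have "\<dots> \<le> expectation (\<lambda>\<xi>. 2 * (2 ^ level n)\<^sup>2 * norm z / scale n)"
      proof (rule integral_mono)
        show "\<bar>tp n (blk z n u \<xi>) - tp n (blk 0 n u \<xi>)\<bar> \<le> 2 * (2 ^ level n)\<^sup>2 * norm z / scale n" for \<xi>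
        proof -
          have "blk z n u \<xi> - blk 0 n u \<xi> = (1 / scale n) *\<^sub>R z" by (simp add: blk_def scaleR_diff_right[symmetric])
          then show ?thesis using tp_bounds(4)[of n "blk z n u \<xi>" "blk 0 n u \<xi>"] scale_pos[of n] by simp
        qed
      qed (intro integrable_abs Bochner_Integration.integrable_diff tp_integrable, simp)
      finally show ?thesis by (simp add: prob_space)
    qed
    show ?thesis using 1 2 3 by linarith
  qed
  then show ?thesis using C(1) by blast
qed

text \<open>Both errors, divided by \<open>n + 1\<close>, are summable: the first because
  \<open>scale n\<close> grows geometrically while \<open>(2 ^ level n)\<^sup>2\<close> is at most
  \<open>n + 1\<close>, the second by \<open>level_decay_summable\<close>. Kronecker's lemma then
  handles the averages.\<close>

lemma mean_mass_average: "(\<lambda>N. (\<Sum>n<N. (\<integral>u. mean_mass z n u \<partial>unit_block)) / real N) \<longlonglongrightarrow> mass_constant * ln 2"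
proof -
  obtain C where C: "C \<ge> 0" "\<And>n u. u \<in> {1..2} \<Longrightarrow> \<bar>mean_mass z n u - mass_constant / u\<bar>
     \<le> 2 * (2 ^ level n)\<^sup>2 * norm z / scale n + C * 2 powr (- tail_exponent * real (level n))"
    using mean_mass_limit by blast
  define d where "d = (\<lambda>n. 2 * (2 ^ level n)\<^sup>2 * norm z / scale n + C * 2 powr (- tail_exponent * real (level n)))"
  have d0: "0 \<le> d n" for n unfolding d_def using C(1) scale_pos[of n] by (intro add_nonneg_nonneg divide_nonneg_nonneg mult_nonneg_nonneg) auto
  have bd: "\<bar>(\<integral>u. mean_mass z n u \<partial>unit_block) - mass_constant * ln 2\<bar> \<le> d n" for n
  proof -
    have i: "integrable unit_block (mean_mass z n)"
      by (rule unit_block.integrable_const_bound[where B="2 ^ level n"]) (use mean_mass_bound in auto)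
    have i2: "integrable unit_block (\<lambda>u. mass_constant / u)"
    proof (rule unit_block.integrable_const_bound[where B=mass_constant])
      show "AE u in unit_block. norm (mass_constant / u) \<le> mass_constant"
        using mass_constant_pos by (intro AE_I2) (auto simp: divide_le_eq mult_le_cancel_left1)
      show "(\<lambda>u. mass_constant / u) \<in> borel_measurable unit_block" by (rule measurable_unit_block) measurable
    qed
    have "(\<integral>u. mean_mass z n u \<partial>unit_block) - mass_constant * ln 2 = (\<integral>u. mean_mass z n u - mass_constant / u \<partial>unit_block)"
      using i i2 by (simp add: unit_block_integral_inverse)
    then show ?thesis using C(2) unfolding d_def by (auto intro!: unit_block_integral_bound)
  qed
  have sd: "summable (\<lambda>n. d n / (real n + 1))"
  proof -
    have "summable (\<lambda>n. 2 * (2 ^ level n)\<^sup>2 * norm z / scale n / (real n + 1))"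
    proof (rule summable_comparison_test'[where N=0])
      define r where "r = (2::real) powr (- H)"
      have r: "0 < r" "r < 1" using H_gt by (auto simp: r_def powr_less_one)
      show "summable (\<lambda>n. 2 * norm z * r ^ n)" using r by (intro summable_mult summable_geometric) auto
      fix n :: nat
      have "(2 ^ level n)\<^sup>2 \<le> ((real n + 1) powr (1 / 16))\<^sup>2" by (intro power_mono level_le) auto
      also have "\<dots> = (real n + 1) powr (1 / 8)" by (simp add: power2_eq_square powr_add[symmetric])
      also have "\<dots> \<le> (real n + 1) powr 1" by (intro powr_mono) auto
      finally have l: "(2 ^ level n)\<^sup>2 \<le> real n + 1" by simp
      have s: "1 / scale n = r ^ n" unfolding r_def by (subst powr_realpow[symmetric]) (simp_all add: powr_powr scale_def powr_minus_divide[symmetric])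
      have "2 * (2 ^ level n)\<^sup>2 * norm z / scale n / (real n + 1) = (2 * norm z * (1 / scale n)) * ((2 ^ level n)\<^sup>2 / (real n + 1))" by simp
      also have "\<dots> \<le> (2 * norm z * (1 / scale n)) * 1"
        using l scale_pos[of n] by (intro mult_left_mono) auto
      finally have "2 * (2 ^ level n)\<^sup>2 * norm z / scale n / (real n + 1) \<le> 2 * norm z * r ^ n" unfolding s by simp
      moreover have "0 \<le> 2 * (2 ^ level n)\<^sup>2 * norm z / scale n / (real n + 1)" using scale_pos[of n] by simp
      ultimately show "norm (2 * (2 ^ level n)\<^sup>2 * norm z / scale n / (real n + 1)) \<le> 2 * norm z * r ^ n"
        by (simp only: real_norm_def abs_of_nonneg)
    qed
    moreover have "summable (\<lambda>n. C * (2 powr (- tail_exponent * real (level n)) / (real n + 1)))"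
      by (intro summable_mult level_decay_summable tail_exponent_pos)
    ultimately have "summable (\<lambda>n. 2 * (2 ^ level n)\<^sup>2 * norm z / scale n / (real n + 1) + C * (2 powr (- tail_exponent * real (level n)) / (real n + 1)))"
      by (rule summable_add)
    then show ?thesis by (simp add: d_def add_divide_distrib)
  qed
  have "(\<lambda>N. (\<Sum>n<N. (\<integral>u. mean_mass z n u \<partial>unit_block) - mass_constant * ln 2) / real N) \<longlonglongrightarrow> 0"
  proof (rule Lim_null_comparison[OF _ average_tendsto_0_of_summable[OF d0 sd]])
    show "\<forall>\<^sub>F N in sequentially. norm ((\<Sum>n<N. (\<integral>u. mean_mass z n u \<partial>unit_block) - mass_constant * ln 2) / real N) \<le> (\<Sum>n<N. d n) / real N"
      using bd by (intro always_eventually allI) (auto intro!: divide_right_mono order_trans[OF sum_abs] sum_mono)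
  qed
  then have "(\<lambda>N. (\<Sum>n<N. (\<integral>u. mean_mass z n u \<partial>unit_block) - mass_constant * ln 2) / real N + mass_constant * ln 2) \<longlonglongrightarrow> 0 + mass_constant * ln 2"
    by (intro tendsto_intros)
  moreover have "\<forall>\<^sub>F N in sequentially. (\<Sum>n<N. (\<integral>u. mean_mass z n u \<partial>unit_block) - mass_constant * ln 2) / real N + mass_constant * ln 2
     = (\<Sum>n<N. (\<integral>u. mean_mass z n u \<partial>unit_block)) / real N"
    using eventually_gt_at_top[of 0] by eventually_elim (simp add: sum_subtractf diff_divide_distrib)
  ultimately show ?thesis by (simp add: filterlim_cong)
qed

section \<open>Full mass of a block\<close>

definition block_mass :: "complex \<Rightarrow> nat \<Rightarrow> 'a \<Rightarrow> ennreal" where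
  "block_mass z n \<xi> = (\<integral>\<^sup>+u. ennreal (norm (blk z n u \<xi>) powr (- (1 / H))) \<partial>unit_block)"

definition block_excess :: "complex \<Rightarrow> nat \<Rightarrow> 'a \<Rightarrow> ennreal" where
  "block_excess z n \<xi> = (\<integral>\<^sup>+u. ennreal (excess_mass z n u \<xi>) \<partial>unit_block)"

lemma excess_joint: "(\<lambda>x. excess_mass z n (snd x) (fst x)) \<in> borel_measurable (M \<Otimes>\<^sub>M unit_block)"
proof -
  have "(\<lambda>w. max 0 (norm w powr (- (1 / H)) - tp n w)) \<in> borel_measurable borel" by measurable
  from measurable_compose[OF blk_joint this] show ?thesis unfolding excess_mass_def .
qed

lemma block_excess_measurable[measurable]: "block_excess z n \<in> borel_measurable M"
proof -
  have "(\<lambda>x. ennreal (excess_mass z n (snd x) (fst x))) \<in> borel_measurable (M \<Otimes>\<^sub>M unit_block)"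
    using excess_joint by measurable
  then have "case_prod (\<lambda>\<xi> u. ennreal (excess_mass z n u \<xi>)) \<in> borel_measurable (M \<Otimes>\<^sub>M unit_block)" by (simp add: case_prod_beta')
  then show ?thesis unfolding block_excess_def[abs_def] by (rule unit_block.borel_measurable_nn_integral)
qed

lemma block_excess_moment:
  "\<exists>C\<ge>0. \<forall>z n. (\<integral>\<^sup>+\<xi>. block_excess z n \<xi> \<partial>M) \<le> ennreal (C * 2 powr (- tail_exponent * real (level n)))"
proof -
  obtain C where C: "C \<ge> 0" "\<And>z n u. u \<in> {1..2} \<Longrightarrow> (\<integral>\<^sup>+\<xi>. ennreal (excess_mass z n u \<xi>) \<partial>M) \<le> ennreal (C * 2 powr (- tail_exponent * real (level n)))"
    using excess_mass_moment by blast
  have "(\<integral>\<^sup>+\<xi>. block_excess z n \<xi> \<partial>M) \<le> ennreal (C * 2 powr (- tail_exponent * real (level n)))" for z n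
  proof -
    interpret P: pair_prob_space M unit_block ..
    have "(\<lambda>x. ennreal (excess_mass z n (snd x) (fst x))) \<in> borel_measurable (M \<Otimes>\<^sub>M unit_block)"
      using excess_joint by measurable
    then have m: "case_prod (\<lambda>\<xi> u. ennreal (excess_mass z n u \<xi>)) \<in> borel_measurable (M \<Otimes>\<^sub>M unit_block)" by (simp add: case_prod_beta')
    have "(\<integral>\<^sup>+\<xi>. block_excess z n \<xi> \<partial>M) = (\<integral>\<^sup>+u. (\<integral>\<^sup>+\<xi>. ennreal (excess_mass z n u \<xi>) \<partial>M) \<partial>unit_block)"
      unfolding block_excess_def using P.Fubini'[OF m] by simp
    also have "\<dots> \<le> (\<integral>\<^sup>+u. ennreal (C * 2 powr (- tail_exponent * real (level n))) \<partial>unit_block)"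
      using C(2) by (intro nn_integral_mono) auto
    finally show ?thesis using unit_block.emeasure_space_1 by simp
  qed
  then show ?thesis using C(1) by blast
qed

text \<open>Off 0 the truncated power and the excess add up exactly to the full power; the truncated
  part is split further into its fluctuation and its mean.\<close>

lemma block_mass_split:
  assumes nz: "\<And>t. t \<ge> 0 \<Longrightarrow> z + W t \<xi> \<noteq> 0" and \<xi>: "\<xi> \<in> space M"
  shows "block_mass z n \<xi> = ennreal (block_fluctuation z n \<xi> + (\<integral>u. mean_mass z n u \<partial>unit_block)) + block_excess z n \<xi>"
    "0 \<le> block_fluctuation z n \<xi> + (\<integral>u. mean_mass z n u \<partial>unit_block)"
proof -
  have sec: "(\<lambda>u. (\<xi>, u)) \<in> unit_block \<rightarrow>\<^sub>M M \<Otimes>\<^sub>M unit_block" using \<xi> by measurable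
  have m1: "(\<lambda>u. tp n (blk z n u \<xi>)) \<in> borel_measurable unit_block"
    using measurable_compose[OF sec tp_joint] by simp
  have m2: "(\<lambda>u. excess_mass z n u \<xi>) \<in> borel_measurable unit_block"
    using measurable_compose[OF sec excess_joint] by simp
  have i1: "integrable unit_block (\<lambda>u. tp n (blk z n u \<xi>))"
    by (rule unit_block.integrable_const_bound[where B="2 ^ level n"]) (use tp_bounds(3) m1 in auto)
  have i2: "integrable unit_block (mean_mass z n)"
    by (rule unit_block.integrable_const_bound[where B="2 ^ level n"]) (use mean_mass_bound in auto)
  have e: "(\<integral>u. tp n (blk z n u \<xi>) \<partial>unit_block) = block_fluctuation z n \<xi> + (\<integral>u. mean_mass z n u \<partial>unit_block)"
    unfolding block_fluctuation_def centred_mass_def using i1 i2 by simp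
  show "0 \<le> block_fluctuation z n \<xi> + (\<integral>u. mean_mass z n u \<partial>unit_block)"
    unfolding e[symmetric] using tp_bounds(1) by (intro integral_nonneg_AE) auto
  have "block_mass z n \<xi> = (\<integral>\<^sup>+u. ennreal (tp n (blk z n u \<xi>)) + ennreal (excess_mass z n u \<xi>) \<partial>unit_block)"
    unfolding block_mass_def
  proof (intro nn_integral_cong)
    fix u assume "u \<in> space unit_block"
    then have u: "u \<ge> 1" by simp
    then have "z + W (2 ^ n * u) \<xi> \<noteq> 0" by (intro nz) auto
    then have "blk z n u \<xi> \<noteq> 0" using scale_pos[of n] by (simp add: blk_def)
    then have "tp n (blk z n u \<xi>) \<le> norm (blk z n u \<xi>) powr (- (1 / H))"
      unfolding tp_def trunc_pow_def using invH H_gt by (intro powr_mono2') auto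
    then show "ennreal (norm (blk z n u \<xi>) powr (- (1 / H))) = ennreal (tp n (blk z n u \<xi>)) + ennreal (excess_mass z n u \<xi>)"
      using tp_bounds(1)[of n "blk z n u \<xi>"] by (subst ennreal_plus[symmetric]) (auto simp: excess_mass_def)
  qed
  also have "\<dots> = (\<integral>\<^sup>+u. ennreal (tp n (blk z n u \<xi>)) \<partial>unit_block) + block_excess z n \<xi>"
    unfolding block_excess_def using m1 m2 by (intro nn_integral_add) auto
  also have "(\<integral>\<^sup>+u. ennreal (tp n (blk z n u \<xi>)) \<partial>unit_block) = ennreal (\<integral>u. tp n (blk z n u \<xi>) \<partial>unit_block)"
    using i1 tp_bounds(1) by (intro nn_integral_eq_integral) auto
  finally show "block_mass z n \<xi> = ennreal (block_fluctuation z n \<xi> + (\<integral>u. mean_mass z n u \<partial>unit_block)) + block_excess z n \<xi>"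
    unfolding e .
qed

text \<open>Of the three averages obtained by splitting, the fluctuations vanish by weak
  correlation, the excess vanishes by its decaying expectation, and only the means contribute to the
  limit.\<close>

lemma AE_block_mass:
  assumes z: "z \<noteq> 0"
  shows "AE \<xi> in M. (\<forall>n. block_mass z n \<xi> < \<infinity>) \<and> (\<lambda>N. (\<Sum>n<N. enn2real (block_mass z n \<xi>)) / real N) \<longlonglongrightarrow> mass_constant * ln 2"
proof -
  obtain C where C: "C \<ge> 0" "\<And>n. (\<integral>\<^sup>+\<xi>. block_excess z n \<xi> \<partial>M) \<le> ennreal (C * 2 powr (- tail_exponent * real (level n)))"
    using block_excess_moment by blast
  have "AE \<xi> in M. block_excess z n \<xi> \<noteq> \<infinity>" for n
    using C(2)[of n] by (intro nn_integral_PInf_AE) (auto simp: top_unique)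
  then have fin: "AE \<xi> in M. \<forall>n. block_excess z n \<xi> \<noteq> \<infinity>" by (simp add: AE_all_countable)
  have "AE \<xi> in M. (\<lambda>N. (\<Sum>n<N. enn2real (block_excess z n \<xi>)) / real N) \<longlonglongrightarrow> 0"
  proof (rule AE_error_average[OF _ C(1) tail_exponent_pos])
    show "(\<integral>\<^sup>+\<xi>. ennreal \<bar>enn2real (block_excess z n \<xi>)\<bar> \<partial>M) \<le> ennreal (C * 2 powr (- tail_exponent * real (level n)))" for n
      by (rule order_trans[OF nn_integral_mono C(2)]) (auto simp: ennreal_enn2real_if)
  qed measurable
  then show ?thesis using fin AE_block_fluctuation_average[of z] AE_never_zero[OF z] AE_space
  proof eventually_elim
    case (elim \<xi>)
    have nz: "z + W t \<xi> \<noteq> 0" if "t \<ge> 0" for t using elim(4) that by blast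
    have split: "block_mass z n \<xi> = ennreal (block_fluctuation z n \<xi> + (\<integral>u. mean_mass z n u \<partial>unit_block)) + block_excess z n \<xi>"
      "0 \<le> block_fluctuation z n \<xi> + (\<integral>u. mean_mass z n u \<partial>unit_block)" for n
      using nz by (auto intro!: block_mass_split elim(5))
    have f: "block_mass z n \<xi> < \<infinity>" for n
    proof -
      have "block_excess z n \<xi> < \<infinity>" using elim(2) by (simp add: top.not_eq_extremum)
      then show ?thesis using split(1)[of n] by (simp add: ennreal_add_eq_top less_top)
    qed
    have e: "enn2real (block_mass z n \<xi>) = block_fluctuation z n \<xi> + (\<integral>u. mean_mass z n u \<partial>unit_block) + enn2real (block_excess z n \<xi>)" for n
      unfolding split(1) using elim(2) split(2)[of n] by (subst enn2real_plus) (auto simp: top.not_eq_extremum)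
    have "(\<lambda>N. (\<Sum>n<N. block_fluctuation z n \<xi>) / real N + (\<Sum>n<N. (\<integral>u. mean_mass z n u \<partial>unit_block)) / real N
       + (\<Sum>n<N. enn2real (block_excess z n \<xi>)) / real N) \<longlonglongrightarrow> 0 + mass_constant * ln 2 + 0"
      by (intro tendsto_add elim(1,3) mean_mass_average)
    then show ?case using f by (simp add: e sum.distrib add_divide_distrib)
  qed
qed

end

section \<open>From dyadic to real times\<close>

text \<open>Every large \<open>t\<close> lies in the block of index
  \<open>\<lfloor>log 2 t\<rfloor>\<close>, which is asymptotic to \<open>ln t / ln 2\<close>. The
  oscillation within block \<open>n\<close> is of smaller order than \<open>n\<close>, so the dyadic
  times decide.\<close>

lemma dyadic_interpolation:
  fixes f :: "real \<Rightarrow> 'b::real_normed_vector" and d :: "nat \<Rightarrow> real"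
  assumes lim: "(\<lambda>n. (1 / real n) *\<^sub>R f (2 ^ n)) \<longlonglongrightarrow> ln 2 *\<^sub>R l"
    and d: "(\<lambda>n. d n / (real n + 1)) \<longlonglongrightarrow> 0"
    and osc: "\<And>n x. x \<in> {0..1} \<Longrightarrow> norm (f (2 ^ n + 2 ^ n * x) - f (2 ^ n)) \<le> d n"
  shows "((\<lambda>t. (1 / ln t) *\<^sub>R f t) \<longlongrightarrow> l) at_top"
proof -
  define N where "N = (\<lambda>t::real. nat \<lfloor>log 2 t\<rfloor>)"
  have N: "filterlim N at_top at_top" unfolding N_def by real_asymp
  have r1: "((\<lambda>t. real (N t) / ln t) \<longlongrightarrow> inverse (ln 2)) at_top" unfolding N_def by real_asymp
  have r2: "((\<lambda>t. (real (N t) + 1) / ln t) \<longlongrightarrow> inverse (ln 2)) at_top" unfolding N_def by real_asymp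
  have main: "((\<lambda>t. (real (N t) / ln t) *\<^sub>R ((1 / real (N t)) *\<^sub>R f (2 ^ N t))) \<longlongrightarrow> inverse (ln 2) *\<^sub>R (ln 2 *\<^sub>R l)) at_top"
    by (intro tendsto_scaleR r1 filterlim_compose[OF lim N])
  have err: "((\<lambda>t. (d (N t) / (real (N t) + 1)) * ((real (N t) + 1) / ln t)) \<longlongrightarrow> 0 * inverse (ln 2)) at_top"
    by (intro tendsto_mult r2 filterlim_compose[OF d N])
  have "((\<lambda>t. (1 / ln t) *\<^sub>R f t - (real (N t) / ln t) *\<^sub>R ((1 / real (N t)) *\<^sub>R f (2 ^ N t))) \<longlongrightarrow> 0) at_top"
  proof (rule Lim_null_comparison)
    show "((\<lambda>t. (d (N t) / (real (N t) + 1)) * ((real (N t) + 1) / ln t)) \<longlongrightarrow> 0) at_top" using err by simp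
    show "eventually (\<lambda>t. norm ((1 / ln t) *\<^sub>R f t - (real (N t) / ln t) *\<^sub>R ((1 / real (N t)) *\<^sub>R f (2 ^ N t)))
       \<le> (d (N t) / (real (N t) + 1)) * ((real (N t) + 1) / ln t)) at_top"
      using eventually_ge_at_top[of 2]
    proof eventually_elim
      case (elim t)
      have l: "ln t > 0" using elim by simp
      have "1 \<le> \<lfloor>log 2 t\<rfloor>" using elim by (simp add: le_log_iff)
      then have rN: "real (N t) = of_int \<lfloor>log 2 t\<rfloor>" and N0: "N t > 0" by (simp_all add: N_def)
      have lo: "2 ^ N t \<le> t"
      proof -
        have "real (N t) \<le> log 2 t" unfolding rN by simp
        then have "2 powr real (N t) \<le> t" using elim by (subst (asm) le_log_iff) auto
        then show ?thesis by (simp add: powr_realpow)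
      qed
      have hi: "t \<le> 2 * 2 ^ N t"
      proof -
        have "log 2 t \<le> real (Suc (N t))" using rN by linarith
        then have "t \<le> 2 powr real (Suc (N t))" using elim by (subst (asm) log_le_iff) auto
        then show ?thesis by (subst (asm) powr_realpow) simp_all
      qed
      define x where "x = t / 2 ^ N t - 1"
      have x: "x \<in> {0..1}" using lo hi by (simp add: x_def field_simps)
      have t: "t = 2 ^ N t + 2 ^ N t * x" by (simp add: x_def field_simps)
      have n: "norm (f t - f (2 ^ N t)) \<le> d (N t)" using osc[OF x, of "N t"] t by simp
      have "(1 / ln t) *\<^sub>R f t - (real (N t) / ln t) *\<^sub>R ((1 / real (N t)) *\<^sub>R f (2 ^ N t)) = (1 / ln t) *\<^sub>R (f t - f (2 ^ N t))"
        using N0 by (simp add: scaleR_diff_right)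
      also have "norm \<dots> = norm (f t - f (2 ^ N t)) / ln t" using l by simp
      also have "\<dots> \<le> d (N t) / ln t" using n l by (intro divide_right_mono) auto
      finally show ?case by simp
    qed
  qed
  from tendsto_add[OF this main] show ?thesis by simp
qed

text \<open>Consecutive normalised sums have the same limit, so a single term is of smaller order
  than its index; this supplies the oscillation bound for integrals of nonnegative
  functions.\<close>

lemma Cesaro_increment_tendsto_0:
  fixes a :: "nat \<Rightarrow> real"
  assumes "(\<lambda>N. (\<Sum>n<N. a n) / real N) \<longlonglongrightarrow> l"
  shows "(\<lambda>n. a n / (real n + 1)) \<longlonglongrightarrow> 0"
proof -
  have 1: "(\<lambda>n. (\<Sum>k<Suc n. a k) / real (Suc n)) \<longlonglongrightarrow> l" using assms by (rule LIMSEQ_Suc)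
  have "(\<lambda>n. real n / real (Suc n)) \<longlonglongrightarrow> 1" by real_asymp
  from tendsto_mult[OF this assms] have "(\<lambda>n. (real n / real (Suc n)) * ((\<Sum>k<n. a k) / real n)) \<longlonglongrightarrow> l" by simp
  from tendsto_diff[OF 1 this] have "(\<lambda>n. (\<Sum>k<Suc n. a k) / real (Suc n) - (real n / real (Suc n)) * ((\<Sum>k<n. a k) / real n)) \<longlonglongrightarrow> 0" by simp
  moreover have "(\<Sum>k<Suc n. a k) / real (Suc n) - (real n / real (Suc n)) * ((\<Sum>k<n. a k) / real n) = a n / (real n + 1)" for n
    by (cases "n = 0") (simp_all add: add_divide_distrib add.commute)
  ultimately show ?thesis by simp
qed

context centred_fbm
begin

text \<open>The logarithm is a continuous lifting chosen path by path; all probabilistic input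
  concerns functionals of the path itself, on one event of full measure.\<close>

lemma AE_continuous_logarithm:
  assumes z: "z \<noteq> 0"
  shows "AE \<xi> in M. \<exists>L. continuous_on {0..} L \<and> (\<forall>t\<ge>0. traj z \<xi> t = exp (L t)) \<and>
     ((\<lambda>t. (1 / ln t) *\<^sub>R (L t - L 0)) \<longlongrightarrow> complex_of_real H) at_top"
proof -
  define \<gamma> where "\<gamma> = (1 / 2 + H) / 2"
  have \<gamma>: "1 / 2 < \<gamma>" "0 < \<gamma>" "\<gamma> < H" using H_gt by (auto simp: \<gamma>_def)
  show ?thesis
    using AE_holder[OF \<gamma>(2,3)] AE_never_zero[OF z] AE_log_modulus[OF z] AE_fine_modulus[of z] AE_coarse_variation[of z] AE_Im_riemann_average[of z]
  proof eventually_elim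
    case (elim \<xi>)
    have hol: "holder_on {0..T} \<gamma> (\<lambda>t. W t \<xi>)" for T using elim(1) by blast
    have "continuous_on {0..} (traj z \<xi>)"
      unfolding traj_def using continuous_on_subset[OF W_continuous] by (intro continuous_intros) auto
    then obtain L where L: "continuous_on {0..} L" "\<And>t. t \<in> {0..} \<Longrightarrow> traj z \<xi> t = exp (L t)"
    proof (rule continuous_logarithm_on_contractible)
      show "contractible {0::real..}" by (intro convex_imp_contractible convex_real_interval)
      show "traj z \<xi> t \<noteq> 0" if "t \<in> {0..}" for t using elim(2) that by (simp add: traj_def)
    qed blast
    have BL: "traj z \<xi> t = exp (L t)" if "t \<ge> 0" for t using L(2) that by simp
    have ffin: "fine_modulus z n \<xi> < \<infinity>" for n using elim(4) by blast
    have fsum: "summable (\<lambda>n. enn2real (fine_modulus z n \<xi>) / (real n + 1))" using elim(4) by blast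
    define F where "F = (\<lambda>n. enn2real (fine_modulus z n \<xi>))"
    have osc1: "norm (L (2 ^ n + 2 ^ n * x) - L (2 ^ n)) \<le> coarse_variation z n \<xi> + 2 * F n" if "x \<in> {0..1}" for n x
      unfolding F_def by (rule block_oscillation(1)[OF \<gamma>(1) hol L(1) BL ffin that])
    have osc2: "norm (L (2 ^ Suc n) - L (2 ^ n) - riemann_sum (traj z \<xi>) (2 ^ n) (2 ^ n) (level n)) \<le> F n" for n
    proof -
      have "norm (L (2 ^ n + 2 ^ n) - L (2 ^ n) - riemann_sum (traj z \<xi>) (2 ^ n) (2 ^ n) (level n)) \<le> F n"
        unfolding F_def by (rule block_oscillation(2)[OF \<gamma>(1) hol L(1) BL ffin])
      moreover have "(2::real) ^ n + 2 ^ n = 2 ^ Suc n" by simp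
      ultimately show ?thesis by (simp only:)
    qed
    have Favg: "(\<lambda>N. (\<Sum>n<N. F n) / real N) \<longlonglongrightarrow> 0"
      unfolding F_def by (rule average_tendsto_0_of_summable[OF enn2real_nonneg fsum])
    have Fdec: "(\<lambda>n. F n / (real n + 1)) \<longlonglongrightarrow> 0" using fsum unfolding F_def by (rule summable_LIMSEQ_zero)
    let ?R = "\<lambda>n. Im (riemann_sum (traj z \<xi>) (2 ^ n) (2 ^ n) (level n))"
    have const: "(\<lambda>n. c / real n) \<longlonglongrightarrow> 0" for c :: real by real_asymp
    have re: "(\<lambda>n. Re ((1 / real n) *\<^sub>R (L (2 ^ n) - L 0))) \<longlonglongrightarrow> H * ln 2"
    proof -
      have "Re (L (2 ^ n)) = ln (norm (z + W (2 ^ n) \<xi>))" for n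
        using BL[of "2 ^ n"] unfolding traj_def by simp
      then have "Re ((1 / real n) *\<^sub>R (L (2 ^ n) - L 0)) = ln (norm (z + W (2 ^ n) \<xi>)) / real n - Re (L 0) / real n" for n
        by (simp add: diff_divide_distrib)
      then show ?thesis using tendsto_diff[OF elim(3) const[of "Re (L 0)"]] by simp
    qed
    have im: "(\<lambda>n. Im ((1 / real n) *\<^sub>R (L (2 ^ n) - L 0))) \<longlonglongrightarrow> 0"
    proof -
      \<comment> \<open>The part of the winding over block \<open>n\<close> that the Riemann sum of
        level \<open>level n\<close> misses. Block 0 starts at time 1, so the winding before that
        time enters as a constant.\<close>
      define e where "e = (\<lambda>n. Im (L (2 ^ Suc n)) - Im (L (2 ^ n)) - ?R n)"
      have eb: "\<bar>e n\<bar> \<le> F n" for n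
        using order_trans[OF abs_Im_le_cmod osc2[of n]] by (simp add: e_def)
      have "(\<lambda>N. (\<Sum>n<N. e n) / real N) \<longlonglongrightarrow> 0"
      proof (rule Lim_null_comparison[OF _ Favg], rule always_eventually, rule allI)
        fix N
        have "\<bar>\<Sum>n<N. e n\<bar> \<le> (\<Sum>n<N. F n)" by (rule order_trans[OF sum_abs sum_mono[OF eb]])
        then show "norm ((\<Sum>n<N. e n) / real N) \<le> (\<Sum>n<N. F n) / real N" by (simp add: divide_right_mono)
      qed
      then have "(\<lambda>N. (Im (L 1) - Im (L 0)) / real N + (\<Sum>n<N. e n) / real N + (\<Sum>n<N. ?R n) / real N) \<longlonglongrightarrow> 0 + 0 + 0"
        by (intro tendsto_add const elim(6))
      moreover have "Im ((1 / real N) *\<^sub>R (L (2 ^ N) - L 0)) = (Im (L 1) - Im (L 0)) / real N + (\<Sum>n<N. e n) / real N + (\<Sum>n<N. ?R n) / real N" for N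
      proof -
        have "(\<Sum>n<N. e n) + (\<Sum>n<N. ?R n) = (\<Sum>n<N. Im (L (2 ^ Suc n)) - Im (L (2 ^ n)))"
          unfolding sum.distrib[symmetric] e_def by (intro sum.cong) auto
        also have "\<dots> = Im (L (2 ^ N)) - Im (L 1)" by (subst sum_lessThan_telescope) simp
        finally have "Im (L (2 ^ N)) - Im (L 0) = (Im (L 1) - Im (L 0)) + (\<Sum>n<N. e n) + (\<Sum>n<N. ?R n)" by simp
        then show ?thesis by (simp add: add_divide_distrib[symmetric])
      qed
      ultimately show ?thesis by simp
    qed
    have "((\<lambda>t. (1 / ln t) *\<^sub>R (L t - L 0)) \<longlongrightarrow> complex_of_real H) at_top"
    proof (rule dyadic_interpolation)
      show "(\<lambda>n. (1 / real n) *\<^sub>R (L (2 ^ n) - L 0)) \<longlonglongrightarrow> ln 2 *\<^sub>R complex_of_real H"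
        using re im by (simp add: tendsto_complex_iff mult.commute)
      show "norm ((L (2 ^ n + 2 ^ n * x) - L 0) - (L (2 ^ n) - L 0)) \<le> coarse_variation z n \<xi> + 2 * F n" if "x \<in> {0..1}" for n x
        using osc1[OF that] by simp
      show "(\<lambda>n. (coarse_variation z n \<xi> + 2 * F n) / (real n + 1)) \<longlonglongrightarrow> 0"
        using tendsto_add[OF elim(5) tendsto_mult_left[OF Fdec, of 2]] by (simp add: add_divide_distrib)
    qed
    then show ?case using L(1) BL by blast
  qed
qed

text \<open>The substitution \<open>s = 2 ^ n * u\<close>: its Jacobian \<open>2 ^ n\<close> is
  exactly \<open>scale n powr (1 / H)\<close>, so no normalising factor remains.\<close>

lemma block_mass_eq:
  assumes nz: "\<And>t. t \<ge> 0 \<Longrightarrow> z + W t \<xi> \<noteq> 0"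
  shows "block_mass z n \<xi> = ennreal (integral {2 ^ n..2 * 2 ^ n} (\<lambda>s. norm (z + W s \<xi>) powr (- (1 / H))))"
proof -
  define g where "g = (\<lambda>s. norm (z + W s \<xi>) powr (- (1 / H)))"
  have Wm: "(\<lambda>s. W s \<xi>) \<in> borel_measurable borel" using W_continuous by (rule borel_measurable_continuous_onI)
  have [measurable]: "g \<in> borel_measurable borel" unfolding g_def using Wm by measurable
  have gc: "continuous_on {2 ^ n..2 * 2 ^ n} g"
  proof -
    have "z + W s \<xi> \<noteq> 0" if "s \<in> {2 ^ n..2 * 2 ^ n}" for s
    proof (rule nz)
      have "(0::real) \<le> 2 ^ n" by simp
      then show "0 \<le> s" using that by (meson atLeastAtMost_iff order_trans)
    qed
    then show ?thesis
      unfolding g_def using continuous_on_subset[OF W_continuous] by (intro continuous_intros) auto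
  qed
  have gi: "set_integrable lborel {2 ^ n..2 * 2 ^ n} g" by (rule borel_integrable_atLeastAtMost'[OF gc])
  have blk: "ennreal (norm (blk z n u \<xi>) powr (- (1 / H))) = ennreal (2 ^ n) * ennreal (g (2 ^ n * u))" for u
  proof -
    have "norm (blk z n u \<xi>) = norm (z + W (2 ^ n * u) \<xi>) / scale n" unfolding blk_def norm_scaleR using scale_pos[of n] by simp
    then have "norm (blk z n u \<xi>) powr (- (1 / H)) = scale n powr (1 / H) * g (2 ^ n * u)"
      by (simp add: powr_divide powr_minus_divide g_def)
    also have "scale n powr (1 / H) = 2 ^ n"
    proof -
      have "scale n powr (1 / H) = 2 powr real n" unfolding scale_def powr_powr using H_gt by simp
      also have "\<dots> = 2 ^ n" by (rule powr_realpow) simp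
      finally show ?thesis .
    qed
    finally show ?thesis by (simp add: ennreal_mult g_def)
  qed
  have ind: "indicator {1..2} u = (indicator {2 ^ n..2 * 2 ^ n} (2 ^ n * u :: real) :: ennreal)" for u :: real
    by (auto simp: indicator_def)
  have "block_mass z n \<xi> = (\<integral>\<^sup>+u. ennreal (norm (blk z n u \<xi>) powr (- (1 / H))) * indicator {1..2} u \<partial>lborel)"
    unfolding block_mass_def unit_block_def by (rule nn_integral_restrict_space) simp
  also have "\<dots> = (\<integral>\<^sup>+u. ennreal (2 ^ n) * (ennreal (g (0 + 2 ^ n * u)) * indicator {2 ^ n..2 * 2 ^ n} (0 + 2 ^ n * u)) \<partial>lborel)"
    unfolding blk ind by (simp add: mult.assoc)
  also have "\<dots> = ennreal (2 ^ n) * (\<integral>\<^sup>+u. ennreal (g (0 + 2 ^ n * u)) * indicator {2 ^ n..2 * 2 ^ n} (0 + 2 ^ n * u) \<partial>lborel)"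
    by (rule nn_integral_cmult) measurable
  also have "\<dots> = (\<integral>\<^sup>+s. ennreal (g s) * indicator {2 ^ n..2 * 2 ^ n} s \<partial>lborel)"
    using nn_integral_real_affine[of "\<lambda>s. ennreal (g s) * indicator {2 ^ n..2 * 2 ^ n} s" "2 ^ n" 0] by simp
  also have "\<dots> = (\<integral>\<^sup>+s. ennreal (indicator {2 ^ n..2 * 2 ^ n} s *\<^sub>R g s) \<partial>lborel)"
    by (intro nn_integral_cong) (auto simp: indicator_def)
  also have "\<dots> = ennreal (LBINT s:{2 ^ n..2 * 2 ^ n}. g s)"
    unfolding set_lebesgue_integral_def using gi
    by (intro nn_integral_eq_integral) (auto simp: set_integrable_def g_def)
  also have "(LBINT s:{2 ^ n..2 * 2 ^ n}. g s) = integral {2 ^ n..2 * 2 ^ n} g"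
    by (rule set_borel_integral_eq_integral(2)[OF gi])
  finally show ?thesis by (simp add: g_def)
qed

text \<open>The integral is monotone in \<open>t\<close>, so within a block it oscillates by at most
  the mass of the block, and convergence of the averages makes that mass of smaller order than the
  index.\<close>

lemma AE_additive_functional:
  assumes z: "z \<noteq> 0"
  shows "AE \<xi> in M. (\<forall>t\<ge>0. set_integrable lborel {0..t} (\<lambda>s. 1 / norm (z + W s \<xi>) powr (1 / H))) \<and>
     ((\<lambda>t. 1 / ln t * (LBINT s:{0..t}. 1 / norm (z + W s \<xi>) powr (1 / H))) \<longlongrightarrow> mass_constant) at_top"
  using AE_never_zero[OF z] AE_block_mass[OF z]
proof eventually_elim
  case (elim \<xi>)
  define g where "g = (\<lambda>s. norm (z + W s \<xi>) powr (- (1 / H)))"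
  have ge: "1 / norm (z + W s \<xi>) powr (1 / H) = g s" for s by (simp add: g_def powr_minus_divide)
  have nz: "z + W t \<xi> \<noteq> 0" if "t \<ge> 0" for t using elim(1) that by blast
  have g0: "g s \<ge> 0" for s by (simp add: g_def)
  have gc: "continuous_on {a..b} g" if "0 \<le> a" for a b
    unfolding g_def using continuous_on_subset[OF W_continuous] nz that by (intro continuous_intros) auto
  have gi: "set_integrable lborel {0..t} g" for t by (intro borel_integrable_atLeastAtMost' gc) simp
  have gh: "g integrable_on {a..b}" if "0 \<le> a" for a b by (intro integrable_continuous_interval gc that)
  have F: "(LBINT s:{0..t}. g s) = integral {0..t} g" for t by (rule set_borel_integral_eq_integral(2)[OF gi])
  have split: "integral {0..b} g = integral {0..a} g + integral {a..b} g" if "0 \<le> a" "a \<le> b" for a b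
    using Henstock_Kurzweil_Integration.integral_combine[OF that gh] by simp
  define m where "m = (\<lambda>n. enn2real (block_mass z n \<xi>))"
  have m: "m n = integral {2 ^ n..2 * 2 ^ n} g" for n
  proof -
    have "block_mass z n \<xi> = ennreal (integral {2 ^ n..2 * 2 ^ n} g)" unfolding g_def by (rule block_mass_eq[OF nz])
    then show ?thesis unfolding m_def using gh g0
      by (simp add: Henstock_Kurzweil_Integration.integral_nonneg)
  qed
  have avg: "(\<lambda>N. (\<Sum>n<N. m n) / real N) \<longlonglongrightarrow> mass_constant * ln 2" using elim(2) by (simp add: m_def)
  have dy: "integral {0..2 ^ N} g = integral {0..1} g + (\<Sum>n<N. m n)" for N
  proof (induction N)
    case (Suc N)
    then show ?case using split[of "2 ^ N" "2 * 2 ^ N"] m[of N] by simp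
  qed simp
  have "((\<lambda>t. (1 / ln t) *\<^sub>R integral {0..t} g) \<longlongrightarrow> mass_constant) at_top"
  proof (rule dyadic_interpolation[OF _ Cesaro_increment_tendsto_0[OF avg]])
    have "(\<lambda>N. integral {0..1} g / real N) \<longlonglongrightarrow> 0" by (rule lim_const_over_n)
    from tendsto_add[OF this avg]
    show "(\<lambda>n. (1 / real n) *\<^sub>R integral {0..2 ^ n} g) \<longlonglongrightarrow> ln 2 *\<^sub>R mass_constant"
      by (simp add: dy add_divide_distrib mult.commute)
    fix n :: nat and x :: real assume x: "x \<in> {0..1}"
    have "integral {0..2 ^ n + 2 ^ n * x} g - integral {0..2 ^ n} g = integral {2 ^ n..2 ^ n + 2 ^ n * x} g"
      using split[of "2 ^ n" "2 ^ n + 2 ^ n * x"] x by simp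
    moreover have "0 \<le> integral {2 ^ n..2 ^ n + 2 ^ n * x} g"
      using gh g0 by (intro Henstock_Kurzweil_Integration.integral_nonneg) auto
    moreover have "integral {2 ^ n..2 ^ n + 2 ^ n * x} g \<le> integral {2 ^ n..2 * 2 ^ n} g"
      using gh g0 x by (intro integral_subset_le) auto
    ultimately show "norm (integral {0..2 ^ n + 2 ^ n * x} g - integral {0..2 ^ n} g) \<le> m n" by (simp add: m)
  qed
  then show ?case unfolding ge using gi F by simp
qed

end

section \<open>Transfer to the given process\<close>

theorem proposition16:
  fixes M :: "'a measure" and B :: "real \<Rightarrow> 'a \<Rightarrow> complex" and H :: real and z0 :: complex
  assumes "1 / 2 < H" and "H < 1" and "z0 \<noteq> 0"
    and "complex_fractional_brownian_motion M B H z0"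
  shows "AE \<omega> in M.
      (\<forall>t\<ge>0. rs_integrable (\<lambda>s. 1 / B s \<omega>) (\<lambda>s. B s \<omega>) 0 t) \<and>
      ((\<lambda>t. 1 / complex_of_real (ln t) * rs_integral (\<lambda>s. 1 / B s \<omega>) (\<lambda>s. B s \<omega>) 0 t)
         \<longlongrightarrow> complex_of_real H) at_top \<and>
      (\<forall>t\<ge>0. set_integrable lborel {0..t} (\<lambda>s. 1 / norm (B s \<omega>) powr (1 / H))) \<and>
      ((\<lambda>t. 1 / ln t * (LBINT s:{0..t}. 1 / norm (B s \<omega>) powr (1 / H)))
         \<longlongrightarrow> Gamma (1 - 1 / (2 * H)) / 2 powr (1 / (2 * H))) at_top"
proof -
  interpret complex_fractional_brownian_motion M B H z0 by fact
  obtain W where W: "centred_fbm M W H" and BW: "AE \<omega> in M. \<forall>t\<ge>0. B t \<omega> = z0 + W t \<omega>"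
    using centred_version[OF assms(1,2)] .
  interpret X: centred_fbm M W H by fact
  define \<gamma> where "\<gamma> = (1 / 2 + H) / 2"
  have \<gamma>: "1 / 2 < \<gamma>" "0 < \<gamma>" "\<gamma> < H" using assms(1) by (auto simp: \<gamma>_def)
  show ?thesis
    using BW X.AE_holder[OF \<gamma>(2,3)] X.AE_continuous_logarithm[OF assms(3)] X.AE_additive_functional[OF assms(3)]
  proof eventually_elim
    case (elim \<omega>)
    have B: "B t \<omega> = z0 + W t \<omega>" if "t \<ge> 0" for t using elim(1) that by blast
    obtain L where L: "continuous_on {0..} L" "\<And>t. t \<ge> 0 \<Longrightarrow> X.traj z0 \<omega> t = exp (L t)"
      "((\<lambda>t. (1 / ln t) *\<^sub>R (L t - L 0)) \<longlongrightarrow> complex_of_real H) at_top"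
      using elim(3) by blast
    \<comment> \<open>The integral is the increment of the continuous logarithm, so its existence
      and its asymptotics both come from \<open>L\<close>.\<close>
    have rs: "has_rs_integral (\<lambda>s. 1 / B s \<omega>) (\<lambda>s. B s \<omega>) 0 t (L t - L 0)" if t: "t \<ge> 0" for t
    proof (rule has_rs_integral_log[OF t \<gamma>(1)])
      show "holder_on {0..t} \<gamma> (\<lambda>s. B s \<omega>)"
        using elim(2) B unfolding holder_on_def by simp
      show "continuous_on {0..t} L" by (rule continuous_on_subset[OF L(1)]) auto
      show "B s \<omega> = exp (L s)" if "s \<in> {0..t}" for s
        using B[of s] L(2)[of s] that by (simp add: X.traj_def)
    qed
    have "eventually (\<lambda>t. (1 / ln t) *\<^sub>R (L t - L 0)
        = 1 / complex_of_real (ln t) * rs_integral (\<lambda>s. 1 / B s \<omega>) (\<lambda>s. B s \<omega>) 0 t) at_top"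
      using eventually_ge_at_top[of 0]
      by eventually_elim (simp add: rs_integral_unique[OF rs] scaleR_conv_of_real)
    from Lim_transform_eventually[OF L(3) this]
    have lim1: "((\<lambda>t. 1 / complex_of_real (ln t) * rs_integral (\<lambda>s. 1 / B s \<omega>) (\<lambda>s. B s \<omega>) 0 t)
       \<longlongrightarrow> complex_of_real H) at_top" .
    \<comment> \<open>\<open>B\<close> and \<open>z0 + W\<close> agree at nonnegative times, which
      is the whole range of integration.\<close>
    have int: "set_integrable lborel {0..t} (\<lambda>s. 1 / norm (B s \<omega>) powr (1 / H))
        = set_integrable lborel {0..t} (\<lambda>s. 1 / norm (z0 + W s \<omega>) powr (1 / H))" for t
      by (intro set_integrable_cong) (auto simp: B)
    have val: "(LBINT s:{0..t}. 1 / norm (B s \<omega>) powr (1 / H)) = (LBINT s:{0..t}. 1 / norm (z0 + W s \<omega>) powr (1 / H))" for t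
      by (intro set_lebesgue_integral_cong) (auto simp: B)
    show ?case unfolding int val using rs lim1 elim(4) unfolding X.mass_constant_def rs_integrable_def by blast
  qed
qed

end
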